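(* Let $n>1$ be an even integer, let $q>0$ be an odd integer, and let $H$ be a continuous, non-negative, even homogeneous function of degree $1$ on $\mathbb{R}^n$. Suppose that $\Delta^{(n+q-1)/2}H^q$ is a function in $\mathbb{R}^n\setminus\{0\}$ such that $(\Delta^{(n+q-1)/2}H^q)|_\Omega\in L_1(\Omega)$, where differentiation is considered in the sense of distributions. Then the function $H^q$ admits the Blaschke-Levy representation with the exponent $q$, that is, there is an even function $b\in L_1(\Omega)$ such that $$H^q(x)=\int_\Omega|(x,\xi)|^q\,b(\xi)\,d\xi\qquad\text{for every }x\in\mathbb{R}^n,$$ and the corresponding function $b\in L_1(\Omega)$ is given by $$b(\xi)=\frac{(-1)^{(n+q-1)/2}\,\pi}{(2\pi)^{n-1}C_q}\int_{\Omega\cap\{(\theta,\xi)=0\}}\Delta^{(n+q-1)/2}H^q(\theta)\,d\theta$$ for every $\xi\in\Omega$. Moreover, if $b\in L_\infty(\Omega)$ then $$\|b\|_\infty\le\frac{2\pi^{(n+1)/2}}{\Gamma((n-1)/2)\,(2\pi)^{n-1}\,C_q}\,\|(\Delta^{(n+q-1)/2}H^q)|_\Omega\|_\infty .$$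
   Context: $\Omega$ is the Euclidean unit sphere in $\mathbb{R}^n$ with (unnormalized) surface measure $d\xi$; $(x,\xi)$ is the standard scalar product; $\Delta$ is the Laplace operator; $\|\cdot\|_\infty$ is the norm of $L_\infty(\Omega)$. The integral over $\Omega\cap\{(\theta,\xi)=0\}$ is with respect to the $(n-2)$-dimensional surface measure on this great subsphere (counting measure on two points if $n=2$). A function $f$ is even homogeneous of degree $p$ if $f(\alpha x)=|\alpha|^p f(x)$ for all real $\alpha\neq0$. For $q>-1$ not an even integer, $$C_q=\frac{2^{q+1}\sqrt{\pi}\,\Gamma((q+1)/2)}{\Gamma(-q/2)}.$$
   Formalization: The formula for b carries an extra factor 1/2 (as printed it fails for H=|x|, n=2, q=1: it gives 1/2, but b=1/4), and C_q in the bound is replaced by |C_q|, since C_q<0 for q=1 mod 4; the restriction to Ω is read through a representative homogeneous of degree 1-n. *)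

theory Defs
  imports "HOL-Analysis.Analysis" "HOL-Probability.Essential_Supremum"
begin

text \<open>
  Surface measure on the unit sphere, as the cone measure: the area of a Borel set \<open>A\<close> of
  directions is \<open>n\<close> times the Lebesgue measure of the part of the unit ball lying over \<open>A\<close>
  (note \<open>sgn x = x /\<^sub>R norm x\<close>).  It is unnormalised.  Its underlying space is
  \<open>sphere 0 1\<close>, so measurability and integrability only concern the values on the sphere.
\<close>

definition sphere_measure :: "'a::euclidean_space measure" where
  "sphere_measure =
     scale_measure (of_nat DIM('a))
       (distr (restrict_space lborel (cball 0 1 - {0})) (restrict_space borel (sphere 0 1)) sgn)"

text \<open>
  The surface measure of dimension \<open>n - 2\<close> on the great subsphere orthogonal to a unit vector
  \<open>\<xi>\<close> is again a cone measure, now inside the hyperplane orthogonal to \<open>\<xi>\<close>.  The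
  \<open>n - 1\<close> dimensional Lebesgue measure of a subset of that hyperplane is the \<open>n\<close>-dimensional
  measure of the right cylinder of height 1 over it.  For \<open>n = 2\<close> this is the counting measure
  on the two points of the great subsphere.
\<close>

definition orth_part :: "'a::euclidean_space \<Rightarrow> 'a \<Rightarrow> 'a" where
  "orth_part \<xi> x = x - (x \<bullet> \<xi>) *\<^sub>R \<xi>"

definition great_subsphere :: "'a::euclidean_space \<Rightarrow> 'a set" where
  "great_subsphere \<xi> = {\<theta> \<in> sphere 0 1. \<theta> \<bullet> \<xi> = 0}"

definition great_subsphere_measure :: "'a::euclidean_space \<Rightarrow> 'a measure" where
  "great_subsphere_measure \<xi> =
     scale_measure (of_nat (DIM('a) - 1))
       (distr
         (restrict_space lborel
           {x. x \<bullet> \<xi> \<in> {0..1} \<and> orth_part \<xi> x \<in> cball 0 1 - {0}})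
         (restrict_space borel (great_subsphere \<xi>))
         (\<lambda>x. sgn (orth_part \<xi> x)))"

definition Linf_norm :: "'a measure \<Rightarrow> ('a \<Rightarrow> real) \<Rightarrow> ereal" where
  "Linf_norm M f = esssup M (\<lambda>x. ereal \<bar>f x\<bar>)"

definition in_Linf :: "'a measure \<Rightarrow> ('a \<Rightarrow> real) \<Rightarrow> bool" where
  "in_Linf M f \<longleftrightarrow> f \<in> borel_measurable M \<and> Linf_norm M f < \<infinity>"

definition pderiv_dir :: "'a::euclidean_space \<Rightarrow> ('a \<Rightarrow> real) \<Rightarrow> 'a \<Rightarrow> real" where
  "pderiv_dir i f x = frechet_derivative f (at x) i"

definition laplacian :: "('a::euclidean_space \<Rightarrow> real) \<Rightarrow> 'a \<Rightarrow> real" where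
  "laplacian f x = (\<Sum>i\<in>Basis. pderiv_dir i (pderiv_dir i f) x)"

primrec C_k :: "nat \<Rightarrow> ('a::euclidean_space \<Rightarrow> real) \<Rightarrow> bool" where
  "C_k 0 f \<longleftrightarrow> continuous_on UNIV f"
| "C_k (Suc k) f \<longleftrightarrow> f differentiable_on UNIV \<and> (\<forall>i\<in>Basis. C_k k (pderiv_dir i f))"

definition test_function_on :: "'a::euclidean_space set \<Rightarrow> ('a \<Rightarrow> real) \<Rightarrow> bool" where
  "test_function_on S \<phi> \<longleftrightarrow>
     (\<forall>k. C_k k \<phi>) \<and> compact (closure {x. \<phi> x \<noteq> 0}) \<and> closure {x. \<phi> x \<noteq> 0} \<subseteq> S"

definition locally_integrable_on :: "'a::euclidean_space set \<Rightarrow> ('a \<Rightarrow> real) \<Rightarrow> bool" where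
  "locally_integrable_on S f \<longleftrightarrow> (\<forall>K. compact K \<and> K \<subseteq> S \<longrightarrow> set_integrable lborel K f)"

text \<open>
  On the open set \<open>S\<close>, the \<open>k\<close>-th iterate of the Laplacian of the distribution \<open>u\<close>
  is the function \<open>f\<close>.
\<close>

definition distr_laplacian_pow_on ::
    "'a::euclidean_space set \<Rightarrow> nat \<Rightarrow> ('a \<Rightarrow> real) \<Rightarrow> ('a \<Rightarrow> real) \<Rightarrow> bool" where
  "distr_laplacian_pow_on S k u f \<longleftrightarrow>
     locally_integrable_on S u \<and> locally_integrable_on S f \<and>
     (\<forall>\<phi>. test_function_on S \<phi> \<longrightarrow>
        (LINT x|lborel. u x * (laplacian ^^ k) \<phi> x) = (LINT x|lborel. f x * \<phi> x))"

definition even_homogeneous :: "real \<Rightarrow> ('a::real_vector \<Rightarrow> real) \<Rightarrow> bool" where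
  "even_homogeneous p f \<longleftrightarrow> (\<forall>\<alpha> x. \<alpha> \<noteq> 0 \<longrightarrow> f (\<alpha> *\<^sub>R x) = \<bar>\<alpha>\<bar> powr p * f x)"

text \<open>
  A locally integrable function that represents a homogeneous distribution is determined only
  almost everywhere, while the sphere is a null set.  Its restriction to the sphere is understood
  through a pointwise homogeneous representative, which always exists.
\<close>

definition homogeneous_off_0 :: "real \<Rightarrow> ('a::real_vector \<Rightarrow> real) \<Rightarrow> bool" where
  "homogeneous_off_0 p f \<longleftrightarrow> (\<forall>x t. x \<noteq> 0 \<and> t > 0 \<longrightarrow> f (t *\<^sub>R x) = t powr p * f x)"

text \<open>Negative whenever \<open>q\<close> is 1 modulo 4, since then \<open>Gamma (- q / 2) < 0\<close>.\<close>

definition C_const :: "real \<Rightarrow> real" where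
  "C_const q = 2 powr (q + 1) * sqrt pi * Gamma ((q + 1) / 2) / Gamma (- q / 2)"

definition blaschke_levy ::
    "nat \<Rightarrow> ('a::euclidean_space \<Rightarrow> real) \<Rightarrow> ('a \<Rightarrow> real) \<Rightarrow> bool" where
  "blaschke_levy q F b \<longleftrightarrow>
     (\<forall>\<xi>\<in>sphere 0 1. b (- \<xi>) = b \<xi>) \<and>
     integrable sphere_measure b \<and>
     (\<forall>x. F x = (LINT \<xi>|sphere_measure. \<bar>x \<bullet> \<xi>\<bar> ^ q * b \<xi>))"

text \<open>
  The density obtained from \<open>f\<close>, the \<open>(n + q - 1) / 2\<close>-th iterated Laplacian of the represented
  function.  The factor 2 in the denominator is needed because the Fourier transform of an even
  representation picks up each direction \<open>\<xi>\<close> twice, through \<open>\<xi>\<close> and \<open>- \<xi>\<close>.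
  For instance \<open>n = 2\<close>, \<open>q = 1\<close>, \<open>H = norm\<close> has \<open>f = 1\<close> on the circle and \<open>C_const 1 = - 2\<close>, and the
  density is the constant \<open>1 / 4\<close>.  The integral is 0 at those \<open>\<xi>\<close> (a null set) for which \<open>f\<close> is
  not integrable over the great subsphere.
\<close>

definition inversion_density ::
    "nat \<Rightarrow> ('a::euclidean_space \<Rightarrow> real) \<Rightarrow> 'a \<Rightarrow> real" where
  "inversion_density q f \<xi> =
     (- 1) ^ ((DIM('a) + q - 1) div 2) * pi /
       (2 * (2 * pi) ^ (DIM('a) - 1) * C_const (real q)) *
     (LINT \<theta>|great_subsphere_measure \<xi>. f \<theta>)"

end

theory Submission
  imports Defs "HOL-Computational_Algebra.Polynomial" "HOL-Computational_Algebra.Formal_Power_Series"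
    "HOL-Probability.Distributions"
begin

text \<open>
  Write \<open>u = H ^ q\<close>, \<open>n = 2 * h\<close>, \<open>m = (n + q - 1) div 2\<close> and let \<open>f\<close> be the \<open>m\<close>-th iterated
  Laplacian of \<open>u\<close>. No Fourier transform is used. Let \<open>N(a)\<close> be \<open>a ^ h\<close> times the integral of \<open>u\<close>
  against the Gaussian \<open>exp (- a * (norm (z - x))\<^sup>2)\<close>. Homogeneity of \<open>u\<close> makes \<open>N(a)\<close> the product
  of \<open>a powr (- q / 2)\<close> and an entire power series in \<open>a\<close>, and by the heat equation
  \<open>- 4 * a\<^sup>2 * d / da\<close> acts on it like the Laplacian. The weak equation, tested on Gaussians, turns
  its \<open>m\<close>-th power into a Gaussian integral of \<open>f\<close>, which polar coordinates reduce to the integral of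
  \<open>f \<theta> * exp (- a * (norm (orth_part \<theta> x))\<^sup>2)\<close> over the sphere. Comparing coefficients expresses
  \<open>N(a)\<close> through Kummer's function; since \<open>q / 2\<close> is not an integer no coefficient is lost. As \<open>a\<close>
  tends to infinity \<open>N(a)\<close> tends to \<open>pi ^ h * u x\<close>, and the asymptotics of Kummer's function exhibit
  \<open>u x\<close> as a multiple of the integral of \<open>f \<theta> * norm (orth_part \<theta> x) ^ q\<close>. The factor
  \<open>norm (orth_part \<theta> x) ^ q\<close> is a multiple of the spherical Radon transform of
  \<open>\<bar>x \<bullet> \<xi>\<bar> ^ q\<close>, so self-adjointness of this transform moves it to \<open>f\<close>.

  For uniqueness, smoothing \<open>\<bar>x \<bullet> \<xi>\<bar> ^ q\<close> by a Gaussian in \<open>x\<close> gives a power series in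
  \<open>(x \<bullet> \<xi>)\<^sup>2\<close> all of whose coefficients are nonzero. An even density with vanishing representation
  therefore has vanishing moments, hence is orthogonal to all exponentials and vanishes by
  Stone-Weierstrass. The norm bound is the total mass of a great subsphere.
\<close>

section \<open>Iterated partial derivatives and cutoff functions\<close>

text \<open>In the time variable 1 / (4 * a) the operator - 4 * a^2 * d / da is plain
  differentiation, so the kernel of its m-th power consists of the polynomials in 1 / a of degree
  less than m. These contain integer powers of a only, whereas odd homogeneity of \<open>u\<close>
  leaves only half-integer powers in N(a); for this reason N(a) can be recovered from its m-th
  derivative. Evenness of n + q - 1 makes m an integer.

  The degree of \<open>f\<close> is q - 2 * m = 1 - n, so \<open>f\<close> cancels the Jacobian r^(n
  - 1). What remains along a line is the integral of a Gaussian, and this depends only on the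
  distance of x from the line.

  Two obstacles shape the rest. Gaussians are not test functions away from the origin, so the weak
  equation has to be extended by cutoffs whose derivative bounds survive dilation. And
  \<open>f\<close> is merely integrable on the sphere, where great subspheres are null sets, so its
  Radon transform exists only almost everywhere. Duality is therefore established between
  nonnegative Borel functions and continuous ones, by comparing two finite measures.\<close>

lemma C_k_Suc_D: "C_k (Suc k) f \<Longrightarrow> C_k k f"
  by (induction k arbitrary: f) (auto intro: differentiable_imp_continuous_on)

lemma C_k_mono: "C_k k f \<Longrightarrow> j \<le> k \<Longrightarrow> C_k j f"
proof (induction k)
  case (Suc k)
  then show ?case by (cases "j = Suc k") (auto dest: C_k_Suc_D simp del: C_k.simps)
qed simp

lemma C_k_differentiable: "C_k (Suc k) f \<Longrightarrow> f differentiable (at x)"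
  by (auto simp: differentiable_on_def)

lemma C_k_continuous: "C_k k f \<Longrightarrow> continuous_on UNIV f"
  using C_k_mono[of k f 0] by simp

lemma pderiv_dir_eqI: "(f has_derivative f') (at x) \<Longrightarrow> pderiv_dir i f x = f' i"
  unfolding pderiv_dir_def by (metis frechet_derivative_at)

lemma differentiable_onI_UNIV: "(\<And>x. f differentiable (at x)) \<Longrightarrow> f differentiable_on UNIV"
  by (simp add: differentiable_on_def)

lemma has_derivative_pderiv:
  "f differentiable (at x) \<Longrightarrow> (f has_derivative frechet_derivative f (at x)) (at x)"
  by (simp add: frechet_derivative_works[symmetric])

lemma pderiv_dir_add:
  assumes "f differentiable (at x)" "g differentiable (at x)"
  shows "pderiv_dir i (\<lambda>x. f x + g x) x = pderiv_dir i f x + pderiv_dir i g x"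
  using pderiv_dir_eqI[OF has_derivative_add[OF has_derivative_pderiv has_derivative_pderiv, OF assms]]
  by (simp add: pderiv_dir_def)

lemma pderiv_dir_mult:
  assumes "f differentiable (at x)" "g differentiable (at x)"
  shows "pderiv_dir i (\<lambda>x. f x * g x) x = f x * pderiv_dir i g x + pderiv_dir i f x * g x"
  using pderiv_dir_eqI[OF has_derivative_mult[OF has_derivative_pderiv has_derivative_pderiv, OF assms]]
  by (simp add: pderiv_dir_def)

lemma pderiv_dir_compose:
  fixes h :: "real \<Rightarrow> real"
  assumes "h differentiable (at (f x))" "f differentiable (at x)"
  shows "pderiv_dir i (\<lambda>x. h (f x)) x = pderiv_dir 1 h (f x) * pderiv_dir i f x"
proof -
  have "(h has_derivative frechet_derivative h (at (f x))) (at (f x))"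
    using assms by (simp add: has_derivative_pderiv)
  then have *: "((\<lambda>x. h (f x)) has_derivative
      (\<lambda>v. frechet_derivative h (at (f x)) (frechet_derivative f (at x) v))) (at x)"
    using has_derivative_compose[OF has_derivative_pderiv[OF assms(2)]] by auto
  interpret linear "frechet_derivative h (at (f x))"
    using assms(1) linear_frechet_derivative by blast
  have "pderiv_dir i (\<lambda>x. h (f x)) x = frechet_derivative h (at (f x)) (pderiv_dir i f x *\<^sub>R 1)"
    using pderiv_dir_eqI[OF *, of i] unfolding pderiv_dir_def by simp
  also have "\<dots> = pderiv_dir i f x * pderiv_dir 1 h (f x)"
    unfolding scale unfolding pderiv_dir_def by simp
  finally show ?thesis by (simp only: mult.commute)
qed

lemma pderiv_dir_const: "pderiv_dir i (\<lambda>x. c) = (\<lambda>x. 0)"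
  by (rule ext, rule pderiv_dir_eqI[OF has_derivative_const])

lemma C_k_const [simp]: "C_k k (\<lambda>x. c)"
  by (induction k arbitrary: c) (simp_all add: pderiv_dir_const)

lemma C_k_add: "C_k k f \<Longrightarrow> C_k k g \<Longrightarrow> C_k k (\<lambda>x. f x + g x)"
proof (induction k arbitrary: f g)
  case (Suc k)
  have "pderiv_dir i (\<lambda>x. f x + g x) = (\<lambda>x. pderiv_dir i f x + pderiv_dir i g x)" for i
    using Suc.prems by (intro ext pderiv_dir_add) (auto simp: differentiable_on_def)
  with Suc show ?case by (auto simp: differentiable_on_def)
qed (auto intro: continuous_on_add)

lemma C_k_mult: "C_k k f \<Longrightarrow> C_k k g \<Longrightarrow> C_k k (\<lambda>x. f x * g x)"
proof (induction k arbitrary: f g)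
  case (Suc k)
  have "pderiv_dir i (\<lambda>x. f x * g x) = (\<lambda>x. f x * pderiv_dir i g x + pderiv_dir i f x * g x)" for i
    using Suc.prems by (intro ext pderiv_dir_mult) (auto simp: differentiable_on_def)
  moreover have "C_k k f" "C_k k g" using Suc.prems C_k_Suc_D by blast+
  ultimately show ?case
    using Suc by (auto simp: differentiable_on_def intro!: C_k_add)
qed (auto intro: continuous_on_mult)

lemma C_k_cmult: "C_k k f \<Longrightarrow> C_k k (\<lambda>x. c * f x)"
  by (intro C_k_mult) auto

lemma C_k_sum: "(\<And>i. i \<in> I \<Longrightarrow> C_k k (f i)) \<Longrightarrow> C_k k (\<lambda>x. \<Sum>i\<in>I. f i x)"
  by (induction I rule: infinite_finite_induct) (auto intro: C_k_add)

lemma C_k_compose: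
  fixes h :: "real \<Rightarrow> real"
  shows "C_k k h \<Longrightarrow> C_k k f \<Longrightarrow> C_k k (\<lambda>x. h (f x))"
proof (induction k arbitrary: f h)
  case 0
  then show ?case by (auto intro: continuous_on_compose2)
next
  case (Suc k)
  have "pderiv_dir i (\<lambda>x. h (f x)) = (\<lambda>x. pderiv_dir 1 h (f x) * pderiv_dir i f x)" for i
    using Suc.prems by (intro ext pderiv_dir_compose) (auto simp: differentiable_on_def)
  moreover have "C_k k f" using Suc.prems(2) C_k_Suc_D by blast
  moreover have "(\<lambda>x. h (f x)) differentiable (at x)" for x
    using differentiable_compose[OF C_k_differentiable[OF Suc.prems(1)] C_k_differentiable[OF Suc.prems(2)]]
    by simp
  ultimately show ?case
    using Suc by (auto simp: differentiable_on_def intro!: C_k_mult)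
qed

lemma C_k_inner [simp]: "C_k k (\<lambda>x. x \<bullet> v)"
proof -
  have "(\<lambda>x. x \<bullet> v) differentiable_on UNIV"
    by (intro differentiable_onI_UNIV bounded_linear_imp_differentiable bounded_linear_inner_left)
  moreover have "pderiv_dir i (\<lambda>x. x \<bullet> v) = (\<lambda>x. i \<bullet> v)" for i
    by (intro ext pderiv_dir_eqI bounded_linear_imp_has_derivative bounded_linear_inner_left)
  ultimately show ?thesis by (cases k) (auto intro: continuous_intros simp: pderiv_dir_const)
qed

lemma pderiv_dir_norm_sq: "pderiv_dir i (\<lambda>z. (norm (z - x))\<^sup>2) = (\<lambda>z. 2 * ((z - x) \<bullet> i))"
proof
  fix z
  have "((\<lambda>z. (z - x) \<bullet> (z - x)) has_derivative (\<lambda>v. 2 * ((z - x) \<bullet> v))) (at z)"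
    by (auto intro!: derivative_eq_intros simp: inner_commute)
  from pderiv_dir_eqI[OF this] show "pderiv_dir i (\<lambda>z. (norm (z - x))\<^sup>2) z = 2 * ((z - x) \<bullet> i)"
    by (simp add: power2_norm_eq_inner)
qed

lemma differentiable_norm_sq: "(\<lambda>z::'a::euclidean_space. (norm (z - x))\<^sup>2) differentiable (at z)"
  unfolding differentiable_def power2_norm_eq_inner
  by (auto intro!: exI derivative_eq_intros)

lemma C_k_norm_sq [simp]: "C_k k (\<lambda>z::'a::euclidean_space. (norm (z - x))\<^sup>2)"
proof (cases k)
  case 0
  then show ?thesis by (auto intro!: continuous_intros)
next
  case (Suc j)
  have "C_k j (\<lambda>z. 2 * ((z - x) \<bullet> i))" for i
    using C_k_cmult[OF C_k_add[OF C_k_inner[of j i] C_k_const[of j "- (x \<bullet> i)"]], of 2]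
    by (simp add: inner_diff_left)
  then show ?thesis
    by (auto simp: Suc pderiv_dir_norm_sq intro!: differentiable_onI_UNIV differentiable_norm_sq)
qed

lemma C_k_norm_sq0 [simp]: "C_k k (\<lambda>z::'a::euclidean_space. (norm z)\<^sup>2)"
  using C_k_norm_sq[of k 0] by simp

lemma pderiv_dir_real: "(h has_real_derivative d) (at t) \<Longrightarrow> pderiv_dir 1 h t = d"
  using pderiv_dir_eqI[of h "(*) d" t 1] by (simp add: has_field_derivative_def)

text \<open>On \<open>real\<close> the only basis vector is \<open>1\<close>, so \<open>C_k\<close>
  speaks of ordinary derivatives. Smoothness of a profile then follows by induction from any family
  closed under differentiation.\<close>

lemma C_k_real_Suc:
  fixes h :: "real \<Rightarrow> real"
  assumes "\<And>t. (h has_real_derivative h' t) (at t)" "C_k k h'"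
  shows "C_k (Suc k) h"
proof -
  have "pderiv_dir 1 h = h'" using assms(1) pderiv_dir_real by blast
  moreover have "h differentiable_on UNIV"
    using assms(1) by (intro differentiable_onI_UNIV) (auto simp: differentiable_def has_field_derivative_def)
  ultimately show ?thesis using assms(2) by simp
qed

lemma C_k_exp: "C_k k (exp :: real \<Rightarrow> real)"
  by (induction k) (auto intro!: continuous_intros intro: C_k_real_Suc DERIV_exp simp del: C_k.simps(2))

section \<open>Flat functions and a smooth step\<close>

definition flat_poly :: "real poly \<Rightarrow> real \<Rightarrow> real" where
  "flat_poly p t = (if t > 0 then poly p (1 / t) * exp (- (1 / t)) else 0)"

lemma poly_times_exp_tendsto_0: "((\<lambda>x. poly p x * exp (- x)) \<longlongrightarrow> (0::real)) at_top"
proof (induction p)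
  case (pCons c p)
  show ?case
  proof -
    have "((\<lambda>x. \<Sum>i\<le>degree (pCons c p). coeff (pCons c p) i * (x ^ i / exp x)) \<longlongrightarrow>
        (\<Sum>i\<le>degree (pCons c p). coeff (pCons c p) i * 0)) at_top"
      by (intro tendsto_sum tendsto_mult tendsto_const tendsto_power_div_exp_0)
    then show ?thesis
      unfolding poly_altdef sum_distrib_right exp_minus by (simp add: divide_inverse mult.assoc)
  qed
qed simp

text \<open>With s = 1 / t, differentiation in t is - s^2 times differentiation in s, so p(s) * exp
  (- s) turns into s^2 * (p - p')(s) * exp (- s). The family is closed under differentiation, and
  smoothness of every order at 0 follows from this one statement for arbitrary
  \<open>p\<close>.\<close>

lemma flat_poly_has_derivative:
  "(flat_poly p has_real_derivative flat_poly ([:0,0,1:] * (p - pderiv p)) t) (at t)"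
proof -
  consider "t > 0" | "t < 0" | "t = 0" by linarith
  then show ?thesis
  proof cases
    case 1
    have "((\<lambda>t. poly p (1 / t) * exp (- (1 / t))) has_real_derivative
        flat_poly ([:0,0,1:] * (p - pderiv p)) t) (at t)"
      using 1 by (auto intro!: derivative_eq_intros simp: flat_poly_def power2_eq_square field_simps)
    then show ?thesis
      by (rule has_field_derivative_transform_within_open[where S="{0<..}"])
        (use 1 in \<open>auto simp: flat_poly_def\<close>)
  next
    case 2
    have "((\<lambda>t. 0) has_real_derivative flat_poly ([:0,0,1:] * (p - pderiv p)) t) (at t)"
      using 2 by (auto simp: flat_poly_def)
    then show ?thesis
      by (rule has_field_derivative_transform_within_open[where S="{..<0}"])
        (use 2 in \<open>auto simp: flat_poly_def\<close>)
  next
    case 3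
    \<comment> \<open>With y = 1 / h the difference quotient at 0 equals y * p(y) * exp (- y); hence
      the additional factor \<open>[:0,1:]\<close>.\<close>
    have "((\<lambda>h. poly ([:0,1:] * p) (inverse h) * exp (- inverse h)) \<longlongrightarrow> 0) (at_right (0::real))"
      by (rule filterlim_compose[OF poly_times_exp_tendsto_0 filterlim_inverse_at_top_right])
    then have "((\<lambda>h. flat_poly p h / h) \<longlongrightarrow> 0) (at_right 0)"
      by (rule Lim_transform_eventually)
        (auto simp: eventually_at_right_less flat_poly_def field_simps
          intro!: eventually_mono[OF eventually_at_right_less[of 0]])
    moreover have "((\<lambda>h. flat_poly p h / h) \<longlongrightarrow> 0) (at_left 0)"
      by (rule tendsto_eventually)
        (auto simp: flat_poly_def eventually_at_left_field intro!: exI[of _ "-1"])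
    ultimately have "((\<lambda>h. flat_poly p h / h) \<longlongrightarrow> 0) (at 0)"
      by (simp add: filterlim_split_at)
    then show ?thesis
      using 3 by (simp add: has_field_derivative_iff flat_poly_def)
  qed
qed

lemma C_k_flat_poly: "C_k k (flat_poly p)"
proof (induction k arbitrary: p)
  case 0
  have "isCont (flat_poly p) t" for t using flat_poly_has_derivative by (rule DERIV_isCont)
  then show ?case by (simp add: continuous_at_imp_continuous_on)
next
  case (Suc k)
  show ?case by (rule C_k_real_Suc[OF flat_poly_has_derivative Suc])
qed

text \<open>A normalised antiderivative of a bump supported in [1, 2]. It is meant to be composed
  with the squared norm, which is smooth also at the origin, and so produces smooth radial
  cutoffs.\<close>

lemma smooth_step_exists:
  obtains \<eta> :: "real \<Rightarrow> real" where "\<And>k. C_k k \<eta>" "\<And>t. t \<le> 1 \<Longrightarrow> \<eta> t = 0" "\<And>t. t \<ge> 2 \<Longrightarrow> \<eta> t = 1"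
    "\<And>t. \<bar>\<eta> t\<bar> \<le> 1"
proof -
  define \<beta> where "\<beta> t = flat_poly 1 (t - 1) * flat_poly 1 (2 - t)" for t
  have sh: "C_k k (\<lambda>t::real. t - 1)" "C_k k (\<lambda>t::real. 2 - t)" for k
    using C_k_add[OF C_k_inner[of k "1::real"] C_k_const[of k "-1"]]
      C_k_add[OF C_k_inner[of k "-1::real"] C_k_const[of k 2]] by simp_all
  have \<beta>: "C_k k \<beta>" for k
    unfolding \<beta>_def[abs_def] by (intro C_k_mult C_k_compose[OF C_k_flat_poly] sh)
  have cont: "continuous_on S \<beta>" for S using C_k_continuous[OF \<beta>[of 0]] by (rule continuous_on_subset) simp
  have \<beta>0: "\<beta> t \<ge> 0" for t by (auto simp: \<beta>_def flat_poly_def)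
  have \<beta>z: "\<beta> t = 0" if "t \<le> 1 \<or> t \<ge> 2" for t using that by (auto simp: \<beta>_def flat_poly_def)
  \<comment> \<open>For t < 1 the interval is empty and the integral is 0, so one formula serves the
    whole line.\<close>
  define I where "I t = integral {1..t} \<beta>" for t
  have der: "(I has_real_derivative \<beta> t) (at t)" for t
  proof -
    \<comment> \<open>The derivative is needed at an interior point of the interval of integration.
      Moving the lower limit from 1 to 0 makes room on the left and changes nothing, since the bump
      vanishes on [0, 1].\<close>
    have *: "((\<lambda>u. integral {0..u} \<beta>) has_real_derivative \<beta> t) (at t)" if "t > 0" for t
    proof -
      have "((\<lambda>u. integral {0..u} \<beta>) has_real_derivative \<beta> t) (at t within {0..t+1})"
        by (rule integral_has_real_derivative) (use cont that in auto)
      moreover have "at t within {0..t+1} = at t"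
        by (rule at_within_interior) (use that in simp)
      ultimately show ?thesis by simp
    qed
    have split: "integral {0..u} \<beta> = I u" if "u > 0" for u
    proof (cases "u \<ge> 1")
      case True
      have "integral {0..1} \<beta> = 0" using \<beta>z by (intro integral_unique has_integral_is_0) auto
      then show ?thesis
        using Henstock_Kurzweil_Integration.integral_combine[of 0 1 u \<beta>] True
          integrable_continuous_interval[OF cont] by (simp add: I_def)
    next
      case False
      then show ?thesis using \<beta>z by (auto simp: I_def intro!: integral_unique has_integral_is_0)
    qed
    show ?thesis
    proof (cases "t > 0")
      case True
      show ?thesis
        by (rule has_field_derivative_transform_within_open[OF *[OF True], where S="{0<..}"])
          (use True split in auto)
    next
      case False
      have "((\<lambda>_. 0) has_real_derivative \<beta> t) (at t)" using False \<beta>z by auto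
      then show ?thesis
        by (rule has_field_derivative_transform_within_open[where S="{..<1}"])
          (use False in \<open>auto simp: I_def\<close>)
    qed
  qed
  have I1: "I t = 0" if "t \<le> 1" for t using that by (cases "t = 1") (auto simp: I_def)
  have I2: "I t = I 2" if "t \<ge> 2" for t
  proof -
    have "integral {2..t} \<beta> = 0" using \<beta>z by (intro integral_unique has_integral_is_0) auto
    then show ?thesis using Henstock_Kurzweil_Integration.integral_combine[of 1 2 t \<beta>] that
          integrable_continuous_interval[OF cont] by (simp add: I_def)
  qed
  have mono: "I s \<le> I t" if "s \<le> t" for s t
    by (rule DERIV_nonneg_imp_nondecreasing[OF that]) (use der \<beta>0 in blast)
  have "I 2 > 0"
  proof (rule ccontr)
    assume "\<not> I 2 > 0"
    then have "integral {1..2} \<beta> = 0" using mono[of 1 2] I1[of 1] by (auto simp: I_def)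
    then have "(\<beta> has_integral 0) (cbox 1 2)"
      using integrable_integral[OF integrable_continuous_interval[OF cont, of 1 2]] by simp
    then have "\<beta> (3/2) = 0"
      using has_integral_0_cbox_imp_0[of 1 2 \<beta> "3/2"] cont[of "{1..2}"] \<beta>0 by (auto simp: box_real)
    then show False by (simp add: \<beta>_def flat_poly_def)
  qed
  define \<eta> where "\<eta> t = I t / I 2" for t
  have "(\<eta> has_real_derivative (1 / I 2) * \<beta> t) (at t)" for t
    using DERIV_cmult[OF der[of t], of "1 / I 2"] unfolding \<eta>_def[abs_def] by simp
  then have "C_k (Suc k) \<eta>" for k by (rule C_k_real_Suc) (intro C_k_cmult \<beta>)
  then have "C_k k \<eta>" for k using C_k_Suc_D by blast
  moreover have "\<bar>\<eta> t\<bar> \<le> 1" for t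
  proof -
    have "0 \<le> I t" using mono[of 1 t] I1[of t] I1[of 1] by (cases "t \<le> 1") auto
    moreover have "I t \<le> I 2" using mono[of t 2] I2[of t] by (cases "t \<le> 2") auto
    ultimately show ?thesis using \<open>I 2 > 0\<close> by (simp add: \<eta>_def)
  qed
  moreover have "\<eta> t = 0" if "t \<le> 1" for t using I1[OF that] by (simp add: \<eta>_def)
  moreover have "\<eta> t = 1" if "t \<ge> 2" for t using I2[OF that] \<open>I 2 > 0\<close> by (simp add: \<eta>_def)
  ultimately show ?thesis using that[of \<eta>] by blast
qed

section \<open>Locality of iterated Laplacians\<close>

lemma has_derivative_cong_open:
  assumes "open S" "x \<in> S" "\<And>y. y \<in> S \<Longrightarrow> f y = g y"
  shows "(f has_derivative f') (at x) \<longleftrightarrow> (g has_derivative f') (at x)"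
  using assms has_derivative_transform_within_open[of f f' x UNIV S g]
    has_derivative_transform_within_open[of g f' x UNIV S f] by auto

text \<open>\<open>frechet_derivative\<close> is a choice from the set of all derivatives at the
  point. That set is the same for two functions that agree nearby, so the identity also covers
  points where they are not differentiable.\<close>

lemma pderiv_dir_cong_open:
  assumes "open S" "x \<in> S" "\<And>y. y \<in> S \<Longrightarrow> f y = g y"
  shows "pderiv_dir i f x = pderiv_dir i g x"
  unfolding pderiv_dir_def frechet_derivative_def
  using has_derivative_cong_open[OF assms] by simp

lemma laplacian_cong_open:
  assumes "open S" "x \<in> S" "\<And>y. y \<in> S \<Longrightarrow> f y = g y"
  shows "laplacian f x = laplacian g x"
  unfolding laplacian_def
  by (intro sum.cong refl pderiv_dir_cong_open[OF assms(1,2)] pderiv_dir_cong_open[OF assms(1)] assms(3))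

lemma laplacian_pow_cong_open:
  assumes "open S" "x \<in> S" "\<And>y. y \<in> S \<Longrightarrow> f y = g y"
  shows "(laplacian ^^ m) f x = (laplacian ^^ m) g x"
  using assms(2)
proof (induction m arbitrary: x)
  case (Suc m)
  then show ?case by (auto intro!: laplacian_cong_open[OF assms(1)])
qed (use assms in auto)

lemma C_k_laplacian: "C_k (Suc (Suc k)) f \<Longrightarrow> C_k k (laplacian f)"
  unfolding laplacian_def[abs_def] by (rule C_k_sum) simp

lemma C_k_laplacian_pow: "C_k (2 * m + k) f \<Longrightarrow> C_k k ((laplacian ^^ m) f)"
proof (induction m arbitrary: k)
  case (Suc m)
  then show ?case using C_k_laplacian[OF Suc.IH[of "Suc (Suc k)"]] by simp
qed simp

text \<open>The weight \<open>w\<close> bounds the function itself; the bound improves by a factor \<open>norm z\<close> with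
  each derivative, so that it is invariant under dilations.\<close>

primrec symbol_bound :: "nat \<Rightarrow> ('a::euclidean_space \<Rightarrow> real) \<Rightarrow> ('a \<Rightarrow> real) \<Rightarrow> bool" where
  "symbol_bound 0 w f \<longleftrightarrow> (\<forall>z. z \<noteq> 0 \<longrightarrow> \<bar>f z\<bar> \<le> w z)"
| "symbol_bound (Suc k) w f \<longleftrightarrow> (\<forall>z. z \<noteq> 0 \<longrightarrow> \<bar>f z\<bar> \<le> w z) \<and>
     (\<forall>i\<in>Basis. symbol_bound k (\<lambda>z. w z / norm z) (pderiv_dir i f))"

lemma symbol_bound_abs: "symbol_bound k w f \<Longrightarrow> z \<noteq> 0 \<Longrightarrow> \<bar>f z\<bar> \<le> w z"
  by (cases k) auto

lemma symbol_bound_mono: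
  "symbol_bound k w f \<Longrightarrow> (\<And>z. z \<noteq> 0 \<Longrightarrow> w z \<le> w' z) \<Longrightarrow> symbol_bound k w' f"
proof (induction k arbitrary: w w' f)
  case (Suc k)
  have "symbol_bound k (\<lambda>z. w' z / norm z) (pderiv_dir i f)" if "i \<in> Basis" for i
    by (rule Suc.IH[of "\<lambda>z. w z / norm z"]) (use Suc.prems that in \<open>auto intro: divide_right_mono\<close>)
  with Suc.prems show ?case by (auto intro: order_trans)
qed (auto intro: order_trans)

lemma symbol_bound_add:
  "C_k k f \<Longrightarrow> C_k k g \<Longrightarrow> symbol_bound k w f \<Longrightarrow> symbol_bound k v g \<Longrightarrow>
   symbol_bound k (\<lambda>z. w z + v z) (\<lambda>z. f z + g z)"
proof (induction k arbitrary: f g w v)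
  case 0
  then show ?case by (fastforce intro: order_trans[OF abs_triangle_ineq])
next
  case (Suc k)
  have "pderiv_dir i (\<lambda>x. f x + g x) = (\<lambda>x. pderiv_dir i f x + pderiv_dir i g x)" for i
    using Suc.prems by (intro ext pderiv_dir_add) (auto simp: differentiable_on_def)
  moreover have "\<bar>f z + g z\<bar> \<le> w z + v z" if "z \<noteq> 0" for z
    using Suc.prems that by (intro order_trans[OF abs_triangle_ineq add_mono]) auto
  ultimately show ?case
    using Suc.IH Suc.prems by (simp add: add_divide_distrib)
qed

lemma symbol_bound_sum:
  fixes f :: "'i \<Rightarrow> 'a::euclidean_space \<Rightarrow> real"
  assumes "finite I" "\<And>i. i \<in> I \<Longrightarrow> C_k k (f i)" "\<And>i. i \<in> I \<Longrightarrow> symbol_bound k (w i) (f i)"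
  shows "symbol_bound k (\<lambda>z. \<Sum>i\<in>I. w i z) (\<lambda>z. \<Sum>i\<in>I. f i z)"
  using assms
proof (induction I rule: finite_induct)
  case empty
  have "symbol_bound k (\<lambda>z. 0) (\<lambda>z::'a. 0)"
    by (induction k) (auto simp: pderiv_dir_const)
  then show ?case by simp
qed (auto intro!: symbol_bound_add C_k_sum)

text \<open>By the Leibniz rule each derivative doubles the number of terms, and each term gains the
  same factor 1 / \<open>norm z\<close> whichever factor is differentiated. This accounts for the
  constant \<open>2 ^ k\<close>.\<close>

lemma symbol_bound_mult:
  "C_k k f \<Longrightarrow> C_k k g \<Longrightarrow> symbol_bound k w f \<Longrightarrow> symbol_bound k v g \<Longrightarrow>
   symbol_bound k (\<lambda>z. 2 ^ k * (w z * v z)) (\<lambda>z. f z * g z)"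
proof (induction k arbitrary: f g w v)
  case 0
  then show ?case by (auto simp: abs_mult intro!: mult_mono intro: order_trans[OF abs_ge_zero])
next
  case (Suc k)
  have pd: "pderiv_dir i (\<lambda>x. f x * g x) = (\<lambda>x. f x * pderiv_dir i g x + pderiv_dir i f x * g x)" for i
    using Suc.prems by (intro ext pderiv_dir_mult) (auto simp: differentiable_on_def)
  have C: "C_k k f" "C_k k g" using Suc.prems C_k_Suc_D by blast+
  have low: "symbol_bound k w' h" if "symbol_bound (Suc k) w' h" for w' and h :: "'a \<Rightarrow> real"
    using that by (induction k arbitrary: w' h) auto
  have "symbol_bound k (\<lambda>z. 2 ^ k * (w z * (v z / norm z)) + 2 ^ k * (w z / norm z * v z))
        (\<lambda>x. f x * pderiv_dir i g x + pderiv_dir i f x * g x)" if "i \<in> Basis" for i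
    using Suc.prems that C low by (intro symbol_bound_add Suc.IH C_k_mult) auto
  moreover have "\<bar>f z * g z\<bar> \<le> 2 ^ Suc k * (w z * v z)" if "z \<noteq> 0" for z
  proof -
    have fg: "\<bar>f z\<bar> \<le> w z" "\<bar>g z\<bar> \<le> v z" using Suc.prems that by auto
    then have "\<bar>f z * g z\<bar> \<le> w z * v z"
      unfolding abs_mult by (intro mult_mono) auto
    also have "\<dots> \<le> 2 ^ Suc k * (w z * v z)"
      using mult_right_mono[of 1 "2 ^ Suc k" "w z * v z"] fg one_le_power[of "2::real" "Suc k"] by auto
    finally show ?thesis .
  qed
  moreover have "(\<lambda>z. 2 ^ k * (w z * (v z / norm z)) + 2 ^ k * (w z / norm z * v z)) =
      (\<lambda>z. 2 ^ Suc k * (w z * v z) / norm z)"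
    by (simp add: fun_eq_iff)
  ultimately show ?case unfolding symbol_bound.simps pd by simp
qed

lemma symbol_bound_cmult:
  "C_k k f \<Longrightarrow> symbol_bound k w f \<Longrightarrow> symbol_bound k (\<lambda>z. \<bar>c\<bar> * w z) (\<lambda>z. c * f z)"
proof (induction k arbitrary: f w)
  case (Suc k)
  have "pderiv_dir i (\<lambda>x. c * f x) = (\<lambda>x. c * pderiv_dir i f x)" for i
    using Suc.prems pderiv_dir_mult[of "\<lambda>_. c" _ f i]
    by (intro ext) (auto simp: differentiable_on_def pderiv_dir_const)
  then show ?case
    using Suc.IH[of "pderiv_dir _ f" "\<lambda>z. w z / norm z"] Suc.prems by (auto simp: abs_mult mult_left_mono)
qed (auto simp: abs_mult mult_left_mono)

section \<open>Symbol bounds under dilations and Laplacians\<close>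

lemma pderiv_dir_dilate:
  assumes "f differentiable (at (c *\<^sub>R x))"
  shows "pderiv_dir i (\<lambda>x. f (c *\<^sub>R x)) x = c * pderiv_dir i f (c *\<^sub>R x)"
proof -
  have d: "(f has_derivative frechet_derivative f (at (c *\<^sub>R x))) (at (c *\<^sub>R x))"
    by (rule has_derivative_pderiv[OF assms])
  have s: "((\<lambda>x. c *\<^sub>R x) has_derivative (\<lambda>x. c *\<^sub>R x)) (at x)"
    by (rule bounded_linear_imp_has_derivative[OF bounded_linear_scaleR_right])
  have "linear (frechet_derivative f (at (c *\<^sub>R x)))" by (rule linear_frechet_derivative[OF assms])
  then show ?thesis
    using pderiv_dir_eqI[OF has_derivative_compose[OF s d], of i] by (simp add: pderiv_dir_def linear_scale)
qed

lemma differentiable_dilate: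
  fixes f :: "'a::euclidean_space \<Rightarrow> real"
  assumes "\<And>x. f differentiable (at x)"
  shows "(\<lambda>x. f (c *\<^sub>R x)) differentiable (at x)"
  by (rule differentiable_compose[OF assms])
    (intro bounded_linear_imp_differentiable bounded_linear_scaleR_right)

lemma C_k_dilate: "C_k k f \<Longrightarrow> C_k k (\<lambda>z. f (c *\<^sub>R z))"
proof (induction k arbitrary: f)
  case 0
  then show ?case by (auto intro!: continuous_on_compose2[of UNIV f] continuous_intros)
next
  case (Suc k)
  have "pderiv_dir i (\<lambda>x. f (c *\<^sub>R x)) = (\<lambda>x. c * pderiv_dir i f (c *\<^sub>R x))" for i
    using Suc.prems by (intro ext pderiv_dir_dilate) (auto simp: differentiable_on_def)
  with Suc show ?case
    by (auto intro!: C_k_cmult differentiable_onI_UNIV differentiable_dilate simp: differentiable_on_def)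
qed

text \<open>The factor c produced by the chain rule is absorbed by
  \<open>norm (c *\<^sub>R z)\<close> in the denominator. A constant weight therefore stays the same
  at all scales, which is what makes the cutoff bounds uniform.\<close>

lemma symbol_bound_dilate:
  assumes "c > 0"
  shows "C_k k f \<Longrightarrow> symbol_bound k w f \<Longrightarrow> symbol_bound k (\<lambda>z. w (c *\<^sub>R z)) (\<lambda>z. f (c *\<^sub>R z))"
proof (induction k arbitrary: f w)
  case 0
  then show ?case using assms by auto
next
  case (Suc k)
  have pd: "pderiv_dir i (\<lambda>x. f (c *\<^sub>R x)) = (\<lambda>x. c * pderiv_dir i f (c *\<^sub>R x))" for i
    using Suc.prems by (intro ext pderiv_dir_dilate) (auto simp: differentiable_on_def)
  have "symbol_bound k (\<lambda>z. w (c *\<^sub>R z) / norm z) (\<lambda>x. c * pderiv_dir i f (c *\<^sub>R x))" if "i \<in> Basis" for i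
  proof -
    have "symbol_bound k (\<lambda>z. \<bar>c\<bar> * (w (c *\<^sub>R z) / norm (c *\<^sub>R z))) (\<lambda>x. c * pderiv_dir i f (c *\<^sub>R x))"
      using Suc.prems that by (intro symbol_bound_cmult C_k_dilate Suc.IH) auto
    then show ?thesis by (rule symbol_bound_mono) (use assms in auto)
  qed
  then show ?case using Suc.prems assms by (auto simp: pd)
qed

lemma symbol_bound_laplacian:
  fixes f :: "'a::euclidean_space \<Rightarrow> real"
  assumes "C_k (Suc (Suc k)) f" "symbol_bound (Suc (Suc k)) w f"
  shows "symbol_bound k (\<lambda>z. real DIM('a) * w z / (norm z)\<^sup>2) (laplacian f)"
proof -
  have "symbol_bound k (\<lambda>z. \<Sum>i\<in>(Basis::'a set). w z / norm z / norm z)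
      (\<lambda>z. \<Sum>i\<in>Basis. pderiv_dir i (pderiv_dir i f) z)"
    using assms by (intro symbol_bound_sum) auto
  then show ?thesis unfolding laplacian_def[abs_def]
    by (simp add: power2_eq_square)
qed

lemma symbol_bound_laplacian_pow:
  fixes f :: "'a::euclidean_space \<Rightarrow> real"
  assumes "\<And>k. C_k k f"
  shows "symbol_bound (2 * m + k) w f \<Longrightarrow>
    symbol_bound k (\<lambda>z. real DIM('a) ^ m * w z / norm z ^ (2 * m)) ((laplacian ^^ m) f)"
proof (induction m arbitrary: k)
  case (Suc m)
  have "symbol_bound k (\<lambda>z. real DIM('a) * (real DIM('a) ^ m * w z / norm z ^ (2 * m)) / (norm z)\<^sup>2)
      (laplacian ((laplacian ^^ m) f))"
    by (intro symbol_bound_laplacian C_k_laplacian_pow assms Suc.IH) (use Suc.prems in simp)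
  then show ?case by (simp add: power2_eq_square mult_ac)
qed simp

text \<open>On the ball of radius R a constant bound C is at most C * R / \<open>norm z\<close>, so
  the decay in \<open>norm z\<close> required of the derivatives costs only a constant.\<close>

lemma symbol_bound_compact_support:
  fixes f :: "'a::euclidean_space \<Rightarrow> real"
  assumes "R > 0"
  shows "C_k k f \<Longrightarrow> (\<And>z. norm z > R \<Longrightarrow> f z = 0) \<Longrightarrow>
    \<exists>C\<ge>0. symbol_bound k (\<lambda>z. if norm z \<le> R then C else 0) f"
proof (induction k arbitrary: f)
  have bd: "\<exists>B\<ge>0. \<forall>z. \<bar>f z\<bar> \<le> (if norm z \<le> R then B else 0)"
    if "continuous_on UNIV f" "\<And>z. norm z > R \<Longrightarrow> f z = 0" for f :: "'a \<Rightarrow> real"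
  proof -
    have "compact (f ` cball 0 R)"
      using that(1) continuous_on_subset by (intro compact_continuous_image) auto
    then obtain B where "\<forall>y\<in>f ` cball 0 R. norm y \<le> B"
      using bounded_iff compact_imp_bounded by blast
    then show ?thesis using that(2) by (intro exI[of _ "max 0 B"]) (auto simp: dist_norm not_le le_max_iff_disj)
  qed
  {
    case 0
    then obtain B where "B \<ge> 0" "\<forall>z. \<bar>f z\<bar> \<le> (if norm z \<le> R then B else 0)"
      using bd[of f] by auto
    then show ?case by (intro exI[of _ B]) simp
  next
    case (Suc k)
    obtain B where B: "B \<ge> 0" "\<And>z. \<bar>f z\<bar> \<le> (if norm z \<le> R then B else 0)"
      using bd[OF C_k_continuous[OF Suc.prems(1)] Suc.prems(2)] by blast
    have "\<exists>C\<ge>0. symbol_bound k (\<lambda>z. if norm z \<le> R then C else 0) (pderiv_dir i f)" if "i \<in> Basis" for i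
    proof (rule Suc.IH)
      show "C_k k (pderiv_dir i f)" using Suc.prems that by simp
      fix z :: 'a assume "norm z > R"
      then have "pderiv_dir i f z = pderiv_dir i (\<lambda>_. 0) z"
        by (intro pderiv_dir_cong_open[of "{z. R < norm z}"] open_Collect_less continuous_intros)
          (use Suc.prems(2) in auto)
      then show "pderiv_dir i f z = 0" by (simp add: pderiv_dir_const)
    qed
    then obtain C where C: "\<And>i. i \<in> Basis \<Longrightarrow> C i \<ge> 0"
      "\<And>i. i \<in> Basis \<Longrightarrow> symbol_bound k (\<lambda>z. if norm z \<le> R then C i else 0) (pderiv_dir i f)"
      by metis
    \<comment> \<open>One constant has to dominate the supremum of the function and, after
      multiplication by R, the constants of all its first derivatives.\<close>
    define D where "D = B + (\<Sum>i\<in>Basis. C i * R)"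
    have CD: "C i * R \<le> D" if "i \<in> Basis" for i
    proof -
      have "C i * R \<le> (\<Sum>i\<in>Basis. C i * R)"
        using that C(1) assms by (intro member_le_sum) auto
      then show ?thesis using B by (simp add: D_def)
    qed
    have BD: "B \<le> D" using C(1) assms by (auto simp: D_def intro!: sum_nonneg)
    have "symbol_bound k (\<lambda>z. (if norm z \<le> R then D else 0) / norm z) (pderiv_dir i f)"
      if "i \<in> Basis" for i
    proof (rule symbol_bound_mono[OF C(2)[OF that]])
      fix z :: 'a assume "z \<noteq> 0"
      have "C i * norm z \<le> D" if "norm z \<le> R"
        using mult_left_mono[OF that C(1)[OF \<open>i \<in> Basis\<close>]] CD[OF \<open>i \<in> Basis\<close>] by linarith
      then show "(if norm z \<le> R then C i else 0) \<le> (if norm z \<le> R then D else 0) / norm z"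
        using \<open>z \<noteq> 0\<close> by (simp add: field_simps)
    qed
    moreover have "\<bar>f z\<bar> \<le> (if norm z \<le> R then D else 0)" for z
      using B(2)[of z] BD by (auto split: if_splits)
    ultimately show ?case using B BD by (intro exI[of _ D]) auto
  }
qed

text \<open>The difference of a radial step dilated by N and by 1 / N: the first term opens the
  cutoff near the origin, the second closes it at infinity, and the annuli exhaust the punctured
  space. Value 1 on a whole neighbourhood is requested so that Laplacians are also unaffected there.
  Uniformity in j comes from the invariance of symbol bounds under dilation.\<close>

lemma cutoff_exists:
  obtains \<psi> :: "nat \<Rightarrow> 'a::euclidean_space \<Rightarrow> real"
  where "\<And>j k. C_k k (\<psi> j)"
    "\<And>j z. \<psi> j z \<noteq> 0 \<Longrightarrow> norm z \<in> {1 / real (j + 2)..2 * real (j + 2)}"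
    "\<And>z. z \<noteq> 0 \<Longrightarrow> \<exists>S. open S \<and> z \<in> S \<and> (\<forall>\<^sub>F j in sequentially. \<forall>y\<in>S. \<psi> j y = 1)"
    "\<And>k. \<exists>C\<ge>0. \<forall>j. symbol_bound k (\<lambda>z. C) (\<psi> j)"
proof -
  obtain \<eta> :: "real \<Rightarrow> real" where \<eta>: "\<And>k. C_k k \<eta>" "\<And>t. t \<le> 1 \<Longrightarrow> \<eta> t = 0"
    "\<And>t. t \<ge> 2 \<Longrightarrow> \<eta> t = 1" "\<And>t. \<bar>\<eta> t\<bar> \<le> 1"
    using smooth_step_exists by blast
  define ch :: "'a \<Rightarrow> real" where "ch z = \<eta> ((norm z)\<^sup>2)" for z
  have ch: "C_k k ch" for k
    unfolding ch_def[abs_def] by (rule C_k_compose[OF \<eta>(1)]) simp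
  have ch0: "ch z = 0" if "norm z \<le> 1" for z
    using that \<eta>(2) by (simp add: ch_def power_le_one)
  have ch1: "ch z = 1" if "norm z \<ge> 2" for z
    using power_mono[OF that, of 2] \<eta>(3)[of "(norm z)\<^sup>2"] by (simp add: ch_def)
  have chb: "\<exists>C\<ge>0. symbol_bound k (\<lambda>z. C) ch" for k
  proof (cases k)
    case 0
    then show ?thesis using \<eta>(4) by (intro exI[of _ 1]) (auto simp: ch_def)
  next
    case (Suc j)
    \<comment> \<open>The step itself is 1 at infinity, but its first derivatives vanish outside
      radius 2, so the bound for compact support applies to them.\<close>
    have "\<exists>C\<ge>0. symbol_bound j (\<lambda>z. if norm z \<le> 2 then C else 0) (pderiv_dir i ch)" if "i \<in> Basis" for i
    proof (rule symbol_bound_compact_support)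
      show "C_k j (pderiv_dir i ch)" using ch[of "Suc j"] that by simp
      fix z :: 'a assume "norm z > 2"
      then have "pderiv_dir i ch z = pderiv_dir i (\<lambda>_. 1) z"
        by (intro pderiv_dir_cong_open[of "{z. 2 < norm z}"] open_Collect_less continuous_intros)
          (use ch1 in auto)
      then show "pderiv_dir i ch z = 0" by (simp add: pderiv_dir_const)
    qed simp
    then obtain C where C: "\<And>i. i \<in> Basis \<Longrightarrow> C i \<ge> 0"
      "\<And>i. i \<in> Basis \<Longrightarrow> symbol_bound j (\<lambda>z. if norm z \<le> 2 then C i else 0) (pderiv_dir i ch)"
      by metis
    define D where "D = 1 + (\<Sum>i\<in>Basis. C i * 2)"
    have CD: "C i * 2 \<le> D" if "i \<in> Basis" for i
    proof -
      have "C i * 2 \<le> (\<Sum>i\<in>Basis. C i * 2)" using that C(1) by (intro member_le_sum) auto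
      then show ?thesis by (simp add: D_def)
    qed
    have D1: "1 \<le> D" using C(1) by (auto simp: D_def intro!: sum_nonneg)
    have "symbol_bound j (\<lambda>z. D / norm z) (pderiv_dir i ch)" if "i \<in> Basis" for i
    proof (rule symbol_bound_mono[OF C(2)[OF that]])
      fix z :: 'a assume "z \<noteq> 0"
      have "C i * norm z \<le> D" if "norm z \<le> 2"
        using mult_left_mono[OF that C(1)[OF \<open>i \<in> Basis\<close>]] CD[OF \<open>i \<in> Basis\<close>] by linarith
      then show "(if norm z \<le> 2 then C i else 0) \<le> D / norm z"
        using \<open>z \<noteq> 0\<close> D1 by (simp add: field_simps)
    qed
    then show ?thesis using D1 \<eta>(4) Suc by (intro exI[of _ D]) (auto simp: ch_def intro: order_trans)
  qed
  define \<psi> where "\<psi> j z = ch (real (j + 2) *\<^sub>R z) + (- 1) * ch ((1 / real (j + 2)) *\<^sub>R z)" for j z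
  show ?thesis
  proof
    show "C_k k (\<psi> j)" for j k
      unfolding \<psi>_def[abs_def] by (intro C_k_add C_k_cmult C_k_dilate ch)
  next
    fix j z assume nz: "\<psi> j z \<noteq> 0"
    show "norm z \<in> {1 / real (j + 2)..2 * real (j + 2)}"
    proof (rule ccontr)
      assume "\<not> ?thesis"
      then consider "norm z < 1 / real (j + 2)" | "norm z > 2 * real (j + 2)" by force
      then show False
      proof cases
        case 1
        then have "real (j + 2) * norm z \<le> 1" by (simp add: field_simps)
        moreover have "norm z \<le> real (j + 2) * norm z"
          using mult_right_mono[of 1 "real (j + 2)" "norm z"] by simp
        moreover have "1 / real (j + 2) * norm z \<le> norm z"
          using mult_right_mono[of "1 / real (j + 2)" 1 "norm z"] by simp
        ultimately show False
          using nz ch0[of "real (j + 2) *\<^sub>R z"] ch0[of "(1 / real (j + 2)) *\<^sub>R z"] by (simp add: \<psi>_def)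
      next
        case 2
        then have "1 / real (j + 2) * norm z \<ge> 2" by (simp add: field_simps)
        moreover have "norm z \<le> real (j + 2) * norm z"
          using mult_right_mono[of 1 "real (j + 2)" "norm z"] by simp
        moreover have "1 / real (j + 2) * norm z \<le> norm z"
          using mult_right_mono[of "1 / real (j + 2)" 1 "norm z"] by simp
        ultimately show False
          using nz ch1[of "real (j + 2) *\<^sub>R z"] ch1[of "(1 / real (j + 2)) *\<^sub>R z"] by (simp add: \<psi>_def)
      qed
    qed
  next
    fix z :: 'a assume z: "z \<noteq> 0"
    let ?S = "{y. norm z / 2 < norm y} \<inter> {y. norm y < 2 * norm z}"
    have "open ?S" by (intro open_Int open_Collect_less continuous_intros)
    moreover have "z \<in> ?S" using z by auto
    moreover have "\<forall>\<^sub>F j in sequentially. \<forall>y\<in>?S. \<psi> j y = 1"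
    proof -
      \<comment> \<open>On the shell between \<open>norm z / 2\<close> and \<open>2 * norm z\<close>
        the first bound brings N * \<open>norm y\<close> above 2, where the step is 1, and the
        second brings \<open>norm y\<close> / N below 1, where it is 0.\<close>
      obtain N :: nat where N: "real N > 4 / norm z" "real N > 2 * norm z"
        using reals_Archimedean2[of "max (4 / norm z) (2 * norm z)"] by auto
      have "\<psi> j y = 1" if "j \<ge> N" "y \<in> ?S" for j y
      proof -
        have "real (j + 2) \<ge> 4 / norm z" "real (j + 2) \<ge> 2 * norm z" using N that(1) by linarith+
        then have "real (j + 2) * norm z \<ge> 4" using z by (simp add: field_simps)
        moreover have "real (j + 2) * norm y \<ge> real (j + 2) * (norm z / 2)"
          using that(2) by (intro mult_left_mono) auto
        ultimately have "real (j + 2) * norm y \<ge> 2" by linarith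
        moreover have "1 / real (j + 2) * norm y \<le> 1"
          using that(2) \<open>real (j + 2) \<ge> 2 * norm z\<close> by (simp add: field_simps)
        ultimately show ?thesis
          using ch1[of "real (j + 2) *\<^sub>R y"] ch0[of "(1 / real (j + 2)) *\<^sub>R y"] by (simp add: \<psi>_def)
      qed
      then show ?thesis unfolding eventually_sequentially by blast
    qed
    ultimately show "\<exists>S. open S \<and> z \<in> S \<and> (\<forall>\<^sub>F j in sequentially. \<forall>y\<in>S. \<psi> j y = 1)" by blast
  next
    fix k
    obtain C where C: "C \<ge> 0" "symbol_bound k (\<lambda>z. C) ch" using chb by blast
    have "symbol_bound k (\<lambda>z. C + \<bar>-1\<bar> * C) (\<psi> j)" for j
      unfolding \<psi>_def[abs_def] 
      using symbol_bound_dilate[OF _ ch[of k] C(2), of "real (j + 2)"]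
        symbol_bound_dilate[OF _ ch[of k] C(2), of "1 / real (j + 2)"]
      by (intro symbol_bound_add symbol_bound_cmult C_k_cmult C_k_dilate ch) auto
    then show "\<exists>C\<ge>0. \<forall>j. symbol_bound k (\<lambda>z. C) (\<psi> j)"
      using C(1) by (intro exI[of _ "C + \<bar>-1\<bar> * C"]) auto
  qed
qed

section \<open>Gaussians as test functions\<close>

lemma has_derivative_polynomial_pderiv:
  fixes p :: "'a::euclidean_space \<Rightarrow> real"
  assumes "real_polynomial_function p"
  shows "p differentiable (at x) \<and> real_polynomial_function (pderiv_dir i p)"
  using assms
proof (induction arbitrary: x rule: real_polynomial_function.induct)
  case (linear f)
  have "pderiv_dir i f = (\<lambda>_. f i)"
    by (intro ext pderiv_dir_eqI bounded_linear_imp_has_derivative linear)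
  then show ?case using linear by (auto intro: bounded_linear_imp_differentiable real_polynomial_function.intros)
next
  case (const c)
  then show ?case by (auto simp: pderiv_dir_const intro: real_polynomial_function.intros)
next
  case (add f g)
  have "pderiv_dir i (\<lambda>x. f x + g x) = (\<lambda>x. pderiv_dir i f x + pderiv_dir i g x)"
    using add by (intro ext pderiv_dir_add) auto
  then show ?case using add by (auto intro: real_polynomial_function.intros)
next
  case (mult f g)
  have "pderiv_dir i (\<lambda>x. f x * g x) = (\<lambda>x. f x * pderiv_dir i g x + pderiv_dir i f x * g x)"
    using mult by (intro ext pderiv_dir_mult) auto
  moreover have "real_polynomial_function (\<lambda>x. f x * pderiv_dir i g x + pderiv_dir i f x * g x)"
    using mult by (intro real_polynomial_function.intros(3,4)) auto
  ultimately show ?case using mult by auto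
qed

text \<open>The exponent \<open>b\<close> stays arbitrary in the induction, so that a product can
  spend \<open>b / 2\<close> on each of its factors.\<close>

lemma polynomial_le_gaussian:
  fixes p :: "'a::euclidean_space \<Rightarrow> real"
  assumes "real_polynomial_function p" "b > 0"
  shows "\<exists>C\<ge>0. \<forall>z. \<bar>p z\<bar> \<le> C * exp (b * (norm (z - x))\<^sup>2)"
  using assms
proof (induction arbitrary: b rule: real_polynomial_function.induct)
  case (linear f)
  then obtain K where K: "\<And>z. norm (f z) \<le> norm z * K" "K > 0"
    using bounded_linear.pos_bounded by blast
  have "\<bar>f z\<bar> \<le> (norm x + 1 + 1 / b) * K * exp (b * (norm (z - x))\<^sup>2)" for z
  proof -
    define t where "t = norm (z - x)"
    have "norm z \<le> norm x + t" unfolding t_def by (metis norm_triangle_sub)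
    also have "t \<le> 1 + t\<^sup>2" 
      using zero_le_power2[of "t - 1"] norm_ge_zero[of "z - x"] unfolding power2_diff t_def[symmetric] by (simp only: power_one)
    also have "t\<^sup>2 = (1 / b) * (b * t\<^sup>2)" using linear by simp
    also have "\<dots> \<le> (1 / b) * exp (b * t\<^sup>2)"
    proof (rule mult_left_mono)
      show "b * t\<^sup>2 \<le> exp (b * t\<^sup>2)" using exp_ge_add_one_self[of "b * t\<^sup>2"] by linarith
    qed (use linear in simp)
    also have "norm x + (1 + 1 / b * exp (b * t\<^sup>2)) \<le> (norm x + 1 + 1 / b) * exp (b * t\<^sup>2)"
      using linear mult_left_mono[of 1 "exp (b * t\<^sup>2)" "norm x + 1"] by (simp add: distrib_right)
    finally have "norm z \<le> (norm x + 1 + 1 / b) * exp (b * t\<^sup>2)" by simp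
    from mult_right_mono[OF this, of K] K show ?thesis 
      using order_trans[OF K(1)[of z]] by (simp add: t_def mult_ac)
  qed
  then show ?case using K linear by (intro exI[of _ "(norm x + 1 + 1 / b) * K"]) auto
next
  case (const c)
  have "\<bar>c\<bar> \<le> \<bar>c\<bar> * exp (b * (norm (z - x))\<^sup>2)" for z
    using const mult_left_mono[of 1 "exp (b * (norm (z - x))\<^sup>2)" "\<bar>c\<bar>"] by simp
  then show ?case by (intro exI[of _ "\<bar>c\<bar>"]) auto
next
  case (add f g)
  obtain C D where "C \<ge> 0" "D \<ge> 0" "\<And>z. \<bar>f z\<bar> \<le> C * exp (b * (norm (z - x))\<^sup>2)"
    "\<And>z. \<bar>g z\<bar> \<le> D * exp (b * (norm (z - x))\<^sup>2)"
    using add.IH[OF \<open>b > 0\<close>] by blast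
  then show ?case by (intro exI[of _ "C + D"])
     (auto simp: distrib_right intro!: order_trans[OF abs_triangle_ineq] add_mono)
next
  case (mult f g)
  have "b / 2 > 0" using mult by simp
  then obtain C D where CD: "C \<ge> 0" "D \<ge> 0" "\<And>z. \<bar>f z\<bar> \<le> C * exp (b / 2 * (norm (z - x))\<^sup>2)"
    "\<And>z. \<bar>g z\<bar> \<le> D * exp (b / 2 * (norm (z - x))\<^sup>2)"
    using mult.IH by blast
  have "\<bar>f z * g z\<bar> \<le> C * D * exp (b * (norm (z - x))\<^sup>2)" for z
  proof -
    have "\<bar>f z * g z\<bar> \<le> (C * exp (b / 2 * (norm (z - x))\<^sup>2)) * (D * exp (b / 2 * (norm (z - x))\<^sup>2))"
      unfolding abs_mult by (intro mult_mono CD) (use CD in auto)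
    also have "\<dots> = C * D * (exp (b / 2 * (norm (z - x))\<^sup>2) * exp (b / 2 * (norm (z - x))\<^sup>2))"
      by (simp only: mult_ac)
    also have "exp (b / 2 * (norm (z - x))\<^sup>2) * exp (b / 2 * (norm (z - x))\<^sup>2) = exp (b * (norm (z - x))\<^sup>2)"
      unfolding exp_add[symmetric] by simp
    finally show ?thesis .
  qed
  then show ?case using CD by (intro exI[of _ "C * D"]) auto
qed

lemma C_k_gaussian: "C_k k (\<lambda>z::'a::euclidean_space. exp (- a * (norm (z - x))\<^sup>2))"
  by (rule C_k_compose[OF C_k_exp]) (intro C_k_cmult C_k_norm_sq)

text \<open>Half of the exponent pays for the polynomial, and the power of
  \<open>max 1 (norm z)\<close> pays for the division by \<open>norm z\<close> that the symbol bound
  imposes at each derivative. All polynomials are treated at once because differentiation replaces p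
  by p' - 2 * a * ((z - x) \<bullet> i) * p in front of the same Gaussian.\<close>

lemma symbol_bound_gaussian:
  fixes p :: "'a::euclidean_space \<Rightarrow> real"
  assumes a: "a > 0"
  shows "real_polynomial_function p \<Longrightarrow> \<exists>C\<ge>0. symbol_bound k
     (\<lambda>z. C * max 1 (norm z) ^ k * exp (- (a / 2) * (norm (z - x))\<^sup>2))
     (\<lambda>z. p z * exp (- a * (norm (z - x))\<^sup>2))"
proof (induction k arbitrary: p)
  have base: "\<exists>C\<ge>0. \<forall>z. \<bar>p z * exp (- a * (norm (z - x))\<^sup>2)\<bar> \<le> C * exp (- (a / 2) * (norm (z - x))\<^sup>2)"
    if p: "real_polynomial_function p" for p :: "'a \<Rightarrow> real"
  proof -
    obtain C where C: "C \<ge> 0" "\<And>z. \<bar>p z\<bar> \<le> C * exp (a / 2 * (norm (z - x))\<^sup>2)"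
      using polynomial_le_gaussian[OF p, of "a / 2" x] a by auto
    have "\<bar>p z * exp (- a * (norm (z - x))\<^sup>2)\<bar> \<le> C * exp (- (a / 2) * (norm (z - x))\<^sup>2)" for z
    proof -
      have "\<bar>p z * exp (- a * (norm (z - x))\<^sup>2)\<bar> \<le>
          (C * exp (a / 2 * (norm (z - x))\<^sup>2)) * exp (- a * (norm (z - x))\<^sup>2)"
        unfolding abs_mult abs_exp_cancel by (intro mult_right_mono C) simp
      also have "\<dots> = C * exp (- (a / 2) * (norm (z - x))\<^sup>2)"
        unfolding mult.assoc exp_add[symmetric] by simp
      finally show ?thesis .
    qed
    then show ?thesis using C(1) by blast
  qed
  {
    case 0
    then show ?case using base[of p] by auto
  next
    case (Suc k)
    let ?g = "\<lambda>z. exp (- a * (norm (z - x))\<^sup>2)"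
    obtain B where B: "B \<ge> 0" "\<And>z. \<bar>p z * ?g z\<bar> \<le> B * exp (- (a / 2) * (norm (z - x))\<^sup>2)"
      using base[OF Suc.prems] by blast
    have pd: "pderiv_dir i (\<lambda>z. p z * ?g z) =
        (\<lambda>z. (p z * (- 2 * a * ((z - x) \<bullet> i)) + pderiv_dir i p z) * ?g z)" for i
    proof
      fix z
      have "pderiv_dir i (\<lambda>z. p z * ?g z) z = p z * pderiv_dir i ?g z + pderiv_dir i p z * ?g z"
        by (intro pderiv_dir_mult C_k_differentiable[OF C_k_gaussian])
          (use has_derivative_polynomial_pderiv[OF Suc.prems] in auto)
      also have "pderiv_dir i ?g z = pderiv_dir 1 exp (- a * (norm (z - x))\<^sup>2) * pderiv_dir i (\<lambda>z. - a * (norm (z - x))\<^sup>2) z"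
        by (intro pderiv_dir_compose C_k_differentiable[OF C_k_exp]
            C_k_differentiable[OF C_k_cmult[OF C_k_norm_sq]])
      also have "pderiv_dir 1 exp (- a * (norm (z - x))\<^sup>2) = ?g z"
        by (rule pderiv_dir_real) (rule DERIV_exp)
      also have "pderiv_dir i (\<lambda>z. - a * (norm (z - x))\<^sup>2) z = - a * (2 * ((z - x) \<bullet> i))"
        using pderiv_dir_mult[of "\<lambda>_. - a" z "\<lambda>z. (norm (z - x))\<^sup>2" i] differentiable_norm_sq[of x z]
        by (simp add: pderiv_dir_const pderiv_dir_norm_sq)
      finally show "pderiv_dir i (\<lambda>z. p z * ?g z) z =
          (p z * (- 2 * a * ((z - x) \<bullet> i)) + pderiv_dir i p z) * ?g z"
        by (simp add: algebra_simps)
    qed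
    have lin: "real_polynomial_function (\<lambda>z. (z - x) \<bullet> i)" for i
      using real_polynomial_function.intros(3)[OF real_polynomial_function.intros(1)[OF bounded_linear_inner_left[of i]]
        real_polynomial_function.intros(2)[of "- (x \<bullet> i)"]] by (simp add: inner_diff_left)
    have "real_polynomial_function (\<lambda>z. p z * (- 2 * a * ((z - x) \<bullet> i)) + pderiv_dir i p z)" for i
      using has_derivative_polynomial_pderiv[OF Suc.prems] lin
      by (intro real_polynomial_function.intros(2,3,4) Suc.prems) auto
    from Suc.IH[OF this] obtain C where C: "\<And>i. C i \<ge> 0"
      "\<And>i. symbol_bound k (\<lambda>z. C i * max 1 (norm z) ^ k * exp (- (a / 2) * (norm (z - x))\<^sup>2))
       (pderiv_dir i (\<lambda>z. p z * ?g z))"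
      unfolding pd by meson
    define D where "D = B + (\<Sum>i\<in>Basis. C i)"
    have CD: "C i \<le> D" if "i \<in> Basis" for i
    proof -
      have "C i \<le> (\<Sum>i\<in>Basis. C i)" using that C(1) by (intro member_le_sum) auto
      then show ?thesis using B by (simp add: D_def)
    qed
    have BD: "B \<le> D" using C(1) by (auto simp: D_def intro!: sum_nonneg)
    have "symbol_bound k (\<lambda>z. D * max 1 (norm z) ^ Suc k * exp (- (a / 2) * (norm (z - x))\<^sup>2) / norm z)
       (pderiv_dir i (\<lambda>z. p z * ?g z))" if "i \<in> Basis" for i
    proof (rule symbol_bound_mono[OF C(2)])
      fix z :: 'a assume "z \<noteq> 0"
      have "C i * max 1 (norm z) ^ k * norm z \<le> D * max 1 (norm z) ^ k * max 1 (norm z)"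
        using CD[OF that] C(1)[of i] by (intro mult_mono) auto
      then have "C i * max 1 (norm z) ^ k \<le> D * max 1 (norm z) ^ Suc k / norm z"
        using \<open>z \<noteq> 0\<close> by (simp add: field_simps)
      from mult_right_mono[OF this, of "exp (- (a / 2) * (norm (z - x))\<^sup>2)"]
      show "C i * max 1 (norm z) ^ k * exp (- (a / 2) * (norm (z - x))\<^sup>2)
        \<le> D * max 1 (norm z) ^ Suc k * exp (- (a / 2) * (norm (z - x))\<^sup>2) / norm z"
        by simp
    qed
    moreover have "\<bar>p z * ?g z\<bar> \<le> D * max 1 (norm z) ^ Suc k * exp (- (a / 2) * (norm (z - x))\<^sup>2)" for z
    proof -
      have "B * 1 \<le> D * max 1 (norm z) ^ Suc k"
        using B BD by (intro mult_mono one_le_power) auto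
      from mult_right_mono[OF this, of "exp (- (a / 2) * (norm (z - x))\<^sup>2)"] show ?thesis
        using order_trans[OF B(2)[of z]] by simp
    qed
    ultimately show ?case using B BD by (intro exI[of _ D]) auto
  }
qed

text \<open>The Gaussian times the annular cutoffs. The two bounds do not depend on j and serve as
  majorants for dominated convergence on the two sides of the weak equation; the singular factor
  \<open>norm z ^ (2 * m)\<close> in the denominator is the price of the cutoffs shrinking to the
  origin.\<close>

lemma gaussian_test_approximation:
  fixes x :: "'a::euclidean_space" and m :: nat
  assumes a: "a > 0"
  defines "g \<equiv> (\<lambda>z. exp (- a * (norm (z - x))\<^sup>2))"
  obtains \<phi> C where "\<And>j. test_function_on (- {0}) (\<phi> j)" "C \<ge> 0"
    "\<And>j z. z \<noteq> 0 \<Longrightarrow> \<bar>\<phi> j z\<bar> \<le> C * g z"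
    "\<And>j z. z \<noteq> 0 \<Longrightarrow> \<bar>(laplacian ^^ m) (\<phi> j) z\<bar> \<le>
       C * max 1 (norm z) ^ (2 * m) * exp (- (a / 2) * (norm (z - x))\<^sup>2) / norm z ^ (2 * m)"
    "\<And>z. z \<noteq> 0 \<Longrightarrow> \<forall>\<^sub>F j in sequentially. \<phi> j z = g z \<and> (laplacian ^^ m) (\<phi> j) z = (laplacian ^^ m) g z"
proof -
  obtain \<psi> :: "nat \<Rightarrow> 'a \<Rightarrow> real" where \<psi>: "\<And>j k. C_k k (\<psi> j)"
    "\<And>j z. \<psi> j z \<noteq> 0 \<Longrightarrow> norm z \<in> {1 / real (j + 2)..2 * real (j + 2)}"
    "\<And>z. z \<noteq> 0 \<Longrightarrow> \<exists>S. open S \<and> z \<in> S \<and> (\<forall>\<^sub>F j in sequentially. \<forall>y\<in>S. \<psi> j y = 1)"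
    "\<And>k. \<exists>C\<ge>0. \<forall>j. symbol_bound k (\<lambda>z. C) (\<psi> j)"
    using cutoff_exists by blast
  define \<phi> where "\<phi> j z = g z * \<psi> j z" for j z
  obtain C1 where C1: "C1 \<ge> 0" "\<And>j. symbol_bound (2 * m) (\<lambda>z. C1) (\<psi> j)" using \<psi>(4) by blast
  obtain C2 where C2: "C2 \<ge> 0" "symbol_bound (2 * m)
     (\<lambda>z. C2 * max 1 (norm z) ^ (2 * m) * exp (- (a / 2) * (norm (z - x))\<^sup>2)) g"
    using symbol_bound_gaussian[OF a, of "\<lambda>_. 1" "2 * m" x] real_polynomial_function.intros(2)[of 1]
    unfolding g_def by auto
  have g: "C_k k g" for k unfolding g_def by (rule C_k_gaussian)
  have \<phi>C: "C_k k (\<phi> j)" for k j unfolding \<phi>_def[abs_def] by (intro C_k_mult g \<psi>)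
  define C where "C = max C1 (real DIM('a) ^ m * (2 ^ (2 * m) * (C2 * C1)))"
  show ?thesis
  proof (rule that[of \<phi> C])
    show "C \<ge> 0" using C1 by (simp add: C_def)
  next
    fix j
    let ?K = "{z. 1 / real (j + 2) \<le> norm z} \<inter> {z. norm z \<le> 2 * real (j + 2)} :: 'a set"
    have sub: "{z. \<phi> j z \<noteq> 0} \<subseteq> ?K" using \<psi>(2) by (auto simp: \<phi>_def)
    have "closed ?K" by (intro closed_Int closed_Collect_le continuous_intros)
    then have cl: "closure {z. \<phi> j z \<noteq> 0} \<subseteq> ?K" using sub closure_minimal by blast
    have "bounded ?K" by (rule bounded_subset[OF bounded_cball[of 0 "2 * real (j + 2)"]]) auto
    then have "compact (closure {z. \<phi> j z \<noteq> 0})"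
      using cl bounded_subset by (auto simp: compact_eq_bounded_closed)
    then show "test_function_on (- {0}) (\<phi> j)"
      using \<phi>C cl by (auto simp: test_function_on_def)
  next
    fix j and z :: 'a assume z: "z \<noteq> 0"
    have "\<bar>\<psi> j z\<bar> \<le> C" using symbol_bound_abs[OF C1(2) z, of j] by (simp add: C_def)
    then show "\<bar>\<phi> j z\<bar> \<le> C * g z"
      by (simp add: \<phi>_def abs_mult g_def)
  next
    fix j and z :: 'a assume z: "z \<noteq> 0"
    let ?w = "\<lambda>z. C2 * max 1 (norm z) ^ (2 * m) * exp (- (a / 2) * (norm (z - x))\<^sup>2)"
    have "symbol_bound (2 * m) (\<lambda>z. 2 ^ (2 * m) * (?w z * C1)) (\<phi> j)"
      unfolding \<phi>_def[abs_def] by (intro symbol_bound_mult g \<psi> C2 C1)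
    then have "symbol_bound 0 (\<lambda>z. real DIM('a) ^ m * (2 ^ (2 * m) * (?w z * C1)) / norm z ^ (2 * m))
        ((laplacian ^^ m) (\<phi> j))"
      by (intro symbol_bound_laplacian_pow \<phi>C) simp
    then have "\<bar>(laplacian ^^ m) (\<phi> j) z\<bar> \<le> real DIM('a) ^ m * (2 ^ (2 * m) * (?w z * C1)) / norm z ^ (2 * m)"
      using z by simp
    also have "\<dots> = (real DIM('a) ^ m * (2 ^ (2 * m) * (C2 * C1))) *
       (max 1 (norm z) ^ (2 * m) * exp (- (a / 2) * (norm (z - x))\<^sup>2) / norm z ^ (2 * m))"
      by simp
    also have "\<dots> \<le> C * (max 1 (norm z) ^ (2 * m) * exp (- (a / 2) * (norm (z - x))\<^sup>2) / norm z ^ (2 * m))"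
      by (intro mult_right_mono) (auto simp: C_def)
    finally show "\<bar>(laplacian ^^ m) (\<phi> j) z\<bar> \<le>
       C * max 1 (norm z) ^ (2 * m) * exp (- (a / 2) * (norm (z - x))\<^sup>2) / norm z ^ (2 * m)" by simp
  next
    fix z :: 'a assume z: "z \<noteq> 0"
    then obtain S where S: "open S" "z \<in> S" "\<forall>\<^sub>F j in sequentially. \<forall>y\<in>S. \<psi> j y = 1"
      using \<psi>(3) by blast
    from S(3) show "\<forall>\<^sub>F j in sequentially. \<phi> j z = g z \<and> (laplacian ^^ m) (\<phi> j) z = (laplacian ^^ m) g z"
    proof eventually_elim
      case (elim j)
      then show ?case using S by (auto simp: \<phi>_def intro!: laplacian_pow_cong_open[OF S(1,2)])
    qed
  qed
qed

section \<open>Closed form of the iterated Laplacian of a Gaussian\<close>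

lemma laplacian_radial:
  fixes x :: "'a::euclidean_space"
  assumes "\<And>t. (h has_real_derivative h' t) (at t)" "\<And>t. (h' has_real_derivative h'' t) (at t)"
  shows "laplacian (\<lambda>z. h ((norm (z - x))\<^sup>2)) z =
    4 * (norm (z - x))\<^sup>2 * h'' ((norm (z - x))\<^sup>2) + 2 * real DIM('a) * h' ((norm (z - x))\<^sup>2)"
proof -
  have diff: "k differentiable (at t)" if "\<And>t. (k has_real_derivative k' t) (at t)" for k k' :: "real \<Rightarrow> real" and t
    using that by (auto simp: differentiable_def has_field_derivative_def)
  have comp: "pderiv_dir i (\<lambda>z. k ((norm (z - x))\<^sup>2)) z = k' ((norm (z - x))\<^sup>2) * (2 * ((z - x) \<bullet> i))"
    if "\<And>t. (k has_real_derivative k' t) (at t)" for k k' :: "real \<Rightarrow> real" and z i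
    using pderiv_dir_compose[OF diff[OF that] differentiable_norm_sq, of i x z]
    by (simp add: pderiv_dir_real[OF that] pderiv_dir_norm_sq)
  have "pderiv_dir i (pderiv_dir i (\<lambda>z. h ((norm (z - x))\<^sup>2))) z =
      4 * ((z - x) \<bullet> i)\<^sup>2 * h'' ((norm (z - x))\<^sup>2) + 2 * h' ((norm (z - x))\<^sup>2)" if "i \<in> Basis" for i
  proof -
    have lin: "((\<lambda>z. 2 * ((z - x) \<bullet> i)) has_derivative (\<lambda>v. 2 * (v \<bullet> i))) (at z)"
      by (auto intro!: derivative_eq_intros)
    have "pderiv_dir i (\<lambda>z. h' ((norm (z - x))\<^sup>2) * (2 * ((z - x) \<bullet> i))) z =
       h' ((norm (z - x))\<^sup>2) * pderiv_dir i (\<lambda>z. 2 * ((z - x) \<bullet> i)) z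
       + pderiv_dir i (\<lambda>z. h' ((norm (z - x))\<^sup>2)) z * (2 * ((z - x) \<bullet> i))"
      using lin by (intro pderiv_dir_mult differentiable_compose[OF diff[OF assms(2)] differentiable_norm_sq])
        (auto simp: differentiable_def)
    also have "pderiv_dir i (\<lambda>z. 2 * ((z - x) \<bullet> i)) z = 2"
      using pderiv_dir_eqI[OF lin, of i] that by simp
    finally show ?thesis
      unfolding comp[OF assms(1)] comp[OF assms(2)] by (simp add: power2_eq_square algebra_simps)
  qed
  then have "laplacian (\<lambda>z. h ((norm (z - x))\<^sup>2)) z =
     (\<Sum>i\<in>Basis. 4 * ((z - x) \<bullet> i)\<^sup>2 * h'' ((norm (z - x))\<^sup>2) + 2 * h' ((norm (z - x))\<^sup>2))"
    unfolding laplacian_def by simp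
  also have "\<dots> = 4 * (\<Sum>i\<in>Basis. ((z - x) \<bullet> i)\<^sup>2) * h'' ((norm (z - x))\<^sup>2) + 2 * real DIM('a) * h' ((norm (z - x))\<^sup>2)"
    by (simp add: sum.distrib sum_distrib_left sum_distrib_right)
  also have "(\<Sum>i\<in>Basis. ((z - x) \<bullet> i)\<^sup>2) = (norm (z - x))\<^sup>2"
    unfolding power2_norm_eq_inner by (subst euclidean_inner) (simp add: power2_eq_square)
  finally show ?thesis .
qed

text \<open>Up to the scaling \<open>(- 4) ^ m * fact m\<close> this is the generalised Laguerre polynomial with
  parameter \<open>h - 1\<close>.\<close>

primrec laguerre_poly :: "real \<Rightarrow> nat \<Rightarrow> real poly" where
  "laguerre_poly h 0 = 1"
| "laguerre_poly h (Suc m) = smult (- 4) (smult (h + real m) (laguerre_poly h m)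
      + [:0, 1:] * pderiv (laguerre_poly h m) - [:0, 1:] * laguerre_poly h m)"

text \<open>Laguerre's differential equation. The recursion defining \<open>laguerre_poly\<close> is
  of first order because it is the action of - 4 * a^2 * d / da on a^(m + h) * p(a * v) * exp (- a *
  v). This equation reconciles it with the second-order operator that the Laplacian induces on
  radial functions.\<close>

lemma laguerre_poly_ode:
  "y * poly (pderiv (pderiv (laguerre_poly h m))) y + (h - y) * poly (pderiv (laguerre_poly h m)) y
     + real m * poly (laguerre_poly h m) y = 0"
proof (induction m arbitrary: y)
  case (Suc m)
  define q where "q = laguerre_poly h m"
  let ?X = "[:0, 1:] :: real poly"
  have ode: "y * poly (pderiv (pderiv q)) y = (y - h) * poly (pderiv q) y - real m * poly q y" for y
    using Suc[of y] by (simp add: q_def algebra_simps)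
  define p where "p = smult (h + real m) q + ?X * pderiv q - ?X * q"
  \<comment> \<open>Inserting the equation for q leaves the contiguous relation p' = (m + 1) * (q' -
    q). Differentiating it once more expresses everything in the equation for p through q.\<close>
  have "poly (pderiv p) y = poly (smult (real m + 1) (pderiv q - q)) y" for y
  proof -
    have "poly (pderiv p) y = (h + real m) * poly (pderiv q) y + poly (pderiv q) y
        + y * poly (pderiv (pderiv q)) y - poly q y - y * poly (pderiv q) y"
      by (simp add: p_def pderiv_add pderiv_diff pderiv_smult pderiv_mult pderiv_pCons algebra_simps)
    then show ?thesis unfolding ode by (simp add: algebra_simps)
  qed
  then have d1: "pderiv p = smult (real m + 1) (pderiv q - q)"
    using poly_eq_poly_eq_iff by blast
  have d2: "pderiv (pderiv p) = smult (real m + 1) (pderiv (pderiv q) - pderiv q)"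
    unfolding d1 by (simp add: pderiv_smult pderiv_diff)
  have "y * poly (pderiv (pderiv p)) y + (h - y) * poly (pderiv p) y + (real m + 1) * poly p y =
     (real m + 1) * (y * poly (pderiv (pderiv q)) y - y * poly (pderiv q) y + (h - y) * (poly (pderiv q) y - poly q y) + poly p y)"
    unfolding d2 unfolding d1 by (simp add: algebra_simps)
  also have "\<dots> = 0"
    unfolding ode by (simp add: p_def algebra_simps)
  finally have "(- 4) * (y * poly (pderiv (pderiv p)) y + (h - y) * poly (pderiv p) y + (real m + 1) * poly p y) = 0"
    by simp
  moreover have "laguerre_poly h (Suc m) = smult (- 4) p" by (simp add: p_def q_def)
  note this
  ultimately show ?case
    unfolding \<open>laguerre_poly h (Suc m) = smult (- 4) p\<close> pderiv_smult poly_smult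
    by (simp add: algebra_simps)
qed (simp add: pderiv_1)

lemma laplacian_pow_gaussian:
  fixes x :: "'a::euclidean_space"
  shows "(laplacian ^^ m) (\<lambda>z. exp (- a * (norm (z - x))\<^sup>2)) =
     (\<lambda>z. a ^ m * poly (laguerre_poly (real DIM('a) / 2) m) (a * (norm (z - x))\<^sup>2) * exp (- a * (norm (z - x))\<^sup>2))"
proof (induction m)
  case (Suc m)
  define q where "q = laguerre_poly (real DIM('a) / 2) m"
  define k where "k = (\<lambda>t. a ^ m * poly q (a * t) * exp (- a * t))"
  define k1 where "k1 = (\<lambda>t. a ^ m * a * poly (pderiv q - q) (a * t) * exp (- a * t))"
  define k2 where "k2 = (\<lambda>t. a ^ m * a * a * poly (pderiv (pderiv q) - 2 * pderiv q + q) (a * t) * exp (- a * t))"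
  have "(k has_real_derivative k1 t) (at t)" "(k1 has_real_derivative k2 t) (at t)" for t
    unfolding k_def k1_def k2_def
    by (auto intro!: derivative_eq_intros simp: pderiv_diff algebra_simps)
  from laplacian_radial[OF this]
  have "laplacian (\<lambda>z. k ((norm (z - x))\<^sup>2)) z = 4 * (norm (z - x))\<^sup>2 * k2 ((norm (z - x))\<^sup>2)
      + 2 * real DIM('a) * k1 ((norm (z - x))\<^sup>2)" for z .
  moreover have "4 * t * k2 t + 2 * real DIM('a) * k1 t =
     a ^ Suc m * poly (laguerre_poly (real DIM('a) / 2) (Suc m)) (a * t) * exp (- a * t)" for t
  proof -
    define y where "y = a * t"
    \<comment> \<open>The Laguerre equation removes the second derivative, so that the remaining
      expression is the first-order recursion.\<close>
    have ode: "y * poly (pderiv (pderiv q)) y = (y - real DIM('a) / 2) * poly (pderiv q) y - real m * poly q y"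
      using laguerre_poly_ode[of y "real DIM('a) / 2" m] by (simp add: q_def algebra_simps)
    have "4 * t * k2 t + 2 * real DIM('a) * k1 t =
      a ^ m * a * exp (- a * t) * (4 * (y * poly (pderiv (pderiv q)) y) - 8 * y * poly (pderiv q) y + 4 * y * poly q y
        + 2 * real DIM('a) * (poly (pderiv q) y - poly q y))"
      by (simp add: k1_def k2_def y_def algebra_simps)
    also have "\<dots> = a ^ m * a * exp (- a * t) * poly (laguerre_poly (real DIM('a) / 2) (Suc m)) y"
      unfolding ode by (simp add: q_def algebra_simps)
    finally show ?thesis by (simp add: y_def mult_ac)
  qed
  ultimately have "laplacian (\<lambda>z. k ((norm (z - x))\<^sup>2)) = (\<lambda>z. a ^ Suc m *
    poly (laguerre_poly (real DIM('a) / 2) (Suc m)) (a * (norm (z - x))\<^sup>2) * exp (- a * (norm (z - x))\<^sup>2))"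
    by (simp add: fun_eq_iff)
  then show ?case using Suc.IH by (simp add: k_def q_def)
qed simp

section \<open>Polar coordinates on the sphere and on hyperplanes\<close>

lemma nn_integral_lborel_translate:
  fixes F :: "'a::euclidean_space \<Rightarrow> ennreal"
  assumes [measurable]: "F \<in> borel_measurable borel"
  shows "(\<integral>\<^sup>+y. F (c + y) \<partial>lborel) = (\<integral>\<^sup>+y. F y \<partial>lborel)"
proof -
  have "(\<integral>\<^sup>+y. F y \<partial>lborel) = (\<integral>\<^sup>+y. F y \<partial>distr lborel borel ((+) c))"
    by (simp add: lborel_distr_plus)
  also have "\<dots> = (\<integral>\<^sup>+y. F (c + y) \<partial>lborel)" by (rule nn_integral_distr) auto
  finally show ?thesis ..
qed

lemma nn_integral_lborel_dilate:
  fixes F :: "'a::euclidean_space \<Rightarrow> ennreal"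
  assumes [measurable]: "F \<in> borel_measurable borel" and "c \<noteq> 0"
  shows "(\<integral>\<^sup>+y. F y \<partial>lborel) = ennreal (\<bar>c\<bar> ^ DIM('a)) * (\<integral>\<^sup>+y. F (c *\<^sub>R y) \<partial>lborel)"
  by (subst lborel_affine[OF assms(2), of 0])
    (simp add: nn_integral_density nn_integral_distr nn_integral_cmult)

lemma orth_part_simps [simp]:
  assumes "norm \<xi> = 1"
  shows "orth_part \<xi> y \<bullet> \<xi> = 0" "orth_part \<xi> (orth_part \<xi> y + t *\<^sub>R \<xi>) = orth_part \<xi> y"
    "(orth_part \<xi> y + t *\<^sub>R \<xi>) \<bullet> \<xi> = t"
proof -
  have "\<xi> \<bullet> \<xi> = 1" using assms by (simp add: norm_eq_1)
  then show "orth_part \<xi> y \<bullet> \<xi> = 0" "orth_part \<xi> (orth_part \<xi> y + t *\<^sub>R \<xi>) = orth_part \<xi> y"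
    "(orth_part \<xi> y + t *\<^sub>R \<xi>) \<bullet> \<xi> = t"
    by (simp_all add: orth_part_def inner_diff_left inner_add_left algebra_simps)
qed

lemma orth_part_scaleR [simp]: "orth_part \<xi> (c *\<^sub>R y) = c *\<^sub>R orth_part \<xi> y"
  by (simp add: orth_part_def scaleR_diff_right)

lemma orth_part_measurable [measurable]:
  assumes [measurable]: "f \<in> borel_measurable M" "g \<in> borel_measurable M"
  shows "(\<lambda>x. orth_part (f x) (g x)) \<in> borel_measurable M"
  unfolding orth_part_def by measurable

text \<open>Fubini for the splitting into a line and its orthogonal hyperplane, the latter integrated over
  the cylinder of height 1. It only needs translation invariance along the line.\<close>

lemma nn_integral_line_hyperplane:
  fixes F :: "'a::euclidean_space \<Rightarrow> ennreal"
  assumes [measurable]: "F \<in> borel_measurable borel" and \<xi>: "norm \<xi> = 1"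
  shows "(\<integral>\<^sup>+y. F y \<partial>lborel) =
    (\<integral>\<^sup>+y. indicator {0..1} (y \<bullet> \<xi>) * (\<integral>\<^sup>+t. F (orth_part \<xi> y + t *\<^sub>R \<xi>) \<partial>lborel) \<partial>lborel)"
proof -
  have [simp]: "\<xi> \<bullet> \<xi> = 1" using \<xi> by (simp add: norm_eq_1)
  \<comment> \<open>The points \<open>orth_part \<xi> y\<close> and y lie on the same line in
    direction \<xi>, so the integral over the line does not distinguish them.\<close>
  have shift: "(\<integral>\<^sup>+t. F (orth_part \<xi> y + t *\<^sub>R \<xi>) \<partial>lborel) = (\<integral>\<^sup>+t. F (y + t *\<^sub>R \<xi>) \<partial>lborel)" for y
  proof -
    have "(\<integral>\<^sup>+t. F (y + t *\<^sub>R \<xi>) \<partial>lborel) = (\<integral>\<^sup>+t. F (y + ((- (y \<bullet> \<xi>)) + t) *\<^sub>R \<xi>) \<partial>lborel)"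
      by (rule nn_integral_lborel_translate[symmetric]) measurable
    then show ?thesis by (simp add: orth_part_def algebra_simps)
  qed
  have "(\<integral>\<^sup>+y. indicator {0..1} (y \<bullet> \<xi>) * (\<integral>\<^sup>+t. F (orth_part \<xi> y + t *\<^sub>R \<xi>) \<partial>lborel) \<partial>lborel)
      = (\<integral>\<^sup>+y. \<integral>\<^sup>+t. indicator {0..1} (y \<bullet> \<xi>) * F (y + t *\<^sub>R \<xi>) \<partial>lborel \<partial>lborel)"
    unfolding shift by (intro nn_integral_cong nn_integral_cmult[symmetric]) measurable
  also have "\<dots> = (\<integral>\<^sup>+t. \<integral>\<^sup>+y. indicator {0..1} (y \<bullet> \<xi>) * F (y + t *\<^sub>R \<xi>) \<partial>lborel \<partial>lborel)"
    by (rule lborel_pair.Fubini') measurable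
  also have "\<dots> = (\<integral>\<^sup>+t. \<integral>\<^sup>+y. indicator {0..1} (y \<bullet> \<xi> - t) * F y \<partial>lborel \<partial>lborel)"
  proof (rule nn_integral_cong)
    fix t
    have "(\<integral>\<^sup>+y. indicator {0..1} (y \<bullet> \<xi> - t) * F y \<partial>lborel) =
        (\<integral>\<^sup>+y. indicator {0..1} ((t *\<^sub>R \<xi> + y) \<bullet> \<xi> - t) * F (t *\<^sub>R \<xi> + y) \<partial>lborel)"
      by (rule nn_integral_lborel_translate[symmetric]) measurable
    then show "(\<integral>\<^sup>+y. indicator {0..1} (y \<bullet> \<xi>) * F (y + t *\<^sub>R \<xi>) \<partial>lborel) =
        (\<integral>\<^sup>+y. indicator {0..1} (y \<bullet> \<xi> - t) * F y \<partial>lborel)"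
      by (simp add: inner_add_left add.commute)
  qed
  also have "\<dots> = (\<integral>\<^sup>+y. \<integral>\<^sup>+t. indicator {0..1} (y \<bullet> \<xi> - t) * F y \<partial>lborel \<partial>lborel)"
    by (rule lborel_pair.Fubini'[symmetric]) measurable
  also have "\<dots> = (\<integral>\<^sup>+y. F y \<partial>lborel)"
  proof (rule nn_integral_cong)
    fix y
    have "(\<integral>\<^sup>+t. indicator {0..1} (y \<bullet> \<xi> - t) * F y \<partial>lborel) =
        (\<integral>\<^sup>+t. indicator {y \<bullet> \<xi> - 1..y \<bullet> \<xi>} t * F y \<partial>lborel)"
      by (intro nn_integral_cong) (auto simp: indicator_def)
    also have "\<dots> = F y" by (subst nn_integral_multc) auto
    finally show "(\<integral>\<^sup>+t. indicator {0..1} (y \<bullet> \<xi> - t) * F y \<partial>lborel) = F y" .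
  qed
  finally show ?thesis ..
qed

text \<open>Integrands of product form separate. The unit cylinder is only one way to weight the
  line direction; any other weight, such as a Gaussian or an interval of another length, can be
  exchanged for it at the cost of its integral.\<close>

lemma nn_integral_line_times_hyperplane:
  fixes G :: "'a::euclidean_space \<Rightarrow> ennreal"
  assumes [measurable]: "G \<in> borel_measurable borel" "w \<in> borel_measurable borel" and \<xi>: "norm \<xi> = 1"
  shows "(\<integral>\<^sup>+y. w (y \<bullet> \<xi>) * G (orth_part \<xi> y) \<partial>lborel) =
    (\<integral>\<^sup>+t. w t \<partial>lborel) * (\<integral>\<^sup>+y. indicator {0..1} (y \<bullet> \<xi>) * G (orth_part \<xi> y) \<partial>lborel)"
proof -
  have "(\<integral>\<^sup>+y. w (y \<bullet> \<xi>) * G (orth_part \<xi> y) \<partial>lborel) =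
    (\<integral>\<^sup>+y. indicator {0..1} (y \<bullet> \<xi>) * (\<integral>\<^sup>+t. w t * G (orth_part \<xi> y) \<partial>lborel) \<partial>lborel)"
    by (subst nn_integral_line_hyperplane[OF _ \<xi>]) (simp_all add: \<xi>)
  also have "\<dots> = (\<integral>\<^sup>+y. (\<integral>\<^sup>+t. w t \<partial>lborel) * (indicator {0..1} (y \<bullet> \<xi>) * G (orth_part \<xi> y)) \<partial>lborel)"
    by (subst nn_integral_multc) (auto simp: mult_ac)
  finally show ?thesis by (subst (asm) nn_integral_cmult) auto
qed

lemma nn_integral_inverse_power:
  assumes "a > 0" "N \<ge> 1"
  shows "(\<integral>\<^sup>+r. ennreal (1 / r ^ (N + 1)) * indicator {a..} r \<partial>lborel) = ennreal (1 / (real N * a ^ N))"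
proof -
  have "(\<integral>\<^sup>+r. ennreal (1 / r ^ (N + 1)) * indicator {a..} r \<partial>lborel) = ennreal (0 - (- (1 / (real N * a ^ N))))"
  proof (rule nn_integral_FTC_atLeast)
    fix r :: real assume r: "a \<le> r"
    then have "r > 0" using assms by simp
    then have "r ^ N = r ^ (N - 1) * r" using assms by (cases N) auto
    with \<open>r > 0\<close> show "((\<lambda>r. - (1 / (real N * r ^ N))) has_real_derivative 1 / r ^ (N + 1)) (at r)"
      using assms by (auto intro!: derivative_eq_intros simp: field_simps power2_eq_square)
    show "0 \<le> 1 / r ^ (N + 1)" using \<open>r > 0\<close> by simp
  next
    have "((\<lambda>r::real. inverse (r ^ N)) \<longlongrightarrow> 0) at_top"
      using assms by (intro tendsto_inverse_0_at_top filterlim_pow_at_top) (auto simp: filterlim_ident)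
    from tendsto_mult[OF tendsto_const[of "- (1 / real N)"] this]
    show "((\<lambda>r. - (1 / (real N * r ^ N))) \<longlongrightarrow> 0) at_top" by (simp add: field_simps)
  qed measurable
  then show ?thesis by simp
qed

text \<open>Polar coordinates for the image of \<open>w \<cdot> lborel\<close> under \<open>p\<close>, a measure that is homogeneous of
  degree \<open>N\<close>. Substituting \<open>r = \<rho> * norm (p y)\<close> in the inner integral and exchanging the integrals
  reduces it to the dilation law.\<close>

lemma nn_integral_polar_homogeneous:
  fixes F :: "'a::euclidean_space \<Rightarrow> ennreal" and p :: "'b::euclidean_space \<Rightarrow> 'a" and w :: "'b \<Rightarrow> ennreal"
  assumes [measurable]: "F \<in> borel_measurable borel" "p \<in> borel_measurable borel" "w \<in> borel_measurable borel"
    and N: "N \<ge> 1" and null: "AE y in lborel. p y \<noteq> 0"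
    and dil: "\<And>G \<rho>. G \<in> borel_measurable borel \<Longrightarrow> \<rho> > 0 \<Longrightarrow>
      (\<integral>\<^sup>+y. w y * G (\<rho> *\<^sub>R p y) \<partial>lborel) = ennreal (1 / \<rho> ^ N) * (\<integral>\<^sup>+y. w y * G (p y) \<partial>lborel)"
  shows "(\<integral>\<^sup>+y. w y * F (p y) \<partial>lborel) = ennreal (real N) * (\<integral>\<^sup>+y. w y * (indicator (cball 0 1 - {0}) (p y) *
     (\<integral>\<^sup>+r. ennreal (r ^ (N - 1)) * indicator {0<..} r * F (r *\<^sub>R sgn (p y)) \<partial>lborel)) \<partial>lborel)"
proof -
  define I :: "'a \<Rightarrow> ennreal" where "I = indicator (cball 0 1 - {0})"
  define J :: "'a \<Rightarrow> ennreal" where "J = indicator (-{0})"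
  have [measurable]: "I \<in> borel_measurable borel" "J \<in> borel_measurable borel"
    unfolding I_def J_def by (intro borel_measurable_indicator; simp)+
  have inner: "(\<integral>\<^sup>+r. ennreal (r ^ (N - 1)) * indicator {0<..} r * F (r *\<^sub>R sgn z) \<partial>lborel) =
      (\<integral>\<^sup>+r. ennreal (r ^ (N - 1) * norm z ^ N) * indicator {0<..} r * F (r *\<^sub>R z) \<partial>lborel)" if "z \<noteq> 0" for z :: 'a
  proof -
    have "(\<integral>\<^sup>+r. ennreal (r ^ (N - 1)) * indicator {0<..} r * F (r *\<^sub>R sgn z) \<partial>lborel) =
       ennreal \<bar>norm z\<bar> * (\<integral>\<^sup>+r. ennreal ((0 + norm z * r) ^ (N - 1)) * indicator {0<..} (0 + norm z * r) * F ((0 + norm z * r) *\<^sub>R sgn z) \<partial>lborel)"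
      using that by (intro nn_integral_real_affine) auto
    also have "\<dots> = (\<integral>\<^sup>+r. ennreal (norm z) * (ennreal ((norm z * r) ^ (N - 1)) * indicator {0<..} (norm z * r) * F ((norm z * r) *\<^sub>R sgn z)) \<partial>lborel)"
      by (subst nn_integral_cmult[symmetric]) auto
    also have "\<dots> = (\<integral>\<^sup>+r. ennreal (r ^ (N - 1) * norm z ^ N) * indicator {0<..} r * F (r *\<^sub>R z) \<partial>lborel)"
    proof (rule nn_integral_cong)
      fix r :: real
      have 1: "(norm z * r) *\<^sub>R sgn z = r *\<^sub>R z" using that by (simp add: sgn_div_norm)
      have 2: "indicator {0<..} (norm z * r) = (indicator {0<..} r :: ennreal)"
        using that by (simp add: indicator_def zero_less_mult_iff)
      have 3: "norm z * (norm z * r) ^ (N - 1) = r ^ (N - 1) * norm z ^ N"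
        using N by (cases N) (auto simp: power_mult_distrib)
      show "ennreal (norm z) * (ennreal ((norm z * r) ^ (N - 1)) * indicator {0<..} (norm z * r) * F ((norm z * r) *\<^sub>R sgn z))
        = ennreal (r ^ (N - 1) * norm z ^ N) * indicator {0<..} r * F (r *\<^sub>R z)"
      proof (cases "r > 0")
        case True
        have "ennreal (norm z) * ennreal ((norm z * r) ^ (N - 1)) = ennreal (r ^ (N - 1) * norm z ^ N)"
          using True by (subst ennreal_mult[symmetric]) (use 3 in auto)
        then show ?thesis unfolding 1 2 by (simp add: mult.assoc[symmetric])
      qed (simp add: 2)
    qed
    finally show ?thesis .
  qed
  have "(\<integral>\<^sup>+y. w y * (I (p y) *
     (\<integral>\<^sup>+r. ennreal (r ^ (N - 1)) * indicator {0<..} r * F (r *\<^sub>R sgn (p y)) \<partial>lborel)) \<partial>lborel)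
    = (\<integral>\<^sup>+y. \<integral>\<^sup>+r. w y * (I (p y) *
        (ennreal (r ^ (N - 1) * norm (p y) ^ N) * indicator {0<..} r * F (r *\<^sub>R p y))) \<partial>lborel \<partial>lborel)"
  proof (rule nn_integral_cong)
    fix y
    have "I (p y) *
       (\<integral>\<^sup>+r. ennreal (r ^ (N - 1)) * indicator {0<..} r * F (r *\<^sub>R sgn (p y)) \<partial>lborel) =
      I (p y) *
       (\<integral>\<^sup>+r. ennreal (r ^ (N - 1) * norm (p y) ^ N) * indicator {0<..} r * F (r *\<^sub>R p y) \<partial>lborel)"
    proof (cases "p y = 0")
      case False
      then show ?thesis by (simp only: inner[OF False])
    qed (simp add: I_def)
    moreover have "(\<integral>\<^sup>+r. I (p y) *
        (ennreal (r ^ (N - 1) * norm (p y) ^ N) * indicator {0<..} r * F (r *\<^sub>R p y)) \<partial>lborel) =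
      I (p y) *
       (\<integral>\<^sup>+r. ennreal (r ^ (N - 1) * norm (p y) ^ N) * indicator {0<..} r * F (r *\<^sub>R p y) \<partial>lborel)"
      by (rule nn_integral_cmult) measurable
    moreover have "(\<integral>\<^sup>+r. w y * (I (p y) *
        (ennreal (r ^ (N - 1) * norm (p y) ^ N) * indicator {0<..} r * F (r *\<^sub>R p y))) \<partial>lborel) =
      w y * (\<integral>\<^sup>+r. I (p y) *
        (ennreal (r ^ (N - 1) * norm (p y) ^ N) * indicator {0<..} r * F (r *\<^sub>R p y)) \<partial>lborel)"
      by (rule nn_integral_cmult) measurable
    ultimately show "w y * (I (p y) *
       (\<integral>\<^sup>+r. ennreal (r ^ (N - 1)) * indicator {0<..} r * F (r *\<^sub>R sgn (p y)) \<partial>lborel)) =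
      (\<integral>\<^sup>+r. w y * (I (p y) *
        (ennreal (r ^ (N - 1) * norm (p y) ^ N) * indicator {0<..} r * F (r *\<^sub>R p y))) \<partial>lborel)"
      by (simp only:)
  qed
  also have "\<dots> = (\<integral>\<^sup>+r. \<integral>\<^sup>+y. w y * (I (p y) *
        (ennreal (r ^ (N - 1) * norm (p y) ^ N) * indicator {0<..} r * F (r *\<^sub>R p y))) \<partial>lborel \<partial>lborel)"
    by (rule lborel_pair.Fubini') measurable
  \<comment> \<open>For fixed r the dilation law is applied with \<rho> = r: the condition that
    \<open>p y\<close> lies in the unit ball becomes \<open>norm (p y)\<close> \<le> r, and F is
    evaluated at \<open>p y\<close> itself.\<close>
  also have "\<dots> = (\<integral>\<^sup>+r. \<integral>\<^sup>+y. w y * (indicator {0..} (r - norm (p y)) * J (p y) *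
        (ennreal (norm (p y) ^ N * (1 / r ^ (N + 1))) * indicator {0<..} r * F (p y))) \<partial>lborel \<partial>lborel)"
  proof (rule nn_integral_cong)
    fix r :: real
    show "(\<integral>\<^sup>+y. w y * (I (p y) *
        (ennreal (r ^ (N - 1) * norm (p y) ^ N) * indicator {0<..} r * F (r *\<^sub>R p y))) \<partial>lborel) =
      (\<integral>\<^sup>+y. w y * (indicator {0..} (r - norm (p y)) * J (p y) *
        (ennreal (norm (p y) ^ N * (1 / r ^ (N + 1))) * indicator {0<..} r * F (p y))) \<partial>lborel)"
    proof (cases "r > 0")
      case True
      let ?G = "\<lambda>z. indicator {0..} (r - norm z) * J z *
        (ennreal (norm z ^ N * (1 / r)) * F z) :: ennreal"
      have "(\<integral>\<^sup>+y. w y * (I (p y) *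
        (ennreal (r ^ (N - 1) * norm (p y) ^ N) * indicator {0<..} r * F (r *\<^sub>R p y))) \<partial>lborel)
        = (\<integral>\<^sup>+y. w y * ?G (r *\<^sub>R p y) \<partial>lborel)"
      proof (rule nn_integral_cong)
        fix y
        have "r * norm (p y) \<le> r \<longleftrightarrow> norm (p y) \<le> 1" using True by simp
        moreover have "(r * norm (p y)) ^ N * (1 / r) = r ^ (N - 1) * norm (p y) ^ N"
          using N True by (cases N) (auto simp: power_mult_distrib)
        ultimately show "w y * (I (p y) *
          (ennreal (r ^ (N - 1) * norm (p y) ^ N) * indicator {0<..} r * F (r *\<^sub>R p y))) = w y * ?G (r *\<^sub>R p y)"
          using True by (auto simp: indicator_def I_def J_def)
      qed
      also have "\<dots> = ennreal (1 / r ^ N) * (\<integral>\<^sup>+y. w y * ?G (p y) \<partial>lborel)"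
        by (rule dil[OF _ True]) measurable
      also have "\<dots> = (\<integral>\<^sup>+y. ennreal (1 / r ^ N) * (w y * ?G (p y)) \<partial>lborel)"
        by (rule nn_integral_cmult[symmetric]) measurable
      also have "\<dots> = (\<integral>\<^sup>+y. w y * (indicator {0..} (r - norm (p y)) * J (p y) *
        (ennreal (norm (p y) ^ N * (1 / r ^ (N + 1))) * indicator {0<..} r * F (p y))) \<partial>lborel)"
      proof (rule nn_integral_cong)
        fix y
        have "ennreal (norm (p y) ^ N * (1 / r ^ (N + 1))) = ennreal (1 / r ^ N) * ennreal (norm (p y) ^ N * (1 / r))"
          using True by (subst ennreal_mult[symmetric]) auto
        then show "ennreal (1 / r ^ N) * (w y * ?G (p y)) = w y * (indicator {0..} (r - norm (p y)) * J (p y) *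
          (ennreal (norm (p y) ^ N * (1 / r ^ (N + 1))) * indicator {0<..} r * F (p y)))"
          using True by (simp add: mult_ac)
      qed
      finally show ?thesis .
    qed simp
  qed
  also have "\<dots> = (\<integral>\<^sup>+y. \<integral>\<^sup>+r. w y * (indicator {0..} (r - norm (p y)) * J (p y) *
        (ennreal (norm (p y) ^ N * (1 / r ^ (N + 1))) * indicator {0<..} r * F (p y))) \<partial>lborel \<partial>lborel)"
    by (rule lborel_pair.Fubini'[symmetric]) measurable
  \<comment> \<open>The integral of 1 / r^(N + 1) over r \<ge> \<open>norm (p y)\<close> is 1 / (N *
    \<open>norm (p y) ^ N\<close>), which cancels the weight and leaves the constant 1 / N.\<close>
  also have "\<dots> = (\<integral>\<^sup>+y. w y * F (p y) * ennreal (1 / real N) \<partial>lborel)"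
  proof (rule nn_integral_cong_AE)
    from null show "AE y in lborel. (\<integral>\<^sup>+r. w y * (indicator {0..} (r - norm (p y)) * J (p y) *
        (ennreal (norm (p y) ^ N * (1 / r ^ (N + 1))) * indicator {0<..} r * F (p y))) \<partial>lborel)
      = w y * F (p y) * ennreal (1 / real N)"
    proof eventually_elim
      case (elim y)
      have "(\<integral>\<^sup>+r. w y * (indicator {0..} (r - norm (p y)) * J (p y) *
        (ennreal (norm (p y) ^ N * (1 / r ^ (N + 1))) * indicator {0<..} r * F (p y))) \<partial>lborel) =
        (\<integral>\<^sup>+r. w y * F (p y) * ennreal (norm (p y) ^ N) * (ennreal (1 / r ^ (N + 1)) * indicator {norm (p y)..} r) \<partial>lborel)"
      proof (rule nn_integral_cong)
        fix r :: real
        show "w y * (indicator {0..} (r - norm (p y)) * J (p y) *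
          (ennreal (norm (p y) ^ N * (1 / r ^ (N + 1))) * indicator {0<..} r * F (p y))) =
          w y * F (p y) * ennreal (norm (p y) ^ N) * (ennreal (1 / r ^ (N + 1)) * indicator {norm (p y)..} r)"
        proof (cases "norm (p y) \<le> r")
          case True
          then have "r > 0" using elim by (meson less_le_trans zero_less_norm_iff)
          then have "ennreal (norm (p y) ^ N * (1 / r ^ (N + 1))) = ennreal (norm (p y) ^ N) * ennreal (1 / r ^ (N + 1))"
            by (intro ennreal_mult) auto
          then show ?thesis using True elim \<open>r > 0\<close> by (simp add: mult_ac J_def)
        qed simp
      qed
      also have "\<dots> = w y * F (p y) * ennreal (norm (p y) ^ N) * (\<integral>\<^sup>+r. ennreal (1 / r ^ (N + 1)) * indicator {norm (p y)..} r \<partial>lborel)"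
        by (rule nn_integral_cmult) measurable
      also have "\<dots> = w y * F (p y) * (ennreal (norm (p y) ^ N) * ennreal (1 / (real N * norm (p y) ^ N)))"
        using elim N by (subst nn_integral_inverse_power) (auto simp: mult.assoc)
      also have "ennreal (norm (p y) ^ N) * ennreal (1 / (real N * norm (p y) ^ N)) = ennreal (1 / real N)"
        using elim N by (subst ennreal_mult[symmetric]) auto
      finally show ?case .
    qed
  qed
  also have "\<dots> = ennreal (1 / real N) * (\<integral>\<^sup>+y. w y * F (p y) \<partial>lborel)"
    by (subst nn_integral_multc) (auto simp: mult.commute)
  finally have *: "(\<integral>\<^sup>+y. w y * (I (p y) *
     (\<integral>\<^sup>+r. ennreal (r ^ (N - 1)) * indicator {0<..} r * F (r *\<^sub>R sgn (p y)) \<partial>lborel)) \<partial>lborel)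
    = ennreal (1 / real N) * (\<integral>\<^sup>+y. w y * F (p y) \<partial>lborel)" .
  have "ennreal (real N) * ennreal (1 / real N) = 1"
    using N by (subst ennreal_mult[symmetric]) auto
  then show ?thesis unfolding I_def[symmetric] * by (simp add: mult.assoc[symmetric])
qed

section \<open>The cone measures on the sphere and on great subspheres\<close>

lemma space_sphere_measure [simp]: "space sphere_measure = sphere 0 1"
  by (simp add: sphere_measure_def space_scale_measure space_restrict_space)

lemma sets_sphere_measure [measurable_cong]: "sets sphere_measure = sets (restrict_space borel (sphere 0 1))"
  by (simp add: sphere_measure_def)

lemma space_great_subsphere_measure [simp]: "space (great_subsphere_measure \<xi>) = great_subsphere \<xi>"
  by (simp add: great_subsphere_measure_def space_scale_measure space_restrict_space)

lemma sets_great_subsphere_measure [measurable_cong]: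
  "sets (great_subsphere_measure \<xi>) = sets (restrict_space borel (great_subsphere \<xi>))"
  by (simp add: great_subsphere_measure_def)

lemma borel_measurable_sphere:
  "F \<in> borel_measurable borel \<Longrightarrow> F \<in> borel_measurable sphere_measure"
  by (simp add: measurable_restrict_space1 measurable_cong_sets[OF sets_sphere_measure])

lemma borel_measurable_great_subsphere:
  "F \<in> borel_measurable borel \<Longrightarrow> F \<in> borel_measurable (great_subsphere_measure \<xi>)"
  by (simp add: measurable_restrict_space1 measurable_cong_sets[OF sets_great_subsphere_measure])

lemma nn_integral_sphere_measure:
  fixes F :: "'a::euclidean_space \<Rightarrow> ennreal"
  assumes [measurable]: "F \<in> borel_measurable borel"
  shows "(\<integral>\<^sup>+\<theta>. F \<theta> \<partial>sphere_measure) =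
     ennreal (real DIM('a)) * (\<integral>\<^sup>+y. F (sgn y) * indicator (cball 0 1 - {0}) y \<partial>lborel)"
proof -
  have meas: "sgn \<in> restrict_space lborel (cball 0 1 - {0::'a}) \<rightarrow>\<^sub>M restrict_space borel (sphere 0 1)"
    by (rule measurable_restrict_space2) (auto simp: space_restrict_space norm_sgn intro: measurable_restrict_space1)
  have F: "F \<in> borel_measurable (restrict_space borel (sphere 0 1))"
    by (simp add: measurable_restrict_space1)
  show ?thesis
    unfolding sphere_measure_def
    by (subst nn_integral_scale_measure)
      (simp_all add: F nn_integral_distr[OF meas] nn_integral_restrict_space ennreal_of_nat_eq_real_of_nat)
qed

lemma nn_integral_great_subsphere:
  fixes F :: "'a::euclidean_space \<Rightarrow> ennreal"
  assumes [measurable]: "F \<in> borel_measurable borel" and \<xi>: "norm \<xi> = 1"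
  shows "(\<integral>\<^sup>+\<theta>. F \<theta> \<partial>great_subsphere_measure \<xi>) = ennreal (real (DIM('a) - 1)) *
     (\<integral>\<^sup>+y. indicator {0..1} (y \<bullet> \<xi>) * (indicator (cball 0 1 - {0}) (orth_part \<xi> y) * F (sgn (orth_part \<xi> y))) \<partial>lborel)"
proof -
  let ?S = "{x. x \<bullet> \<xi> \<in> {0..1} \<and> orth_part \<xi> x \<in> cball 0 1 - {0}}"
  have "?S = {x. x \<bullet> \<xi> \<in> {0..1} \<and> norm (orth_part \<xi> x) \<le> 1 \<and> norm (orth_part \<xi> x) > 0}" by auto
  also have "\<dots> \<in> sets borel" by measurable
  finally have [measurable]: "?S \<in> sets borel" .
  have meas: "(\<lambda>x. sgn (orth_part \<xi> x)) \<in> restrict_space lborel ?S \<rightarrow>\<^sub>M restrict_space borel (great_subsphere \<xi>)"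
    by (rule measurable_restrict_space2)
      (auto simp: space_restrict_space norm_sgn great_subsphere_def sgn_div_norm \<xi> intro!: measurable_restrict_space1)
  have F: "F \<in> borel_measurable (restrict_space borel (great_subsphere \<xi>))"
    by (simp add: measurable_restrict_space1)
  have "(\<integral>\<^sup>+\<theta>. F \<theta> \<partial>great_subsphere_measure \<xi>) = of_nat (DIM('a) - 1) * (\<integral>\<^sup>+\<theta>. F \<theta>
      \<partial>distr (restrict_space lborel ?S) (restrict_space borel (great_subsphere \<xi>)) (\<lambda>x. sgn (orth_part \<xi> x)))"
    unfolding great_subsphere_measure_def
    by (rule nn_integral_scale_measure) (simp add: F)
  also have "\<dots> = of_nat (DIM('a) - 1) * (\<integral>\<^sup>+y. F (sgn (orth_part \<xi> y)) \<partial>restrict_space lborel ?S)"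
    by (subst nn_integral_distr[OF meas]) (simp_all only: measurable_distr_eq1 F)
  also have "\<dots> = of_nat (DIM('a) - 1) * (\<integral>\<^sup>+y. F (sgn (orth_part \<xi> y)) * indicator ?S y \<partial>lborel)"
    by (subst nn_integral_restrict_space) (use \<open>?S \<in> sets borel\<close> in \<open>simp_all only: sets_lborel space_lborel space_borel Int_UNIV_right\<close>)
  also have "(\<integral>\<^sup>+y. F (sgn (orth_part \<xi> y)) * indicator ?S y \<partial>lborel) =
    (\<integral>\<^sup>+y. indicator {0..1} (y \<bullet> \<xi>) * (indicator (cball 0 1 - {0}) (orth_part \<xi> y) * F (sgn (orth_part \<xi> y))) \<partial>lborel)"
    by (intro nn_integral_cong) (auto simp: indicator_def)
  finally show ?thesis by (simp add: ennreal_of_nat_eq_real_of_nat)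
qed

lemma nn_integral_polar:
  fixes F :: "'a::euclidean_space \<Rightarrow> ennreal"
  assumes [measurable]: "F \<in> borel_measurable borel"
  shows "(\<integral>\<^sup>+y. F y \<partial>lborel) =
    (\<integral>\<^sup>+\<theta>. (\<integral>\<^sup>+r. ennreal (r ^ (DIM('a) - 1)) * indicator {0<..} r * F (r *\<^sub>R \<theta>) \<partial>lborel) \<partial>sphere_measure)"
proof -
  have null: "AE y in lborel. y \<noteq> (0::'a)"
    by (auto intro!: AE_I[of _ _ "{0}"])
  have dil: "(\<integral>\<^sup>+y. 1 * G (\<rho> *\<^sub>R y) \<partial>lborel) = ennreal (1 / \<rho> ^ DIM('a)) * (\<integral>\<^sup>+y. 1 * G y \<partial>lborel)"
    if [measurable]: "G \<in> borel_measurable borel" and "\<rho> > 0" for G :: "'a \<Rightarrow> ennreal" and \<rho> :: real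
    using nn_integral_lborel_dilate[of G \<rho>] that
    by (simp add: mult.assoc[symmetric] ennreal_mult[symmetric] del: ennreal_1)
       (simp add: ennreal_1)
  have "(\<integral>\<^sup>+y. 1 * F y \<partial>lborel) = ennreal (real DIM('a)) * (\<integral>\<^sup>+y. 1 * (indicator (cball 0 1 - {0}) y *
     (\<integral>\<^sup>+r. ennreal (r ^ (DIM('a) - 1)) * indicator {0<..} r * F (r *\<^sub>R sgn y) \<partial>lborel)) \<partial>lborel)"
    by (rule nn_integral_polar_homogeneous[where p = "\<lambda>y. y"]) (use null dil in auto)
  then show ?thesis
    by (subst nn_integral_sphere_measure) (simp_all add: mult.commute)
qed

text \<open>The exceptional set is the line through \<xi>. In dimension at least 2 there is a
  nonzero v orthogonal to \<xi>, and the line lies in the null hyperplane orthogonal to v.\<close>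

lemma AE_orth_part_nonzero:
  fixes \<xi> :: "'a::euclidean_space"
  assumes "norm \<xi> = 1" "DIM('a) \<ge> 2"
  shows "AE y in lborel. orth_part \<xi> y \<noteq> 0"
proof -
  obtain v :: 'a where v: "v \<noteq> 0" "orthogonal \<xi> v"
    using orthogonal_to_vector_exists[OF assms(2)] by metis
  have "{y. v \<bullet> y = 0} \<in> null_sets lebesgue"
    using negligible_hyperplane[of v 0] v by (simp add: negligible_iff_null_sets)
  moreover have "{y. v \<bullet> y = 0} \<in> sets lborel" by measurable
  ultimately have "{y. v \<bullet> y = 0} \<in> null_sets lborel" by (simp add: null_sets_completion_iff)
  then show ?thesis
  proof (rule AE_I')
    show "{y \<in> space lborel. \<not> orth_part \<xi> y \<noteq> 0} \<subseteq> {y. v \<bullet> y = 0}"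
    proof clarsimp
      fix y assume "orth_part \<xi> y = 0"
      then have "y = (y \<bullet> \<xi>) *\<^sub>R \<xi>" by (simp add: orth_part_def)
      then have "v \<bullet> y = (y \<bullet> \<xi>) * (v \<bullet> \<xi>)" by (metis inner_scaleR_right)
      then show "v \<bullet> y = 0" using v(2) by (simp add: orthogonal_def inner_commute)
    qed
  qed
qed

text \<open>The cylinder of height 1 is not invariant under dilation. Stretching its height to
  \<rho> multiplies the integral by \<rho>, while dilating the whole space contributes \<rho>^n; the
  quotient is the dilation law of degree n - 1, and the homogeneous polar formula applies with N = n
  - 1.\<close>

lemma nn_integral_hyperplane_polar:
  fixes F :: "'a::euclidean_space \<Rightarrow> ennreal"
  assumes [measurable]: "F \<in> borel_measurable borel" and \<xi>: "norm \<xi> = 1" and n: "DIM('a) \<ge> 2"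
  shows "(\<integral>\<^sup>+y. indicator {0..1} (y \<bullet> \<xi>) * F (orth_part \<xi> y) \<partial>lborel) =
    (\<integral>\<^sup>+\<theta>. (\<integral>\<^sup>+r. ennreal (r ^ (DIM('a) - 2)) * indicator {0<..} r * F (r *\<^sub>R \<theta>) \<partial>lborel) \<partial>great_subsphere_measure \<xi>)"
proof -
  have dil: "(\<integral>\<^sup>+y. indicator {0..1} (y \<bullet> \<xi>) * G (\<rho> *\<^sub>R orth_part \<xi> y) \<partial>lborel) =
      ennreal (1 / \<rho> ^ (DIM('a) - 1)) * (\<integral>\<^sup>+y. indicator {0..1} (y \<bullet> \<xi>) * G (orth_part \<xi> y) \<partial>lborel)"
    if [measurable]: "G \<in> borel_measurable borel" and \<rho>: "\<rho> > 0" for G :: "'a \<Rightarrow> ennreal" and \<rho> :: real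
  proof -
    let ?I = "\<integral>\<^sup>+y. indicator {0..1} (y \<bullet> \<xi>) * G (orth_part \<xi> y) \<partial>lborel"
    have "ennreal \<rho> * ?I = (\<integral>\<^sup>+y. indicator {0..\<rho>} (y \<bullet> \<xi>) * G (orth_part \<xi> y) \<partial>lborel)"
      using \<rho> by (subst nn_integral_line_times_hyperplane[OF _ _ \<xi>]) auto
    also have "\<dots> = ennreal (\<bar>\<rho>\<bar> ^ DIM('a)) * (\<integral>\<^sup>+y. indicator {0..\<rho>} ((\<rho> *\<^sub>R y) \<bullet> \<xi>) * G (orth_part \<xi> (\<rho> *\<^sub>R y)) \<partial>lborel)"
      using \<rho> by (intro nn_integral_lborel_dilate) auto
    also have "(\<integral>\<^sup>+y. indicator {0..\<rho>} ((\<rho> *\<^sub>R y) \<bullet> \<xi>) * G (orth_part \<xi> (\<rho> *\<^sub>R y)) \<partial>lborel) =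
       (\<integral>\<^sup>+y. indicator {0..1} (y \<bullet> \<xi>) * G (\<rho> *\<^sub>R orth_part \<xi> y) \<partial>lborel)"
      using \<rho> by (intro nn_integral_cong) (auto simp: indicator_def zero_le_mult_iff)
    finally have *: "ennreal \<rho> * ?I = ennreal (\<rho> ^ DIM('a)) * (\<integral>\<^sup>+y. indicator {0..1} (y \<bullet> \<xi>) * G (\<rho> *\<^sub>R orth_part \<xi> y) \<partial>lborel)"
      using \<rho> by simp
    have "ennreal (1 / \<rho> ^ DIM('a)) * (ennreal \<rho> * ?I) = 
        (ennreal (1 / \<rho> ^ DIM('a)) * ennreal (\<rho> ^ DIM('a))) * (\<integral>\<^sup>+y. indicator {0..1} (y \<bullet> \<xi>) * G (\<rho> *\<^sub>R orth_part \<xi> y) \<partial>lborel)"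
      unfolding * by (simp add: mult.assoc)
    also have "ennreal (1 / \<rho> ^ DIM('a)) * ennreal (\<rho> ^ DIM('a)) = 1"
      using \<rho> by (subst ennreal_mult[symmetric]) auto
    also have "ennreal (1 / \<rho> ^ DIM('a)) * (ennreal \<rho> * ?I) = ennreal (1 / \<rho> ^ (DIM('a) - 1)) * ?I"
    proof -
      have "1 / \<rho> ^ DIM('a) * \<rho> = 1 / \<rho> ^ (DIM('a) - 1)"
        using \<rho> n by (cases "DIM('a)") auto
      then have "ennreal (1 / \<rho> ^ DIM('a)) * ennreal \<rho> = ennreal (1 / \<rho> ^ (DIM('a) - 1))"
        using \<rho> by (subst ennreal_mult[symmetric]) auto
      then show ?thesis by (simp add: mult.assoc[symmetric])
    qed
    finally show ?thesis by simp
  qed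
  have "(\<integral>\<^sup>+y. indicator {0..1} (y \<bullet> \<xi>) * F (orth_part \<xi> y) \<partial>lborel) =
    ennreal (real (DIM('a) - 1)) * (\<integral>\<^sup>+y. indicator {0..1} (y \<bullet> \<xi>) * (indicator (cball 0 1 - {0}) (orth_part \<xi> y) *
     (\<integral>\<^sup>+r. ennreal (r ^ (DIM('a) - 1 - 1)) * indicator {0<..} r * F (r *\<^sub>R sgn (orth_part \<xi> y)) \<partial>lborel)) \<partial>lborel)"
    by (rule nn_integral_polar_homogeneous[where p = "orth_part \<xi>"]) (use AE_orth_part_nonzero[OF \<xi> n] dil n in auto)
  also have "DIM('a) - 1 - 1 = DIM('a) - 2" by simp
  finally show ?thesis by (subst nn_integral_great_subsphere[OF _ \<xi>]) simp_all
qed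

section \<open>Gaussian moments and total masses\<close>

lemma Gamma_half_nat: "Gamma (real k + 1 / 2) = sqrt pi * fact (2 * k) / (4 ^ k * fact k)"
proof (induction k)
  case (Suc k)
  have "Gamma (real (Suc k) + 1 / 2) = Gamma ((real k + 1 / 2) + 1)" by (simp add: algebra_simps)
  also have "\<dots> = (real k + 1 / 2) * Gamma (real k + 1 / 2)"
    by (rule Gamma_plus1) (auto elim!: nonpos_Ints_cases')
  also have "\<dots> = sqrt pi * fact (2 * Suc k) / (4 ^ Suc k * fact (Suc k))"
  proof -
    have "(x + 1 / 2) * (s * F / (P * G)) = s * ((2 * x + 2) * (2 * x + 1) * F) / (4 * P * ((x + 1) * G))"
      if "P > 0" "G > 0" "x \<ge> 0" for x s F P G :: real
    proof -
      have "(2 * x + 2) * (2 * x + 1) / (4 * (x + 1)) = x + 1 / 2"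
        using that by (simp add: divide_simps) (simp add: algebra_simps)
      then have "(x + 1 / 2) * (s * F / (P * G)) = (2 * x + 2) * (2 * x + 1) / (4 * (x + 1)) * (s * F / (P * G))"
        by simp
      then show ?thesis by (simp only: times_divide_times_eq mult_ac)
    qed
    from this[of "4 ^ k" "fact k" "real k" "sqrt pi" "fact (2 * k)"] show ?thesis
      unfolding Suc by (simp add: algebra_simps)
  qed
  finally show ?case .
qed (simp add: Gamma_one_half_real)

text \<open>Even and odd moments have different closed forms in factorials. \<open>Gamma\<close>
  unifies them, by its values at half-integers for even s and at integers for odd s.\<close>

lemma gaussian_half_line_moment:
  "has_bochner_integral lborel (\<lambda>r::real. indicator {0..} r *\<^sub>R (exp (- r\<^sup>2) * r ^ s)) (Gamma ((real s + 1) / 2) / 2)"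
proof (cases "even s")
  case True
  then obtain k where k: "s = 2 * k" by (elim evenE)
  have e: "(real (2 * k) + 1) / 2 = real k + 1 / 2" by (simp add: field_simps)
  have V: "sqrt pi / 2 * (fact (2 * k) / (2 ^ (2 * k) * fact k)) = Gamma ((real (2 * k) + 1) / 2) / 2"
    unfolding e Gamma_half_nat by (simp add: power_mult)
  show ?thesis using gaussian_moment_even_pos[of k] unfolding V k .
next
  case False
  then obtain k where k: "s = 2 * k + 1" by (elim oddE)
  have e: "(real s + 1) / 2 = 1 + real k" by (simp add: k)
  show ?thesis using gaussian_moment_odd_pos[of k] unfolding e Gamma_fact by (simp add: k)
qed

lemma gaussian_abs_moment:
  "has_bochner_integral lborel (\<lambda>r::real. exp (- r\<^sup>2) * \<bar>r\<bar> ^ s) (Gamma ((real s + 1) / 2))"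
proof -
  have "has_bochner_integral lborel (\<lambda>r::real. indicator {0..} r *\<^sub>R (exp (- r\<^sup>2) * \<bar>r\<bar> ^ s)) (Gamma ((real s + 1) / 2) / 2)"
    by (rule has_bochner_integral_cong[THEN iffD1, OF _ _ _ gaussian_half_line_moment[of s]]) (auto simp: indicator_def)
  from has_bochner_integral_even_function[OF this] show ?thesis by simp
qed

lemma nn_integral_gaussian_abs_moment:
  "(\<integral>\<^sup>+r. ennreal (exp (- r\<^sup>2) * \<bar>r\<bar> ^ s) \<partial>lborel) = ennreal (Gamma ((real s + 1) / 2))"
  using gaussian_abs_moment[of s]
  by (subst nn_integral_eq_integral) (auto simp: has_bochner_integral_iff)

lemma nn_integral_gaussian_half_line_moment:
  "(\<integral>\<^sup>+r. ennreal (r ^ s) * indicator {0<..} r * ennreal (exp (- r\<^sup>2)) \<partial>lborel) = ennreal (Gamma ((real s + 1) / 2) / 2)"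
proof -
  have "(\<integral>\<^sup>+r. ennreal (r ^ s) * indicator {0<..} r * ennreal (exp (- r\<^sup>2)) \<partial>lborel) =
      (\<integral>\<^sup>+r. ennreal (indicator {0..} r *\<^sub>R (exp (- r\<^sup>2) * r ^ s)) \<partial>lborel)"
  proof (rule nn_integral_cong_AE)
    have "AE r in lborel. r \<noteq> (0::real)" by (auto intro!: AE_I[of _ _ "{0}"])
    then show "AE r in lborel. ennreal (r ^ s) * indicator {0<..} r * ennreal (exp (- r\<^sup>2)) =
        ennreal (indicator {0..} r *\<^sub>R (exp (- r\<^sup>2) * r ^ s))"
      by eventually_elim (auto simp: indicator_def ennreal_mult mult.commute)
  qed
  also have "\<dots> = ennreal (Gamma ((real s + 1) / 2) / 2)"
    using gaussian_half_line_moment[of s]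
    by (subst nn_integral_eq_integral) (auto simp: has_bochner_integral_iff indicator_def)
  finally show ?thesis .
qed

lemma emeasure_sphere_measure_finite: "emeasure (sphere_measure :: 'a::euclidean_space measure) (sphere 0 1) < \<infinity>"
proof -
  have "emeasure (sphere_measure :: 'a measure) (sphere 0 1) = (\<integral>\<^sup>+\<theta>. 1 \<partial>(sphere_measure :: 'a measure))"
    by simp
  also have "\<dots> = ennreal (real DIM('a)) * (\<integral>\<^sup>+y. 1 * indicator (cball 0 1 - {0}) (y::'a) \<partial>lborel)"
    by (rule nn_integral_sphere_measure) simp
  also have "\<dots> \<le> ennreal (real DIM('a)) * emeasure lborel (cball (0::'a) 1)"
    by (intro mult_left_mono) (simp_all add: emeasure_mono)
  also have "\<dots> < \<infinity>" by (simp add: emeasure_cball ennreal_mult_less_top)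
  finally show ?thesis .
qed

global_interpretation sphere: finite_measure "sphere_measure :: 'a::euclidean_space measure"
  by (rule finite_measureI) (use emeasure_sphere_measure_finite[where 'a = 'a] in simp)

text \<open>Polar coordinates reduce the integral to a radial Gamma moment times the area of the
  sphere. By the definition of the cone measure that area is n times the volume of the unit
  ball.\<close>

lemma nn_integral_gaussian: "(\<integral>\<^sup>+y. ennreal (exp (- (norm (y::'a::euclidean_space))\<^sup>2)) \<partial>lborel) = ennreal (pi powr (real DIM('a) / 2))"
proof -
  let ?n = "real DIM('a)"
  have "(\<integral>\<^sup>+y. ennreal (exp (- (norm (y::'a))\<^sup>2)) \<partial>lborel) =
     (\<integral>\<^sup>+\<theta>. (\<integral>\<^sup>+r. ennreal (r ^ (DIM('a) - 1)) * indicator {0<..} r * ennreal (exp (- (norm (r *\<^sub>R \<theta>))\<^sup>2)) \<partial>lborel) \<partial>(sphere_measure :: 'a measure))"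
    by (rule nn_integral_polar) measurable
  also have "\<dots> = (\<integral>\<^sup>+\<theta>. ennreal (Gamma (?n / 2) / 2) \<partial>(sphere_measure :: 'a measure))"
  proof (rule nn_integral_cong)
    fix \<theta> :: 'a assume "\<theta> \<in> space sphere_measure"
    then have "(norm (r *\<^sub>R \<theta>))\<^sup>2 = r\<^sup>2" for r by (simp add: power_mult_distrib)
    then show "(\<integral>\<^sup>+r. ennreal (r ^ (DIM('a) - 1)) * indicator {0<..} r * ennreal (exp (- (norm (r *\<^sub>R \<theta>))\<^sup>2)) \<partial>lborel) = ennreal (Gamma (?n / 2) / 2)"
      using nn_integral_gaussian_half_line_moment[of "DIM('a) - 1"] by (simp add: of_nat_diff)
  qed
  also have "\<dots> = ennreal ?n * (\<integral>\<^sup>+y. ennreal (Gamma (?n / 2) / 2) * indicator (cball 0 1 - {0}) (y::'a) \<partial>lborel)"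
    by (rule nn_integral_sphere_measure) simp
  also have "(\<integral>\<^sup>+y. ennreal (Gamma (?n / 2) / 2) * indicator (cball 0 1 - {0}) (y::'a) \<partial>lborel) =
     ennreal (Gamma (?n / 2) / 2) * emeasure lborel (cball (0::'a) 1 - {0})"
    by (rule nn_integral_cmult_indicator) simp
  also have "emeasure lborel (cball (0::'a) 1 - {0}) = emeasure lborel (cball (0::'a) 1)"
    by (subst emeasure_Diff) auto
  also have "\<dots> = ennreal (unit_ball_vol ?n)" by (simp add: emeasure_cball)
  also have "ennreal ?n * (ennreal (Gamma (?n / 2) / 2) * ennreal (unit_ball_vol ?n)) =
      ennreal (?n * (Gamma (?n / 2) / 2 * unit_ball_vol ?n))"
    by (simp add: ennreal_mult[symmetric])
  also have "?n * (Gamma (?n / 2) / 2 * unit_ball_vol ?n) = pi powr (?n / 2)"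
  proof -
    have "?n / 2 > 0" by simp
    then have "?n / 2 \<notin> \<int>\<^sub>\<le>\<^sub>0" using nonpos_Ints_nonpos by force
    then have e: "Gamma (?n / 2 + 1) = (?n / 2) * Gamma (?n / 2)"
      by (rule Gamma_plus1)
    have "Gamma (?n / 2) > 0" by (intro Gamma_real_pos) simp
    then have "Gamma (?n / 2) \<noteq> 0" by linarith
    then show ?thesis unfolding unit_ball_vol_def e by simp
  qed
  finally show ?thesis .
qed

lemma norm_orth_part:
  assumes "norm \<xi> = 1"
  shows "(norm y)\<^sup>2 = (y \<bullet> \<xi>)\<^sup>2 + (norm (orth_part \<xi> y))\<^sup>2"
proof -
  have "\<xi> \<bullet> \<xi> = 1" using assms by (simp add: norm_eq_1)
  then show ?thesis
    unfolding power2_norm_eq_inner orth_part_def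
    by (simp add: inner_diff_left inner_diff_right inner_commute power2_eq_square)
qed

text \<open>The Gaussian is a product along \<xi> and its orthogonal hyperplane, so this is the
  n-dimensional integral divided by the one-dimensional \<open>sqrt pi\<close>.\<close>

lemma nn_integral_gaussian_hyperplane:
  fixes \<xi> :: "'a::euclidean_space"
  assumes \<xi>: "norm \<xi> = 1"
  shows "(\<integral>\<^sup>+y. indicator {0..1} (y \<bullet> \<xi>) * ennreal (exp (- (norm (orth_part \<xi> y))\<^sup>2)) \<partial>lborel) =
    ennreal (pi powr ((real DIM('a) - 1) / 2))" (is "?I = _")
proof -
  have "ennreal (pi powr (real DIM('a) / 2)) = (\<integral>\<^sup>+y. ennreal (exp (- (norm (y::'a))\<^sup>2)) \<partial>lborel)"
    by (simp add: nn_integral_gaussian)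
  also have "\<dots> = (\<integral>\<^sup>+y. ennreal (exp (- (y \<bullet> \<xi>)\<^sup>2)) * ennreal (exp (- (norm (orth_part \<xi> y))\<^sup>2)) \<partial>lborel)"
  proof (rule nn_integral_cong)
    fix y
    show "ennreal (exp (- (norm y)\<^sup>2)) = ennreal (exp (- (y \<bullet> \<xi>)\<^sup>2)) * ennreal (exp (- (norm (orth_part \<xi> y))\<^sup>2))"
      unfolding norm_orth_part[OF \<xi>, of y] by (simp add: ennreal_mult[symmetric] exp_add[symmetric])
  qed
  also have "\<dots> = (\<integral>\<^sup>+t. ennreal (exp (- t\<^sup>2)) \<partial>lborel) * ?I"
    by (rule nn_integral_line_times_hyperplane[OF _ _ \<xi>]) measurable
  also have "(\<integral>\<^sup>+t. ennreal (exp (- t\<^sup>2)) \<partial>lborel) = ennreal (sqrt pi)"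
    using nn_integral_gaussian_abs_moment[of 0] by (simp add: Gamma_one_half_real)
  finally have *: "ennreal (pi powr (real DIM('a) / 2)) = ennreal (sqrt pi) * ?I" .
  have "?I = (ennreal (1 / sqrt pi) * ennreal (sqrt pi)) * ?I"
    by (subst ennreal_mult[symmetric]) auto
  also have "\<dots> = ennreal (1 / sqrt pi * pi powr (real DIM('a) / 2))"
    unfolding mult.assoc *[symmetric] by (subst ennreal_mult) auto
  also have "1 / sqrt pi * pi powr (real DIM('a) / 2) = pi powr ((real DIM('a) - 1) / 2)"
    by (simp add: powr_half_sqrt[symmetric] powr_diff[symmetric] diff_divide_distrib)
  finally show ?thesis .
qed

text \<open>The measure \<open>great_subsphere_measure \<xi>\<close> lives on a space that moves
  with \<xi>. Over the fixed measure \<open>lborel\<close> the vector \<xi> is a mere parameter, so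
  measurability in \<xi> becomes accessible, and the expression makes sense for every vector
  \<xi>.\<close>

definition great_integral :: "('a::euclidean_space \<Rightarrow> ennreal) \<Rightarrow> 'a \<Rightarrow> ennreal" where
  "great_integral F \<xi> = ennreal (real (DIM('a) - 1)) * (\<integral>\<^sup>+y. indicator {0..1} (y \<bullet> \<xi>) *
     (indicator {0<..1} (norm (orth_part \<xi> y)) * F (sgn (orth_part \<xi> y))) \<partial>lborel)"

lemma great_integral_eq:
  assumes "F \<in> borel_measurable borel" "norm \<xi> = 1"
  shows "(\<integral>\<^sup>+\<theta>. F \<theta> \<partial>great_subsphere_measure \<xi>) = great_integral F \<xi>"
proof -
  have "indicator {0<..1} (norm (orth_part \<xi> y)) = (indicator (cball 0 1 - {0}) (orth_part \<xi> y) :: ennreal)" for y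
    by (auto simp: indicator_def)
  then show ?thesis
    unfolding nn_integral_great_subsphere[OF assms] great_integral_def by simp
qed

lemma great_integral_measurable [measurable]:
  assumes [measurable]: "F \<in> borel_measurable borel"
  shows "great_integral F \<in> borel_measurable borel"
  unfolding great_integral_def[abs_def] by measurable

text \<open>Separates a radial profile h from the angular part F. With a Gaussian profile the left
  side can often be evaluated by other means, and that determines the integral over the great
  subsphere.\<close>

lemma great_integral_gaussian:
  fixes F :: "'a::euclidean_space \<Rightarrow> ennreal"
  assumes [measurable]: "F \<in> borel_measurable borel" and \<xi>: "norm \<xi> = 1" and n: "DIM('a) \<ge> 2"
    and h[measurable]: "h \<in> borel_measurable borel"
  shows "(\<integral>\<^sup>+y. indicator {0..1} (y \<bullet> \<xi>) * (h (norm (orth_part \<xi> y)) * F (sgn (orth_part \<xi> y))) \<partial>lborel)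
     = (\<integral>\<^sup>+r. ennreal (r ^ (DIM('a) - 2)) * indicator {0<..} r * h r \<partial>lborel) * great_integral F \<xi>"
proof -
  have "(\<integral>\<^sup>+y. indicator {0..1} (y \<bullet> \<xi>) * (h (norm (orth_part \<xi> y)) * F (sgn (orth_part \<xi> y))) \<partial>lborel)
    = (\<integral>\<^sup>+\<theta>. (\<integral>\<^sup>+r. ennreal (r ^ (DIM('a) - 2)) * indicator {0<..} r * (h (norm (r *\<^sub>R \<theta>)) * F (sgn (r *\<^sub>R \<theta>))) \<partial>lborel) \<partial>great_subsphere_measure \<xi>)"
    by (rule nn_integral_hyperplane_polar[OF _ \<xi> n, of "\<lambda>z. h (norm z) * F (sgn z)"]) measurable
  also have "\<dots> = (\<integral>\<^sup>+\<theta>. (\<integral>\<^sup>+r. ennreal (r ^ (DIM('a) - 2)) * indicator {0<..} r * h r \<partial>lborel) * F \<theta> \<partial>great_subsphere_measure \<xi>)"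
  proof (rule nn_integral_cong)
    fix \<theta> assume "\<theta> \<in> space (great_subsphere_measure \<xi>)"
    then have "norm \<theta> = 1" by (simp add: great_subsphere_def)
    then have "(\<integral>\<^sup>+r. ennreal (r ^ (DIM('a) - 2)) * indicator {0<..} r * (h (norm (r *\<^sub>R \<theta>)) * F (sgn (r *\<^sub>R \<theta>))) \<partial>lborel) =
      (\<integral>\<^sup>+r. (ennreal (r ^ (DIM('a) - 2)) * indicator {0<..} r * h r) * F \<theta> \<partial>lborel)"
      by (intro nn_integral_cong) (auto simp: indicator_def sgn_scaleR sgn_div_norm[of \<theta>] mult_ac)
    also have "\<dots> = (\<integral>\<^sup>+r. ennreal (r ^ (DIM('a) - 2)) * indicator {0<..} r * h r \<partial>lborel) * F \<theta>"
      by (rule nn_integral_multc) measurable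
    finally show "(\<integral>\<^sup>+r. ennreal (r ^ (DIM('a) - 2)) * indicator {0<..} r * (h (norm (r *\<^sub>R \<theta>)) * F (sgn (r *\<^sub>R \<theta>))) \<partial>lborel)
      = (\<integral>\<^sup>+r. ennreal (r ^ (DIM('a) - 2)) * indicator {0<..} r * h r \<partial>lborel) * F \<theta>" .
  qed
  also have "\<dots> = (\<integral>\<^sup>+r. ennreal (r ^ (DIM('a) - 2)) * indicator {0<..} r * h r \<partial>lborel) * great_integral F \<xi>"
    by (subst nn_integral_cmult) (simp_all add: borel_measurable_great_subsphere great_integral_eq \<xi>)
  finally show ?thesis .
qed

text \<open>The area of the unit sphere of dimension n - 2, read off from the Gaussian integral over
  the hyperplane. For n = 2 it equals 2, the number of points.\<close>

lemma great_integral_1: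
  fixes \<xi> :: "'a::euclidean_space"
  assumes \<xi>: "norm \<xi> = 1" and n: "DIM('a) \<ge> 2"
  shows "great_integral (\<lambda>_. 1) \<xi> = ennreal (2 * pi powr ((real DIM('a) - 1) / 2) / Gamma ((real DIM('a) - 1) / 2))"
proof -
  let ?G = "Gamma ((real DIM('a) - 1) / 2)"
  have G: "?G > 0" using n by (intro Gamma_real_pos) simp
  have "ennreal (pi powr ((real DIM('a) - 1) / 2)) = ennreal (?G / 2) * great_integral (\<lambda>_. 1) \<xi>"
    using great_integral_gaussian[OF _ \<xi> n, of "\<lambda>_. 1" "\<lambda>r. ennreal (exp (- r\<^sup>2))"]
      nn_integral_gaussian_hyperplane[OF \<xi>] nn_integral_gaussian_half_line_moment[of "DIM('a) - 2"] n
    by (simp add: of_nat_diff)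
  then have "ennreal (2 / ?G) * ennreal (pi powr ((real DIM('a) - 1) / 2)) = (ennreal (2 / ?G) * ennreal (?G / 2)) * great_integral (\<lambda>_. 1) \<xi>"
    by (simp add: mult.assoc)
  also have "ennreal (2 / ?G) * ennreal (?G / 2) = 1"
    using G by (subst ennreal_mult[symmetric]) auto
  also have "ennreal (2 / ?G) * ennreal (pi powr ((real DIM('a) - 1) / 2)) = ennreal (2 / ?G * pi powr ((real DIM('a) - 1) / 2))"
    using G by (subst ennreal_mult[symmetric]) auto
  finally show ?thesis by simp
qed

text \<open>Closed sets form a generator stable under intersection, and the indicator of a closed
  set C is the limit of the continuous functions \<open>max 0 (1 - real k * infdist y C)\<close>.
  Finiteness of the measures lets the constant 1 dominate.\<close>

lemma measure_eqI_continuous: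
  fixes M N :: "'a::euclidean_space measure"
  assumes sets: "sets M = sets borel" "sets N = sets borel"
    and fin: "emeasure M UNIV \<noteq> \<infinity>" "emeasure N UNIV \<noteq> \<infinity>"
    and eq: "\<And>\<phi>::'a \<Rightarrow> real. continuous_on UNIV \<phi> \<Longrightarrow> (\<And>y. 0 \<le> \<phi> y \<and> \<phi> y \<le> 1) \<Longrightarrow>
      (\<integral>\<^sup>+y. ennreal (\<phi> y) \<partial>M) = (\<integral>\<^sup>+y. ennreal (\<phi> y) \<partial>N)"
  shows "M = N"
proof (rule measure_eqI_generator_eq[where \<Omega> = UNIV and E = "Collect closed" and A = "\<lambda>_. UNIV"])
  show "Int_stable (Collect closed :: 'a set set)" by (auto simp: Int_stable_def)
  show "sets M = sigma_sets UNIV (Collect closed)" "sets N = sigma_sets UNIV (Collect closed)"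
    unfolding sets by (subst borel_eq_closed, simp)+
  fix C :: "'a set" assume "C \<in> Collect closed"
  then have C: "closed C" by simp
  show "emeasure M C = emeasure N C"
  \<comment> \<open>The empty set is treated apart because \<open>infdist\<close> to it is 0 by
    convention, which would make the approximants equal to 1.\<close>
  proof (cases "C = {}")
    case False
    define \<phi> where "\<phi> k y = max 0 (1 - real k * infdist y C)" for k y
    have cont: "continuous_on UNIV (\<phi> k)" for k
      unfolding \<phi>_def by (intro continuous_intros)
    have [measurable]: "\<phi> k \<in> borel_measurable borel" for k
      using cont by (rule borel_measurable_continuous_onI)
    have bd: "0 \<le> \<phi> k y \<and> \<phi> k y \<le> 1" for k y by (simp add: \<phi>_def infdist_nonneg)
    have lim: "(\<lambda>k. ennreal (\<phi> k y)) \<longlonglongrightarrow> indicator C y" for y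
    proof (cases "y \<in> C")
      case True
      then show ?thesis by (simp add: \<phi>_def)
    next
      case notin: False
      then have pos: "infdist y C > 0"
        using in_closed_iff_infdist_zero[OF C False] infdist_nonneg[of y C] by (metis order_le_less)
      obtain K :: nat where K: "real K * infdist y C > 1"
        using pos reals_Archimedean3 by blast
      have "\<phi> k y = 0" if "k \<ge> K" for k
      proof -
        have "real K * infdist y C \<le> real k * infdist y C"
          using that pos by (intro mult_right_mono) auto
        then show ?thesis using K by (simp add: \<phi>_def)
      qed
      then have "\<forall>\<^sub>F k in sequentially. ennreal (\<phi> k y) = indicator C y"
        using notin by (auto simp: eventually_sequentially intro!: exI[of _ K])
      then show ?thesis by (rule tendsto_eventually)
    qed
    have conv: "(\<lambda>k. \<integral>\<^sup>+y. ennreal (\<phi> k y) \<partial>L) \<longlonglongrightarrow> emeasure L C"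
      if L: "sets L = sets borel" "emeasure L UNIV \<noteq> \<infinity>" for L :: "'a measure"
    proof -
      note [measurable_cong] = L(1)
      have [measurable]: "C \<in> sets L" using C by (simp add: L(1))
      have sp: "space L = UNIV" using sets_eq_imp_space_eq[OF L(1)] by simp
      have "(\<lambda>k. \<integral>\<^sup>+y. ennreal (\<phi> k y) \<partial>L) \<longlonglongrightarrow> (\<integral>\<^sup>+y. indicator C y \<partial>L)"
        using L(2) bd lim sp C by (intro nn_integral_dominated_convergence[where w = "\<lambda>_. 1"])
          (auto simp: less_top L(1))
      then show ?thesis using C by (simp add: L(1))
    qed
    have "(\<integral>\<^sup>+y. ennreal (\<phi> k y) \<partial>M) = (\<integral>\<^sup>+y. ennreal (\<phi> k y) \<partial>N)" for k
      by (rule eq[OF cont bd])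
    then show ?thesis
      using LIMSEQ_unique[OF conv[OF sets(1) fin(1)]] conv[OF sets(2) fin(2)] by simp
  qed simp
qed (use fin in auto)

section \<open>Self-adjointness of the spherical Radon transform\<close>

text \<open>Up to a constant, the slab integral is the integral of \<open>F \<theta>\<close> against a kernel that depends
  only on \<open>\<xi> \<bullet> \<theta>\<close>, hence is symmetric; as \<open>\<delta>\<close> tends to 0 it concentrates on the great
  subsphere.\<close>

definition slab_integral :: "real \<Rightarrow> ('a::euclidean_space \<Rightarrow> real) \<Rightarrow> 'a \<Rightarrow> ennreal" where
  "slab_integral \<delta> F \<xi> = (\<integral>\<^sup>+y. indicator {0..\<delta>} (y \<bullet> \<xi>) * ennreal (exp (- (norm y)\<^sup>2) * F (sgn y)) \<partial>lborel)"

lemma slab_integral_measurable [measurable]: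
  assumes [measurable]: "F \<in> borel_measurable borel"
  shows "slab_integral \<delta> F \<in> borel_measurable borel"
  unfolding slab_integral_def[abs_def] by measurable

lemma slab_integral_symmetric:
  fixes F G :: "'a::euclidean_space \<Rightarrow> real"
  assumes [measurable]: "F \<in> borel_measurable borel" "G \<in> borel_measurable borel"
    and nn: "\<And>x. F x \<ge> 0" "\<And>x. G x \<ge> 0"
  shows "(\<integral>\<^sup>+\<xi>. ennreal (G \<xi>) * slab_integral \<delta> F \<xi> \<partial>sphere_measure) =
    (\<integral>\<^sup>+\<xi>. ennreal (F \<xi>) * slab_integral \<delta> G \<xi> \<partial>sphere_measure)"
proof -
  interpret pair_sigma_finite "sphere_measure :: 'a measure" "sphere_measure :: 'a measure" ..
  define k where "k s = (\<integral>\<^sup>+r. ennreal (r ^ (DIM('a) - 1)) * indicator {0<..} r *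
     (indicator {0..\<delta>} (r * s) * ennreal (exp (- r\<^sup>2))) \<partial>lborel)" for s
  have [measurable]: "k \<in> borel_measurable borel" unfolding k_def by measurable
  have fst_m: "(\<lambda>x. fst x) \<in> borel_measurable (sphere_measure \<Otimes>\<^sub>M (sphere_measure :: 'a measure))"
    "(\<lambda>x. snd x) \<in> borel_measurable (sphere_measure \<Otimes>\<^sub>M (sphere_measure :: 'a measure))"
    by (rule measurable_compose[OF measurable_fst borel_measurable_sphere[OF measurable_ident_sets[OF refl], simplified]])
      (rule measurable_compose[OF measurable_snd borel_measurable_sphere[OF measurable_ident_sets[OF refl], simplified]])
  note [measurable] = fst_m
  have kernel: "slab_integral \<delta> F \<xi> = (\<integral>\<^sup>+\<theta>. ennreal (F \<theta>) * k (\<xi> \<bullet> \<theta>) \<partial>sphere_measure)"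
    if [measurable]: "F \<in> borel_measurable borel" and "\<And>x. F x \<ge> 0" for F :: "'a \<Rightarrow> real" and \<xi>
  proof -
    have "slab_integral \<delta> F \<xi> = (\<integral>\<^sup>+\<theta>. (\<integral>\<^sup>+r. ennreal (r ^ (DIM('a) - 1)) * indicator {0<..} r *
       (indicator {0..\<delta>} ((r *\<^sub>R \<theta>) \<bullet> \<xi>) * ennreal (exp (- (norm (r *\<^sub>R \<theta>))\<^sup>2) * F (sgn (r *\<^sub>R \<theta>)))) \<partial>lborel) \<partial>sphere_measure)"
      unfolding slab_integral_def by (rule nn_integral_polar) measurable
    also have "\<dots> = (\<integral>\<^sup>+\<theta>. ennreal (F \<theta>) * k (\<xi> \<bullet> \<theta>) \<partial>sphere_measure)"
    proof (rule nn_integral_cong)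
      fix \<theta> :: 'a assume "\<theta> \<in> space sphere_measure"
      then have \<theta>: "norm \<theta> = 1" by simp
      have "(\<integral>\<^sup>+r. ennreal (r ^ (DIM('a) - 1)) * indicator {0<..} r *
         (indicator {0..\<delta>} ((r *\<^sub>R \<theta>) \<bullet> \<xi>) * ennreal (exp (- (norm (r *\<^sub>R \<theta>))\<^sup>2) * F (sgn (r *\<^sub>R \<theta>)))) \<partial>lborel) =
        (\<integral>\<^sup>+r. ennreal (F \<theta>) * (ennreal (r ^ (DIM('a) - 1)) * indicator {0<..} r *
         (indicator {0..\<delta>} (r * (\<xi> \<bullet> \<theta>)) * ennreal (exp (- r\<^sup>2)))) \<partial>lborel)"
      proof (rule nn_integral_cong)
        fix r :: real
        show "ennreal (r ^ (DIM('a) - 1)) * indicator {0<..} r *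
         (indicator {0..\<delta>} ((r *\<^sub>R \<theta>) \<bullet> \<xi>) * ennreal (exp (- (norm (r *\<^sub>R \<theta>))\<^sup>2) * F (sgn (r *\<^sub>R \<theta>)))) =
         ennreal (F \<theta>) * (ennreal (r ^ (DIM('a) - 1)) * indicator {0<..} r *
         (indicator {0..\<delta>} (r * (\<xi> \<bullet> \<theta>)) * ennreal (exp (- r\<^sup>2))))"
        proof (cases "r > 0")
          case True
          then have "sgn (r *\<^sub>R \<theta>) = \<theta>" "(norm (r *\<^sub>R \<theta>))\<^sup>2 = r\<^sup>2"
            using \<theta> by (simp_all add: sgn_scaleR sgn_div_norm[of \<theta>])
          then show ?thesis
            using that(2) by (simp add: inner_commute[of \<theta>] ennreal_mult mult_ac)
        qed simp
      qed
      also have "\<dots> = ennreal (F \<theta>) * k (\<xi> \<bullet> \<theta>)"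
        unfolding k_def by (rule nn_integral_cmult) measurable
      finally show "(\<integral>\<^sup>+r. ennreal (r ^ (DIM('a) - 1)) * indicator {0<..} r *
         (indicator {0..\<delta>} ((r *\<^sub>R \<theta>) \<bullet> \<xi>) * ennreal (exp (- (norm (r *\<^sub>R \<theta>))\<^sup>2) * F (sgn (r *\<^sub>R \<theta>)))) \<partial>lborel) =
         ennreal (F \<theta>) * k (\<xi> \<bullet> \<theta>)" .
    qed
    finally show ?thesis .
  qed
  have pull: "(\<integral>\<^sup>+\<xi>. ennreal (G \<xi>) * slab_integral \<delta> F \<xi> \<partial>sphere_measure) =
      (\<integral>\<^sup>+\<xi>. \<integral>\<^sup>+\<theta>. ennreal (G \<xi>) * (ennreal (F \<theta>) * k (\<xi> \<bullet> \<theta>)) \<partial>sphere_measure \<partial>sphere_measure)"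
    if [measurable]: "F \<in> borel_measurable borel" and "\<And>x. F x \<ge> 0" for F G :: "'a \<Rightarrow> real"
    unfolding kernel[OF that]
    by (intro nn_integral_cong nn_integral_cmult[symmetric] borel_measurable_sphere) measurable
  have "(\<integral>\<^sup>+\<xi>. ennreal (G \<xi>) * slab_integral \<delta> F \<xi> \<partial>sphere_measure) =
      (\<integral>\<^sup>+\<theta>. \<integral>\<^sup>+\<xi>. ennreal (G \<xi>) * (ennreal (F \<theta>) * k (\<xi> \<bullet> \<theta>)) \<partial>sphere_measure \<partial>sphere_measure)"
    unfolding pull[OF assms(1) nn(1)] by (rule Fubini'[symmetric]) measurable
  also have "\<dots> = (\<integral>\<^sup>+\<xi>. ennreal (F \<xi>) * slab_integral \<delta> G \<xi> \<partial>sphere_measure)"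
    unfolding pull[OF assms(2) nn(2)] by (simp add: mult_ac inner_commute)
  finally show ?thesis .
qed

text \<open>Substituting \<delta> * t for t fixes the height of the slab. The parameter \<delta>
  survives only inside the continuous integrand, so the limit can be taken there.\<close>

lemma slab_integral_rescaled:
  fixes F :: "'a::euclidean_space \<Rightarrow> real"
  assumes [measurable]: "F \<in> borel_measurable borel" and \<xi>: "norm \<xi> = 1" and \<delta>: "\<delta> > 0"
  shows "slab_integral \<delta> F \<xi> = ennreal \<delta> * (\<integral>\<^sup>+y. indicator {0..1} (y \<bullet> \<xi>) *
    (\<integral>\<^sup>+t. indicator {0..1} t * ennreal (exp (- ((\<delta> * t)\<^sup>2 + (norm (orth_part \<xi> y))\<^sup>2)) *
       F (sgn (orth_part \<xi> y + (\<delta> * t) *\<^sub>R \<xi>))) \<partial>lborel) \<partial>lborel)"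
proof -
  have "slab_integral \<delta> F \<xi> = (\<integral>\<^sup>+y. indicator {0..1} (y \<bullet> \<xi>) *
    (\<integral>\<^sup>+t. indicator {0..\<delta>} ((orth_part \<xi> y + t *\<^sub>R \<xi>) \<bullet> \<xi>) * ennreal (exp (- (norm (orth_part \<xi> y + t *\<^sub>R \<xi>))\<^sup>2) *
       F (sgn (orth_part \<xi> y + t *\<^sub>R \<xi>))) \<partial>lborel) \<partial>lborel)"
    unfolding slab_integral_def by (rule nn_integral_line_hyperplane[OF _ \<xi>]) measurable
  also have "\<dots> = (\<integral>\<^sup>+y. ennreal \<delta> * (indicator {0..1} (y \<bullet> \<xi>) *
    (\<integral>\<^sup>+t. indicator {0..1} t * ennreal (exp (- ((\<delta> * t)\<^sup>2 + (norm (orth_part \<xi> y))\<^sup>2)) *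
       F (sgn (orth_part \<xi> y + (\<delta> * t) *\<^sub>R \<xi>))) \<partial>lborel)) \<partial>lborel)"
  proof (rule nn_integral_cong)
    fix y
    have sq: "(norm (orth_part \<xi> y + t *\<^sub>R \<xi>))\<^sup>2 = t\<^sup>2 + (norm (orth_part \<xi> y))\<^sup>2" for t
      using norm_orth_part[OF \<xi>, of "orth_part \<xi> y + t *\<^sub>R \<xi>"] by (simp add: \<xi>)
    have "(\<integral>\<^sup>+t. indicator {0..\<delta>} ((orth_part \<xi> y + t *\<^sub>R \<xi>) \<bullet> \<xi>) * ennreal (exp (- (norm (orth_part \<xi> y + t *\<^sub>R \<xi>))\<^sup>2) *
       F (sgn (orth_part \<xi> y + t *\<^sub>R \<xi>))) \<partial>lborel) =
      (\<integral>\<^sup>+t. indicator {0..\<delta>} t * ennreal (exp (- (t\<^sup>2 + (norm (orth_part \<xi> y))\<^sup>2)) *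
       F (sgn (orth_part \<xi> y + t *\<^sub>R \<xi>))) \<partial>lborel)"
      by (simp add: sq \<xi>)
    also have "\<dots> = ennreal \<bar>\<delta>\<bar> * (\<integral>\<^sup>+t. indicator {0..\<delta>} (0 + \<delta> * t) * ennreal (exp (- ((0 + \<delta> * t)\<^sup>2 + (norm (orth_part \<xi> y))\<^sup>2)) *
       F (sgn (orth_part \<xi> y + (0 + \<delta> * t) *\<^sub>R \<xi>))) \<partial>lborel)"
      using \<delta> by (intro nn_integral_real_affine) auto
    also have "(\<integral>\<^sup>+t. indicator {0..\<delta>} (0 + \<delta> * t) * ennreal (exp (- ((0 + \<delta> * t)\<^sup>2 + (norm (orth_part \<xi> y))\<^sup>2)) *
       F (sgn (orth_part \<xi> y + (0 + \<delta> * t) *\<^sub>R \<xi>))) \<partial>lborel) =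
       (\<integral>\<^sup>+t. indicator {0..1} t * ennreal (exp (- ((\<delta> * t)\<^sup>2 + (norm (orth_part \<xi> y))\<^sup>2)) *
       F (sgn (orth_part \<xi> y + (\<delta> * t) *\<^sub>R \<xi>))) \<partial>lborel)"
      using \<delta> by (intro nn_integral_cong) (auto simp: indicator_def zero_le_mult_iff)
    finally show "indicator {0..1} (y \<bullet> \<xi>) * (\<integral>\<^sup>+t. indicator {0..\<delta>} ((orth_part \<xi> y + t *\<^sub>R \<xi>) \<bullet> \<xi>) * ennreal (exp (- (norm (orth_part \<xi> y + t *\<^sub>R \<xi>))\<^sup>2) *
       F (sgn (orth_part \<xi> y + t *\<^sub>R \<xi>))) \<partial>lborel) = ennreal \<delta> * (indicator {0..1} (y \<bullet> \<xi>) *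
      (\<integral>\<^sup>+t. indicator {0..1} t * ennreal (exp (- ((\<delta> * t)\<^sup>2 + (norm (orth_part \<xi> y))\<^sup>2)) *
       F (sgn (orth_part \<xi> y + (\<delta> * t) *\<^sub>R \<xi>))) \<partial>lborel))"
      using \<delta> by (simp add: mult_ac)
  qed
  also have "\<dots> = ennreal \<delta> * (\<integral>\<^sup>+y. (indicator {0..1} (y \<bullet> \<xi>) *
    (\<integral>\<^sup>+t. indicator {0..1} t * ennreal (exp (- ((\<delta> * t)\<^sup>2 + (norm (orth_part \<xi> y))\<^sup>2)) *
       F (sgn (orth_part \<xi> y + (\<delta> * t) *\<^sub>R \<xi>))) \<partial>lborel)) \<partial>lborel)"
    by (rule nn_integral_cmult) measurable
  finally show ?thesis .
qed

text \<open>Dominated convergence is used twice, along the line and over the hyperplane, with the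
  majorant B * exp (- norm^2) on the hyperplane. Points with \<open>orth_part \<xi> y = 0\<close>,
  where \<open>sgn\<close> is discontinuous, form a null set. The second claim is uniform in k and
  \<xi>, as needed for the later limit under the integral over the sphere.\<close>

lemma slab_integral_limit:
  fixes F :: "'a::euclidean_space \<Rightarrow> real"
  assumes cont: "continuous_on UNIV F" and bd: "\<And>x. 0 \<le> F x \<and> F x \<le> B"
    and \<xi>: "norm \<xi> = 1" and n: "DIM('a) \<ge> 2"
  shows "(\<lambda>k. ennreal (real (Suc k)) * slab_integral (1 / real (Suc k)) F \<xi>) \<longlonglongrightarrow>
      ennreal (Gamma ((real DIM('a) - 1) / 2) / 2) * great_integral (\<lambda>x. ennreal (F x)) \<xi>"
    and "ennreal (real (Suc k)) * slab_integral (1 / real (Suc k)) F \<xi> \<le> ennreal (B * pi powr ((real DIM('a) - 1) / 2))"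
proof -
  have [measurable]: "F \<in> borel_measurable borel" using cont by (rule borel_measurable_continuous_onI)
  have B: "B \<ge> 0" using bd[of 0] by linarith
  define g where "g k y t = indicator {0..1} t * ennreal (exp (- ((1 / real (Suc k) * t)\<^sup>2 + (norm (orth_part \<xi> y))\<^sup>2)) *
       F (sgn (orth_part \<xi> y + (1 / real (Suc k) * t) *\<^sub>R \<xi>)))" for k y t
  define h where "h k y = indicator {0..1} (y \<bullet> \<xi>) * (\<integral>\<^sup>+t. g k y t \<partial>lborel)" for k y
  let ?w = "\<lambda>y. indicator {0..1} (y \<bullet> \<xi>) * ennreal (B * exp (- (norm (orth_part \<xi> y))\<^sup>2))"
  have [measurable]: "(\<lambda>t. g k y t) \<in> borel_measurable borel" for k y unfolding g_def by measurable
  have [measurable]: "h k \<in> borel_measurable borel" for k unfolding h_def g_def by measurable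
  have eq: "ennreal (real (Suc k)) * slab_integral (1 / real (Suc k)) F \<xi> = (\<integral>\<^sup>+y. h k y \<partial>lborel)" for k
  proof -
    have "ennreal (real (Suc k)) * slab_integral (1 / real (Suc k)) F \<xi> =
       (ennreal (real (Suc k)) * ennreal (1 / real (Suc k))) * (\<integral>\<^sup>+y. h k y \<partial>lborel)"
      unfolding h_def g_def by (subst slab_integral_rescaled[OF _ \<xi>]) (simp_all only: mult.assoc, auto)
    also have "ennreal (real (Suc k)) * ennreal (1 / real (Suc k)) = 1"
      by (subst ennreal_mult[symmetric]) auto
    finally show ?thesis by simp
  qed
  have g_le: "g k y t \<le> ennreal (B * exp (- (norm (orth_part \<xi> y))\<^sup>2)) * indicator {0..1} t" for k y t
  proof -
    have "exp (- ((1 / real (Suc k) * t)\<^sup>2 + (norm (orth_part \<xi> y))\<^sup>2)) *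
       F (sgn (orth_part \<xi> y + (1 / real (Suc k) * t) *\<^sub>R \<xi>)) \<le> exp (- (norm (orth_part \<xi> y))\<^sup>2) * B"
      using bd by (intro mult_mono) auto
    then show ?thesis unfolding g_def by (auto simp: indicator_def mult.commute intro!: ennreal_leI)
  qed
  have h_le: "h k y \<le> ?w y" for k y
  proof -
    have "(\<integral>\<^sup>+t. g k y t \<partial>lborel) \<le> (\<integral>\<^sup>+t. ennreal (B * exp (- (norm (orth_part \<xi> y))\<^sup>2)) * indicator {0..1::real} t \<partial>lborel)"
      by (intro nn_integral_mono g_le)
    also have "\<dots> = ennreal (B * exp (- (norm (orth_part \<xi> y))\<^sup>2))"
      by (subst nn_integral_cmult_indicator) auto
    finally show ?thesis unfolding h_def by (intro mult_left_mono) auto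
  qed
  have w: "(\<integral>\<^sup>+y. ?w y \<partial>lborel) = ennreal (B * pi powr ((real DIM('a) - 1) / 2))"
  proof -
    have "(\<integral>\<^sup>+y. ?w y \<partial>lborel) = (\<integral>\<^sup>+y. ennreal B * (indicator {0..1} (y \<bullet> \<xi>) * ennreal (exp (- (norm (orth_part \<xi> y))\<^sup>2))) \<partial>lborel)"
      using B by (intro nn_integral_cong) (simp add: ennreal_mult mult_ac)
    also have "\<dots> = ennreal B * ennreal (pi powr ((real DIM('a) - 1) / 2))"
      unfolding nn_integral_gaussian_hyperplane[OF \<xi>, symmetric] by (rule nn_integral_cmult) measurable
    finally show ?thesis using B by (simp add: ennreal_mult)
  qed
  show "ennreal (real (Suc k)) * slab_integral (1 / real (Suc k)) F \<xi> \<le> ennreal (B * pi powr ((real DIM('a) - 1) / 2))"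
    unfolding eq w[symmetric] by (intro nn_integral_mono h_le)
  define h' where "h' y = indicator {0..1} (y \<bullet> \<xi>) * (ennreal (exp (- (norm (orth_part \<xi> y))\<^sup>2)) * ennreal (F (sgn (orth_part \<xi> y))))" for y
  have "(\<lambda>k. \<integral>\<^sup>+y. h k y \<partial>lborel) \<longlonglongrightarrow> (\<integral>\<^sup>+y. h' y \<partial>lborel)"
  proof (rule nn_integral_dominated_convergence[where w = ?w])
    show "AE y in lborel. (\<lambda>k. h k y) \<longlonglongrightarrow> h' y"
      using AE_orth_part_nonzero[OF \<xi> n]
    proof eventually_elim
      case (elim y)
      define L where "L t = ennreal (exp (- (norm (orth_part \<xi> y))\<^sup>2) * F (sgn (orth_part \<xi> y))) * indicator {0..1} t" for t :: real
      have "(\<lambda>k. \<integral>\<^sup>+t. g k y t \<partial>lborel) \<longlonglongrightarrow> (\<integral>\<^sup>+t. L t \<partial>lborel)"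
      proof (rule nn_integral_dominated_convergence[where w = "\<lambda>t. ennreal (B * exp (- (norm (orth_part \<xi> y))\<^sup>2)) * indicator {0..1} t"])
        show "AE t in lborel. (\<lambda>k. g k y t) \<longlonglongrightarrow> L t"
        proof (rule AE_I2)
          fix t :: real
          have z: "(\<lambda>k. 1 / real (Suc k) * t) \<longlonglongrightarrow> 0 * t"
            by (intro tendsto_mult tendsto_const LIMSEQ_Suc lim_1_over_n)
          have "isCont F (sgn (orth_part \<xi> y))"
            using cont continuous_on_eq_continuous_at open_UNIV by blast
          moreover
          have "(\<lambda>k. sgn (orth_part \<xi> y + (1 / real (Suc k) * t) *\<^sub>R \<xi>)) \<longlonglongrightarrow> sgn (orth_part \<xi> y + (0 * t) *\<^sub>R \<xi>)"
            using elim by (intro tendsto_sgn tendsto_add tendsto_const tendsto_scaleR z) simp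
          then have "(\<lambda>k. sgn (orth_part \<xi> y + (1 / real (Suc k) * t) *\<^sub>R \<xi>)) \<longlonglongrightarrow> sgn (orth_part \<xi> y)"
            by simp
          ultimately have "(\<lambda>k. F (sgn (orth_part \<xi> y + (1 / real (Suc k) * t) *\<^sub>R \<xi>))) \<longlonglongrightarrow> F (sgn (orth_part \<xi> y))"
            by (rule isCont_tendsto_compose)
          then have "(\<lambda>k. exp (- ((1 / real (Suc k) * t)\<^sup>2 + (norm (orth_part \<xi> y))\<^sup>2)) *
             F (sgn (orth_part \<xi> y + (1 / real (Suc k) * t) *\<^sub>R \<xi>))) \<longlonglongrightarrow>
             exp (- ((0 * t)\<^sup>2 + (norm (orth_part \<xi> y))\<^sup>2)) * F (sgn (orth_part \<xi> y))"
            by (intro tendsto_mult tendsto_exp tendsto_minus tendsto_add tendsto_power z tendsto_const)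
          from tendsto_ennrealI[OF this] show "(\<lambda>k. g k y t) \<longlonglongrightarrow> L t"
            unfolding g_def L_def by (cases "t \<in> {0..1}") auto
        qed
        show "AE t in lborel. g k y t \<le> ennreal (B * exp (- (norm (orth_part \<xi> y))\<^sup>2)) * indicator {0..1} t" for k
          by (rule AE_I2) (rule g_le)
        show "(\<integral>\<^sup>+t. ennreal (B * exp (- (norm (orth_part \<xi> y))\<^sup>2)) * indicator {0..1::real} t \<partial>lborel) < \<infinity>"
          by (subst nn_integral_cmult_indicator) auto
      qed (auto simp: L_def)
      also have "(\<integral>\<^sup>+t. L t \<partial>lborel) = ennreal (exp (- (norm (orth_part \<xi> y))\<^sup>2) * F (sgn (orth_part \<xi> y)))"
        unfolding L_def by (subst nn_integral_cmult_indicator) auto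
      finally show ?case
        unfolding h_def h'_def using bd by (cases "y \<bullet> \<xi> \<in> {0..1}") (auto simp: ennreal_mult)
    qed
    show "AE y in lborel. h k y \<le> ?w y" for k by (rule AE_I2) (rule h_le)
    show "(\<integral>\<^sup>+y. ?w y \<partial>lborel) < \<infinity>" unfolding w by simp
  qed (auto simp: h'_def)
  also have "(\<integral>\<^sup>+y. h' y \<partial>lborel) = ennreal (Gamma ((real DIM('a) - 1) / 2) / 2) * great_integral (\<lambda>x. ennreal (F x)) \<xi>"
    using great_integral_gaussian[OF _ \<xi> n, of "\<lambda>x. ennreal (F x)" "\<lambda>r. ennreal (exp (- r\<^sup>2))"]
      nn_integral_gaussian_half_line_moment[of "DIM('a) - 2"] n
    unfolding h'_def by (simp add: of_nat_diff)
  finally show "(\<lambda>k. ennreal (real (Suc k)) * slab_integral (1 / real (Suc k)) F \<xi>) \<longlonglongrightarrow>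
      ennreal (Gamma ((real DIM('a) - 1) / 2) / 2) * great_integral (\<lambda>x. ennreal (F x)) \<xi>"
    unfolding eq .
qed

text \<open>The symmetric slab identity divided by the slab height, in the limit. The auxiliary
  limit is stated for an arbitrary pair of functions because it is used with the two roles
  exchanged.\<close>

lemma great_integral_duality_continuous:
  fixes F G :: "'a::euclidean_space \<Rightarrow> real"
  assumes F: "continuous_on UNIV F" "\<And>x. 0 \<le> F x \<and> F x \<le> B"
    and G: "continuous_on UNIV G" "\<And>x. 0 \<le> G x \<and> G x \<le> D" and n: "DIM('a) \<ge> 2"
  shows "(\<integral>\<^sup>+\<xi>. ennreal (G \<xi>) * great_integral (\<lambda>x. ennreal (F x)) \<xi> \<partial>sphere_measure) =
    (\<integral>\<^sup>+\<xi>. ennreal (F \<xi>) * great_integral (\<lambda>x. ennreal (G x)) \<xi> \<partial>sphere_measure)"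
proof -
  let ?c = "Gamma ((real DIM('a) - 1) / 2) / 2"
  have c: "?c > 0" using n by (intro divide_pos_pos Gamma_real_pos) auto
  have lim: "(\<lambda>k. \<integral>\<^sup>+\<xi>. ennreal (G \<xi>) * (ennreal (real (Suc k)) * slab_integral (1 / real (Suc k)) F \<xi>) \<partial>sphere_measure)
     \<longlonglongrightarrow> (\<integral>\<^sup>+\<xi>. ennreal (G \<xi>) * (ennreal ?c * great_integral (\<lambda>x. ennreal (F x)) \<xi>) \<partial>sphere_measure)"
    if F: "continuous_on UNIV F" "\<And>x. 0 \<le> F x \<and> F x \<le> B"
    and G: "continuous_on UNIV G" "\<And>x. 0 \<le> G x \<and> G x \<le> D" for F G :: "'a \<Rightarrow> real" and B D
  proof (rule nn_integral_dominated_convergence[where w = "\<lambda>_. ennreal (D * (B * pi powr ((real DIM('a) - 1) / 2)))"])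
    have [measurable]: "F \<in> borel_measurable borel" "G \<in> borel_measurable borel"
      using F G by (auto intro: borel_measurable_continuous_onI)
    show "(\<lambda>\<xi>. ennreal (G \<xi>) * (ennreal (real (Suc k)) * slab_integral (1 / real (Suc k)) F \<xi>)) \<in> borel_measurable sphere_measure" for k
      by (rule borel_measurable_sphere) measurable
    show "(\<lambda>\<xi>. ennreal (G \<xi>) * (ennreal ?c * great_integral (\<lambda>x. ennreal (F x)) \<xi>)) \<in> borel_measurable sphere_measure"
      by (rule borel_measurable_sphere) measurable
    have BD: "B \<ge> 0" "D \<ge> 0" using F(2)[of 0] G(2)[of 0] by linarith+
    show "AE \<xi> in sphere_measure. ennreal (G \<xi>) * (ennreal (real (Suc k)) * slab_integral (1 / real (Suc k)) F \<xi>) \<le>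
        ennreal (D * (B * pi powr ((real DIM('a) - 1) / 2)))" for k
    proof (rule AE_I2)
      fix \<xi> :: 'a assume "\<xi> \<in> space sphere_measure"
      then have "ennreal (G \<xi>) * (ennreal (real (Suc k)) * slab_integral (1 / real (Suc k)) F \<xi>) \<le>
          ennreal D * ennreal (B * pi powr ((real DIM('a) - 1) / 2))"
        using G(2) by (intro mult_mono slab_integral_limit(2)[OF F _ n] ennreal_leI) auto
      then show "ennreal (G \<xi>) * (ennreal (real (Suc k)) * slab_integral (1 / real (Suc k)) F \<xi>) \<le>
        ennreal (D * (B * pi powr ((real DIM('a) - 1) / 2)))"
        using BD by (simp add: ennreal_mult)
    qed
    show "AE \<xi> in sphere_measure. (\<lambda>k. ennreal (G \<xi>) * (ennreal (real (Suc k)) * slab_integral (1 / real (Suc k)) F \<xi>))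
       \<longlonglongrightarrow> ennreal (G \<xi>) * (ennreal ?c * great_integral (\<lambda>x. ennreal (F x)) \<xi>)"
      by (intro AE_I2 ennreal_tendsto_cmult slab_integral_limit(1)[OF F _ n]) auto
    show "(\<integral>\<^sup>+\<xi>. ennreal (D * (B * pi powr ((real DIM('a) - 1) / 2))) \<partial>(sphere_measure :: 'a measure)) < \<infinity>"
      using emeasure_sphere_measure_finite[where 'a = 'a] by (simp add: ennreal_mult_less_top)
  qed simp
  have m: "F \<in> borel_measurable borel" "G \<in> borel_measurable borel"
    using F G by (auto intro: borel_measurable_continuous_onI)
  note [measurable] = m
  have swap: "(\<integral>\<^sup>+\<xi>. ennreal (G \<xi>) * (ennreal (real (Suc k)) * slab_integral (1 / real (Suc k)) F \<xi>) \<partial>sphere_measure) =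
      (\<integral>\<^sup>+\<xi>. ennreal (F \<xi>) * (ennreal (real (Suc k)) * slab_integral (1 / real (Suc k)) G \<xi>) \<partial>sphere_measure)" for k
  proof -
    have "(\<integral>\<^sup>+\<xi>. ennreal (G \<xi>) * (ennreal (real (Suc k)) * slab_integral (1 / real (Suc k)) F \<xi>) \<partial>sphere_measure) =
      ennreal (real (Suc k)) * (\<integral>\<^sup>+\<xi>. ennreal (G \<xi>) * slab_integral (1 / real (Suc k)) F \<xi> \<partial>sphere_measure)"
      if [measurable]: "F \<in> borel_measurable borel" "G \<in> borel_measurable borel" for F G :: "'a \<Rightarrow> real"
      by (subst nn_integral_cmult[symmetric]) (auto intro: borel_measurable_sphere simp: mult_ac)
    then show ?thesis using m slab_integral_symmetric[OF m] F(2) G(2) by simp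
  qed
  have "(\<integral>\<^sup>+\<xi>. ennreal (G \<xi>) * (ennreal ?c * great_integral (\<lambda>x. ennreal (F x)) \<xi>) \<partial>sphere_measure) =
     (\<integral>\<^sup>+\<xi>. ennreal (F \<xi>) * (ennreal ?c * great_integral (\<lambda>x. ennreal (G x)) \<xi>) \<partial>sphere_measure)"
    using lim[OF F G] lim[OF G F] unfolding swap by (rule LIMSEQ_unique)
  moreover have "(\<integral>\<^sup>+\<xi>. ennreal (G \<xi>) * (ennreal ?c * great_integral (\<lambda>x. ennreal (F x)) \<xi>) \<partial>sphere_measure)
     = ennreal ?c * (\<integral>\<^sup>+\<xi>. ennreal (G \<xi>) * great_integral (\<lambda>x. ennreal (F x)) \<xi> \<partial>sphere_measure)"
    if [measurable]: "F \<in> borel_measurable borel" "G \<in> borel_measurable borel" for F G :: "'a \<Rightarrow> real"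
    by (subst nn_integral_cmult[symmetric]) (auto intro: borel_measurable_sphere simp: mult_ac)
  ultimately show ?thesis using c m by (simp add: ennreal_mult_cancel_left)
qed

text \<open>As functions of F both sides are integrals against Borel measures. These are finite,
  since G is bounded and a great subsphere has finite area, and they agree on continuous functions
  with values in [0, 1]; hence they are equal, and F may be any nonnegative Borel function.\<close>

lemma great_integral_duality:
  fixes G :: "'a::euclidean_space \<Rightarrow> real" and F :: "'a \<Rightarrow> ennreal"
  assumes [measurable]: "F \<in> borel_measurable borel"
    and G: "continuous_on UNIV G" "\<And>x. 0 \<le> G x \<and> G x \<le> D" and n: "DIM('a) \<ge> 2"
  shows "(\<integral>\<^sup>+\<xi>. ennreal (G \<xi>) * great_integral F \<xi> \<partial>sphere_measure) =
    (\<integral>\<^sup>+\<xi>. F \<xi> * great_integral (\<lambda>x. ennreal (G x)) \<xi> \<partial>sphere_measure)"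
proof -
  let ?S = "sphere_measure :: 'a measure"
  interpret pair_sigma_finite ?S "lborel :: 'a measure" ..
  have [measurable]: "G \<in> borel_measurable borel" using G by (auto intro: borel_measurable_continuous_onI)
  have [measurable]: "(\<lambda>x. fst x) \<in> borel_measurable (?S \<Otimes>\<^sub>M (lborel :: 'a measure))"
    by (rule measurable_compose[OF measurable_fst borel_measurable_sphere[OF measurable_ident_sets[OF refl], simplified]])
  define d where "d = (\<lambda>(\<xi>, y). ennreal (G \<xi>) * (ennreal (real (DIM('a) - 1)) * (indicator {0..1} (y \<bullet> \<xi>) *
     indicator {0<..1} (norm (orth_part \<xi> y)))))"
  have [measurable]: "d \<in> borel_measurable (?S \<Otimes>\<^sub>M (lborel :: 'a measure))"
    unfolding d_def by measurable
  \<comment> \<open>The image, under the direction of the hyperplane component of y, of the product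
    measure on pairs of \<xi> and y, weighted by G and the cone over the great subsphere.\<close>
  define M1 where "M1 = distr (density (?S \<Otimes>\<^sub>M lborel) d) borel (\<lambda>(\<xi>, y). sgn (orth_part \<xi> y))"
  define M2 where "M2 = distr (density ?S (great_integral (\<lambda>x. ennreal (G x)))) borel (\<lambda>x. x)"
  have M1: "(\<integral>\<^sup>+y. F y \<partial>M1) = (\<integral>\<^sup>+\<xi>. ennreal (G \<xi>) * great_integral F \<xi> \<partial>?S)"
    if [measurable]: "F \<in> borel_measurable borel" for F :: "'a \<Rightarrow> ennreal"
  proof -
    have "(\<integral>\<^sup>+y. F y \<partial>M1) = (\<integral>\<^sup>+p. d p * F (case p of (\<xi>, y) \<Rightarrow> sgn (orth_part \<xi> y)) \<partial>(?S \<Otimes>\<^sub>M lborel))"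
      unfolding M1_def by (subst nn_integral_distr) (simp_all add: nn_integral_density)
    also have "\<dots> = (\<integral>\<^sup>+\<xi>. \<integral>\<^sup>+y. d (\<xi>, y) * F (sgn (orth_part \<xi> y)) \<partial>lborel \<partial>?S)"
      by (subst lborel.nn_integral_fst[symmetric]) simp_all
    also have "\<dots> = (\<integral>\<^sup>+\<xi>. ennreal (G \<xi>) * great_integral F \<xi> \<partial>?S)"
    proof (rule nn_integral_cong)
      fix \<xi>
      have "(\<integral>\<^sup>+y. d (\<xi>, y) * F (sgn (orth_part \<xi> y)) \<partial>lborel) =
        (\<integral>\<^sup>+y. (ennreal (G \<xi>) * ennreal (real (DIM('a) - 1))) * (indicator {0..1} (y \<bullet> \<xi>) *
         (indicator {0<..1} (norm (orth_part \<xi> y)) * F (sgn (orth_part \<xi> y)))) \<partial>lborel)"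
        unfolding d_def by (simp add: mult_ac)
      also have "\<dots> = (ennreal (G \<xi>) * ennreal (real (DIM('a) - 1))) * (\<integral>\<^sup>+y. (indicator {0..1} (y \<bullet> \<xi>) *
         (indicator {0<..1} (norm (orth_part \<xi> y)) * F (sgn (orth_part \<xi> y)))) \<partial>lborel)"
        by (rule nn_integral_cmult) measurable
      finally show "(\<integral>\<^sup>+y. d (\<xi>, y) * F (sgn (orth_part \<xi> y)) \<partial>lborel) = ennreal (G \<xi>) * great_integral F \<xi>"
        unfolding great_integral_def by (simp only: mult.assoc)
    qed
    finally show ?thesis .
  qed
  have GI[measurable]: "great_integral (\<lambda>x. ennreal (G x)) \<in> borel_measurable ?S"
    by (rule borel_measurable_sphere) measurable
  have [measurable]: "(\<lambda>x. x) \<in> borel_measurable ?S"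
    by (rule borel_measurable_sphere) simp
  have M2: "(\<integral>\<^sup>+y. F y \<partial>M2) = (\<integral>\<^sup>+\<xi>. F \<xi> * great_integral (\<lambda>x. ennreal (G x)) \<xi> \<partial>?S)"
    if [measurable]: "F \<in> borel_measurable borel" for F :: "'a \<Rightarrow> ennreal"
    unfolding M2_def using borel_measurable_sphere[OF that]
    by (subst nn_integral_distr) (simp_all add: nn_integral_density mult.commute)
  have "M1 = M2"
  proof (rule measure_eqI_continuous)
    show "sets M1 = sets borel" "sets M2 = sets borel" by (simp_all add: M1_def M2_def)
    show eq: "(\<integral>\<^sup>+y. ennreal (\<phi> y) \<partial>M1) = (\<integral>\<^sup>+y. ennreal (\<phi> y) \<partial>M2)"
      if "continuous_on UNIV \<phi>" "\<And>y. 0 \<le> \<phi> y \<and> \<phi> y \<le> 1" for \<phi> :: "'a \<Rightarrow> real"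
      using great_integral_duality_continuous[OF that G n] borel_measurable_continuous_onI[OF that(1)]
      by (simp add: M1 M2)
    have "emeasure M1 UNIV = (\<integral>\<^sup>+y. 1 \<partial>M1)" by (simp add: M1_def)
    also have "\<dots> = (\<integral>\<^sup>+\<xi>. ennreal (G \<xi>) * great_integral (\<lambda>_. 1) \<xi> \<partial>?S)" by (rule M1) simp
    also have "\<dots> \<le> (\<integral>\<^sup>+\<xi>. ennreal D * ennreal (2 * pi powr ((real DIM('a) - 1) / 2) / Gamma ((real DIM('a) - 1) / 2)) \<partial>?S)"
      using G n by (intro nn_integral_mono mult_mono ennreal_leI) (auto simp: great_integral_1)
    also have "\<dots> < \<infinity>"
      using emeasure_sphere_measure_finite[where 'a = 'a] by (simp add: ennreal_mult_less_top)
    finally show fin: "emeasure M1 UNIV \<noteq> \<infinity>" by simp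
    have "emeasure M2 UNIV = (\<integral>\<^sup>+y. ennreal 1 \<partial>M2)" by (simp add: M2_def)
    also have "\<dots> = (\<integral>\<^sup>+y. ennreal 1 \<partial>M1)" by (rule eq[symmetric]) auto
    also have "\<dots> = emeasure M1 UNIV" by (simp add: M1_def)
    finally show "emeasure M2 UNIV \<noteq> \<infinity>" using fin by simp
  qed
  then show ?thesis using M1[of F] M2[of F] by simp
qed

section \<open>Radon transform of powers of a linear form\<close>

lemma inner_orth_part_orth_part:
  assumes "norm \<xi> = 1"
  shows "x \<bullet> orth_part \<xi> y = orth_part \<xi> x \<bullet> y" "orth_part \<xi> x \<bullet> orth_part \<xi> y = orth_part \<xi> x \<bullet> y"
proof -
  have "\<xi> \<bullet> \<xi> = 1" using assms by (simp add: norm_eq_1)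
  then show "x \<bullet> orth_part \<xi> y = orth_part \<xi> x \<bullet> y" "orth_part \<xi> x \<bullet> orth_part \<xi> y = orth_part \<xi> x \<bullet> y"
    by (simp_all add: orth_part_def inner_diff_left inner_diff_right inner_commute algebra_simps)
qed

text \<open>A Gaussian factor along \<theta> turns the hyperplane integral into one over the whole
  space, which no longer refers to \<theta> except through the linear form d * (y \<bullet> \<eta>),
  where \<eta> is the normalised projection of x. Splitting again, now along \<eta>, leaves a
  one-dimensional absolute moment. If the projection vanishes, both sides are 0 because q >
  0.\<close>

lemma nn_integral_hyperplane_power:
  fixes x \<theta> :: "'a::euclidean_space"
  assumes \<theta>: "norm \<theta> = 1" and q: "q > 0"
  shows "(\<integral>\<^sup>+y. indicator {0..1} (y \<bullet> \<theta>) * ennreal (exp (- (norm (orth_part \<theta> y))\<^sup>2) * \<bar>x \<bullet> orth_part \<theta> y\<bar> ^ q) \<partial>lborel) =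
    ennreal (pi powr ((real DIM('a) - 2) / 2) * Gamma ((real q + 1) / 2) * norm (orth_part \<theta> x) ^ q)" (is "?I = _")
proof (cases "orth_part \<theta> x = 0")
  case True
  then show ?thesis using q by (simp add: inner_orth_part_orth_part[OF \<theta>] power_0_left)
next
  case False
  define d where "d = norm (orth_part \<theta> x)"
  define \<eta> where "\<eta> = orth_part \<theta> x /\<^sub>R d"
  have d: "d > 0" using False by (simp add: d_def)
  have \<eta>: "norm \<eta> = 1" using d by (simp add: \<eta>_def d_def)
  have x\<eta>: "orth_part \<theta> x = d *\<^sub>R \<eta>" using d by (simp add: \<eta>_def)
  let ?G = "Gamma ((real q + 1) / 2)" and ?p = "pi powr ((real DIM('a) - 1) / 2)"
  have G: "?G > 0" by (intro Gamma_real_pos) simp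
  have "ennreal (sqrt pi) * ?I = (\<integral>\<^sup>+t. ennreal (exp (- t\<^sup>2)) \<partial>lborel) * ?I"
    using nn_integral_gaussian_abs_moment[of 0] by (simp add: Gamma_one_half_real)
  also have "\<dots> = (\<integral>\<^sup>+y. ennreal (exp (- (y \<bullet> \<theta>)\<^sup>2)) * ennreal (exp (- (norm (orth_part \<theta> y))\<^sup>2) * \<bar>x \<bullet> orth_part \<theta> y\<bar> ^ q) \<partial>lborel)"
    by (rule nn_integral_line_times_hyperplane[OF _ _ \<theta>, symmetric]) measurable
  also have "\<dots> = (\<integral>\<^sup>+y. ennreal (d ^ q * (exp (- (y \<bullet> \<eta>)\<^sup>2) * \<bar>y \<bullet> \<eta>\<bar> ^ q)) * ennreal (exp (- (norm (orth_part \<eta> y))\<^sup>2)) \<partial>lborel)"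
  proof (rule nn_integral_cong)
    fix y
    have "x \<bullet> orth_part \<theta> y = d * (y \<bullet> \<eta>)"
      unfolding inner_orth_part_orth_part[OF \<theta>] x\<eta> by (simp add: inner_commute)
    then have "exp (- (y \<bullet> \<theta>)\<^sup>2) * (exp (- (norm (orth_part \<theta> y))\<^sup>2) * \<bar>x \<bullet> orth_part \<theta> y\<bar> ^ q) =
      exp (- (norm y)\<^sup>2) * (d ^ q * \<bar>y \<bullet> \<eta>\<bar> ^ q)"
      unfolding norm_orth_part[OF \<theta>, of y] using d by (simp add: exp_add[symmetric] abs_mult power_mult_distrib mult.assoc[symmetric])
    also have "\<dots> = d ^ q * (exp (- (y \<bullet> \<eta>)\<^sup>2) * \<bar>y \<bullet> \<eta>\<bar> ^ q) * exp (- (norm (orth_part \<eta> y))\<^sup>2)"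
      unfolding norm_orth_part[OF \<eta>, of y] by (simp add: exp_diff exp_minus field_simps)
    finally show "ennreal (exp (- (y \<bullet> \<theta>)\<^sup>2)) * ennreal (exp (- (norm (orth_part \<theta> y))\<^sup>2) * \<bar>x \<bullet> orth_part \<theta> y\<bar> ^ q) =
      ennreal (d ^ q * (exp (- (y \<bullet> \<eta>)\<^sup>2) * \<bar>y \<bullet> \<eta>\<bar> ^ q)) * ennreal (exp (- (norm (orth_part \<eta> y))\<^sup>2))"
      using d by (simp add: ennreal_mult[symmetric])
  qed
  also have "\<dots> = (\<integral>\<^sup>+t. ennreal (d ^ q * (exp (- t\<^sup>2) * \<bar>t\<bar> ^ q)) \<partial>lborel) * ennreal ?p"
    unfolding nn_integral_gaussian_hyperplane[OF \<eta>, symmetric]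
    by (rule nn_integral_line_times_hyperplane[OF _ _ \<eta>]) measurable
  also have "(\<integral>\<^sup>+t. ennreal (d ^ q * (exp (- t\<^sup>2) * \<bar>t\<bar> ^ q)) \<partial>lborel) = ennreal (d ^ q) * ennreal ?G"
    unfolding nn_integral_gaussian_abs_moment[symmetric] using d
    by (subst nn_integral_cmult[symmetric]) (simp_all add: ennreal_mult)
  also have "ennreal (d ^ q) * ennreal ?G * ennreal ?p = ennreal (d ^ q * ?G * ?p)"
    using d G by (simp add: ennreal_mult)
  finally have *: "ennreal (sqrt pi) * ?I = ennreal (d ^ q * ?G * ?p)" .
  have "?I = (ennreal (1 / sqrt pi) * ennreal (sqrt pi)) * ?I"
    by (subst ennreal_mult[symmetric]) auto
  also have "\<dots> = ennreal (1 / sqrt pi * (d ^ q * ?G * ?p))"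
    unfolding mult.assoc *
    using d G by (subst ennreal_mult) auto
  also have "1 / sqrt pi * (d ^ q * ?G * ?p) = (1 / sqrt pi * ?p) * ?G * d ^ q" by simp
  also have "1 / sqrt pi * ?p = pi powr ((real DIM('a) - 2) / 2)"
    by (simp add: powr_half_sqrt[symmetric] powr_diff[symmetric] diff_divide_distrib)
  finally show ?thesis by (simp add: d_def)
qed

text \<open>The form has degree q, so the radial factor of the Gaussian integral over the hyperplane
  is the moment of order n - 2 + q. Its value \<open>Gamma ((n + q - 1) / 2) / 2\<close> is what
  appears in the denominator.\<close>

lemma great_integral_inner_power:
  fixes x \<theta> :: "'a::euclidean_space"
  assumes \<theta>: "norm \<theta> = 1" and q: "q > 0" and n: "DIM('a) \<ge> 2"
  shows "great_integral (\<lambda>\<xi>. ennreal (\<bar>x \<bullet> \<xi>\<bar> ^ q)) \<theta> =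
    ennreal (2 * pi powr ((real DIM('a) - 2) / 2) * Gamma ((real q + 1) / 2) / Gamma ((real DIM('a) + real q - 1) / 2)
      * norm (orth_part \<theta> x) ^ q)"
proof -
  let ?G = "Gamma ((real DIM('a) + real q - 1) / 2)" and ?g = "Gamma ((real q + 1) / 2)"
  have G: "?G > 0" "?g > 0" using n by (auto intro!: Gamma_real_pos)
  let ?V = "pi powr ((real DIM('a) - 2) / 2) * ?g * norm (orth_part \<theta> x) ^ q"
  have "ennreal ?V = (\<integral>\<^sup>+y. indicator {0..1} (y \<bullet> \<theta>) * ennreal (exp (- (norm (orth_part \<theta> y))\<^sup>2) * \<bar>x \<bullet> orth_part \<theta> y\<bar> ^ q) \<partial>lborel)"
    by (rule nn_integral_hyperplane_power[OF \<theta> q, symmetric])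
  also have "\<dots> = (\<integral>\<^sup>+y. indicator {0..1} (y \<bullet> \<theta>) * (ennreal (norm (orth_part \<theta> y) ^ q * exp (- (norm (orth_part \<theta> y))\<^sup>2)) *
      ennreal (\<bar>x \<bullet> sgn (orth_part \<theta> y)\<bar> ^ q)) \<partial>lborel)"
  proof (rule nn_integral_cong)
    fix y
    have "x \<bullet> orth_part \<theta> y = norm (orth_part \<theta> y) * (x \<bullet> sgn (orth_part \<theta> y))"
      by (cases "orth_part \<theta> y = 0") (simp_all add: sgn_div_norm)
    then have "exp (- (norm (orth_part \<theta> y))\<^sup>2) * \<bar>x \<bullet> orth_part \<theta> y\<bar> ^ q =
       norm (orth_part \<theta> y) ^ q * exp (- (norm (orth_part \<theta> y))\<^sup>2) * \<bar>x \<bullet> sgn (orth_part \<theta> y)\<bar> ^ q"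
      by (simp only: abs_mult power_mult_distrib abs_norm_cancel mult_ac)
    then show "indicator {0..1} (y \<bullet> \<theta>) * ennreal (exp (- (norm (orth_part \<theta> y))\<^sup>2) * \<bar>x \<bullet> orth_part \<theta> y\<bar> ^ q) =
      indicator {0..1} (y \<bullet> \<theta>) * (ennreal (norm (orth_part \<theta> y) ^ q * exp (- (norm (orth_part \<theta> y))\<^sup>2)) *
      ennreal (\<bar>x \<bullet> sgn (orth_part \<theta> y)\<bar> ^ q))"
      by (simp only:) (simp add: ennreal_mult[symmetric])
  qed
  also have "\<dots> = (\<integral>\<^sup>+r. ennreal (r ^ (DIM('a) - 2)) * indicator {0<..} r * ennreal (r ^ q * exp (- r\<^sup>2)) \<partial>lborel)
     * great_integral (\<lambda>\<xi>. ennreal (\<bar>x \<bullet> \<xi>\<bar> ^ q)) \<theta>"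
    by (rule great_integral_gaussian[OF _ \<theta> n, of "\<lambda>\<xi>. ennreal (\<bar>x \<bullet> \<xi>\<bar> ^ q)" "\<lambda>r. ennreal (r ^ q * exp (- r\<^sup>2))"]) measurable
  also have "(\<integral>\<^sup>+r. ennreal (r ^ (DIM('a) - 2)) * indicator {0<..} r * ennreal (r ^ q * exp (- r\<^sup>2)) \<partial>lborel) =
     (\<integral>\<^sup>+r. ennreal (r ^ (DIM('a) - 2 + q)) * indicator {0<..} r * ennreal (exp (- r\<^sup>2)) \<partial>lborel)"
    by (intro nn_integral_cong) (auto simp: indicator_def ennreal_mult[symmetric] power_add mult_ac)
  also have "\<dots> = ennreal (?G / 2)"
    using nn_integral_gaussian_half_line_moment[of "DIM('a) - 2 + q"] n by (simp add: of_nat_diff algebra_simps)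
  finally have *: "ennreal ?V = ennreal (?G / 2) * great_integral (\<lambda>\<xi>. ennreal (\<bar>x \<bullet> \<xi>\<bar> ^ q)) \<theta>" .
  have "great_integral (\<lambda>\<xi>. ennreal (\<bar>x \<bullet> \<xi>\<bar> ^ q)) \<theta> = (ennreal (2 / ?G) * ennreal (?G / 2)) * great_integral (\<lambda>\<xi>. ennreal (\<bar>x \<bullet> \<xi>\<bar> ^ q)) \<theta>"
    using G by (subst ennreal_mult[symmetric]) auto
  also have "\<dots> = ennreal (2 / ?G * ?V)"
    unfolding mult.assoc *[symmetric] using G by (subst ennreal_mult) auto
  finally show ?thesis by (simp add: mult_ac)
qed

section \<open>Signed integrands and the Radon transform almost everywhere\<close>

lemma great_subsphere_integrable_iff:
  fixes f :: "'a::euclidean_space \<Rightarrow> real"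
  assumes [measurable]: "f \<in> borel_measurable borel" and \<xi>: "norm \<xi> = 1"
  shows "integrable (great_subsphere_measure \<xi>) f \<longleftrightarrow> great_integral (\<lambda>x. ennreal \<bar>f x\<bar>) \<xi> < \<infinity>"
proof -
  have "(\<integral>\<^sup>+x. ennreal (norm (f x)) \<partial>great_subsphere_measure \<xi>) = great_integral (\<lambda>x. ennreal \<bar>f x\<bar>) \<xi>"
    by (subst great_integral_eq[OF _ \<xi>]) auto
  then show ?thesis by (simp add: integrable_iff_bounded borel_measurable_great_subsphere)
qed

lemma great_integral_mono: "(\<And>x. F x \<le> G x) \<Longrightarrow> great_integral F \<xi> \<le> great_integral G \<xi>"
  unfolding great_integral_def by (intro mult_left_mono nn_integral_mono) auto

text \<open>The Bochner integral has the default value 0 when the function is not integrable.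
  Writing this out with \<open>great_integral\<close> shows that the Radon transform is measurable
  in \<xi>.\<close>

lemma great_subsphere_lebesgue_integral:
  fixes f :: "'a::euclidean_space \<Rightarrow> real"
  assumes [measurable]: "f \<in> borel_measurable borel" and \<xi>: "norm \<xi> = 1"
  shows "(LINT \<theta>|great_subsphere_measure \<xi>. f \<theta>) =
    (if great_integral (\<lambda>x. ennreal \<bar>f x\<bar>) \<xi> < \<infinity> then enn2real (great_integral (\<lambda>x. ennreal (f x)) \<xi>)
       - enn2real (great_integral (\<lambda>x. ennreal (- f x)) \<xi>) else 0)"
  using great_subsphere_integrable_iff[OF assms] great_integral_eq[OF _ \<xi>, of "\<lambda>x. ennreal (f x)"]
    great_integral_eq[OF _ \<xi>, of "\<lambda>x. ennreal (- f x)"]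
  by (auto simp: real_lebesgue_integral_def not_integrable_integral_eq)

lemma spherical_radon_measurable:
  fixes f :: "'a::euclidean_space \<Rightarrow> real"
  assumes [measurable]: "f \<in> borel_measurable borel"
  shows "(\<lambda>\<xi>. LINT \<theta>|great_subsphere_measure \<xi>. f \<theta>) \<in> borel_measurable sphere_measure"
proof -
  have "(\<lambda>\<xi>. if great_integral (\<lambda>x. ennreal \<bar>f x\<bar>) \<xi> < \<infinity> then enn2real (great_integral (\<lambda>x. ennreal (f x)) \<xi>)
       - enn2real (great_integral (\<lambda>x. ennreal (- f x)) \<xi>) else 0) \<in> borel_measurable sphere_measure"
    by (rule borel_measurable_sphere) measurable
  then show ?thesis
    by (rule measurable_cong[THEN iffD1, rotated]) (simp add: great_subsphere_lebesgue_integral)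
qed

text \<open>Duality is applied to the positive and negative parts of f. The transform of g is passed
  as a real function \<gamma> with global bounds, so that f * \<gamma> is integrable without further
  work.\<close>

lemma spherical_radon_duality:
  fixes f g \<gamma> :: "'a::euclidean_space \<Rightarrow> real"
  assumes f[measurable]: "f \<in> borel_measurable borel" and fi: "integrable sphere_measure f"
    and g: "continuous_on UNIV g" "\<And>x. 0 \<le> g x \<and> g x \<le> D" and n: "DIM('a) \<ge> 2"
    and \<gamma>[measurable]: "\<gamma> \<in> borel_measurable borel" and \<gamma>g: "\<And>\<theta>. norm \<theta> = 1 \<Longrightarrow> great_integral (\<lambda>x. ennreal (g x)) \<theta> = ennreal (\<gamma> \<theta>)"
    and \<gamma>0: "\<And>\<theta>. 0 \<le> \<gamma> \<theta> \<and> \<gamma> \<theta> \<le> E"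
  shows "integrable sphere_measure (\<lambda>\<xi>. g \<xi> * (LINT \<theta>|great_subsphere_measure \<xi>. f \<theta>))"
    and "(LINT \<xi>|sphere_measure. g \<xi> * (LINT \<theta>|great_subsphere_measure \<xi>. f \<theta>)) = (LINT \<theta>|sphere_measure. f \<theta> * \<gamma> \<theta>)"
proof -
  let ?S = "sphere_measure :: 'a measure"
  have [measurable]: "g \<in> borel_measurable borel" using g by (auto intro: borel_measurable_continuous_onI)
  define P where "P = great_integral (\<lambda>x. ennreal (f x))"
  define N where "N = great_integral (\<lambda>x. ennreal (- f x))"
  have [measurable]: "P \<in> borel_measurable borel" "N \<in> borel_measurable borel" unfolding P_def N_def by measurable
  have gm: "g \<in> borel_measurable ?S" by (rule borel_measurable_sphere) measurable
  have dual: "(\<integral>\<^sup>+\<xi>. ennreal (g \<xi>) * great_integral (\<lambda>x. ennreal (h x)) \<xi> \<partial>?S) = (\<integral>\<^sup>+\<theta>. ennreal (h \<theta>) * ennreal (\<gamma> \<theta>) \<partial>?S)"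
    if [measurable]: "h \<in> borel_measurable borel" for h :: "'a \<Rightarrow> real"
    by (subst great_integral_duality[OF _ g n]) (auto intro!: nn_integral_cong simp: \<gamma>g)
  have absfin: "(\<integral>\<^sup>+\<theta>. ennreal \<bar>f \<theta>\<bar> \<partial>?S) < \<infinity>" using fi by (simp add: integrable_iff_bounded)
  \<comment> \<open>Duality with the constant 1 shows that the transform of \<bar>f\<bar> has a
    finite integral, so f is integrable over almost every great subsphere.\<close>
  have fin1: "AE \<xi> in ?S. great_integral (\<lambda>x. ennreal \<bar>f x\<bar>) \<xi> < \<infinity>"
  proof -
    have "(\<integral>\<^sup>+\<xi>. great_integral (\<lambda>x. ennreal \<bar>f x\<bar>) \<xi> \<partial>?S) = (\<integral>\<^sup>+\<xi>. ennreal 1 * great_integral (\<lambda>x. ennreal \<bar>f x\<bar>) \<xi> \<partial>?S)"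
      by simp
    also have "\<dots> = (\<integral>\<^sup>+\<xi>. ennreal \<bar>f \<xi>\<bar> * great_integral (\<lambda>x. ennreal 1) \<xi> \<partial>?S)"
      by (rule great_integral_duality[OF _ _ _ n]) auto
    also have "\<dots> = (\<integral>\<^sup>+\<xi>. ennreal \<bar>f \<xi>\<bar> * ennreal (2 * pi powr ((real DIM('a) - 1) / 2) / Gamma ((real DIM('a) - 1) / 2)) \<partial>?S)"
      using great_integral_1[OF _ n] by (intro nn_integral_cong) simp
    also have "\<dots> = (\<integral>\<^sup>+\<xi>. ennreal \<bar>f \<xi>\<bar> \<partial>?S) * ennreal (2 * pi powr ((real DIM('a) - 1) / 2) / Gamma ((real DIM('a) - 1) / 2))"
      by (rule nn_integral_multc) (rule borel_measurable_sphere, measurable)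
    also have "\<dots> < \<infinity>" using absfin by (simp add: ennreal_mult_less_top)
    finally have "(\<integral>\<^sup>+\<xi>. great_integral (\<lambda>x. ennreal \<bar>f x\<bar>) \<xi> \<partial>?S) \<noteq> \<infinity>" by simp
    then have "AE \<xi> in ?S. great_integral (\<lambda>x. ennreal \<bar>f x\<bar>) \<xi> \<noteq> \<infinity>"
      by (rule nn_integral_PInf_AE[rotated]) (rule borel_measurable_sphere, measurable)
    then show ?thesis by eventually_elim (simp add: less_top)
  qed
  have rad: "AE \<xi> in ?S. P \<xi> < \<infinity> \<and> N \<xi> < \<infinity> \<and> (LINT \<theta>|great_subsphere_measure \<xi>. f \<theta>) = enn2real (P \<xi>) - enn2real (N \<xi>)"
    using fin1 AE_space
  proof eventually_elim
    case (elim \<xi>)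
    have "P \<xi> \<le> great_integral (\<lambda>x. ennreal \<bar>f x\<bar>) \<xi>" "N \<xi> \<le> great_integral (\<lambda>x. ennreal \<bar>f x\<bar>) \<xi>"
      unfolding P_def N_def by (intro great_integral_mono ennreal_leI; simp)+
    then have "P \<xi> < \<infinity>" "N \<xi> < \<infinity>" using elim(1) by (auto intro: le_less_trans)
    moreover have "norm \<xi> = 1" using elim(2) by simp
    ultimately show ?case using great_subsphere_lebesgue_integral[OF f \<open>norm \<xi> = 1\<close>] elim(1)
      by (simp add: P_def N_def)
  qed
  have part: "integrable ?S (\<lambda>\<xi>. g \<xi> * enn2real (Q \<xi>)) \<and>
       (LINT \<xi>|?S. g \<xi> * enn2real (Q \<xi>)) = (LINT \<theta>|?S. max 0 (h \<theta>) * \<gamma> \<theta>) \<and> integrable ?S (\<lambda>\<theta>. max 0 (h \<theta>) * \<gamma> \<theta>)"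
    if Q: "Q = great_integral (\<lambda>x. ennreal (h x))" and h[measurable]: "h \<in> borel_measurable borel" and hf: "\<And>x. \<bar>h x\<bar> \<le> \<bar>f x\<bar>"
      and fin: "AE \<xi> in ?S. Q \<xi> < \<infinity>" for Q h
  proof -
    have [measurable]: "Q \<in> borel_measurable borel" unfolding Q by measurable
    have "(\<integral>\<^sup>+\<xi>. ennreal (g \<xi> * enn2real (Q \<xi>)) \<partial>?S) = (\<integral>\<^sup>+\<xi>. ennreal (g \<xi>) * Q \<xi> \<partial>?S)"
      using fin by (intro nn_integral_cong_AE, eventually_elim) (use g in \<open>simp add: ennreal_mult less_top\<close>)
    also have "\<dots> = (\<integral>\<^sup>+\<theta>. ennreal (h \<theta>) * ennreal (\<gamma> \<theta>) \<partial>?S)" unfolding Q by (rule dual[OF h])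
    also have "\<dots> = (\<integral>\<^sup>+\<theta>. ennreal (max 0 (h \<theta>) * \<gamma> \<theta>) \<partial>?S)"
    proof (intro nn_integral_cong)
      fix \<theta>
      \<comment> \<open>\<open>ennreal\<close> sends negative numbers to 0, so the transform of h
        already sees only its positive part.\<close>
      have "ennreal (h \<theta>) = ennreal (max 0 (h \<theta>))" by (cases "h \<theta> \<ge> 0") (auto simp: ennreal_neg max_def)
      then show "ennreal (h \<theta>) * ennreal (\<gamma> \<theta>) = ennreal (max 0 (h \<theta>) * \<gamma> \<theta>)"
        using \<gamma>0 by (simp add: ennreal_mult)
    qed
    finally have eq: "(\<integral>\<^sup>+\<xi>. ennreal (g \<xi> * enn2real (Q \<xi>)) \<partial>?S) = (\<integral>\<^sup>+\<theta>. ennreal (max 0 (h \<theta>) * \<gamma> \<theta>) \<partial>?S)" .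
    have m1: "(\<lambda>\<theta>. max 0 (h \<theta>) * \<gamma> \<theta>) \<in> borel_measurable ?S"
      by (rule borel_measurable_sphere) measurable
    have m2: "(\<lambda>\<xi>. g \<xi> * enn2real (Q \<xi>)) \<in> borel_measurable ?S"
      by (rule borel_measurable_sphere) measurable
    have int1: "integrable ?S (\<lambda>\<theta>. max 0 (h \<theta>) * \<gamma> \<theta>)"
    proof (rule Bochner_Integration.integrable_bound[OF integrable_mult_left[OF fi, of E]])
      show "AE \<theta> in ?S. norm (max 0 (h \<theta>) * \<gamma> \<theta>) \<le> norm (f \<theta> * E)"
      proof (rule AE_I2)
        fix \<theta>
        have "\<bar>max 0 (h \<theta>)\<bar> * \<bar>\<gamma> \<theta>\<bar> \<le> \<bar>f \<theta>\<bar> * \<bar>E\<bar>"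
          using hf[of \<theta>] \<gamma>0[of \<theta>] by (intro mult_mono) auto
        then show "norm (max 0 (h \<theta>) * \<gamma> \<theta>) \<le> norm (f \<theta> * E)" by (simp add: abs_mult)
      qed
    qed (rule m1)
    have int2: "integrable ?S (\<lambda>\<xi>. g \<xi> * enn2real (Q \<xi>))"
    proof (rule integrableI_nonneg[OF m2])
      show "AE \<xi> in ?S. 0 \<le> g \<xi> * enn2real (Q \<xi>)" using g by (intro AE_I2) auto
      show "(\<integral>\<^sup>+\<xi>. ennreal (g \<xi> * enn2real (Q \<xi>)) \<partial>?S) < \<infinity>"
        unfolding eq using int1 \<gamma>0 by (simp add: integrable_iff_bounded abs_mult)
    qed
    have "(LINT \<xi>|?S. g \<xi> * enn2real (Q \<xi>)) = (LINT \<theta>|?S. max 0 (h \<theta>) * \<gamma> \<theta>)"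
      using g \<gamma>0 m1 m2 eq by (simp add: integral_eq_nn_integral)
    then show ?thesis using int1 int2 by simp
  qed
  have p: "AE \<xi> in ?S. P \<xi> < \<infinity>" "AE \<xi> in ?S. N \<xi> < \<infinity>" using rad by (auto elim: AE_mp)
  note P = part[OF P_def f order_refl p(1)]
  have fm: "(\<lambda>x. - f x) \<in> borel_measurable borel" by measurable
  note N = part[OF N_def fm _ p(2), simplified]
  have radm: "(\<lambda>\<xi>. g \<xi> * (LINT \<theta>|great_subsphere_measure \<xi>. f \<theta>)) \<in> borel_measurable ?S"
    using gm spherical_radon_measurable[OF f] by measurable
  have ae: "AE \<xi> in ?S. g \<xi> * enn2real (P \<xi>) - g \<xi> * enn2real (N \<xi>) = g \<xi> * (LINT \<theta>|great_subsphere_measure \<xi>. f \<theta>)"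
    using rad by eventually_elim (simp add: right_diff_distrib)
  have int: "integrable ?S (\<lambda>\<xi>. g \<xi> * enn2real (P \<xi>) - g \<xi> * enn2real (N \<xi>))"
    using P N by auto
  then show "integrable ?S (\<lambda>\<xi>. g \<xi> * (LINT \<theta>|great_subsphere_measure \<xi>. f \<theta>))"
    by (rule integrable_cong_AE_imp[OF _ radm ae])
  have "(LINT \<xi>|?S. g \<xi> * (LINT \<theta>|great_subsphere_measure \<xi>. f \<theta>)) = (LINT \<xi>|?S. g \<xi> * enn2real (P \<xi>) - g \<xi> * enn2real (N \<xi>))"
    using ae by (intro integral_cong_AE radm borel_measurable_integrable[OF int]) auto
  also have "\<dots> = (LINT \<theta>|?S. max 0 (f \<theta>) * \<gamma> \<theta>) - (LINT \<theta>|?S. max 0 (- f \<theta>) * \<gamma> \<theta>)"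
    using P N by (subst Bochner_Integration.integral_diff) auto
  also have "\<dots> = (LINT \<theta>|?S. max 0 (f \<theta>) * \<gamma> \<theta> - max 0 (- f \<theta>) * \<gamma> \<theta>)"
    using P N by (subst Bochner_Integration.integral_diff) auto
  also have "\<dots> = (LINT \<theta>|?S. f \<theta> * \<gamma> \<theta>)"
    by (intro Bochner_Integration.integral_cong refl) (auto simp: max_def)
  finally show "(LINT \<xi>|?S. g \<xi> * (LINT \<theta>|great_subsphere_measure \<xi>. f \<theta>)) = (LINT \<theta>|?S. f \<theta> * \<gamma> \<theta>)" .
qed

text \<open>Replacing \<xi> by its negative moves the cylinder to the other side of the hyperplane,
  from heights in [0, 1] to heights in [-1, 0]; both intervals have length 1. This is the source of
  evenness of the density.\<close>

lemma great_subsphere_measure_minus: 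
  fixes \<xi> :: "'a::euclidean_space"
  assumes \<xi>: "norm \<xi> = 1"
  shows "great_subsphere_measure (- \<xi>) = great_subsphere_measure \<xi>"
proof (rule measure_eqI)
  have gs: "great_subsphere (- \<xi>) = great_subsphere \<xi>" by (simp add: great_subsphere_def)
  show sets: "sets (great_subsphere_measure (- \<xi>)) = sets (great_subsphere_measure \<xi>)"
    by (simp add: sets_great_subsphere_measure gs)
  fix A assume A: "A \<in> sets (great_subsphere_measure (- \<xi>))"
  have "closed (great_subsphere \<xi>)"
    unfolding great_subsphere_def sphere_def Collect_conj_eq[symmetric] mem_Collect_eq
    by (intro closed_Collect_conj closed_Collect_eq continuous_intros)
  then have A': "A \<in> sets borel"
    using A by (auto simp: gs sets_great_subsphere_measure sets_restrict_space intro!: sets.Int)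
  have [measurable]: "(indicator A :: 'a \<Rightarrow> ennreal) \<in> borel_measurable borel" using A' by simp
  have op: "orth_part (- \<xi>) y = orth_part \<xi> y" for y by (simp add: orth_part_def)
  let ?G = "\<lambda>z::'a. indicator {0<..1} (norm z) * indicator A (sgn z) :: ennreal"
  have 1: "(\<integral>\<^sup>+y. indicator {-1..0} (y \<bullet> \<xi>) * ?G (orth_part \<xi> y) \<partial>lborel) =
     (\<integral>\<^sup>+t. indicator {-1..0::real} t \<partial>lborel) * (\<integral>\<^sup>+y. indicator {0..1} (y \<bullet> \<xi>) * ?G (orth_part \<xi> y) \<partial>lborel)"
    by (rule nn_integral_line_times_hyperplane[OF _ _ \<xi>, of ?G]) measurable
  have "great_integral (indicator A) (- \<xi>) = great_integral (indicator A) \<xi>"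
  proof -
    have "indicator {0..1} (y \<bullet> - \<xi>) = (indicator {-1..0} (y \<bullet> \<xi>) :: ennreal)" for y
      by (auto simp: indicator_def)
    then show ?thesis using 1 unfolding great_integral_def op by simp
  qed
  then have "(\<integral>\<^sup>+\<theta>. indicator A \<theta> \<partial>great_subsphere_measure (- \<xi>)) = (\<integral>\<^sup>+\<theta>. indicator A \<theta> \<partial>great_subsphere_measure \<xi>)"
    using \<xi> by (simp add: great_integral_eq)
  then show "emeasure (great_subsphere_measure (- \<xi>)) A = emeasure (great_subsphere_measure \<xi>) A"
    using A sets by simp
qed

section \<open>Kummer's function at half-integers\<close>

definition half_integer :: "real \<Rightarrow> bool" where
  "half_integer \<alpha> \<longleftrightarrow> (\<exists>i::int. \<alpha> = of_int i + 1 / 2)"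

lemma half_integer_add: "half_integer \<alpha> \<Longrightarrow> half_integer (\<alpha> + real j)"
  unfolding half_integer_def by (metis add.assoc add.commute of_int_add of_int_of_nat_eq)

lemma half_integer_abs: "half_integer \<alpha> \<Longrightarrow> \<bar>\<alpha>\<bar> \<ge> 1 / 2"
proof -
  assume "half_integer \<alpha>"
  then obtain i :: int where i: "\<alpha> = of_int i + 1 / 2" by (auto simp: half_integer_def)
  show ?thesis by (cases "i \<ge> 0") (simp_all add: i abs_if)
qed

lemma half_integer_not_nonpos_Int: "half_integer \<alpha> \<Longrightarrow> \<alpha> \<notin> \<int>\<^sub>\<le>\<^sub>0"
proof
  assume "half_integer \<alpha>" "\<alpha> \<in> \<int>\<^sub>\<le>\<^sub>0"
  then obtain i j :: int where "\<alpha> = of_int i + 1 / 2" "\<alpha> = of_int j"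
    unfolding half_integer_def by (metis nonpos_Ints_cases)
  then have "of_int (2 * i + 1) = (of_int (2 * j) :: real)" by simp
  then have "2 * i + 1 = 2 * j" by linarith
  then show False by presburger
qed

text \<open>Each factor \<alpha> + i is again a half-integer and so has distance at least 1 / 2 from
  0.\<close>

lemma pochhammer_half_integer_bound:
  assumes "half_integer \<alpha>"
  shows "\<bar>1 / pochhammer \<alpha> m\<bar> \<le> 2 ^ m" "pochhammer \<alpha> m \<noteq> 0"
proof -
  have "(\<Prod>i<m. (1 / 2 :: real)) \<le> (\<Prod>i<m. \<bar>\<alpha> + real i\<bar>)"
    by (intro prod_mono) (use half_integer_abs[OF half_integer_add[OF assms]] in auto)
  also have "\<dots> = \<bar>pochhammer \<alpha> m\<bar>"
    by (simp add: pochhammer_prod abs_prod atLeast0LessThan)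
  finally have le: "(1 / 2) ^ m \<le> \<bar>pochhammer \<alpha> m\<bar>" by simp
  moreover have "(0::real) < (1 / 2) ^ m" by simp
  ultimately show "pochhammer \<alpha> m \<noteq> 0" by linarith
  have "1 / \<bar>pochhammer \<alpha> m\<bar> \<le> 1 / (1 / 2) ^ m"
    by (intro divide_left_mono le) (use \<open>pochhammer \<alpha> m \<noteq> 0\<close> in auto)
  then show "\<bar>1 / pochhammer \<alpha> m\<bar> \<le> 2 ^ m" by (simp add: power_one_over)
qed

text \<open>Up to the factor \<open>1 / pochhammer \<alpha> m\<close> this is Kummer's function
  \<open>M(\<alpha>, \<alpha> + m, - z)\<close>.\<close>

definition kummer_series :: "real \<Rightarrow> nat \<Rightarrow> real \<Rightarrow> real" where
  "kummer_series \<alpha> m z = (\<Sum>j. (- z) ^ j / (fact j * pochhammer (\<alpha> + real j) m))"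

lemma kummer_term_bound:
  assumes "half_integer \<alpha>"
  shows "\<bar>(- z) ^ j / (fact j * pochhammer (\<alpha> + real j) m)\<bar> \<le> 2 ^ m * (\<bar>z\<bar> ^ j / fact j)"
proof -
  have "\<bar>(- z) ^ j / (fact j * pochhammer (\<alpha> + real j) m)\<bar> = (\<bar>z\<bar> ^ j / fact j) * \<bar>1 / pochhammer (\<alpha> + real j) m\<bar>"
    by (simp add: abs_mult power_abs)
  also have "\<dots> \<le> (\<bar>z\<bar> ^ j / fact j) * 2 ^ m"
    using pochhammer_half_integer_bound[OF half_integer_add[OF assms]] by (intro mult_left_mono) auto
  finally show ?thesis by (simp add: mult.commute)
qed

lemma summable_exp_real: "summable (\<lambda>j. \<bar>z::real\<bar> ^ j / fact j)"
  using summable_exp[of "\<bar>z\<bar>"] by (simp add: field_simps)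

lemma kummer_summable:
  assumes "half_integer \<alpha>"
  shows "summable (\<lambda>j. (- z) ^ j / (fact j * pochhammer (\<alpha> + real j) m))"
proof (rule summable_comparison_test')
  show "summable (\<lambda>j. 2 ^ m * (\<bar>z\<bar> ^ j / fact j))" by (rule summable_mult[OF summable_exp_real])
  show "norm ((- z) ^ j / (fact j * pochhammer (\<alpha> + real j) m)) \<le> 2 ^ m * (\<bar>z\<bar> ^ j / fact j)" for j
    using kummer_term_bound[OF assms] by (simp only: real_norm_def)
qed

lemma kummer_series_derivative:
  assumes "half_integer \<alpha>"
  shows "(kummer_series \<alpha> m has_real_derivative - kummer_series (\<alpha> + 1) m z) (at z)"
proof -
  define c where "c j = (- 1) ^ j / (fact j * pochhammer (\<alpha> + real j) m)" for j
  have c: "c j * y ^ j = (- y) ^ j / (fact j * pochhammer (\<alpha> + real j) m)" for y j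
    by (simp add: c_def power_minus[of y])
  have "((\<lambda>z. \<Sum>j. c j * z ^ j) has_real_derivative (\<Sum>j. diffs c j * z ^ j)) (at z)"
    by (rule termdiffs_strong_converges_everywhere) (use kummer_summable[OF assms] in \<open>simp add: c\<close>)
  moreover have "diffs c j * z ^ j = - ((- z) ^ j / (fact j * pochhammer (\<alpha> + 1 + real j) m))" for j
  proof -
    have p: "\<alpha> + real (Suc j) = \<alpha> + 1 + real j" by simp
    show ?thesis unfolding diffs_def c_def p by (simp add: power_minus[of z] del: of_nat_Suc)
  qed
  ultimately show ?thesis
    by (simp add: c kummer_series_def[abs_def] suminf_minus kummer_summable half_integer_add[of \<alpha> 1, simplified] assms)
qed

lemma kummer_series_continuous: "half_integer \<alpha> \<Longrightarrow> continuous_on S (kummer_series \<alpha> m)"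
  by (meson DERIV_continuous_on has_field_derivative_at_within kummer_series_derivative)

text \<open>For m = 1 the product of z^\<alpha> and the series is the lower incomplete Gamma
  function when \<alpha> > 0, and this is its recurrence in \<alpha>. It follows termwise from 1 - j
  / (\<alpha> + j) = \<alpha> / (\<alpha> + j) and so holds for negative half-integers too.\<close>

lemma kummer_series_1_recurrence:
  assumes \<alpha>: "half_integer \<alpha>"
  shows "\<alpha> * kummer_series \<alpha> 1 z = exp (- z) + z * kummer_series (\<alpha> + 1) 1 z"
proof -
  have \<alpha>1: "half_integer (\<alpha> + 1)" using half_integer_add[OF \<alpha>, of 1] by simp
  have nz: "\<alpha> + real j \<noteq> 0" for j using half_integer_abs[OF half_integer_add[OF \<alpha>, of j]] by auto
  have "(\<lambda>j. (- z) ^ j / (fact j * (\<alpha> + 1 + real j))) sums kummer_series (\<alpha> + 1) 1 z"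
    unfolding kummer_series_def using summable_sums[OF kummer_summable[OF \<alpha>1, of z 1]] by simp
  from sums_mult[OF this, of "- z"]
  have "(\<lambda>j. (- z) ^ Suc j / fact (Suc j) * (real (Suc j) / (\<alpha> + real (Suc j)))) sums (- z * kummer_series (\<alpha> + 1) 1 z)"
  proof (rule sums_cong[THEN iffD1, rotated])
    fix j
    have "S \<noteq> 0 \<Longrightarrow> a * b / (S * F) * (S / D) = a * (b / (F * D))" for S F D a b :: real by simp
    from this[of "real (Suc j)" "- z" "(- z) ^ j" "fact j" "\<alpha> + real (Suc j)"]
    show "- z * ((- z) ^ j / (fact j * (\<alpha> + 1 + real j))) =
        (- z) ^ Suc j / fact (Suc j) * (real (Suc j) / (\<alpha> + real (Suc j)))"
      unfolding fact_Suc power_Suc by (simp add: add_ac)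
  qed
  then have s1: "(\<lambda>j. (- z) ^ j / fact j * (real j / (\<alpha> + real j))) sums (- z * kummer_series (\<alpha> + 1) 1 z)"
    by (subst (asm) sums_Suc_iff) simp
  have "(\<lambda>j. (- z) ^ j / fact j) sums exp (- z)"
    using exp_converges[of "- z"] by (simp add: field_simps)
  from sums_diff[OF this s1]
  have "(\<lambda>j. (- z) ^ j / fact j - (- z) ^ j / fact j * (real j / (\<alpha> + real j))) sums (exp (- z) + z * kummer_series (\<alpha> + 1) 1 z)"
    by simp
  also have "(\<lambda>j. (- z) ^ j / fact j - (- z) ^ j / fact j * (real j / (\<alpha> + real j))) =
      (\<lambda>j. \<alpha> * ((- z) ^ j / (fact j * pochhammer (\<alpha> + real j) 1)))"
  proof
    fix j
    have "1 - real j / (\<alpha> + real j) = \<alpha> / (\<alpha> + real j)" using nz[of j] by (simp add: field_simps)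
    moreover have "(- z) ^ j / fact j - (- z) ^ j / fact j * (real j / (\<alpha> + real j)) = (- z) ^ j / fact j * (1 - real j / (\<alpha> + real j))"
      by (simp only: right_diff_distrib mult_1_right)
    ultimately show "(- z) ^ j / fact j - (- z) ^ j / fact j * (real j / (\<alpha> + real j)) =
      \<alpha> * ((- z) ^ j / (fact j * pochhammer (\<alpha> + real j) 1))" by simp
  qed
  finally have "(\<lambda>j. \<alpha> * ((- z) ^ j / (fact j * pochhammer (\<alpha> + real j) 1))) sums (exp (- z) + z * kummer_series (\<alpha> + 1) 1 z)" .
  moreover have "(\<lambda>j. \<alpha> * ((- z) ^ j / (fact j * pochhammer (\<alpha> + real j) 1))) sums (\<alpha> * kummer_series \<alpha> 1 z)"
    unfolding kummer_series_def by (intro sums_mult summable_sums kummer_summable \<alpha>)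
  ultimately show ?thesis by (simp add: sums_iff)
qed

text \<open>Partial fractions: 1 / \<open>pochhammer x m\<close> - 1 /
  \<open>pochhammer (x + 1) m\<close> equals m / \<open>pochhammer x (Suc m)\<close>.\<close>

lemma kummer_series_Suc:
  assumes \<alpha>: "half_integer \<alpha>" and m: "m \<ge> 1"
  shows "kummer_series \<alpha> (Suc m) z = (kummer_series \<alpha> m z - kummer_series (\<alpha> + 1) m z) / real m"
proof -
  have \<alpha>1: "half_integer (\<alpha> + 1)" using half_integer_add[OF \<alpha>, of 1] by simp
  have "(\<lambda>j. ((- z) ^ j / (fact j * pochhammer (\<alpha> + real j) m) - (- z) ^ j / (fact j * pochhammer (\<alpha> + 1 + real j) m)) / real m)
     sums ((kummer_series \<alpha> m z - kummer_series (\<alpha> + 1) m z) / real m)"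
    unfolding kummer_series_def by (intro sums_divide sums_diff summable_sums kummer_summable \<alpha> \<alpha>1)
  also have "(\<lambda>j. ((- z) ^ j / (fact j * pochhammer (\<alpha> + real j) m) - (- z) ^ j / (fact j * pochhammer (\<alpha> + 1 + real j) m)) / real m)
     = (\<lambda>j. (- z) ^ j / (fact j * pochhammer (\<alpha> + real j) (Suc m)))"
  proof
    fix j
    define x where "x = \<alpha> + real j"
    have x: "half_integer x" unfolding x_def by (rule half_integer_add[OF \<alpha>])
    have nz: "pochhammer x m \<noteq> 0" "pochhammer (x + 1) m \<noteq> 0" "pochhammer x (Suc m) \<noteq> 0"
      using x half_integer_add[OF x, of 1] by (auto intro!: pochhammer_half_integer_bound)
    have "pochhammer x (Suc m) = x * pochhammer (x + 1) m" "pochhammer x (Suc m) = pochhammer x m * (x + real m)"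
      by (rule pochhammer_rec, rule pochhammer_Suc)
    then have "1 / pochhammer x m = (x + real m) / pochhammer x (Suc m)" "1 / pochhammer (x + 1) m = x / pochhammer x (Suc m)"
      using nz by (metis nonzero_mult_divide_mult_cancel_left mult.right_neutral mult.commute)+
    then have "(1 / pochhammer x m - 1 / pochhammer (x + 1) m) / real m = 1 / pochhammer x (Suc m)"
      using m by (simp add: diff_divide_distrib[symmetric])
    then have "(- z) ^ j / fact j * ((1 / pochhammer x m - 1 / pochhammer (x + 1) m) / real m) = (- z) ^ j / fact j * (1 / pochhammer x (Suc m))"
      by (simp only:)
    then show "((- z) ^ j / (fact j * pochhammer (\<alpha> + real j) m) - (- z) ^ j / (fact j * pochhammer (\<alpha> + 1 + real j) m)) / real m
     = (- z) ^ j / (fact j * pochhammer (\<alpha> + real j) (Suc m))"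
      by (simp add: x_def[symmetric] add_ac right_diff_distrib diff_divide_distrib)
  qed
  finally show ?thesis by (simp add: kummer_series_def sums_iff)
qed

section \<open>Asymptotics at infinity and a global bound\<close>

lemma powr_times_exp_tendsto_0: "((\<lambda>z::real. z powr \<alpha> * exp (- z)) \<longlongrightarrow> 0) at_top"
proof -
  obtain k :: nat where k: "\<alpha> \<le> real k" using real_arch_simple by blast
  have lim: "((\<lambda>z::real. z ^ k / exp z) \<longlongrightarrow> 0) at_top" by (rule tendsto_power_div_exp_0)
  show ?thesis
  proof (rule tendsto_sandwich[OF _ _ tendsto_const lim])
    show "\<forall>\<^sub>F z::real in at_top. z powr \<alpha> * exp (- z) \<le> z ^ k / exp z"
      using eventually_ge_at_top[of 1]
    proof eventually_elim
      case (elim z)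
      have "z powr \<alpha> \<le> z powr real k" using k elim by (rule powr_mono)
      then show ?case using elim by (simp add: powr_realpow exp_minus field_simps)
    qed
  qed auto
qed

text \<open>By the recurrence, z^\<alpha> times the series has derivative z^(\<alpha> - 1) * exp (-
  z), and for \<alpha> > 0 it is continuous with value 0 at the origin. It is therefore the Euler
  integral truncated at z.\<close>

lemma kummer_series_1_asymptotic_pos:
  assumes \<alpha>: "half_integer \<alpha>" and pos: "\<alpha> > 0"
  shows "((\<lambda>z. z powr \<alpha> * kummer_series \<alpha> 1 z) \<longlongrightarrow> Gamma \<alpha>) at_top"
proof -
  define F where "F z = z powr \<alpha> * kummer_series \<alpha> 1 z" for z
  define f where "f t = t powr (\<alpha> - 1) / exp t" for t :: real
  have der: "(F has_real_derivative f z) (at z)" if "z > 0" for z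
  proof -
    have "(F has_real_derivative (\<alpha> * z powr (\<alpha> - 1)) * kummer_series \<alpha> 1 z + (- kummer_series (\<alpha> + 1) 1 z) * z powr \<alpha>) (at z)"
      unfolding F_def[abs_def]
      by (rule DERIV_mult[OF has_real_derivative_powr[OF that] kummer_series_derivative[OF \<alpha>]])
    also have "(\<alpha> * z powr (\<alpha> - 1)) * kummer_series \<alpha> 1 z + (- kummer_series (\<alpha> + 1) 1 z) * z powr \<alpha> =
       z powr (\<alpha> - 1) * (\<alpha> * kummer_series \<alpha> 1 z - z * kummer_series (\<alpha> + 1) 1 z)"
    proof -
      have "z powr \<alpha> = z powr (\<alpha> - 1) * z" using that powr_mult_base[of z "\<alpha> - 1"] by (simp add: mult.commute)
      then show ?thesis by (simp add: algebra_simps)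
    qed
    also have "\<dots> = f z" unfolding kummer_series_1_recurrence[OF \<alpha>] f_def by (simp add: exp_minus field_simps)
    finally show ?thesis .
  qed
  have int: "(f has_integral F z) {0..z}" if "z \<ge> 0" for z
  proof -
    have "continuous_on {0..z} F"
      unfolding F_def using pos by (intro continuous_intros continuous_on_powr' kummer_series_continuous \<alpha>) auto
    then have "(f has_integral (F z - F 0)) {0..z}"
      by (intro fundamental_theorem_of_calculus_interior that)
        (use der in \<open>auto simp: has_real_derivative_iff_has_vector_derivative[symmetric]\<close>)
    then show ?thesis using pos by (simp add: F_def)
  qed
  have nn: "(\<integral>\<^sup>+t. ennreal (indicator {0..} t * t powr (\<alpha> - 1) / exp t) \<partial>lborel) = ennreal (Gamma \<alpha>)"
    using Gamma_conv_nn_integral_real[OF pos] by simp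
  have m: "(\<lambda>t. indicator {0..} t * t powr (\<alpha> - 1) / exp t :: real) \<in> borel_measurable lborel" by measurable
  have hb: "has_bochner_integral lborel (\<lambda>t. indicator {0..} t * t powr (\<alpha> - 1) / exp t) (Gamma \<alpha>)"
    by (rule has_bochner_integral_nn_integral[OF m _ _ nn]) (auto simp: Gamma_real_nonneg pos less_imp_le)
  have "((\<lambda>y. LINT t|lborel. indicator {..y} t *\<^sub>R (indicator {0..} t * t powr (\<alpha> - 1) / exp t)) \<longlongrightarrow>
      (LINT t|lborel. indicator {0..} t * t powr (\<alpha> - 1) / exp t)) at_top"
    by (rule tendsto_integral_at_top) (use hb in \<open>auto simp: has_bochner_integral_iff\<close>)
  also have "(LINT t|lborel. indicator {0..} t * t powr (\<alpha> - 1) / exp t) = Gamma \<alpha>"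
    using hb by (simp add: has_bochner_integral_iff)
  finally have lim: "((\<lambda>y. LINT t|lborel. indicator {..y} t *\<^sub>R (indicator {0..} t * t powr (\<alpha> - 1) / exp t)) \<longlongrightarrow> Gamma \<alpha>) at_top" .
  have "\<forall>\<^sub>F y in at_top. (LINT t|lborel. indicator {..y} t *\<^sub>R (indicator {0..} t * t powr (\<alpha> - 1) / exp t)) = F y"
    using eventually_ge_at_top[of 0]
  proof eventually_elim
    case (elim y)
    have "integrable lborel (\<lambda>t. indicator {..y} t *\<^sub>R (indicator {0..} t * t powr (\<alpha> - 1) / exp t))"
      by (rule integrable_mult_indicator) (use hb in \<open>auto simp: has_bochner_integral_iff\<close>)
    then have "set_integrable lborel {0..y} f"
    proof -
      have eq: "(\<lambda>x. indicator {0..y} x *\<^sub>R f x) =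
          (\<lambda>t. indicator {..y} t *\<^sub>R (indicator {0..} t * t powr (\<alpha> - 1) / exp t))"
        by (auto simp: fun_eq_iff indicator_def f_def)
      from \<open>integrable lborel _\<close> show ?thesis unfolding set_integrable_def eq .
    qed
    then have "(LINT t:{0..y}|lborel. f t) = integral {0..y} f" by (rule set_borel_integral_eq_integral)
    also have "\<dots> = F y" using int[OF elim] by (rule integral_unique)
    finally have "(LINT t:{0..y}|lborel. f t) = F y" .
    then show ?case
      unfolding set_lebesgue_integral_def
      by (subst Bochner_Integration.integral_cong[OF refl, where g = "\<lambda>t. indicator {0..y} t *\<^sub>R f t"]) (auto simp: indicator_def f_def)
  qed
  from Lim_transform_eventually[OF lim this] show ?thesis by (simp add: F_def)
qed

text \<open>The recurrence carries the limit down from \<alpha> + 1 to \<alpha>, just as it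
  continues \<open>Gamma\<close>, since the exponential term is negligible. The application has
  \<alpha> = - q / 2, which is negative.\<close>

lemma kummer_series_1_asymptotic:
  assumes "half_integer \<alpha>"
  shows "((\<lambda>z. z powr \<alpha> * kummer_series \<alpha> 1 z) \<longlongrightarrow> Gamma \<alpha>) at_top"
proof -
  obtain k :: nat where "- \<alpha> < real k" using reals_Archimedean2 by blast
  then show ?thesis using assms
  proof (induction k arbitrary: \<alpha>)
    case 0
    then show ?case by (intro kummer_series_1_asymptotic_pos) auto
  next
    case (Suc k)
    have \<alpha>1: "half_integer (\<alpha> + 1)" using half_integer_add[OF Suc.prems(2), of 1] by simp
    have "\<alpha> \<noteq> 0" using half_integer_abs[OF Suc.prems(2)] by auto
    have "((\<lambda>z. (z powr \<alpha> * exp (- z) + z powr (\<alpha> + 1) * kummer_series (\<alpha> + 1) 1 z) / \<alpha>) \<longlongrightarrow> (0 + Gamma (\<alpha> + 1)) / \<alpha>) at_top"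
      using Suc.prems \<alpha>1 \<open>\<alpha> \<noteq> 0\<close>
      by (intro tendsto_divide tendsto_add powr_times_exp_tendsto_0 Suc.IH tendsto_const) auto
    also have "(0 + Gamma (\<alpha> + 1)) / \<alpha> = Gamma \<alpha>"
      using Gamma_plus1[OF half_integer_not_nonpos_Int[OF Suc.prems(2)]] \<open>\<alpha> \<noteq> 0\<close> by simp
    finally show ?case
    proof (rule Lim_transform_eventually)
      show "\<forall>\<^sub>F z in at_top. (z powr \<alpha> * exp (- z) + z powr (\<alpha> + 1) * kummer_series (\<alpha> + 1) 1 z) / \<alpha> = z powr \<alpha> * kummer_series \<alpha> 1 z"
        using eventually_gt_at_top[of 0]
      proof eventually_elim
        case (elim z)
        have "z powr (\<alpha> + 1) = z powr \<alpha> * z" using elim powr_mult_base[of z \<alpha>] by (simp add: add.commute mult.commute)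
        then have "z powr \<alpha> * exp (- z) + z powr (\<alpha> + 1) * kummer_series (\<alpha> + 1) 1 z = z powr \<alpha> * (\<alpha> * kummer_series \<alpha> 1 z)"
          unfolding kummer_series_1_recurrence[OF Suc.prems(2)] by (simp add: algebra_simps)
        then show ?case using \<open>\<alpha> \<noteq> 0\<close> by simp
      qed
    qed
  qed
qed

text \<open>In the partial fraction step the series with parameter \<alpha> + 1 is smaller by a
  factor 1 / z, so raising m only divides the limit by m, which builds up
  \<open>Gamma (real m)\<close>.\<close>

lemma kummer_series_asymptotic:
  assumes "half_integer \<alpha>" "m \<ge> 1"
  shows "((\<lambda>z. z powr \<alpha> * kummer_series \<alpha> m z) \<longlongrightarrow> Gamma \<alpha> / Gamma (real m)) at_top"
  using assms(2,1)
proof (induction m arbitrary: \<alpha> rule: nat_induct_at_least)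
  case base
  then show ?case using kummer_series_1_asymptotic by simp
next
  case (Suc m)
  have \<alpha>1: "half_integer (\<alpha> + 1)" using half_integer_add[OF Suc.prems, of 1] by simp
  have inv: "((\<lambda>z::real. inverse z) \<longlongrightarrow> 0) at_top" by (rule tendsto_inverse_0_at_top) (rule filterlim_ident)
  have "((\<lambda>z. (z powr \<alpha> * kummer_series \<alpha> m z - inverse z * (z powr (\<alpha> + 1) * kummer_series (\<alpha> + 1) m z)) / real m) \<longlongrightarrow>
      (Gamma \<alpha> / Gamma (real m) - 0 * (Gamma (\<alpha> + 1) / Gamma (real m))) / real m) at_top"
    using Suc.hyps by (intro tendsto_divide tendsto_diff tendsto_mult Suc.IH Suc.prems \<alpha>1 inv tendsto_const) auto
  also have "(Gamma \<alpha> / Gamma (real m) - 0 * (Gamma (\<alpha> + 1) / Gamma (real m))) / real m = Gamma \<alpha> / Gamma (real (Suc m))"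
  proof -
    have "real m \<notin> \<int>\<^sub>\<le>\<^sub>0" using Suc.hyps nonpos_Ints_nonpos by force
    then have "Gamma (real m + 1) = real m * Gamma (real m)" by (rule Gamma_plus1)
    then show ?thesis by (simp add: add.commute mult.commute)
  qed
  finally show ?case
  proof (rule Lim_transform_eventually)
    show "\<forall>\<^sub>F z in at_top. (z powr \<alpha> * kummer_series \<alpha> m z - inverse z * (z powr (\<alpha> + 1) * kummer_series (\<alpha> + 1) m z)) / real m = z powr \<alpha> * kummer_series \<alpha> (Suc m) z"
      using eventually_gt_at_top[of 0]
    proof eventually_elim
      case (elim z)
      have "z powr (\<alpha> + 1) = z * z powr \<alpha>" using elim powr_mult_base[of z \<alpha>] by (simp add: add.commute)
      then have "inverse z * (z powr (\<alpha> + 1) * kummer_series (\<alpha> + 1) m z) = z powr \<alpha> * kummer_series (\<alpha> + 1) m z"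
        using elim by simp
      then show ?case unfolding kummer_series_Suc[OF Suc.prems Suc.hyps(1)] by (simp add: right_diff_distrib)
    qed
  qed
qed

text \<open>Continuity on a compact interval and the asymptotics beyond it. The summand 1 covers the
  neighbourhood of 0, where z^(- \<alpha>) is small for negative \<alpha>.\<close>

lemma kummer_series_bound:
  assumes "half_integer \<alpha>" "m \<ge> 1"
  obtains C where "C \<ge> 0" "\<And>z. z \<ge> 0 \<Longrightarrow> \<bar>kummer_series \<alpha> m z\<bar> \<le> C * (1 + z powr (- \<alpha>))"
proof -
  define L where "L = Gamma \<alpha> / Gamma (real m)"
  have "\<forall>\<^sub>F z in at_top. dist (z powr \<alpha> * kummer_series \<alpha> m z) L < 1"
    using kummer_series_asymptotic[OF assms] by (simp add: L_def tendsto_iff)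
  then obtain Z0 where Z0: "\<And>z. z \<ge> Z0 \<Longrightarrow> dist (z powr \<alpha> * kummer_series \<alpha> m z) L < 1"
    by (auto simp: eventually_at_top_linorder)
  define Z where "Z = max Z0 1"
  have "compact (kummer_series \<alpha> m ` {0..Z})"
    by (intro compact_continuous_image kummer_series_continuous assms) auto
  then obtain B where B: "\<And>z. z \<in> {0..Z} \<Longrightarrow> \<bar>kummer_series \<alpha> m z\<bar> \<le> B"
    using compact_imp_bounded bounded_iff by (metis image_eqI real_norm_def)
  define C where "C = max B (\<bar>L\<bar> + 1)"
  have "\<bar>kummer_series \<alpha> m z\<bar> \<le> C * (1 + z powr (- \<alpha>))" if z: "z \<ge> 0" for z
  proof (cases "z \<le> Z")
    case True
    then have "\<bar>kummer_series \<alpha> m z\<bar> \<le> C" using B[of z] z by (simp add: C_def)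
    also have "C \<le> C * (1 + z powr (- \<alpha>))"
      using mult_left_mono[of 1 "1 + z powr (- \<alpha>)" C] by (simp add: C_def le_max_iff_disj)
    finally show ?thesis .
  next
    case False
    then have "z > 0" "z \<ge> Z0" by (auto simp: Z_def)
    then have "\<bar>z powr \<alpha> * kummer_series \<alpha> m z\<bar> \<le> C" using Z0[of z] by (auto simp: dist_real_def C_def abs_if split: if_splits)
    then have "z powr (- \<alpha>) * \<bar>z powr \<alpha> * kummer_series \<alpha> m z\<bar> \<le> z powr (- \<alpha>) * C" by (intro mult_left_mono) auto
    moreover have "z powr (- \<alpha>) * \<bar>z powr \<alpha> * kummer_series \<alpha> m z\<bar> = \<bar>kummer_series \<alpha> m z\<bar>"
      using \<open>z > 0\<close> by (simp add: abs_mult mult.assoc[symmetric] powr_add[symmetric])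
    ultimately have "\<bar>kummer_series \<alpha> m z\<bar> \<le> C * z powr (- \<alpha>)" by (simp add: mult.commute)
    also have "\<dots> \<le> C * (1 + z powr (- \<alpha>))" by (intro mult_left_mono) (auto simp: C_def le_max_iff_disj)
    finally show ?thesis .
  qed
  then show ?thesis using that[of C] by (simp add: C_def le_max_iff_disj)
qed

section \<open>Dominated integrals and power series\<close>

lemma has_real_derivative_integral:
  fixes F F' :: "real \<Rightarrow> 'b \<Rightarrow> real"
  assumes \<delta>: "\<delta> > 0"
    and int: "\<And>t. \<bar>t - a\<bar> < \<delta> \<Longrightarrow> integrable M (F t)"
    and der: "\<And>t y. \<bar>t - a\<bar> < \<delta> \<Longrightarrow> ((\<lambda>t. F t y) has_real_derivative F' t y) (at t)"
    and bd: "\<And>t y. \<bar>t - a\<bar> < \<delta> \<Longrightarrow> \<bar>F' t y\<bar> \<le> g y"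
    and meas: "F' a \<in> borel_measurable M" and g: "integrable M g"
  shows "((\<lambda>t. LINT y|M. F t y) has_real_derivative (LINT y|M. F' a y)) (at a)"
  unfolding has_field_derivative_iff tendsto_at_iff_sequentially comp_def
proof (intro allI impI)
  fix X :: "nat \<Rightarrow> real" assume X: "\<forall>i. X i \<in> UNIV - {a}" "X \<longlonglongrightarrow> a"
  have ne: "X i \<noteq> a" for i using X(1) by auto
  have "\<forall>\<^sub>F i in sequentially. dist (X i) a < \<delta>" using X(2) \<delta> by (simp add: tendsto_iff)
  then obtain N where N: "\<And>i. i \<ge> N \<Longrightarrow> \<bar>X i - a\<bar> < \<delta>"
    by (auto simp: eventually_sequentially dist_real_def)
  have X': "(\<lambda>i. X (i + N)) \<longlonglongrightarrow> a" by (rule LIMSEQ_ignore_initial_segment[OF X(2)])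
  have inta: "integrable M (F a)" using int[of a] \<delta> by simp
  have "(\<lambda>i. LINT y|M. (F (X (i + N)) y - F a y) / (X (i + N) - a)) \<longlonglongrightarrow> (LINT y|M. F' a y)"
  proof (rule integral_dominated_convergence[where w = g])
    show "(\<lambda>y. (F (X (i + N)) y - F a y) / (X (i + N) - a)) \<in> borel_measurable M" for i
      using borel_measurable_integrable[OF int[OF N[of "i + N"]]] borel_measurable_integrable[OF inta] by auto
    show "AE y in M. (\<lambda>i. (F (X (i + N)) y - F a y) / (X (i + N) - a)) \<longlonglongrightarrow> F' a y"
    proof (rule AE_I2)
      fix y
      have "((\<lambda>t. (F t y - F a y) / (t - a)) \<longlongrightarrow> F' a y) (at a)"
        using der[of a y] \<delta> by (simp add: has_field_derivative_iff)
      then show "(\<lambda>i. (F (X (i + N)) y - F a y) / (X (i + N) - a)) \<longlonglongrightarrow> F' a y"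
        using X' ne by (auto simp: tendsto_at_iff_sequentially comp_def)
    qed
    show "AE y in M. norm ((F (X (i + N)) y - F a y) / (X (i + N) - a)) \<le> g y" for i
    proof (rule AE_I2)
      fix y
      have near: "\<bar>t - a\<bar> < \<delta>" if "t \<in> closed_segment a (X (i + N))" for t
        using that N[of "i + N"] by (auto simp: closed_segment_eq_real_ivl split: if_splits)
      have "norm (F (X (i + N)) y - F a y) \<le> g y * norm (X (i + N) - a)"
      proof (rule field_differentiable_bound[where S = "closed_segment a (X (i + N))"])
        show "((\<lambda>t. F t y) has_field_derivative F' t y) (at t within closed_segment a (X (i + N)))"
          if "t \<in> closed_segment a (X (i + N))" for t
          using der[OF near[OF that]] by (rule has_field_derivative_at_within)
        show "norm (F' t y) \<le> g y" if "t \<in> closed_segment a (X (i + N))" for t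
          using bd[OF near[OF that]] by simp
      qed auto
      then show "norm ((F (X (i + N)) y - F a y) / (X (i + N) - a)) \<le> g y"
        using ne[of "i + N"] by (simp add: field_simps)
    qed
  qed (use meas g in auto)
  moreover have "(LINT y|M. (F (X (i + N)) y - F a y) / (X (i + N) - a)) =
      ((LINT y|M. F (X (i + N)) y) - (LINT y|M. F a y)) / (X (i + N) - a)" for i
    using int[OF N[of "i + N"]] inta by simp
  ultimately have "(\<lambda>i. ((LINT y|M. F (X (i + N)) y) - (LINT y|M. F a y)) / (X (i + N) - a)) \<longlonglongrightarrow> (LINT y|M. F' a y)"
    by (simp only:)
  then show "(\<lambda>i. ((LINT y|M. F (X i) y) - (LINT y|M. F a y)) / (X i - a)) \<longlonglongrightarrow> (LINT y|M. F' a y)"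
    by (rule LIMSEQ_offset)
qed

text \<open>The majorant is asked for the partial sums only, which suits alternating series; a
  single term, as the difference of two partial sums, is then bounded by 2 * G.\<close>

lemma sums_integral_dominated:
  fixes g :: "nat \<Rightarrow> 'b \<Rightarrow> real"
  assumes meas: "\<And>j. g j \<in> borel_measurable M" and s: "\<And>y. y \<in> space M \<Longrightarrow> (\<lambda>j. g j y) sums s y"
    and bd: "\<And>k y. y \<in> space M \<Longrightarrow> \<bar>\<Sum>j<k. g j y\<bar> \<le> G y" and G: "integrable M G"
  shows "\<And>j. integrable M (g j)" "integrable M s" "(\<lambda>j. LINT y|M. g j y) sums (LINT y|M. s y)"
proof -
  show int: "integrable M (g j)" for j
  proof (rule Bochner_Integration.integrable_bound[OF integrable_mult_right[OF G, of 2] meas])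
    show "AE y in M. norm (g j y) \<le> norm (2 * G y)"
    proof (rule AE_I2)
      fix y assume y: "y \<in> space M"
      have "g j y = (\<Sum>i<Suc j. g i y) - (\<Sum>i<j. g i y)" by simp
      then show "norm (g j y) \<le> norm (2 * G y)" using bd[OF y, of "Suc j"] bd[OF y, of j] by simp
    qed
  qed
  have sm: "s \<in> borel_measurable M"
  proof (rule borel_measurable_LIMSEQ_real)
    show "(\<lambda>k. \<Sum>j<k. g j y) \<longlonglongrightarrow> s y" if "y \<in> space M" for y using s[OF that] by (simp add: sums_def)
  qed (use meas in auto)
  have dc: "integrable M s" "(\<lambda>k. LINT y|M. (\<Sum>j<k. g j y)) \<longlonglongrightarrow> (LINT y|M. s y)"
    using s bd meas sm by (auto intro!: integrable_dominated_convergence[where w = G and s = "\<lambda>k y. \<Sum>j<k. g j y"]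
        integral_dominated_convergence[where w = G] G AE_I2 simp: sums_def)
  then show "integrable M s" "(\<lambda>j. LINT y|M. g j y) sums (LINT y|M. s y)"
    using int by (simp_all add: sums_def)
qed

text \<open>The identity is known for positive a only, so the constant coefficient is found as a
  limit from the right, and division by a shifts the series.\<close>

lemma power_series_zero_imp_coeff_zero:
  fixes c :: "nat \<Rightarrow> real"
  assumes "\<And>a. a > 0 \<Longrightarrow> (\<lambda>j. c j * a ^ j) sums 0"
  shows "c j = 0"
  using assms
proof (induction j arbitrary: c)
  have c0: "c 0 = 0" if c: "\<And>a. a > 0 \<Longrightarrow> (\<lambda>j. c j * a ^ j) sums 0" for c :: "nat \<Rightarrow> real"
  proof -
    have "((\<lambda>x. \<Sum>n. c n * x ^ n) \<longlongrightarrow> c 0) (at 0)"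
      by (rule powser_limit_0[of 1]) (use c sums_unique summable_sums sums_summable abs_less_iff in
          \<open>auto intro!: summable_sums powser_inside[of c 2, OF sums_summable[OF c]]\<close>)
    then have "((\<lambda>x. \<Sum>n. c n * x ^ n) \<longlongrightarrow> c 0) (at_right 0)"
      by (rule tendsto_mono[rotated]) (simp add: at_le)
    moreover have "((\<lambda>x. \<Sum>n. c n * x ^ n) \<longlongrightarrow> 0) (at_right 0)"
      by (rule tendsto_eventually) (use c in \<open>auto simp: sums_iff intro: eventually_at_right_less eventually_mono\<close>)
    ultimately show ?thesis by (rule tendsto_unique[rotated]) simp
  qed
  {
    case 0
    then show ?case using c0 by blast
  next
    case (Suc j)
    have "(\<lambda>j. c (Suc j) * a ^ j) sums 0" if a: "a > 0" for a
    proof -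
      have "(\<lambda>j. c (Suc j) * a ^ Suc j) sums 0"
        using Suc.prems[OF a] c0[OF Suc.prems] by (subst sums_Suc_iff) simp
      from sums_mult[OF this, of "1 / a"] show ?thesis using a by (simp add: field_simps)
    qed
    from Suc.IH[OF this] show ?case .
  }
qed

lemma power_series_times_exp:
  fixes c :: "nat \<Rightarrow> real"
  assumes "summable (\<lambda>j. \<bar>c j * a ^ j\<bar>)"
  shows "(\<lambda>k. (\<Sum>i\<le>k. b ^ i / fact i * c (k - i)) * a ^ k) sums (exp (b * a) * (\<Sum>j. c j * a ^ j))"
proof -
  have e: "(\<lambda>j. (b * a) ^ j / fact j) sums exp (b * a)"
    using exp_converges[of "b * a"] by (simp add: field_simps)
  have "summable (\<lambda>j. norm ((b * a) ^ j / fact j))"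
    using summable_exp_real[of "b * a"] by (simp add: power_abs)
  from Cauchy_product_sums[OF this, of "\<lambda>j. c j * a ^ j"] assms
  have "(\<lambda>k. \<Sum>i\<le>k. (b * a) ^ i / fact i * (c (k - i) * a ^ (k - i))) sums (exp (b * a) * (\<Sum>j. c j * a ^ j))"
    using e by (simp add: sums_iff)
  moreover have "(\<Sum>i\<le>k. (b * a) ^ i / fact i * (c (k - i) * a ^ (k - i))) = (\<Sum>i\<le>k. b ^ i / fact i * c (k - i)) * a ^ k" for k
  proof -
    have "(b * a) ^ i / fact i * (c (k - i) * a ^ (k - i)) = b ^ i / fact i * c (k - i) * a ^ k" if "i \<le> k" for i
    proof -
      have "a ^ k = a ^ i * a ^ (k - i)" using that by (simp add: power_add[symmetric])
      then show ?thesis by (simp add: power_mult_distrib)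
    qed
    then show ?thesis unfolding sum_distrib_right by (intro sum.cong) auto
  qed
  ultimately show ?thesis by simp
qed

section \<open>Integrability and evaluation in polar coordinates\<close>

lemma lebesgue_integral_dilate:
  fixes F :: "'a::euclidean_space \<Rightarrow> real"
  assumes [measurable]: "F \<in> borel_measurable borel" and "c \<noteq> 0"
  shows "(LINT z|lborel. F z) = \<bar>c\<bar> ^ DIM('a) * (LINT z|lborel. F (t + c *\<^sub>R z))"
  by (subst lborel_affine[OF assms(2), of t])
    (simp add: integral_density integral_distr)

lemma integrable_abs_power_gaussian:
  assumes b: "b > 0"
  shows "integrable lborel (\<lambda>r::real. \<bar>r\<bar> ^ k * exp (- b * r\<^sup>2))"
proof -
  have "integrable lborel (\<lambda>r::real. exp (- r\<^sup>2) * \<bar>r\<bar> ^ k)"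
    using gaussian_abs_moment[of k] by (simp add: has_bochner_integral_iff)
  then have "integrable lborel (\<lambda>r. exp (- (0 + sqrt b * r)\<^sup>2) * \<bar>0 + sqrt b * r\<bar> ^ k)"
    by (rule lborel_integrable_real_affine) (use b in auto)
  then have "integrable lborel (\<lambda>r. (1 / sqrt b ^ k) * (exp (- (0 + sqrt b * r)\<^sup>2) * \<bar>0 + sqrt b * r\<bar> ^ k))"
    by (rule integrable_mult_right)
  also have "(\<lambda>r. (1 / sqrt b ^ k) * (exp (- (0 + sqrt b * r)\<^sup>2) * \<bar>0 + sqrt b * r\<bar> ^ k)) =
      (\<lambda>r. \<bar>r\<bar> ^ k * exp (- b * r\<^sup>2))"
    using b by (auto simp: fun_eq_iff abs_mult power_mult_distrib)
  finally show ?thesis .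
qed

lemma integrable_polar_bound:
  fixes F h :: "'a::euclidean_space \<Rightarrow> real" and G :: "real \<Rightarrow> real"
  assumes [measurable]: "F \<in> borel_measurable borel" "h \<in> borel_measurable borel"
    and h: "integrable sphere_measure h" and G: "integrable lborel G" and G0: "\<And>r. G r \<ge> 0"
    and bd: "\<And>z. z \<noteq> 0 \<Longrightarrow> \<bar>F z\<bar> * norm z ^ (DIM('a) - 1) \<le> \<bar>h (sgn z)\<bar> * G (norm z)"
  shows "integrable lborel F"
proof (rule integrableI_bounded)
  have [measurable]: "G \<in> borel_measurable borel" using G by simp
  have "(\<integral>\<^sup>+z. ennreal (norm (F z)) \<partial>lborel) = (\<integral>\<^sup>+\<theta>. (\<integral>\<^sup>+r. ennreal (r ^ (DIM('a) - 1)) * indicator {0<..} r *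
      ennreal (norm (F (r *\<^sub>R \<theta>))) \<partial>lborel) \<partial>sphere_measure)"
    by (rule nn_integral_polar) measurable
  also have "\<dots> \<le> (\<integral>\<^sup>+\<theta>. (\<integral>\<^sup>+r. ennreal \<bar>h \<theta>\<bar> * ennreal (G r) \<partial>lborel) \<partial>sphere_measure)"
  proof (intro nn_integral_mono)
    fix \<theta> :: 'a and r :: real assume "\<theta> \<in> space sphere_measure"
    then have \<theta>: "norm \<theta> = 1" by simp
    show "ennreal (r ^ (DIM('a) - 1)) * indicator {0<..} r * ennreal (norm (F (r *\<^sub>R \<theta>))) \<le> ennreal \<bar>h \<theta>\<bar> * ennreal (G r)"
    proof (cases "r > 0")
      case True
      then have "sgn (r *\<^sub>R \<theta>) = \<theta>" "norm (r *\<^sub>R \<theta>) = r"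
        using \<theta> by (simp_all add: sgn_scaleR sgn_div_norm[of \<theta>])
      moreover have "r *\<^sub>R \<theta> \<noteq> 0" using True \<theta> by auto
      ultimately have "r ^ (DIM('a) - 1) * \<bar>F (r *\<^sub>R \<theta>)\<bar> \<le> \<bar>h \<theta>\<bar> * G r"
        using bd[of "r *\<^sub>R \<theta>"] by (simp add: mult.commute)
      then show ?thesis using True G0 by (simp add: ennreal_mult[symmetric] ennreal_leI)
    qed simp
  qed
  also have "\<dots> = (\<integral>\<^sup>+\<theta>. ennreal \<bar>h \<theta>\<bar> * (\<integral>\<^sup>+r. ennreal (G r) \<partial>lborel) \<partial>sphere_measure)"
    by (intro nn_integral_cong nn_integral_cmult) measurable
  also have "\<dots> = (\<integral>\<^sup>+\<theta>. ennreal \<bar>h \<theta>\<bar> \<partial>sphere_measure) * (\<integral>\<^sup>+r. ennreal (G r) \<partial>lborel)"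
    by (rule nn_integral_multc) (rule borel_measurable_sphere, measurable)
  also have "\<dots> < \<infinity>"
    using h G G0 by (simp add: integrable_iff_bounded ennreal_mult_less_top)
  finally show "(\<integral>\<^sup>+z. ennreal (norm (F z)) \<partial>lborel) < \<infinity>" .
qed measurable

text \<open>The homogeneity of f cancels the Jacobian, so that the radial integral involves \<phi>
  alone. Working with nonnegative integrals of the two parts of f yields integrability along with
  the value.\<close>

lemma integral_polar_homogeneous:
  fixes f \<phi> \<Phi> :: "'a::euclidean_space \<Rightarrow> real"
  assumes f[measurable]: "f \<in> borel_measurable borel" and fi: "integrable sphere_measure f"
    and hom: "\<And>t x. t > 0 \<Longrightarrow> x \<noteq> 0 \<Longrightarrow> f (t *\<^sub>R x) = f x / t ^ (DIM('a) - 1)"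
    and \<phi>[measurable]: "\<phi> \<in> borel_measurable borel" and \<phi>0: "\<And>z. \<phi> z \<ge> 0"
    and \<Phi>[measurable]: "\<Phi> \<in> borel_measurable borel" and \<Phi>b: "\<And>\<theta>. 0 \<le> \<Phi> \<theta> \<and> \<Phi> \<theta> \<le> E"
    and \<phi>\<Phi>: "\<And>\<theta>. norm \<theta> = 1 \<Longrightarrow> (\<integral>\<^sup>+r. indicator {0<..} r * ennreal (\<phi> (r *\<^sub>R \<theta>)) \<partial>lborel) = ennreal (\<Phi> \<theta>)"
  shows "integrable lborel (\<lambda>z. f z * \<phi> z)" "(LINT z|lborel. f z * \<phi> z) = (LINT \<theta>|sphere_measure. f \<theta> * \<Phi> \<theta>)"
proof -
  let ?S = "sphere_measure :: 'a measure"
  have part: "(\<integral>\<^sup>+z. ennreal (g z * \<phi> z) \<partial>lborel) = (\<integral>\<^sup>+\<theta>. ennreal (g \<theta> * \<Phi> \<theta>) \<partial>?S)"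
    if g0: "\<And>z. g z \<ge> 0" and [measurable]: "g \<in> borel_measurable borel"
    and ghom: "\<And>t x. t > 0 \<Longrightarrow> x \<noteq> 0 \<Longrightarrow> g (t *\<^sub>R x) = g x / t ^ (DIM('a) - 1)" for g :: "'a \<Rightarrow> real"
  proof -
    have "(\<integral>\<^sup>+z. ennreal (g z * \<phi> z) \<partial>lborel) = (\<integral>\<^sup>+\<theta>. (\<integral>\<^sup>+r. ennreal (r ^ (DIM('a) - 1)) * indicator {0<..} r *
        ennreal (g (r *\<^sub>R \<theta>) * \<phi> (r *\<^sub>R \<theta>)) \<partial>lborel) \<partial>?S)"
      by (rule nn_integral_polar) measurable
    also have "\<dots> = (\<integral>\<^sup>+\<theta>. ennreal (g \<theta> * \<Phi> \<theta>) \<partial>?S)"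
    proof (rule nn_integral_cong)
      fix \<theta> :: 'a assume "\<theta> \<in> space ?S"
      then have \<theta>: "norm \<theta> = 1" "\<theta> \<noteq> 0" by auto
      have "(\<integral>\<^sup>+r. ennreal (r ^ (DIM('a) - 1)) * indicator {0<..} r * ennreal (g (r *\<^sub>R \<theta>) * \<phi> (r *\<^sub>R \<theta>)) \<partial>lborel) =
        (\<integral>\<^sup>+r. ennreal (g \<theta>) * (indicator {0<..} r * ennreal (\<phi> (r *\<^sub>R \<theta>))) \<partial>lborel)"
      proof (rule nn_integral_cong)
        fix r :: real
        show "ennreal (r ^ (DIM('a) - 1)) * indicator {0<..} r * ennreal (g (r *\<^sub>R \<theta>) * \<phi> (r *\<^sub>R \<theta>)) =
          ennreal (g \<theta>) * (indicator {0<..} r * ennreal (\<phi> (r *\<^sub>R \<theta>)))"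
        proof (cases "r > 0")
          case True
          then have "r ^ (DIM('a) - 1) * (g (r *\<^sub>R \<theta>) * \<phi> (r *\<^sub>R \<theta>)) = g \<theta> * \<phi> (r *\<^sub>R \<theta>)"
            using ghom[OF True \<theta>(2)] by simp
          then show ?thesis using True g0 \<phi>0 by (simp add: ennreal_mult[symmetric])
        qed simp
      qed
      also have "\<dots> = ennreal (g \<theta>) * ennreal (\<Phi> \<theta>)"
        unfolding \<phi>\<Phi>[OF \<theta>(1), symmetric] by (rule nn_integral_cmult) measurable
      finally show "(\<integral>\<^sup>+r. ennreal (r ^ (DIM('a) - 1)) * indicator {0<..} r * ennreal (g (r *\<^sub>R \<theta>) * \<phi> (r *\<^sub>R \<theta>)) \<partial>lborel) =
        ennreal (g \<theta> * \<Phi> \<theta>)" using g0 \<Phi>b by (simp add: ennreal_mult)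
    qed
    finally show ?thesis .
  qed
  have piece: "integrable lborel (\<lambda>z. g z * \<phi> z) \<and> integrable ?S (\<lambda>z. g z * \<Phi> z) \<and>
      (LINT z|lborel. g z * \<phi> z) = (LINT \<theta>|?S. g \<theta> * \<Phi> \<theta>)"
    if g0: "\<And>z. g z \<ge> 0" and gm[measurable]: "g \<in> borel_measurable borel" and gf: "\<And>z. g z \<le> \<bar>f z\<bar>"
    and ghom: "\<And>t x. t > 0 \<Longrightarrow> x \<noteq> 0 \<Longrightarrow> g (t *\<^sub>R x) = g x / t ^ (DIM('a) - 1)" for g :: "'a \<Rightarrow> real"
  proof -
    have m: "(\<lambda>\<theta>. g \<theta> * \<Phi> \<theta>) \<in> borel_measurable ?S" by (rule borel_measurable_sphere) measurable
    have i1: "integrable ?S (\<lambda>\<theta>. g \<theta> * \<Phi> \<theta>)"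
    proof (rule Bochner_Integration.integrable_bound[OF integrable_mult_left[OF fi, of E] m])
      show "AE \<theta> in ?S. norm (g \<theta> * \<Phi> \<theta>) \<le> norm (f \<theta> * E)"
      proof (rule AE_I2)
        fix \<theta>
        have "\<bar>g \<theta>\<bar> * \<bar>\<Phi> \<theta>\<bar> \<le> \<bar>f \<theta>\<bar> * \<bar>E\<bar>" using gf[of \<theta>] g0[of \<theta>] \<Phi>b[of \<theta>] by (intro mult_mono) auto
        then show "norm (g \<theta> * \<Phi> \<theta>) \<le> norm (f \<theta> * E)" by (simp add: abs_mult)
      qed
    qed
    have i2: "integrable lborel (\<lambda>z. g z * \<phi> z)"
    proof (rule integrableI_nonneg)
      show "(\<integral>\<^sup>+z. ennreal (g z * \<phi> z) \<partial>lborel) < \<infinity>"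
        using part[OF g0 gm ghom] i1 g0 \<Phi>b by (simp add: integrable_iff_bounded abs_mult)
    qed (use g0 \<phi>0 in auto)
    have "(LINT z|lborel. g z * \<phi> z) = (LINT \<theta>|?S. g \<theta> * \<Phi> \<theta>)"
      using g0 \<phi>0 \<Phi>b m part[OF g0 gm ghom] by (simp add: integral_eq_nn_integral)
    then show ?thesis using i1 i2 by simp
  qed
  \<comment> \<open>Positive and negative parts inherit the homogeneity of f, because the scaling
    factor is positive.\<close>
  have max_divide: "max 0 (y / s) = max 0 y / s" if "s > 0" for y s :: real
    using that by (simp add: max_def zero_le_divide_iff)
  have p: "integrable lborel (\<lambda>z. max 0 (f z) * \<phi> z) \<and> integrable ?S (\<lambda>z. max 0 (f z) * \<Phi> z) \<and>
      (LINT z|lborel. max 0 (f z) * \<phi> z) = (LINT \<theta>|?S. max 0 (f \<theta>) * \<Phi> \<theta>)"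
    by (rule piece) (auto simp: hom max_divide minus_divide_left simp del: minus_divide_left[symmetric] divide_minus_left)
  have n: "integrable lborel (\<lambda>z. max 0 (- f z) * \<phi> z) \<and> integrable ?S (\<lambda>z. max 0 (- f z) * \<Phi> z) \<and>
      (LINT z|lborel. max 0 (- f z) * \<phi> z) = (LINT \<theta>|?S. max 0 (- f \<theta>) * \<Phi> \<theta>)"
    by (rule piece) (auto simp: hom max_divide minus_divide_left simp del: minus_divide_left[symmetric] divide_minus_left)
  have split: "f z * w = max 0 (f z) * w - max 0 (- f z) * w" for z w by (auto simp: max_def)
  show "integrable lborel (\<lambda>z. f z * \<phi> z)" unfolding split using p n by auto
  show "(LINT z|lborel. f z * \<phi> z) = (LINT \<theta>|?S. f \<theta> * \<Phi> \<theta>)" unfolding split using p n by simp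
qed

lemma poly_le_exp:
  assumes "b > 0"
  shows "\<exists>C\<ge>0. \<forall>y\<ge>0. \<bar>poly p y\<bar> \<le> C * exp (b * y :: real)"
  using assms
proof (induction p arbitrary: b)
  case 0
  then show ?case by (intro exI[of _ 0]) auto
next
  case (pCons c p)
  then obtain C where C: "C \<ge> 0" "\<And>y. y \<ge> 0 \<Longrightarrow> \<bar>poly p y\<bar> \<le> C * exp (b / 2 * y)"
    using pCons.IH[of "b / 2"] by auto
  have "\<bar>poly (pCons c p) y\<bar> \<le> (\<bar>c\<bar> + 2 / b * C) * exp (b * y)" if y: "y \<ge> 0" for y
  proof -
    have "b / 2 * y \<le> exp (b / 2 * y)" using exp_ge_add_one_self[of "b / 2 * y"] by linarith
    then have y2: "y \<le> 2 / b * exp (b / 2 * y)" using pCons.prems by (simp add: field_simps)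
    have "\<bar>poly (pCons c p) y\<bar> \<le> \<bar>c\<bar> + y * \<bar>poly p y\<bar>"
      using y abs_triangle_ineq[of c "y * poly p y"] by (simp add: abs_mult)
    also have "\<dots> \<le> \<bar>c\<bar> * exp (b * y) + (2 / b * exp (b / 2 * y)) * (C * exp (b / 2 * y))"
    proof (intro add_mono mult_mono y2 C(2) y)
      show "\<bar>c\<bar> \<le> \<bar>c\<bar> * exp (b * y)" using pCons.prems y mult_left_mono[of 1 "exp (b * y)" "\<bar>c\<bar>"] by simp
    qed (use pCons.prems in auto)
    also have "(2 / b * exp (b / 2 * y)) * (C * exp (b / 2 * y)) = 2 / b * C * (exp (b / 2 * y) * exp (b / 2 * y))"
      by (simp only: mult_ac)
    also have "exp (b / 2 * y) * exp (b / 2 * y) = exp (b * y)" unfolding exp_add[symmetric] by simp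
    finally show ?thesis by (simp add: distrib_right)
  qed
  then show ?case using C(1) pCons.prems by (intro exI[of _ "\<bar>c\<bar> + 2 / b * C"]) auto
qed

section \<open>Gaussian moments of a homogeneous function\<close>

lemma gaussian_norm_bound:
  fixes x z :: "'a::euclidean_space"
  assumes b: "b > 0"
  shows "exp (- b * (norm (z - x))\<^sup>2) \<le> exp (b * (norm x)\<^sup>2) * exp (- (b / 2) * (norm z)\<^sup>2)"
proof -
  have "norm z \<le> norm (z - x) + norm x" by (metis norm_triangle_sub add.commute)
  then have "(norm z)\<^sup>2 \<le> (norm (z - x) + norm x)\<^sup>2" by (intro power_mono) auto
  also have "\<dots> \<le> 2 * (norm (z - x))\<^sup>2 + 2 * (norm x)\<^sup>2"
    using zero_le_power2[of "norm (z - x) - norm x"] unfolding power2_sum power2_diff by linarith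
  finally have "(norm z)\<^sup>2 / 2 - (norm x)\<^sup>2 \<le> (norm (z - x))\<^sup>2" by linarith
  then have "b * ((norm z)\<^sup>2 / 2 - (norm x)\<^sup>2) \<le> b * (norm (z - x))\<^sup>2" using b by (intro mult_left_mono) auto
  then have "- b * (norm (z - x))\<^sup>2 \<le> b * (norm x)\<^sup>2 + - (b / 2) * (norm z)\<^sup>2" by (simp add: algebra_simps)
  then show ?thesis unfolding exp_add[symmetric] by (rule exp_le_cancel_iff[THEN iffD2])
qed

text \<open>The hypothesis on scaling includes t = 0 and therefore gives u 0 = 0. With h half the
  dimension, the normalising factor a^(n / 2) of the Gaussian is a natural power.\<close>

locale homogeneous_function =
  fixes u :: "'a::euclidean_space \<Rightarrow> real" and q h :: nat
  assumes cont: "continuous_on UNIV u"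
    and hom: "u (t *\<^sub>R x) = \<bar>t\<bar> ^ q * u x"
    and q: "odd q" and n: "DIM('a) = 2 * h"
begin

lemma h_pos: "h \<ge> 1" using n DIM_positive[where 'a = 'a] by linarith

lemma borel_u [measurable]: "u \<in> borel_measurable borel"
  using cont by (rule borel_measurable_continuous_onI)

lemma even_u: "u (- z) = u z" using hom[of "- 1" z] by simp

lemma growth: obtains B where "B \<ge> 0" "\<And>z. \<bar>u z\<bar> \<le> B * norm z ^ q"
proof -
  have "compact (u ` sphere 0 1)"
    using cont continuous_on_subset by (intro compact_continuous_image) auto
  then obtain B where B: "\<forall>y\<in>u ` sphere 0 1. norm y \<le> B"
    using bounded_iff compact_imp_bounded by blast
  have "\<bar>u z\<bar> \<le> max 0 B * norm z ^ q" for z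
  proof (cases "z = 0")
    case True
    have "u 0 = 0" using hom[of 0 0] q by (cases q) auto
    then show ?thesis using True by simp
  next
    case False
    have "u z = norm z ^ q * u (sgn z)" using hom[of "norm z" "sgn z"] by (simp add: sgn_div_norm False)
    moreover have "\<bar>u (sgn z)\<bar> \<le> max 0 B" using B False by (auto simp: norm_sgn le_max_iff_disj)
    ultimately show ?thesis using mult_right_mono[of "\<bar>u (sgn z)\<bar>" "max 0 B" "norm z ^ q"]
      by (simp add: abs_mult mult.commute)
  qed
  then show ?thesis using that[of "max 0 B"] by simp
qed

lemma integrable_gaussian_bound:
  assumes [measurable]: "F \<in> borel_measurable borel" and b: "b > 0"
    and bd: "\<And>z. z \<noteq> 0 \<Longrightarrow> \<bar>F z\<bar> * norm z ^ (DIM('a) - 1) \<le> K * norm z ^ k * exp (- b * (norm z)\<^sup>2)" and K: "K \<ge> 0"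
  shows "integrable lborel (F :: 'a \<Rightarrow> real)"
proof (rule integrable_polar_bound[where h = "\<lambda>_. 1" and G = "\<lambda>r. K * (\<bar>r\<bar> ^ k * exp (- b * r\<^sup>2))"])
  show "integrable lborel (\<lambda>r::real. K * (\<bar>r\<bar> ^ k * exp (- b * r\<^sup>2)))"
    by (intro integrable_mult_right integrable_abs_power_gaussian b)
qed (use bd K in \<open>auto simp: mult.assoc\<close>)

lemma integrable_u_gaussian_bound:
  assumes [measurable]: "F \<in> borel_measurable borel" and b: "b > 0" and K: "K \<ge> 0"
    and bd: "\<And>z. \<bar>F z\<bar> \<le> K * norm z ^ k * exp (- b * (norm (z - x))\<^sup>2)"
  shows "integrable lborel (\<lambda>z. u z * F z)"
proof -
  obtain B where B: "B \<ge> 0" "\<And>z. \<bar>u z\<bar> \<le> B * norm z ^ q" using growth by blast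
  show ?thesis
  proof (rule integrable_gaussian_bound[where k = "q + k + (DIM('a) - 1)" and b = "b / 2" and K = "B * K * exp (b * (norm x)\<^sup>2)"])
    fix z :: 'a
    have "\<bar>u z\<bar> * \<bar>F z\<bar> \<le> (B * norm z ^ q) * (K * norm z ^ k * (exp (b * (norm x)\<^sup>2) * exp (- (b / 2) * (norm z)\<^sup>2)))"
    proof (intro mult_mono B)
      show "\<bar>F z\<bar> \<le> K * norm z ^ k * (exp (b * (norm x)\<^sup>2) * exp (- (b / 2) * (norm z)\<^sup>2))"
        using K by (intro order_trans[OF bd] mult_left_mono gaussian_norm_bound b) auto
    qed (use B in auto)
    note le = mult_right_mono[OF this zero_le_power[OF norm_ge_zero[of z]], of "DIM('a) - 1"]
    have e: "norm z ^ (q + k + (DIM('a) - 1)) = norm z ^ q * norm z ^ k * norm z ^ (DIM('a) - 1)"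
      by (simp only: power_add)
    from le show "\<bar>u z * F z\<bar> * norm z ^ (DIM('a) - 1) \<le>
      B * K * exp (b * (norm x)\<^sup>2) * norm z ^ (q + k + (DIM('a) - 1)) * exp (- (b / 2) * (norm z)\<^sup>2)"
      unfolding e abs_mult by (simp only: mult_ac)
  qed (use b B K in auto)
qed

text \<open>\<open>gauss_moment k x a\<close> is \<open>a ^ h\<close> times the integral of \<open>u\<close> against the \<open>k\<close>-fold Laplacian of
  \<open>exp (- a * (norm (z - x))\<^sup>2)\<close>. Since \<open>a ^ h * exp (- a * r)\<close> is a heat kernel at time
  \<open>1 / (4 * a)\<close>, the Laplacian acts on it as \<open>- 4 * a\<^sup>2\<close> times the derivative with respect to \<open>a\<close>.\<close>

definition gauss_moment :: "nat \<Rightarrow> 'a \<Rightarrow> real \<Rightarrow> real" where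
  "gauss_moment k x a = (LINT z|lborel. u z * (a ^ (k + h) *
     poly (laguerre_poly (real h) k) (a * (norm (z - x))\<^sup>2) * exp (- a * (norm (z - x))\<^sup>2)))"

text \<open>Differentiation under the integral; the recursion of \<open>laguerre_poly\<close> is
  made so that the derivative of the k-th integrand is a multiple of the next one.\<close>

lemma gauss_moment_derivative:
  assumes a: "a > 0"
  shows "(gauss_moment k x has_real_derivative - (1 / (4 * a\<^sup>2)) * gauss_moment (Suc k) x a) (at a)"
proof -
  define p where "p = laguerre_poly (real h) k"
  define p' where "p' = laguerre_poly (real h) (Suc k)"
  obtain C where C: "C \<ge> 0" "\<And>y. y \<ge> 0 \<Longrightarrow> \<bar>poly p y\<bar> \<le> C * exp (1 / 2 * y)" using poly_le_exp[of "1/2" p] by auto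
  obtain C' where C': "C' \<ge> 0" "\<And>y. y \<ge> 0 \<Longrightarrow> \<bar>poly p' y\<bar> \<le> C' * exp (1 / 2 * y)" using poly_le_exp[of "1/2" p'] by auto
  have bound: "\<bar>s * poly r (t * v) * exp (- t * v)\<bar> \<le> \<bar>s\<bar> * D * exp (- (t / 2) * v)"
    if D: "D \<ge> 0" "\<And>y. y \<ge> 0 \<Longrightarrow> \<bar>poly r y\<bar> \<le> D * exp (1 / 2 * y)" and "t > 0" "v \<ge> 0" for s D t v :: real and r :: "real poly"
  proof -
    have "\<bar>poly r (t * v)\<bar> * exp (- t * v) \<le> (D * exp (1 / 2 * (t * v))) * exp (- t * v)"
      using that by (intro mult_right_mono D) auto
    also have "\<dots> = D * exp (- (t / 2) * v)" unfolding mult.assoc exp_add[symmetric] by simp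
    finally show ?thesis
      using mult_left_mono[of _ _ "\<bar>s\<bar>"] by (simp add: abs_mult mult.assoc)
  qed
  define F where "F t z = u z * (t ^ (k + h) * poly p (t * (norm (z - x))\<^sup>2) * exp (- t * (norm (z - x))\<^sup>2))" for t z
  define F' where "F' t z = u z * (- (1 / 4) * t ^ (k + h - 1) * poly p' (t * (norm (z - x))\<^sup>2) * exp (- t * (norm (z - x))\<^sup>2))" for t z
  \<comment> \<open>For t between a / 2 and 2 * a the polynomial consumes half of the exponent t,
    and t / 2 is still above a / 4; the power of t is bounded by that of 2 * a.\<close>
  define g where "g z = \<bar>u z\<bar> * ((2 * a) ^ (k + h - 1) * C' * exp (- (a / 4) * (norm (z - x))\<^sup>2))" for z
  have near: "a / 2 < t \<and> t < 2 * a" if "\<bar>t - a\<bar> < a / 2" for t using that a by (auto simp: abs_if split: if_splits)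
  have "((\<lambda>t. LINT z|lborel. F t z) has_real_derivative (LINT z|lborel. F' a z)) (at a)"
  proof (rule has_real_derivative_integral[where \<delta> = "a / 2" and g = g])
    show "0 < a / 2" using a by simp
    show "integrable lborel (F t)" if "\<bar>t - a\<bar> < a / 2" for t
    proof -
      have t: "t > 0" using near[OF that] a by linarith
      have "integrable lborel (\<lambda>z. u z * (t ^ (k + h) * poly p (t * (norm (z - x))\<^sup>2) * exp (- t * (norm (z - x))\<^sup>2)))"
      proof (rule integrable_u_gaussian_bound[where b = "t / 2" and K = "t ^ (k + h) * C" and k = 0 and x = x])
        show "\<bar>t ^ (k + h) * poly p (t * (norm (z - x))\<^sup>2) * exp (- t * (norm (z - x))\<^sup>2)\<bar> \<le>
            t ^ (k + h) * C * norm z ^ 0 * exp (- (t / 2) * (norm (z - x))\<^sup>2)" for z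
          using bound[OF C t, of "(norm (z - x))\<^sup>2" "t ^ (k + h)"] t by simp
        have "continuous_on UNIV (\<lambda>z::'a. t ^ (k + h) * poly p (t * (norm (z - x))\<^sup>2) * exp (- t * (norm (z - x))\<^sup>2))"
          by (intro continuous_intros)
        then show "(\<lambda>z::'a. t ^ (k + h) * poly p (t * (norm (z - x))\<^sup>2) * exp (- t * (norm (z - x))\<^sup>2)) \<in> borel_measurable borel"
          by (rule borel_measurable_continuous_onI)
      qed (use t C in auto)
      then show ?thesis by (simp add: F_def[abs_def])
    qed
    show "((\<lambda>t. F t z) has_real_derivative F' t z) (at t)" if "\<bar>t - a\<bar> < a / 2" for t z
    proof -
      define v where "v = (norm (z - x))\<^sup>2"
      have t: "t > 0" using near[OF that] a by linarith
      have kh: "k + h = Suc (k + h - 1)" using h_pos by simp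
      have "((\<lambda>t. t ^ (k + h) * poly p (t * v) * exp (- t * v)) has_real_derivative
        (real (k + h) * t ^ (k + h - 1) * poly p (t * v) * exp (- t * v) + t ^ (k + h) * (poly (pderiv p) (t * v) * v) * exp (- t * v)
         - t ^ (k + h) * poly p (t * v) * (exp (- t * v) * v))) (at t)"
        by (auto intro!: derivative_eq_intros simp: algebra_simps)
      also have "real (k + h) * t ^ (k + h - 1) * poly p (t * v) * exp (- t * v) + t ^ (k + h) * (poly (pderiv p) (t * v) * v) * exp (- t * v)
         - t ^ (k + h) * poly p (t * v) * (exp (- t * v) * v) = - (1 / 4) * t ^ (k + h - 1) * poly p' (t * v) * exp (- t * v)"
        unfolding p'_def laguerre_poly.simps p_def[symmetric] by (subst (2 3) kh) (simp add: algebra_simps)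
      finally show ?thesis unfolding F_def F'_def v_def by (intro DERIV_cmult)
    qed
    show "\<bar>F' t z\<bar> \<le> g z" if "\<bar>t - a\<bar> < a / 2" for t z
    proof -
      define v where "v = (norm (z - x))\<^sup>2"
      have v: "v \<ge> 0" by (simp add: v_def)
      have t: "t > 0" "a / 2 < t" "t < 2 * a" using near[OF that] a by linarith+
      have "\<bar>- (1 / 4) * t ^ (k + h - 1) * poly p' (t * v) * exp (- t * v)\<bar> \<le> \<bar>- (1 / 4) * t ^ (k + h - 1)\<bar> * C' * exp (- (t / 2) * v)"
        by (rule bound[OF C' t(1) v])
      also have "\<dots> \<le> (2 * a) ^ (k + h - 1) * C' * exp (- (a / 4) * v)"
      proof (intro mult_mono)
        have "\<bar>- (1 / 4) * t ^ (k + h - 1)\<bar> \<le> t ^ (k + h - 1)" using t by (simp add: abs_mult)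
        also have "\<dots> \<le> (2 * a) ^ (k + h - 1)" using t by (intro power_mono) auto
        finally show "\<bar>- (1 / 4) * t ^ (k + h - 1)\<bar> \<le> (2 * a) ^ (k + h - 1)" .
        have "a / 4 * v \<le> t / 2 * v" using t v by (intro mult_right_mono) auto
        then show "exp (- (t / 2) * v) \<le> exp (- (a / 4) * v)" by simp
      qed (use C' a in auto)
      finally show ?thesis unfolding F'_def g_def v_def abs_mult[of "u z"] by (intro mult_left_mono) auto
    qed
    have "continuous_on UNIV (\<lambda>z::'a. - (1 / 4) * a ^ (k + h - 1) * poly p' (a * (norm (z - x))\<^sup>2) * exp (- a * (norm (z - x))\<^sup>2))"
      by (intro continuous_intros)
    from borel_measurable_times[OF borel_u borel_measurable_continuous_onI[OF this]]
    show "F' a \<in> borel_measurable lborel"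
      unfolding F'_def[abs_def] by simp
    have "integrable lborel (\<lambda>z. u z * ((2 * a) ^ (k + h - 1) * C' * exp (- (a / 4) * (norm (z - x))\<^sup>2)))"
      by (rule integrable_u_gaussian_bound[where b = "a / 4" and K = "(2 * a) ^ (k + h - 1) * C'" and k = 0 and x = x])
        (use a C' in auto)
    from integrable_norm[OF this] show "integrable lborel g"
      using a C' by (simp add: g_def[abs_def] abs_mult)
  qed
  moreover have "(LINT z|lborel. F' a z) = - (1 / (4 * a\<^sup>2)) * gauss_moment (Suc k) x a"
  proof -
    have "a ^ (Suc k + h) = a\<^sup>2 * a ^ (k + h - 1)" using h_pos by (simp add: power_add[symmetric])
    then have "F' a z = - (1 / (4 * a\<^sup>2)) * (u z * (a ^ (Suc k + h) * poly p' (a * (norm (z - x))\<^sup>2) * exp (- a * (norm (z - x))\<^sup>2)))" for z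
      using a by (simp add: F'_def)
    then show ?thesis unfolding gauss_moment_def p'_def[symmetric] by simp
  qed
  moreover have "gauss_moment k x = (\<lambda>t. LINT z|lborel. F t z)"
    by (simp add: gauss_moment_def F_def p_def fun_eq_iff)
  ultimately show ?thesis by simp
qed

text \<open>The substitution of z / sqrt a for z extracts a^(- q / 2) from u and cancels a^h. It
  leaves exp (- a * norm(x)^2) times the integral of u against exp (- norm(z)^2 + 2 * sqrt a * (x
  \<bullet> z)). Evenness of u replaces the last exponential by \<open>cosh\<close>, whose even
  powers of sqrt a are integer powers of a.\<close>

lemma gauss_moment_0_power_series:
  obtains p where "\<And>a. summable (\<lambda>j. p j * a ^ j)" "\<And>a. a > 0 \<Longrightarrow> gauss_moment 0 x a = a powr (- real q / 2) * (\<Sum>j. p j * a ^ j)"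
proof -
  define w where "w z = exp (- (norm z)\<^sup>2)" for z :: 'a
  define c where "c j = 4 ^ j / fact (2 * j) * (LINT z|lborel. u z * w z * (x \<bullet> z) ^ (2 * j))" for j
  define g where "g a j z = (2 * sqrt a * (x \<bullet> z)) ^ (2 * j) / fact (2 * j)" for a j and z :: 'a
  have g_eq: "g a j z = a ^ j * (4 ^ j / fact (2 * j) * (x \<bullet> z) ^ (2 * j))" if "a \<ge> 0" for a j z
    using that by (simp add: g_def power_mult_distrib power_mult)
  have g0: "g a j z \<ge> 0" for a j z unfolding g_def by simp
  have gs: "(\<lambda>j. g a j z) sums cosh (2 * sqrt a * (x \<bullet> z))" for a z
  proof -
    let ?t = "2 * sqrt a * (x \<bullet> z)"
    have "(\<lambda>n. if even n then ?t ^ n /\<^sub>R fact n else 0) sums cosh ?t" by (rule cosh_converges)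
    then have "(\<lambda>j. (\<lambda>n. if even n then ?t ^ n /\<^sub>R fact n else 0) (2 * j)) sums cosh ?t"
      by (subst sums_mono_reindex[of "\<lambda>j. 2 * j"]) (auto simp: strict_mono_def elim!: evenE)
    then show ?thesis by (simp add: g_def divide_inverse mult.commute)
  qed
  have g_le: "(\<Sum>j<k. g a j z) \<le> cosh (2 * sqrt a * (x \<bullet> z))" for a k z
    using sum_le_suminf[of "\<lambda>j. g a j z" "{..<k}"] gs[of a z] g0 by (auto simp: sums_iff)
  have cosh_eq: "w z * exp (2 * sqrt a * (x \<bullet> z)) = exp (a * (norm x)\<^sup>2) * exp (- 1 * (norm (z - sqrt a *\<^sub>R x))\<^sup>2)" if "a \<ge> 0" for a z
  proof -
    have "(norm (z - sqrt a *\<^sub>R x))\<^sup>2 = (norm z)\<^sup>2 - 2 * sqrt a * (x \<bullet> z) + a * (norm x)\<^sup>2"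
      using that unfolding power2_norm_eq_inner
      by (simp add: inner_diff_left inner_diff_right inner_commute algebra_simps)
    then show ?thesis unfolding w_def exp_add[symmetric] by simp
  qed
  have int_exp: "integrable lborel (\<lambda>z. u z * (w z * exp (2 * s * (x \<bullet> z))))" for s :: real
  proof -
    define y where "y = (if s \<ge> 0 then x else - x)"
    have e: "w z * exp (2 * s * (x \<bullet> z)) = exp (s\<^sup>2 * (norm x)\<^sup>2) * exp (- 1 * (norm (z - s *\<^sub>R x))\<^sup>2)" for z
    proof -
      have "(norm (z - s *\<^sub>R x))\<^sup>2 = (norm z)\<^sup>2 - 2 * s * (x \<bullet> z) + s\<^sup>2 * (norm x)\<^sup>2"
        unfolding power2_norm_eq_inner
        by (simp add: inner_diff_left inner_diff_right inner_commute algebra_simps power2_eq_square)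
      then show ?thesis unfolding w_def exp_add[symmetric] by simp
    qed
    show ?thesis unfolding e
      by (rule integrable_u_gaussian_bound[where b = 1 and K = "exp (s\<^sup>2 * (norm x)\<^sup>2)" and k = 0 and x = "s *\<^sub>R x"]) auto
  qed
  have int_cosh: "integrable lborel (\<lambda>z. u z * (w z * cosh (2 * sqrt a * (x \<bullet> z))))" for a
  proof -
    have "integrable lborel (\<lambda>z. 1/2 * (u z * (w z * exp (2 * sqrt a * (x \<bullet> z)))) + 1/2 * (u z * (w z * exp (2 * (- sqrt a) * (x \<bullet> z)))))"
      by (intro Bochner_Integration.integrable_add integrable_mult_right int_exp)
    then show ?thesis by (simp add: cosh_def algebra_simps add_divide_distrib)
  qed
  have w0: "w z > 0" for z by (simp add: w_def)
  have [measurable]: "w \<in> borel_measurable borel" unfolding w_def by measurable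
  have series: "integrable lborel (\<lambda>z. v z * w z * g a j z)" "(\<lambda>j. LINT z|lborel. v z * w z * g a j z) sums (LINT z|lborel. v z * w z * cosh (2 * sqrt a * (x \<bullet> z)))"
    if v: "v = u \<or> v = (\<lambda>z. \<bar>u z\<bar>)" for v a j
  proof -
    have vu: "\<bar>v z\<bar> = \<bar>u z\<bar>" for z using v by auto
    have [measurable]: "v \<in> borel_measurable borel" using v by auto
    have "\<bar>\<Sum>j<k. v z * w z * g a j z\<bar> \<le> \<bar>u z * (w z * cosh (2 * sqrt a * (x \<bullet> z)))\<bar>" for k z
    proof -
      have "\<bar>\<Sum>j<k. v z * w z * g a j z\<bar> = \<bar>u z\<bar> * (w z * \<bar>\<Sum>j<k. g a j z\<bar>)"
        unfolding sum_distrib_left[symmetric] using w0[of z] by (simp add: abs_mult vu)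
      also have "\<dots> \<le> \<bar>u z\<bar> * (w z * cosh (2 * sqrt a * (x \<bullet> z)))"
        using g_le[of a z k] w0[of z] sum_nonneg[of "{..<k}" "\<lambda>j. g a j z"] g0 by (intro mult_left_mono) auto
      finally show ?thesis using w0[of z] by (simp add: abs_mult)
    qed
    note * = sums_integral_dominated[of "\<lambda>j z. v z * w z * g a j z" lborel "\<lambda>z. v z * w z * cosh (2 * sqrt a * (x \<bullet> z))", OF _ _ this integrable_norm[OF int_cosh, unfolded real_norm_def]]
    have gm: "(\<lambda>z. v z * w z * g a j z) \<in> borel_measurable lborel" for j unfolding g_def by measurable
    have sm: "(\<lambda>j. v z * w z * g a j z) sums (v z * w z * cosh (2 * sqrt a * (x \<bullet> z)))" for z by (rule sums_mult[OF gs])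
    show "integrable lborel (\<lambda>z. v z * w z * g a j z)" by (rule *(1)[OF gm sm])
    show "(\<lambda>j. LINT z|lborel. v z * w z * g a j z) sums (LINT z|lborel. v z * w z * cosh (2 * sqrt a * (x \<bullet> z)))"
      by (rule *(3)[OF gm sm])
  qed
  have term_eq: "(LINT z|lborel. u z * w z * g a j z) = c j * a ^ j" if "a \<ge> 0" for a j
  proof -
    have "(LINT z|lborel. u z * w z * g a j z) = (LINT z|lborel. (a ^ j * (4 ^ j / fact (2 * j))) * (u z * w z * (x \<bullet> z) ^ (2 * j)))"
      by (simp add: g_eq[OF that] mult_ac)
    then show ?thesis by (simp add: c_def)
  qed
  have csum: "(\<lambda>j. c j * a ^ j) sums (LINT z|lborel. u z * w z * cosh (2 * sqrt a * (x \<bullet> z)))" if "a \<ge> 0" for a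
    using series(2)[of u a] by (simp add: term_eq[OF that])
  \<comment> \<open>Comparison with the same series for \<bar>u\<bar>, which has nonnegative terms,
    gives absolute convergence for every real a; the Cauchy product with the exponential requires
    it.\<close>
  have cabs: "summable (\<lambda>j. \<bar>c j * a ^ j\<bar>)" for a
  proof (rule summable_comparison_test')
    show "summable (\<lambda>j. LINT z|lborel. \<bar>u z\<bar> * w z * g \<bar>a\<bar> j z)"
      using series(2)[of "\<lambda>z. \<bar>u z\<bar>" "\<bar>a\<bar>"] by (simp add: sums_iff)
    show "norm \<bar>c j * a ^ j\<bar> \<le> (LINT z|lborel. \<bar>u z\<bar> * w z * g \<bar>a\<bar> j z)" for j
    proof -
      have "\<bar>c j * a ^ j\<bar> = \<bar>LINT z|lborel. u z * w z * g \<bar>a\<bar> j z\<bar>"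
        by (subst term_eq) (simp_all add: abs_mult power_abs)
      also have "\<dots> \<le> (LINT z|lborel. \<bar>u z * w z * g \<bar>a\<bar> j z\<bar>)" by (rule integral_abs_bound)
      also have "\<dots> = (LINT z|lborel. \<bar>u z\<bar> * w z * g \<bar>a\<bar> j z)"
        using w0 g0 by (simp add: abs_mult less_imp_le abs_of_pos)
      finally show ?thesis by simp
    qed
  qed
  \<comment> \<open>Coefficients of the product with exp (- a * norm(x)^2).\<close>
  define p where "p k = (\<Sum>i\<le>k. (- (norm x)\<^sup>2) ^ i / fact i * c (k - i))" for k
  have p: "summable (\<lambda>j. p j * a ^ j)" "exp (- (norm x)\<^sup>2 * a) * (\<Sum>j. c j * a ^ j) = (\<Sum>j. p j * a ^ j)" for a
    using power_series_times_exp[OF cabs, of "- (norm x)\<^sup>2" a] by (simp_all add: p_def sums_iff)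
  show ?thesis
  proof (rule that[OF p(1)])
    fix a :: real assume a: "a > 0"
    have "gauss_moment 0 x a = a ^ h * (LINT z|lborel. u z * exp (- a * (norm (z - x))\<^sup>2))"
      by (subst integral_mult_right_zero[symmetric]) (simp add: gauss_moment_def mult_ac)
    also have "(LINT z|lborel. u z * exp (- a * (norm (z - x))\<^sup>2)) =
       \<bar>1 / sqrt a\<bar> ^ DIM('a) * (LINT z|lborel. u (0 + (1 / sqrt a) *\<^sub>R z) * exp (- a * (norm (0 + (1 / sqrt a) *\<^sub>R z - x))\<^sup>2))"
      by (rule lebesgue_integral_dilate) (use a in auto)
    also have "(LINT z|lborel. u (0 + (1 / sqrt a) *\<^sub>R z) * exp (- a * (norm (0 + (1 / sqrt a) *\<^sub>R z - x))\<^sup>2)) =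
       (LINT z|lborel. ((1 / sqrt a) ^ q * exp (- (norm x)\<^sup>2 * a)) * (u z * (w z * exp (2 * sqrt a * (x \<bullet> z)))))"
    proof (intro Bochner_Integration.integral_cong refl)
      fix z :: 'a
      have "a * (norm ((1 / sqrt a) *\<^sub>R z - x))\<^sup>2 = (sqrt a * norm ((1 / sqrt a) *\<^sub>R z - x))\<^sup>2"
        using a by (simp add: power_mult_distrib)
      also have "sqrt a * norm ((1 / sqrt a) *\<^sub>R z - x) = norm (sqrt a *\<^sub>R ((1 / sqrt a) *\<^sub>R z - x))" using a by simp
      also have "sqrt a *\<^sub>R ((1 / sqrt a) *\<^sub>R z - x) = z - sqrt a *\<^sub>R x" using a by (simp add: scaleR_diff_right)
      finally have e1: "exp (- a * (norm ((1 / sqrt a) *\<^sub>R z - x))\<^sup>2) = exp (- 1 * (norm (z - sqrt a *\<^sub>R x))\<^sup>2)" by simp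
      have "exp (- (norm x)\<^sup>2 * a) * (exp (a * (norm x)\<^sup>2) * exp (- 1 * (norm (z - sqrt a *\<^sub>R x))\<^sup>2)) = exp (- 1 * (norm (z - sqrt a *\<^sub>R x))\<^sup>2)"
        unfolding exp_add[symmetric] by (simp add: mult.commute)
      then have "exp (- a * (norm ((1 / sqrt a) *\<^sub>R z - x))\<^sup>2) = exp (- (norm x)\<^sup>2 * a) * (w z * exp (2 * sqrt a * (x \<bullet> z)))"
        unfolding cosh_eq[OF less_imp_le[OF a]] e1 by simp
      then show "u (0 + (1 / sqrt a) *\<^sub>R z) * exp (- a * (norm (0 + (1 / sqrt a) *\<^sub>R z - x))\<^sup>2) =
        ((1 / sqrt a) ^ q * exp (- (norm x)\<^sup>2 * a)) * (u z * (w z * exp (2 * sqrt a * (x \<bullet> z))))"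
        using a by (simp add: hom)
    qed
    also have "\<dots> = ((1 / sqrt a) ^ q * exp (- (norm x)\<^sup>2 * a)) * (LINT z|lborel. u z * (w z * exp (2 * sqrt a * (x \<bullet> z))))"
      by (rule integral_mult_right_zero)
    \<comment> \<open>Reflection in the origin and evenness of u; the odd powers of sqrt a drop out
      here.\<close>
    also have "(LINT z|lborel. u z * (w z * exp (2 * sqrt a * (x \<bullet> z)))) = (LINT z|lborel. u z * w z * cosh (2 * sqrt a * (x \<bullet> z)))"
    proof -
      have m[measurable]: "(\<lambda>z. u z * (w z * exp (2 * sqrt a * (x \<bullet> z)))) \<in> borel_measurable borel" by measurable
      have "(LINT z|lborel. u z * (w z * exp (2 * sqrt a * (x \<bullet> z)))) = (LINT z|lborel. u z * (w z * exp (2 * (- sqrt a) * (x \<bullet> z))))"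
        using lebesgue_integral_dilate[OF m, of "-1" 0] by (simp add: even_u w_def)
      then have "2 * (LINT z|lborel. u z * (w z * exp (2 * sqrt a * (x \<bullet> z)))) =
        (LINT z|lborel. u z * (w z * exp (2 * sqrt a * (x \<bullet> z)))) + (LINT z|lborel. u z * (w z * exp (2 * (- sqrt a) * (x \<bullet> z))))" by simp
      also have "\<dots> = (LINT z|lborel. u z * (w z * exp (2 * sqrt a * (x \<bullet> z))) + u z * (w z * exp (2 * (- sqrt a) * (x \<bullet> z))))"
        by (intro Bochner_Integration.integral_add[symmetric] int_exp)
      also have "\<dots> = (LINT z|lborel. 2 * (u z * w z * cosh (2 * sqrt a * (x \<bullet> z))))"
        by (intro Bochner_Integration.integral_cong refl) (simp add: cosh_def algebra_simps)
      finally show ?thesis by simp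
    qed
    also have "\<dots> = (\<Sum>j. c j * a ^ j)" using csum[of a] a by (simp add: sums_iff)
    finally have "gauss_moment 0 x a = a ^ h * \<bar>1 / sqrt a\<bar> ^ DIM('a) * (1 / sqrt a) ^ q * (exp (- (norm x)\<^sup>2 * a) * (\<Sum>j. c j * a ^ j))"
      by (simp add: mult_ac)
    also have "a ^ h * \<bar>1 / sqrt a\<bar> ^ DIM('a) = 1"
    proof -
      have "a * (1 / sqrt a)\<^sup>2 = 1" using a by (simp add: power_divide)
      then show ?thesis using a by (simp add: n power_mult power_mult_distrib[symmetric])
    qed
    also have "(1 / sqrt a) ^ q = a powr (- real q / 2)"
      using a by (simp add: powr_half_sqrt[symmetric] powr_minus_divide powr_realpow[symmetric] powr_powr power_one_over)
    finally show "gauss_moment 0 x a = a powr (- real q / 2) * (\<Sum>j. p j * a ^ j)" unfolding p(2) by simp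
  qed
qed

end

section \<open>Higher moments and the limit for concentrated Gaussians\<close>

context homogeneous_function begin

lemma half_integer_q: "half_integer (- real q / 2)"
proof -
  obtain k where "q = 2 * k + 1" using q by (elim oddE)
  then have "- real q / 2 = of_int (- int k - 1) + 1 / 2" by (simp add: field_simps)
  then show ?thesis unfolding half_integer_def by blast
qed

text \<open>The operator - 4 * a^2 * d / da sends a^(\<beta> + j) to - 4 * (\<beta> + j) *
  a^(\<beta> + j + 1). Applied k times to the powers a^(j - q / 2), it produces the Pochhammer
  symbol and shifts the common exponent by k.\<close>

lemma gauss_moment_power_series:
  obtains p where
    "\<And>k a. summable (\<lambda>j. p j * (- 4) ^ k * pochhammer (real j - real q / 2) k * a ^ j)"
    "\<And>k a. a > 0 \<Longrightarrow> gauss_moment k x a = a powr (real k - real q / 2) *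
       (\<Sum>j. p j * (- 4) ^ k * pochhammer (real j - real q / 2) k * a ^ j)"
proof -
  obtain p where p: "\<And>a. summable (\<lambda>j. p j * a ^ j)"
    "\<And>a. a > 0 \<Longrightarrow> gauss_moment 0 x a = a powr (- real q / 2) * (\<Sum>j. p j * a ^ j)"
    using gauss_moment_0_power_series by blast
  define s where "s k j = p j * (- 4) ^ k * pochhammer (real j - real q / 2) k" for k j
  have main: "(\<forall>a. summable (\<lambda>j. s k j * a ^ j)) \<and>
      (\<forall>a>0. gauss_moment k x a = a powr (real k - real q / 2) * (\<Sum>j. s k j * a ^ j))" for k
  proof (induction k)
    case 0
    then show ?case using p by (simp add: s_def)
  next
    case (Suc k)
    define \<beta> where "\<beta> = real k - real q / 2"
    have sm: "summable (\<lambda>j. s k j * a ^ j)" for a using Suc by blast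
    have step: "s (Suc k) j * a ^ j = - 4 * (\<beta> * (s k j * a ^ j) + real j * s k j * a ^ j)" for j a
      by (simp add: s_def \<beta>_def pochhammer_Suc algebra_simps)
    \<comment> \<open>The Euler operator a * d / da multiplies the j-th coefficient by j; the term
      for j = 0 vanishes, which accounts for the shift of index.\<close>
    have euler: "(\<lambda>j. real j * s k j * a ^ j) sums (a * (\<Sum>j. diffs (s k) j * a ^ j))" for a
    proof -
      have "summable (\<lambda>j. diffs (s k) j * a ^ j)"
        by (rule termdiff_converges_all) (use sm in auto)
      from sums_mult[OF summable_sums[OF this], of a]
      have "(\<lambda>j. real (Suc j) * s k (Suc j) * a ^ Suc j) sums (a * (\<Sum>j. diffs (s k) j * a ^ j))"
        by (simp add: diffs_def mult_ac del: of_nat_Suc)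
      then show ?thesis by (subst (asm) sums_Suc_iff) simp
    qed
    have sums: "(\<lambda>j. s (Suc k) j * a ^ j) sums (- 4 * (\<beta> * (\<Sum>j. s k j * a ^ j) + a * (\<Sum>j. diffs (s k) j * a ^ j)))" for a
      unfolding step by (intro sums_mult sums_add euler summable_sums sm)
    have "gauss_moment (Suc k) x a = a powr (real (Suc k) - real q / 2) * (\<Sum>j. s (Suc k) j * a ^ j)" if a: "a > 0" for a
    proof -
      let ?S = "\<Sum>j. s k j * a ^ j" and ?D = "\<Sum>j. diffs (s k) j * a ^ j"
      have "((\<lambda>a. a powr \<beta> * (\<Sum>j. s k j * a ^ j)) has_real_derivative (\<beta> * a powr (\<beta> - 1)) * ?S + ?D * a powr \<beta>) (at a)"
        by (rule DERIV_mult[OF has_real_derivative_powr[OF a] termdiffs_strong_converges_everywhere[OF sm]])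
      then have "(gauss_moment k x has_real_derivative (\<beta> * a powr (\<beta> - 1)) * ?S + ?D * a powr \<beta>) (at a)"
        by (rule has_field_derivative_transform_within_open[where S = "{0<..}"]) (use a Suc in \<open>auto simp: \<beta>_def\<close>)
      from DERIV_unique[OF this gauss_moment_derivative[OF a]]
      have "(\<beta> * a powr (\<beta> - 1)) * ?S + ?D * a powr \<beta> = - (1 / (4 * a\<^sup>2)) * gauss_moment (Suc k) x a" .
      then have "gauss_moment (Suc k) x a = - 4 * a\<^sup>2 * ((\<beta> * a powr (\<beta> - 1)) * ?S + ?D * a powr \<beta>)"
        using a by (simp add: field_simps)
      also have "\<dots> = a powr (\<beta> + 1) * (- 4 * (\<beta> * ?S + a * ?D))"
      proof -
        have "a powr \<beta> = a * a powr (\<beta> - 1)" "a powr (\<beta> + 1) = a * (a * a powr (\<beta> - 1))"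
          using a powr_mult_base[of a "\<beta> - 1"] powr_mult_base[of a \<beta>] by (simp_all add: add.commute)
        then show ?thesis by (simp add: power2_eq_square algebra_simps)
      qed
      also have "- 4 * (\<beta> * ?S + a * ?D) = (\<Sum>j. s (Suc k) j * a ^ j)" using sums[of a] by (simp add: sums_iff)
      finally show ?thesis by (simp add: \<beta>_def add.commute add_diff_eq)
    qed
    moreover have "summable (\<lambda>j. s (Suc k) j * a ^ j)" for a using sums by (rule sums_summable)
    ultimately show ?case by blast
  qed
  show ?thesis by (rule that[of p]) (use main in \<open>auto simp: s_def\<close>)
qed

text \<open>The normalised Gaussian of total mass pi^h concentrates at x. The parameter a runs
  through squares so that the substitution x + z / s involves no root.\<close>

lemma gauss_moment_limit:
  "(\<lambda>k. gauss_moment 0 x ((real (Suc k))\<^sup>2)) \<longlonglongrightarrow> pi ^ h * u x"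
proof -
  have e: "gauss_moment 0 x ((real (Suc k))\<^sup>2) = (LINT z|lborel. u (x + (1 / real (Suc k)) *\<^sub>R z) * exp (- (norm z)\<^sup>2))" for k
  proof -
    define s where "s = real (Suc k)"
    have s: "s > 0" by (simp add: s_def)
    have "gauss_moment 0 x (s\<^sup>2) = (s\<^sup>2) ^ h * (LINT z|lborel. u z * exp (- s\<^sup>2 * (norm (z - x))\<^sup>2))"
      by (subst integral_mult_right_zero[symmetric]) (simp add: gauss_moment_def mult_ac)
    also have "(LINT z|lborel. u z * exp (- s\<^sup>2 * (norm (z - x))\<^sup>2)) = \<bar>1 / s\<bar> ^ DIM('a) *
        (LINT z|lborel. u (x + (1 / s) *\<^sub>R z) * exp (- s\<^sup>2 * (norm (x + (1 / s) *\<^sub>R z - x))\<^sup>2))"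
      by (rule lebesgue_integral_dilate) (use s in auto)
    also have "(LINT z|lborel. u (x + (1 / s) *\<^sub>R z) * exp (- s\<^sup>2 * (norm (x + (1 / s) *\<^sub>R z - x))\<^sup>2)) =
       (LINT z|lborel. u (x + (1 / s) *\<^sub>R z) * exp (- (norm z)\<^sup>2))"
      using s by (intro Bochner_Integration.integral_cong refl) (simp add: power_mult_distrib power_divide)
    finally show ?thesis using s unfolding s_def[symmetric] by (simp add: n power_mult power_mult_distrib[symmetric] mult.assoc[symmetric] power_divide)
  qed
  obtain B where B: "B \<ge> 0" "\<And>z. \<bar>u z\<bar> \<le> B * norm z ^ q" using growth by blast
  \<comment> \<open>A majorant independent of k, because the displacement of x is at most
    \<open>norm z\<close>.\<close>
  define w where "w z = B * (norm x + norm z) ^ q * exp (- 1 * (norm z)\<^sup>2)" for z :: 'a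
  have w: "integrable lborel w"
  proof -
    have le: "(norm x + norm z) ^ q \<le> (2 * norm x) ^ q + (2 * norm z) ^ q" for z
    proof -
      have "(norm x + norm z) ^ q \<le> (2 * max (norm x) (norm z)) ^ q" by (intro power_mono) auto
      also have "\<dots> \<le> (2 * norm x) ^ q + (2 * norm z) ^ q" by (cases "norm x \<le> norm z") (auto simp: max_def)
      finally show ?thesis .
    qed
    have i: "integrable lborel (\<lambda>z::'a. norm z ^ k * exp (- 1 * (norm z)\<^sup>2))" for k
    proof (rule integrable_gaussian_bound[where b = 1 and K = 1 and k = "k + (DIM('a) - 1)"])
      show "\<bar>norm z ^ k * exp (- 1 * (norm z)\<^sup>2)\<bar> * norm z ^ (DIM('a) - 1) \<le>
          1 * norm z ^ (k + (DIM('a) - 1)) * exp (- 1 * (norm z)\<^sup>2)" for z :: 'a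
        unfolding power_add by simp
    qed auto
    have i2: "integrable lborel (\<lambda>z::'a. (B * (2 * norm x) ^ q) * (norm z ^ 0 * exp (- 1 * (norm z)\<^sup>2)) + (B * 2 ^ q) * (norm z ^ q * exp (- 1 * (norm z)\<^sup>2)))"
      by (intro Bochner_Integration.integrable_add integrable_mult_right i)
    show ?thesis
    proof (rule Bochner_Integration.integrable_bound[OF i2])
      show "w \<in> borel_measurable lborel" unfolding w_def by measurable
      show "AE z in lborel. norm (w z) \<le> norm ((B * (2 * norm x) ^ q) * (norm z ^ 0 * exp (- 1 * (norm z)\<^sup>2)) + (B * 2 ^ q) * (norm z ^ q * exp (- 1 * (norm z)\<^sup>2)))"
      proof (rule AE_I2)
        fix z :: 'a
        have "w z \<le> B * ((2 * norm x) ^ q + (2 * norm z) ^ q) * exp (- 1 * (norm z)\<^sup>2)"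
          unfolding w_def using B by (intro mult_right_mono mult_left_mono le) auto
        moreover have "w z \<ge> 0" using B by (simp add: w_def)
        ultimately show "norm (w z) \<le> norm ((B * (2 * norm x) ^ q) * (norm z ^ 0 * exp (- 1 * (norm z)\<^sup>2)) + (B * 2 ^ q) * (norm z ^ q * exp (- 1 * (norm z)\<^sup>2)))"
          by (simp add: power_mult_distrib algebra_simps)
      qed
    qed
  qed
  have "(\<lambda>k. LINT z|lborel. u (x + (1 / real (Suc k)) *\<^sub>R z) * exp (- (norm z)\<^sup>2)) \<longlonglongrightarrow> (LINT z|lborel. u x * exp (- (norm (z::'a))\<^sup>2))"
  proof (rule integral_dominated_convergence[where w = w])
    show "integrable lborel w" by (rule w)
    show "AE z in lborel. (\<lambda>k. u (x + (1 / real (Suc k)) *\<^sub>R z) * exp (- (norm z)\<^sup>2)) \<longlonglongrightarrow> u x * exp (- (norm z)\<^sup>2)"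
    proof (rule AE_I2)
      fix z :: 'a
      have "(\<lambda>k. 1 / real (Suc k)) \<longlonglongrightarrow> 0" by (intro LIMSEQ_Suc lim_1_over_n)
      then have "(\<lambda>k. x + (1 / real (Suc k)) *\<^sub>R z) \<longlonglongrightarrow> x + 0 *\<^sub>R z" by (intro tendsto_intros)
      moreover have "isCont u x" using cont continuous_on_eq_continuous_at open_UNIV by blast
      ultimately have "(\<lambda>k. u (x + (1 / real (Suc k)) *\<^sub>R z)) \<longlonglongrightarrow> u x"
        by (intro isCont_tendsto_compose[where g = u]) auto
      then show "(\<lambda>k. u (x + (1 / real (Suc k)) *\<^sub>R z) * exp (- (norm z)\<^sup>2)) \<longlonglongrightarrow> u x * exp (- (norm z)\<^sup>2)"
        by (intro tendsto_intros)
    qed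
    show "AE z in lborel. norm (u (x + (1 / real (Suc k)) *\<^sub>R z) * exp (- (norm z)\<^sup>2)) \<le> w z" for k
    proof (rule AE_I2)
      fix z :: 'a
      have "norm (x + (1 / real (Suc k)) *\<^sub>R z) \<le> norm x + norm ((1 / real (Suc k)) *\<^sub>R z)" by (rule norm_triangle_ineq)
      also have "norm ((1 / real (Suc k)) *\<^sub>R z) \<le> norm z"
        using mult_right_mono[of "1 / real (Suc k)" 1 "norm z"] by simp
      finally have "norm (x + (1 / real (Suc k)) *\<^sub>R z) ^ q \<le> (norm x + norm z) ^ q" by (intro power_mono) auto
      then have "\<bar>u (x + (1 / real (Suc k)) *\<^sub>R z)\<bar> \<le> B * (norm x + norm z) ^ q"
        using B(2)[of "x + (1 / real (Suc k)) *\<^sub>R z"] mult_left_mono[OF _ B(1)] order_trans by blast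
      from mult_right_mono[OF this, of "exp (- (norm z)\<^sup>2)"]
      show "norm (u (x + (1 / real (Suc k)) *\<^sub>R z) * exp (- (norm z)\<^sup>2)) \<le> w z" by (simp add: w_def abs_mult)
    qed
  qed measurable
  also have "(LINT z|lborel. u x * exp (- (norm (z::'a))\<^sup>2)) = pi ^ h * u x"
  proof -
    have "(LINT z|lborel. exp (- (norm (z::'a))\<^sup>2)) = pi ^ h"
      by (subst integral_eq_nn_integral) (simp_all add: nn_integral_gaussian n powr_realpow)
    then show ?thesis by simp
  qed
  finally show ?thesis unfolding e .
qed

end

text \<open>The equation 2 * m + 1 = n + q fixes m without truncated division. The degree of f is
  then q - 2 * m = 1 - n, written as division by a natural power.\<close>

locale homogeneous_laplacian = homogeneous_function u q h
  for u :: "'a::euclidean_space \<Rightarrow> real" and q h +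
  fixes f :: "'a \<Rightarrow> real" and m :: nat
  assumes borel_f [measurable]: "f \<in> borel_measurable borel"
    and int_f: "integrable sphere_measure f"
    and hom_f: "t > 0 \<Longrightarrow> x \<noteq> 0 \<Longrightarrow> f (t *\<^sub>R x) = f x / t ^ (DIM('a) - 1)"
    and m: "2 * m + 1 = DIM('a) + q"
    and weak: "test_function_on (- {0}) \<phi> \<Longrightarrow>
      (LINT z|lborel. u z * (laplacian ^^ m) \<phi> z) = (LINT z|lborel. f z * \<phi> z)"
begin

text \<open>On a ray the Gaussian centred at - x reproduces the one centred at x on the opposite
  ray, so the sum is an integral over the full line. There Pythagoras splits off the distance of x
  from the line.\<close>

lemma nn_integral_ray_gaussian:
  assumes a: "a > 0" and \<theta>: "norm \<theta> = 1"
  shows "(\<integral>\<^sup>+r. indicator {0<..} r * ennreal (exp (- a * (norm (r *\<^sub>R \<theta> - x))\<^sup>2) + exp (- a * (norm (r *\<^sub>R \<theta> + x))\<^sup>2)) \<partial>lborel) =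
    ennreal (sqrt (pi / a) * exp (- a * (norm (orth_part \<theta> x))\<^sup>2))"
proof -
  let ?g = "\<lambda>r. exp (- a * (norm (r *\<^sub>R \<theta> - x))\<^sup>2)"
  have neg: "norm (r *\<^sub>R \<theta> + x) = norm ((- r) *\<^sub>R \<theta> - x)" for r
  proof -
    have "r *\<^sub>R \<theta> + x = - ((- r) *\<^sub>R \<theta> - x)" by simp
    then show ?thesis by (simp only: norm_minus_cancel)
  qed
  have "(\<integral>\<^sup>+r. indicator {0<..} r * ennreal (?g r + exp (- a * (norm (r *\<^sub>R \<theta> + x))\<^sup>2)) \<partial>lborel) =
     (\<integral>\<^sup>+r. indicator {0<..} r * ennreal (?g r) + indicator {0<..} r * ennreal (?g (- r)) \<partial>lborel)"
    unfolding neg by (intro nn_integral_cong) (simp add: distrib_left)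
  also have "\<dots> = (\<integral>\<^sup>+r. indicator {0<..} r * ennreal (?g r) \<partial>lborel) + (\<integral>\<^sup>+r. indicator {0<..} r * ennreal (?g (- r)) \<partial>lborel)"
    by (rule nn_integral_add) measurable
  also have "(\<integral>\<^sup>+r. indicator {0<..} r * ennreal (?g (- r)) \<partial>lborel) = (\<integral>\<^sup>+r. indicator {0<..} (- r) * ennreal (?g r) \<partial>lborel)"
  proof -
    have um: "(\<lambda>r::real. - r) \<in> borel_measurable borel" by measurable
    have ind: "(\<lambda>r::real. indicator {0<..} (- r) :: ennreal) \<in> borel_measurable borel"
      using measurable_compose[OF um borel_measurable_indicator[of "{0<..} :: real set" borel]]
      by simp
    have "(\<lambda>r. ennreal (?g r)) \<in> borel_measurable borel" by measurable
    from borel_measurable_times_ennreal[OF ind this]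
    have negm: "(\<lambda>r. indicator {0<..} (- r) * ennreal (?g r)) \<in> borel_measurable borel" .
    have "(\<integral>\<^sup>+r. indicator {0<..} (- r) * ennreal (?g r) \<partial>lborel) =
        ennreal \<bar>- 1\<bar> * (\<integral>\<^sup>+r. indicator {0<..} (- (0 + (- 1) * r)) * ennreal (?g (0 + (- 1) * r)) \<partial>lborel)"
      by (rule nn_integral_real_affine[OF negm]) simp
    also have "\<dots> = (\<integral>\<^sup>+r. indicator {0<..} r * ennreal (?g (- r)) \<partial>lborel)"
      by (simp add: indicator_def)
    finally show ?thesis ..
  qed
  also have "(\<integral>\<^sup>+r. indicator {0<..} r * ennreal (?g r) \<partial>lborel) + (\<integral>\<^sup>+r. indicator {0<..} (- r) * ennreal (?g r) \<partial>lborel)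
     = (\<integral>\<^sup>+r. indicator {0<..} r * ennreal (?g r) + indicator {0<..} (- r) * ennreal (?g r) \<partial>lborel)"
    by (rule nn_integral_add[symmetric]) measurable
  also have "\<dots> = (\<integral>\<^sup>+r. ennreal (?g r) \<partial>lborel)"
  proof (rule nn_integral_cong_AE)
    have "AE r in lborel. r \<noteq> (0::real)" by (auto intro!: AE_I[of _ _ "{0}"])
    then show "AE r in lborel. indicator {0<..} r * ennreal (?g r) + indicator {0<..} (- r) * ennreal (?g r) = ennreal (?g r)"
      by eventually_elim (auto simp: indicator_def)
  qed
  also have "\<dots> = (\<integral>\<^sup>+r. ennreal (exp (- a * (norm (orth_part \<theta> x))\<^sup>2)) * ennreal (exp (- a * (r - x \<bullet> \<theta>)\<^sup>2)) \<partial>lborel)"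
  proof (rule nn_integral_cong)
    fix r
    have "\<theta> \<bullet> \<theta> = 1" using \<theta> by (simp add: norm_eq_1)
    then have "(r *\<^sub>R \<theta> - x) \<bullet> \<theta> = r - x \<bullet> \<theta>" "orth_part \<theta> (r *\<^sub>R \<theta> - x) = - orth_part \<theta> x"
      by (simp_all add: inner_diff_left orth_part_def algebra_simps)
    then have "(norm (r *\<^sub>R \<theta> - x))\<^sup>2 = (r - x \<bullet> \<theta>)\<^sup>2 + (norm (orth_part \<theta> x))\<^sup>2"
      using norm_orth_part[OF \<theta>, of "r *\<^sub>R \<theta> - x"] by simp
    then show "ennreal (?g r) = ennreal (exp (- a * (norm (orth_part \<theta> x))\<^sup>2)) * ennreal (exp (- a * (r - x \<bullet> \<theta>)\<^sup>2))"
      by (simp add: ennreal_mult[symmetric] exp_add[symmetric] algebra_simps)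
  qed
  also have "\<dots> = ennreal (exp (- a * (norm (orth_part \<theta> x))\<^sup>2)) * (\<integral>\<^sup>+r. ennreal (exp (- a * (r - x \<bullet> \<theta>)\<^sup>2)) \<partial>lborel)"
    by (rule nn_integral_cmult) measurable
  also have "(\<integral>\<^sup>+r. ennreal (exp (- a * (r - x \<bullet> \<theta>)\<^sup>2)) \<partial>lborel) =
      ennreal \<bar>1 / sqrt a\<bar> * (\<integral>\<^sup>+r. ennreal (exp (- a * (x \<bullet> \<theta> + 1 / sqrt a * r - x \<bullet> \<theta>)\<^sup>2)) \<partial>lborel)"
    by (rule nn_integral_real_affine) (measurable, use a in simp)
  also have "(\<integral>\<^sup>+r. ennreal (exp (- a * (x \<bullet> \<theta> + 1 / sqrt a * r - x \<bullet> \<theta>)\<^sup>2)) \<partial>lborel) = ennreal (sqrt pi)"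
    using nn_integral_gaussian_abs_moment[of 0] a by (simp add: Gamma_one_half_real power_divide)
  also have "ennreal \<bar>1 / sqrt a\<bar> * ennreal (sqrt pi) = ennreal (sqrt (pi / a))"
    using a by (simp add: ennreal_mult[symmetric] real_sqrt_divide)
  also have "ennreal (exp (- a * (norm (orth_part \<theta> x))\<^sup>2)) * ennreal (sqrt (pi / a)) =
      ennreal (sqrt (pi / a) * exp (- a * (norm (orth_part \<theta> x))\<^sup>2))"
    using a by (simp add: ennreal_mult[symmetric] mult.commute)
  finally show ?thesis .
qed

text \<open>Symmetrising the Gaussian in x closes the radial integral for each single direction,
  whatever the symmetry of f.\<close>

lemma integral_f_gaussian:
  assumes a: "a > 0"
  shows "integrable lborel (\<lambda>z. f z * (exp (- a * (norm (z - x))\<^sup>2) + exp (- a * (norm (z + x))\<^sup>2)))"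
    and "(LINT z|lborel. f z * (exp (- a * (norm (z - x))\<^sup>2) + exp (- a * (norm (z + x))\<^sup>2))) =
      sqrt (pi / a) * (LINT \<theta>|sphere_measure. f \<theta> * exp (- a * (norm (orth_part \<theta> x))\<^sup>2))"
proof -
  let ?\<phi> = "\<lambda>z. exp (- a * (norm (z - x))\<^sup>2) + exp (- a * (norm (z + x))\<^sup>2)"
  let ?\<Phi> = "\<lambda>\<theta>. sqrt (pi / a) * exp (- a * (norm (orth_part \<theta> x))\<^sup>2)"
  have b: "0 \<le> ?\<Phi> \<theta> \<and> ?\<Phi> \<theta> \<le> sqrt (pi / a)" for \<theta>
    using a by (auto intro!: mult_left_le)
  note * = integral_polar_homogeneous[OF borel_f int_f hom_f, of ?\<phi> ?\<Phi> "sqrt (pi / a)"]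
  show "integrable lborel (\<lambda>z. f z * ?\<phi> z)"
    by (rule *(1)) (use b nn_integral_ray_gaussian[OF a] in \<open>auto intro: add_nonneg_nonneg\<close>)
  have "(LINT z|lborel. f z * ?\<phi> z) = (LINT \<theta>|sphere_measure. f \<theta> * ?\<Phi> \<theta>)"
    by (rule *(2)) (use b nn_integral_ray_gaussian[OF a] in \<open>auto intro: add_nonneg_nonneg\<close>)
  also have "\<dots> = sqrt (pi / a) * (LINT \<theta>|sphere_measure. f \<theta> * exp (- a * (norm (orth_part \<theta> x))\<^sup>2))"
    by (subst integral_mult_right_zero[symmetric]) (simp add: mult_ac)
  finally show "(LINT z|lborel. f z * ?\<phi> z) = sqrt (pi / a) * (LINT \<theta>|sphere_measure. f \<theta> * exp (- a * (norm (orth_part \<theta> x))\<^sup>2))" .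
qed

lemma integrable_f_gaussian:
  assumes a: "a > 0"
  shows "integrable lborel (\<lambda>z. f z * exp (- a * (norm (z - x))\<^sup>2))"
  by (rule Bochner_Integration.integrable_bound[OF integral_f_gaussian(1)[OF a, of x]])
    (auto simp: abs_mult intro!: AE_I2 mult_left_mono)

text \<open>The weak equation extends to Gaussians: near the origin the integrand is of order
  \<open>norm z ^ (q - 2 * m) = norm z ^ (1 - DIM('a))\<close>, which is integrable.\<close>

lemma weak_gaussian:
  assumes a: "a > 0"
  shows "(LINT z|lborel. u z * (laplacian ^^ m) (\<lambda>z. exp (- a * (norm (z - x))\<^sup>2)) z) =
    (LINT z|lborel. f z * exp (- a * (norm (z - x))\<^sup>2))"
proof -
  let ?g = "\<lambda>z::'a. exp (- a * (norm (z - x))\<^sup>2)"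
  obtain \<phi> C where \<phi>: "\<And>j. test_function_on (- {0}) (\<phi> j)" and C: "C \<ge> 0"
    and \<phi>1: "\<And>j z. z \<noteq> 0 \<Longrightarrow> \<bar>\<phi> j z\<bar> \<le> C * ?g z"
    and \<phi>2: "\<And>j z. z \<noteq> 0 \<Longrightarrow> \<bar>(laplacian ^^ m) (\<phi> j) z\<bar> \<le>
       C * max 1 (norm z) ^ (2 * m) * exp (- (a / 2) * (norm (z - x))\<^sup>2) / norm z ^ (2 * m)"
    and \<phi>3: "\<And>z. z \<noteq> 0 \<Longrightarrow> \<forall>\<^sub>F j in sequentially. \<phi> j z = ?g z \<and> (laplacian ^^ m) (\<phi> j) z = (laplacian ^^ m) ?g z"
    using gaussian_test_approximation[OF a, of x m] by blast
  obtain B where B: "B \<ge> 0" "\<And>z. \<bar>u z\<bar> \<le> B * norm z ^ q" using growth by blast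
  have ne0: "AE z in lborel. z \<noteq> (0::'a)" by (auto intro!: AE_I[of _ _ "{0}"])
  have C_k_meas: "F \<in> borel_measurable borel" if "C_k k F" for k and F :: "'a \<Rightarrow> real"
    using C_k_continuous[OF that] by (rule borel_measurable_continuous_onI)
  have [measurable]: "\<phi> j \<in> borel_measurable borel" for j
    using \<phi>[of j] by (intro C_k_meas[of 0]) (auto simp: test_function_on_def)
  have [measurable]: "(laplacian ^^ m) (\<phi> j) \<in> borel_measurable borel" for j
    using \<phi>[of j] by (intro C_k_meas[of 0] C_k_laplacian_pow) (auto simp: test_function_on_def)
  have [measurable]: "(laplacian ^^ m) ?g \<in> borel_measurable borel"
    by (intro C_k_meas[of 0] C_k_laplacian_pow C_k_gaussian)
  have 1: "(\<lambda>j. LINT z|lborel. f z * \<phi> j z) \<longlonglongrightarrow> (LINT z|lborel. f z * ?g z)"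
  proof (rule integral_dominated_convergence[where w = "\<lambda>z. C * \<bar>f z * ?g z\<bar>"])
    show "integrable lborel (\<lambda>z. C * \<bar>f z * ?g z\<bar>)"
      using integrable_norm[OF integrable_f_gaussian[OF a, of x]] by (intro integrable_mult_right) simp
    show "AE z in lborel. (\<lambda>j. f z * \<phi> j z) \<longlonglongrightarrow> f z * ?g z"
      using ne0 by eventually_elim (intro tendsto_mult tendsto_const tendsto_eventually eventually_mono[OF \<phi>3], auto)
    show "AE z in lborel. norm (f z * \<phi> j z) \<le> C * \<bar>f z * ?g z\<bar>" for j
      using ne0
    proof eventually_elim
      case (elim z)
      from mult_left_mono[OF \<phi>1[OF elim, of j], of "\<bar>f z\<bar>"] show ?case by (simp add: abs_mult mult_ac)
    qed
  qed measurable
  define w where "w z = B * norm z ^ q * (C * max 1 (norm z) ^ (2 * m) * exp (- (a / 2) * (norm (z - x))\<^sup>2) / norm z ^ (2 * m))" for z :: 'a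
  have w: "integrable lborel w"
  proof -
    define K where "K = B * C * exp (a / 2 * (norm x)\<^sup>2)"
    have K: "K \<ge> 0" using B C by (simp add: K_def)
    have bd: "\<bar>w z\<bar> * norm z ^ (DIM('a) - 1) \<le> K * (1 + norm z ^ (2 * m)) * exp (- (a / 4) * (norm z)\<^sup>2)" if z: "z \<noteq> 0" for z
    proof -
      \<comment> \<open>The growth of u and the Jacobian together have degree q + n - 1 = 2 * m and
        cancel the singular factor left by the cutoffs exactly.\<close>
      have qm: "norm z ^ q * norm z ^ (DIM('a) - 1) = norm z ^ (2 * m)"
      proof -
        have "q + (DIM('a) - 1) = 2 * m" using m DIM_positive[where 'a = 'a] by linarith
        then show ?thesis by (simp add: power_add[symmetric])
      qed
      have w0: "w z \<ge> 0" using B C by (simp add: w_def)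
      have "w z * norm z ^ (DIM('a) - 1) = (B * C * max 1 (norm z) ^ (2 * m) * exp (- (a / 2) * (norm (z - x))\<^sup>2)) *
          (norm z ^ q * norm z ^ (DIM('a) - 1)) / norm z ^ (2 * m)" by (simp add: w_def)
      also have "\<dots> = B * C * max 1 (norm z) ^ (2 * m) * exp (- (a / 2) * (norm (z - x))\<^sup>2)"
        unfolding qm using z by simp
      also have "\<dots> \<le> B * C * (1 + norm z ^ (2 * m)) * (exp (a / 2 * (norm x)\<^sup>2) * exp (- (a / 2 / 2) * (norm z)\<^sup>2))"
      proof (intro mult_mono gaussian_norm_bound)
        show "max 1 (norm z) ^ (2 * m) \<le> 1 + norm z ^ (2 * m)" by (cases "norm z \<ge> 1") (auto simp: max_def)
      qed (use B C a in auto)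
      finally show ?thesis using w0 by (simp add: K_def mult_ac)
    qed
    show ?thesis
    proof (rule integrable_polar_bound[where h = "\<lambda>_. 1" and G = "\<lambda>r. K * (\<bar>r\<bar> ^ 0 * exp (- (a / 4) * r\<^sup>2)) + K * (\<bar>r\<bar> ^ (2 * m) * exp (- (a / 4) * r\<^sup>2))"])
      show "integrable lborel (\<lambda>r::real. K * (\<bar>r\<bar> ^ 0 * exp (- (a / 4) * r\<^sup>2)) + K * (\<bar>r\<bar> ^ (2 * m) * exp (- (a / 4) * r\<^sup>2)))"
        using a by (intro Bochner_Integration.integrable_add integrable_mult_right integrable_abs_power_gaussian) auto
      show "\<bar>w z\<bar> * norm z ^ (DIM('a) - 1) \<le> \<bar>1\<bar> * (K * (\<bar>norm z\<bar> ^ 0 * exp (- (a / 4) * (norm z)\<^sup>2)) + K * (\<bar>norm z\<bar> ^ (2 * m) * exp (- (a / 4) * (norm z)\<^sup>2)))"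
        if "z \<noteq> 0" for z using bd[OF that] by (simp add: algebra_simps)
      show "w \<in> borel_measurable borel" unfolding w_def by measurable
    qed (use K in \<open>auto intro!: add_nonneg_nonneg mult_nonneg_nonneg\<close>)
  qed
  have 2: "(\<lambda>j. LINT z|lborel. u z * (laplacian ^^ m) (\<phi> j) z) \<longlonglongrightarrow> (LINT z|lborel. u z * (laplacian ^^ m) ?g z)"
  proof (rule integral_dominated_convergence[OF _ _ w])
    show "AE z in lborel. (\<lambda>j. u z * (laplacian ^^ m) (\<phi> j) z) \<longlonglongrightarrow> u z * (laplacian ^^ m) ?g z"
      using ne0 by eventually_elim (intro tendsto_mult tendsto_const tendsto_eventually eventually_mono[OF \<phi>3], auto)
    show "AE z in lborel. norm (u z * (laplacian ^^ m) (\<phi> j) z) \<le> w z" for j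
      using ne0
    proof eventually_elim
      case (elim z)
      then show ?case unfolding w_def real_norm_def abs_mult using B by (intro mult_mono \<phi>2) auto
    qed
  qed measurable
  show ?thesis using LIMSEQ_unique[OF 2] 1 unfolding weak[OF \<phi>] by blast
qed

end

section \<open>Identification of the moments and the inversion formula\<close>

context homogeneous_laplacian begin

lemma gauss_moment_uminus: "gauss_moment k (- x) a = gauss_moment k x a"
proof -
  let ?F = "\<lambda>x z. u z * (a ^ (k + h) * poly (laguerre_poly (real h) k) (a * (norm (z - x))\<^sup>2) * exp (- a * (norm (z - x))\<^sup>2))"
  have "continuous_on UNIV (?F (- x))" by (intro continuous_intros cont)
  then have F: "?F (- x) \<in> borel_measurable borel" by (rule borel_measurable_continuous_onI)
  have "norm (- z + x) = norm (z - x)" for z by (metis minus_diff_eq norm_minus_cancel uminus_add_conv_diff)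
  then have eq: "?F (- x) (0 + (- 1) *\<^sub>R z) = ?F x z" for z by (simp add: even_u)
  have "(LINT z|lborel. ?F (- x) z) = \<bar>- 1\<bar> ^ DIM('a) * (LINT z|lborel. ?F (- x) (0 + (- 1) *\<^sub>R z))"
    by (rule lebesgue_integral_dilate[OF F]) simp
  also have "\<dots> = (LINT z|lborel. ?F x z)" unfolding eq by simp
  finally show ?thesis unfolding gauss_moment_def .
qed

text \<open>The moment is even in x, so it equals its average over x and - x; the right side is
  known only for that symmetrised Gaussian.\<close>

lemma gauss_moment_m:
  assumes a: "a > 0"
  shows "gauss_moment m x a = a ^ h * sqrt (pi / a) / 2 * (LINT \<theta>|sphere_measure. f \<theta> * exp (- a * (norm (orth_part \<theta> x))\<^sup>2))"
proof -
  have h: "real DIM('a) / 2 = real h" using n by simp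
  have 1: "gauss_moment m x a = a ^ h * (LINT z|lborel. f z * exp (- a * (norm (z - x))\<^sup>2))" for x
    unfolding weak_gaussian[OF a, symmetric] laplacian_pow_gaussian h gauss_moment_def
    by (subst integral_mult_right_zero[symmetric]) (simp add: power_add mult_ac)
  have "2 * gauss_moment m x a = gauss_moment m x a + gauss_moment m (- x) a" by (simp add: gauss_moment_uminus)
  also have "\<dots> = a ^ h * ((LINT z|lborel. f z * exp (- a * (norm (z - x))\<^sup>2)) + (LINT z|lborel. f z * exp (- a * (norm (z - (- x)))\<^sup>2)))"
    unfolding 1 by (simp add: distrib_left)
  also have "(LINT z|lborel. f z * exp (- a * (norm (z - x))\<^sup>2)) + (LINT z|lborel. f z * exp (- a * (norm (z - (- x)))\<^sup>2)) =
     (LINT z|lborel. f z * exp (- a * (norm (z - x))\<^sup>2) + f z * exp (- a * (norm (z - (- x)))\<^sup>2))"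
    by (intro Bochner_Integration.integral_add[symmetric] integrable_f_gaussian a)
  also have "\<dots> = (LINT z|lborel. f z * (exp (- a * (norm (z - x))\<^sup>2) + exp (- a * (norm (z + x))\<^sup>2)))"
    by (simp add: distrib_left)
  also have "\<dots> = sqrt (pi / a) * (LINT \<theta>|sphere_measure. f \<theta> * exp (- a * (norm (orth_part \<theta> x))\<^sup>2))"
    by (rule integral_f_gaussian(2)[OF a])
  finally show ?thesis by simp
qed

lemma norm_orth_part_le: "norm \<theta> = 1 \<Longrightarrow> norm (orth_part \<theta> x) \<le> norm x"
  using norm_orth_part[of \<theta> x] by (intro power2_le_imp_le[OF _ norm_ge_zero]) simp

text \<open>Since \<open>orth_part\<close> does not increase the norm, coefficients of size K / j!
  keep all partial sums below K * exp (a * norm(x)^2). The statement is used once for the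
  exponential and once for Kummer's series.\<close>

lemma sphere_integral_power_series:
  assumes e: "\<And>j. \<bar>e j\<bar> \<le> K / fact j" and s: "\<And>y. y \<ge> 0 \<Longrightarrow> (\<lambda>j. e j * y ^ j) sums S y" and a: "a \<ge> 0"
  shows "(\<lambda>j. e j * (LINT \<theta>|sphere_measure. f \<theta> * (norm (orth_part \<theta> x))\<^sup>2 ^ j) * a ^ j) sums
     (LINT \<theta>|sphere_measure. f \<theta> * S (a * (norm (orth_part \<theta> x))\<^sup>2))"
proof -
  let ?d = "\<lambda>\<theta>. (norm (orth_part \<theta> x))\<^sup>2"
  let ?g = "\<lambda>j \<theta>. f \<theta> * (e j * (a * ?d \<theta>) ^ j)"
  have K: "K \<ge> 0" using e[of 0] by simp
  have "(\<lambda>j. LINT \<theta>|sphere_measure. ?g j \<theta>) sums (LINT \<theta>|sphere_measure. f \<theta> * S (a * ?d \<theta>))"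
  proof (rule sums_integral_dominated(3)[where G = "\<lambda>\<theta>. \<bar>f \<theta>\<bar> * (K * exp (a * (norm x)\<^sup>2))"])
    show "?g j \<in> borel_measurable sphere_measure" for j by (rule borel_measurable_sphere) measurable
    show "(\<lambda>j. ?g j \<theta>) sums (f \<theta> * S (a * ?d \<theta>))" for \<theta> using a by (intro sums_mult s) simp
    show "integrable sphere_measure (\<lambda>\<theta>. \<bar>f \<theta>\<bar> * (K * exp (a * (norm x)\<^sup>2)))"
      using int_f by (intro integrable_mult_left integrable_abs)
    fix k and \<theta> :: 'a assume "\<theta> \<in> space sphere_measure"
    then have \<theta>: "norm \<theta> = 1" by simp
    let ?y = "a * ?d \<theta>"
    have y: "0 \<le> ?y" using a by simp
    have "\<bar>\<Sum>j<k. e j * ?y ^ j\<bar> \<le> (\<Sum>j<k. K * (?y ^ j / fact j))"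
    proof (rule order_trans[OF sum_abs sum_mono])
      fix j
      show "\<bar>e j * ?y ^ j\<bar> \<le> K * (?y ^ j / fact j)"
        using mult_right_mono[OF e[of j] zero_le_power[OF y, of j]] y by (simp add: abs_mult)
    qed
    also have "\<dots> = K * (\<Sum>j<k. ?y ^ j / fact j)" by (simp add: sum_distrib_left)
    also have "(\<Sum>j<k. ?y ^ j / fact j) \<le> exp ?y"
    proof -
      have "(\<lambda>j. ?y ^ j / fact j) sums exp ?y" using exp_converges[of ?y] by (simp add: field_simps)
      then show ?thesis using sum_le_suminf[of "\<lambda>j. ?y ^ j / fact j" "{..<k}"] y by (simp add: sums_iff)
    qed
    also have "exp ?y \<le> exp (a * (norm x)\<^sup>2)"
      using norm_orth_part_le[OF \<theta>, of x] a by (simp add: mult_left_mono power_mono)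
    finally have "\<bar>\<Sum>j<k. e j * ?y ^ j\<bar> \<le> K * exp (a * (norm x)\<^sup>2)" using K by (simp add: mult_left_mono)
    then show "\<bar>\<Sum>j<k. ?g j \<theta>\<bar> \<le> \<bar>f \<theta>\<bar> * (K * exp (a * (norm x)\<^sup>2))"
      unfolding sum_distrib_left[symmetric] abs_mult by (intro mult_left_mono) auto
  qed
  moreover have "(LINT \<theta>|sphere_measure. ?g j \<theta>) = e j * (LINT \<theta>|sphere_measure. f \<theta> * ?d \<theta> ^ j) * a ^ j" for j
  proof -
    have "?g j \<theta> = (e j * a ^ j) * (f \<theta> * ?d \<theta> ^ j)" for \<theta> by (simp add: power_mult_distrib)
    then have "(LINT \<theta>|sphere_measure. ?g j \<theta>) = (LINT \<theta>|sphere_measure. (e j * a ^ j) * (f \<theta> * ?d \<theta> ^ j))"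
      by (simp only:)
    also have "\<dots> = (e j * a ^ j) * (LINT \<theta>|sphere_measure. f \<theta> * ?d \<theta> ^ j)" by (rule integral_mult_right_zero)
    finally show ?thesis by (simp only: mult_ac)
  qed
  ultimately show ?thesis by simp
qed

lemma m_pos: "m \<ge> 1" using m n h_pos by linarith

text \<open>Two expansions of the m-th moment in powers of a are compared, one with unknown
  coefficients \<open>p j\<close> times a Pochhammer symbol, one with spherical moments of f. The
  symbol does not vanish at half-integers, so \<open>p j\<close> is determined, and resumming
  without the symbol gives \<open>kummer_series\<close>.\<close>

lemma gauss_moment_0_eq:
  assumes a: "a > 0"
  shows "gauss_moment 0 x a = a powr (- real q / 2) * (sqrt pi / (2 * (- 4) ^ m) *
     (LINT \<theta>|sphere_measure. f \<theta> * kummer_series (- real q / 2) m (a * (norm (orth_part \<theta> x))\<^sup>2)))"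
proof -
  obtain p where p: "\<And>k a. summable (\<lambda>j. p j * (- 4) ^ k * pochhammer (real j - real q / 2) k * a ^ j)"
    "\<And>k a. a > 0 \<Longrightarrow> gauss_moment k x a = a powr (real k - real q / 2) *
       (\<Sum>j. p j * (- 4) ^ k * pochhammer (real j - real q / 2) k * a ^ j)"
    using gauss_moment_power_series[of x] by blast
  define F where "F j = (LINT \<theta>|sphere_measure. f \<theta> * (norm (orth_part \<theta> x))\<^sup>2 ^ j)" for j
  define P where "P j = pochhammer (- real q / 2 + real j) m" for j
  have P: "pochhammer (real j - real q / 2) m = P j" for j by (simp add: P_def)
  have P0: "P j \<noteq> 0" "\<bar>1 / P j\<bar> \<le> 2 ^ m" for j
    unfolding P_def using pochhammer_half_integer_bound[OF half_integer_add[OF half_integer_q, of j], of m] by auto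
  have coeff: "p j * (- 4) ^ m * P j - sqrt pi / 2 * ((- 1) ^ j / fact j * F j) = 0" for j
  proof (rule power_series_zero_imp_coeff_zero)
    fix a :: real assume a: "a > 0"
    have "(\<lambda>j. (- 1) ^ j / fact j * F j * a ^ j) sums (LINT \<theta>|sphere_measure. f \<theta> * exp (- (a * (norm (orth_part \<theta> x))\<^sup>2)))"
      unfolding F_def
    proof (rule sphere_integral_power_series[where K = 1])
      show "(\<lambda>j. (- 1) ^ j / fact j * y ^ j) sums exp (- y)" for y :: real
        using exp_converges[of "- y"] by (simp add: power_minus[of y] field_simps)
    qed (use a in \<open>auto simp: abs_mult power_abs\<close>)
    then have 1: "(\<lambda>j. sqrt pi / 2 * ((- 1) ^ j / fact j * F j * a ^ j)) sums
       (sqrt pi / 2 * (LINT \<theta>|sphere_measure. f \<theta> * exp (- a * (norm (orth_part \<theta> x))\<^sup>2)))"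
      by (intro sums_mult) simp
    \<comment> \<open>The exponents of the prefactors agree: the power series carries a^(m - q / 2),
      the Gaussian integral a^h times a^(- 1 / 2).\<close>
    have mq: "real m - real q / 2 = real h - 1 / 2" using m n by (simp add: field_simps)
    have pw: "a ^ h * sqrt (pi / a) = a powr (real m - real q / 2) * sqrt pi"
      unfolding mq using a by (simp add: powr_diff powr_realpow powr_half_sqrt real_sqrt_divide)
    have "a powr (real m - real q / 2) * (\<Sum>j. p j * (- 4) ^ m * P j * a ^ j) =
       a powr (real m - real q / 2) * (sqrt pi / 2 * (LINT \<theta>|sphere_measure. f \<theta> * exp (- a * (norm (orth_part \<theta> x))\<^sup>2)))"
    proof -
      have "a powr (real m - real q / 2) * (\<Sum>j. p j * (- 4) ^ m * P j * a ^ j) = gauss_moment m x a"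
        using p(2)[OF a, of m] unfolding P ..
      also have "\<dots> = a powr (real m - real q / 2) * (sqrt pi / 2 * (LINT \<theta>|sphere_measure. f \<theta> * exp (- a * (norm (orth_part \<theta> x))\<^sup>2)))"
        unfolding gauss_moment_m[OF a, of x] pw by (simp only: times_divide_eq_left times_divide_eq_right mult.assoc)
      finally show ?thesis .
    qed
    then have E: "(\<Sum>j. p j * (- 4) ^ m * P j * a ^ j) = sqrt pi / 2 * (LINT \<theta>|sphere_measure. f \<theta> * exp (- a * (norm (orth_part \<theta> x))\<^sup>2))"
      using a by simp
    have 2: "(\<lambda>j. p j * (- 4) ^ m * P j * a ^ j) sums (sqrt pi / 2 * (LINT \<theta>|sphere_measure. f \<theta> * exp (- a * (norm (orth_part \<theta> x))\<^sup>2)))"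
      using summable_sums[OF p(1)[of m a]] unfolding P E .
    from sums_diff[OF 2 1] show "(\<lambda>j. (p j * (- 4) ^ m * P j - sqrt pi / 2 * ((- 1) ^ j / fact j * F j)) * a ^ j) sums 0"
      by (simp only: left_diff_distrib mult.assoc diff_self)
  qed
  have pj: "p j = sqrt pi / (2 * (- 4) ^ m) * ((- 1) ^ j / (fact j * P j) * F j)" for j
    using coeff[of j] P0(1)[of j] by (simp add: field_simps)
  have "(\<lambda>j. (- 1) ^ j / (fact j * P j) * F j * a ^ j) sums
      (LINT \<theta>|sphere_measure. f \<theta> * kummer_series (- real q / 2) m (a * (norm (orth_part \<theta> x))\<^sup>2))"
    unfolding F_def
  proof (rule sphere_integral_power_series[where K = "2 ^ m"])
    show "\<bar>(- 1) ^ j / (fact j * P j)\<bar> \<le> 2 ^ m / fact j" for j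
      using P0(2)[of j] by (simp add: abs_mult power_abs field_simps)
    show "(\<lambda>j. (- 1) ^ j / (fact j * P j) * y ^ j) sums kummer_series (- real q / 2) m y" for y
      using summable_sums[OF kummer_summable[OF half_integer_q, of y m]]
      by (simp add: kummer_series_def P_def power_minus[of y])
  qed (use a in auto)
  from sums_mult[OF this, of "sqrt pi / (2 * (- 4) ^ m)"]
  have "(\<lambda>j. p j * a ^ j) sums (sqrt pi / (2 * (- 4) ^ m) *
      (LINT \<theta>|sphere_measure. f \<theta> * kummer_series (- real q / 2) m (a * (norm (orth_part \<theta> x))\<^sup>2)))"
    unfolding pj by (simp only: mult.assoc)
  then show ?thesis using p(2)[OF a, of 0] by (simp add: sums_iff)
qed

text \<open>With a = s^2 the prefactor is s^(- q) and the argument of the series is s^2 * d^2, where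
  d is the distance of x from the line through \<theta>. The asymptotics turn the product into d^q
  times a quotient of Gamma values, and the integral over the sphere follows by domination.\<close>

theorem inversion_formula:
  "u x = sqrt pi / (2 * pi ^ h * (- 4) ^ m) * (Gamma (- real q / 2) / Gamma (real m)) *
     (LINT \<theta>|sphere_measure. f \<theta> * norm (orth_part \<theta> x) ^ q)"
proof -
  let ?E = "kummer_series (- real q / 2) m" and ?d = "\<lambda>\<theta>. norm (orth_part \<theta> x)"
  let ?L = "Gamma (- real q / 2) / Gamma (real m)"
  obtain C where C: "C \<ge> 0" "\<And>z. z \<ge> 0 \<Longrightarrow> \<bar>?E z\<bar> \<le> C * (1 + z powr (real q / 2))"
    using kummer_series_bound[OF half_integer_q m_pos] by auto
  have q0: "q > 0" using q by (rule odd_pos)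
  have half: "(y\<^sup>2) powr (real q / 2) = y ^ q" if "y \<ge> 0" for y :: real
  proof (cases "y = 0")
    case False
    then have y: "y > 0" using that by simp
    then have "y\<^sup>2 = y powr 2" by simp
    then have "(y\<^sup>2) powr (real q / 2) = y powr real q" by (simp only: powr_powr) simp
    then show ?thesis using powr_realpow[OF y, of q] by simp
  qed (use q0 in simp)
  define s where "s k = real (Suc k)" for k
  have s: "s k \<ge> 1" for k by (simp add: s_def)
  define G where "G k \<theta> = f \<theta> * (1 / s k ^ q * ?E ((s k)\<^sup>2 * (?d \<theta>)\<^sup>2))" for k \<theta>
  have [measurable]: "?E \<in> borel_measurable borel"
    by (rule borel_measurable_continuous_onI[OF kummer_series_continuous[OF half_integer_q]])
  have "(\<lambda>k. LINT \<theta>|sphere_measure. G k \<theta>) \<longlonglongrightarrow> (LINT \<theta>|sphere_measure. f \<theta> * (?d \<theta> ^ q * ?L))"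
  proof (rule integral_dominated_convergence[where w = "\<lambda>\<theta>. \<bar>f \<theta>\<bar> * (C * (1 + norm x ^ q))"])
    show "integrable sphere_measure (\<lambda>\<theta>. \<bar>f \<theta>\<bar> * (C * (1 + norm x ^ q)))"
      using int_f by (intro integrable_mult_left integrable_abs)
    show "(\<lambda>\<theta>. f \<theta> * (?d \<theta> ^ q * ?L)) \<in> borel_measurable sphere_measure" by (rule borel_measurable_sphere) measurable
    show "(\<lambda>\<theta>. G k \<theta>) \<in> borel_measurable sphere_measure" for k unfolding G_def by (rule borel_measurable_sphere) measurable
    show "AE \<theta> in sphere_measure. (\<lambda>k. G k \<theta>) \<longlonglongrightarrow> f \<theta> * (?d \<theta> ^ q * ?L)"
    proof (rule AE_I2)
      fix \<theta> :: 'a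
      have sinf: "filterlim s at_top sequentially"
        unfolding s_def by (rule filterlim_compose[OF filterlim_real_sequentially filterlim_Suc])
      have "(\<lambda>k. 1 / s k ^ q * ?E ((s k)\<^sup>2 * (?d \<theta>)\<^sup>2)) \<longlonglongrightarrow> ?d \<theta> ^ q * ?L"
      proof (cases "?d \<theta> = 0")
        \<comment> \<open>If x lies on the line, the series is evaluated at 0 and s^(- q) alone
          forces the limit 0, which is d^q since q > 0.\<close>
        case True
        have "(\<lambda>k. inverse (s k ^ q)) \<longlonglongrightarrow> 0"
          by (intro tendsto_inverse_0_at_top filterlim_pow_at_top q0 sinf)
        from tendsto_mult_right[OF this, of "?E 0"] show ?thesis using True q0 by (simp add: field_simps zero_power)
      next
        case False
        then have d: "?d \<theta> > 0" by simp
        have "filterlim (\<lambda>k. (?d \<theta>)\<^sup>2 * (s k)\<^sup>2) at_top sequentially"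
          using d by (intro filterlim_tendsto_pos_mult_at_top[OF tendsto_const] filterlim_pow_at_top sinf) auto
        then have "filterlim (\<lambda>k. (s k)\<^sup>2 * (?d \<theta>)\<^sup>2) at_top sequentially" by (simp add: mult.commute)
        from filterlim_compose[OF kummer_series_asymptotic[OF half_integer_q m_pos] this]
        have "(\<lambda>k. ((s k)\<^sup>2 * (?d \<theta>)\<^sup>2) powr (- real q / 2) * ?E ((s k)\<^sup>2 * (?d \<theta>)\<^sup>2)) \<longlonglongrightarrow> ?L" .
        from tendsto_mult_left[OF this, of "?d \<theta> ^ q"]
        have "(\<lambda>k. ?d \<theta> ^ q * (((s k)\<^sup>2 * (?d \<theta>)\<^sup>2) powr (- real q / 2) * ?E ((s k)\<^sup>2 * (?d \<theta>)\<^sup>2))) \<longlonglongrightarrow> ?d \<theta> ^ q * ?L" .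
        moreover have "?d \<theta> ^ q * (((s k)\<^sup>2 * (?d \<theta>)\<^sup>2) powr (- real q / 2)) = 1 / s k ^ q" for k
        proof -
          have "((s k)\<^sup>2 * (?d \<theta>)\<^sup>2) powr (real q / 2) = s k ^ q * ?d \<theta> ^ q"
            using half[of "s k * ?d \<theta>"] s[of k] by (simp add: power_mult_distrib)
          then have "((s k)\<^sup>2 * (?d \<theta>)\<^sup>2) powr (- real q / 2) = 1 / (s k ^ q * ?d \<theta> ^ q)"
            by (simp add: powr_minus_divide)
          then show ?thesis using d by simp
        qed
        ultimately show ?thesis by (simp only: mult.assoc[symmetric])
      qed
      then show "(\<lambda>k. G k \<theta>) \<longlonglongrightarrow> f \<theta> * (?d \<theta> ^ q * ?L)" unfolding G_def by (rule tendsto_mult[OF tendsto_const])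
    qed
    show "AE \<theta> in sphere_measure. norm (G k \<theta>) \<le> \<bar>f \<theta>\<bar> * (C * (1 + norm x ^ q))" for k
    proof (rule AE_I2)
      fix \<theta> :: 'a assume "\<theta> \<in> space sphere_measure"
      then have \<theta>: "norm \<theta> = 1" by simp
      have sq: "s k ^ q \<ge> 1" using s[of k] by (rule one_le_power)
      have "\<bar>?E ((s k)\<^sup>2 * (?d \<theta>)\<^sup>2)\<bar> \<le> C * (1 + s k ^ q * ?d \<theta> ^ q)"
        using C(2)[of "(s k)\<^sup>2 * (?d \<theta>)\<^sup>2"] half[of "s k * ?d \<theta>"] s[of k] by (simp add: power_mult_distrib)
      also have "\<dots> \<le> C * (s k ^ q * (1 + norm x ^ q))"
      proof (intro mult_left_mono C)
        \<comment> \<open>Because s is at least 1, its q-th power also absorbs the constant summand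
          of the bound.\<close>
        have "s k ^ q * ?d \<theta> ^ q \<le> s k ^ q * norm x ^ q"
          using norm_orth_part_le[OF \<theta>, of x] sq by (intro mult_left_mono power_mono) auto
        then show "1 + s k ^ q * ?d \<theta> ^ q \<le> s k ^ q * (1 + norm x ^ q)" using sq by (simp only: distrib_left mult_1_right)
      qed
      finally have "1 / s k ^ q * \<bar>?E ((s k)\<^sup>2 * (?d \<theta>)\<^sup>2)\<bar> \<le> 1 / s k ^ q * (C * (s k ^ q * (1 + norm x ^ q)))"
        using sq by (intro mult_left_mono) auto
      also have "\<dots> = C * (1 + norm x ^ q)" using s[of k] by simp
      finally have "\<bar>1 / s k ^ q * ?E ((s k)\<^sup>2 * (?d \<theta>)\<^sup>2)\<bar> \<le> C * (1 + norm x ^ q)"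
        using sq by (simp add: abs_mult)
      then show "norm (G k \<theta>) \<le> \<bar>f \<theta>\<bar> * (C * (1 + norm x ^ q))"
        unfolding G_def real_norm_def abs_mult[of "f \<theta>"] by (intro mult_left_mono) auto
    qed
  qed
  from tendsto_mult_left[OF this, of "sqrt pi / (2 * (- 4) ^ m)"]
  have lim: "(\<lambda>k. sqrt pi / (2 * (- 4) ^ m) * (LINT \<theta>|sphere_measure. G k \<theta>)) \<longlonglongrightarrow>
     sqrt pi / (2 * (- 4) ^ m) * (LINT \<theta>|sphere_measure. f \<theta> * (?d \<theta> ^ q * ?L))" .
  have eq: "gauss_moment 0 x ((real (Suc k))\<^sup>2) = sqrt pi / (2 * (- 4) ^ m) * (LINT \<theta>|sphere_measure. G k \<theta>)" for k
  proof -
    have "((s k)\<^sup>2) powr (- real q / 2) = 1 / s k ^ q"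
      using half[of "s k"] s[of k] by (simp add: powr_minus_divide)
    moreover have "(LINT \<theta>|sphere_measure. G k \<theta>) = 1 / s k ^ q * (LINT \<theta>|sphere_measure. f \<theta> * ?E ((s k)\<^sup>2 * (?d \<theta>)\<^sup>2))"
      unfolding G_def by (subst integral_mult_right_zero[symmetric]) (simp add: mult_ac)
    moreover have "(s k)\<^sup>2 > 0" using s[of k] by simp
    ultimately show ?thesis unfolding s_def[symmetric] by (subst gauss_moment_0_eq) (simp_all add: mult_ac)
  qed
  have "pi ^ h * u x = sqrt pi / (2 * (- 4) ^ m) * (LINT \<theta>|sphere_measure. f \<theta> * (?d \<theta> ^ q * ?L))"
    by (rule LIMSEQ_unique[OF gauss_moment_limit[of x, unfolded eq] lim])
  also have "(LINT \<theta>|sphere_measure. f \<theta> * (?d \<theta> ^ q * ?L)) = ?L * (LINT \<theta>|sphere_measure. f \<theta> * ?d \<theta> ^ q)"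
    by (subst integral_mult_right_zero[symmetric]) (simp add: mult_ac)
  finally have "pi ^ h * u x = sqrt pi / (2 * (- 4) ^ m) * (?L * (LINT \<theta>|sphere_measure. f \<theta> * ?d \<theta> ^ q))" .
  moreover have div: "u x = X / pi ^ h" if "pi ^ h * u x = X" for X
    using that by (auto simp: field_simps)
  ultimately have "u x = (sqrt pi / (2 * (- 4) ^ m) * (?L * (LINT \<theta>|sphere_measure. f \<theta> * ?d \<theta> ^ q))) / pi ^ h"
    by blast
  moreover have "(a / (2 * c) * (L * I)) / p = a / (2 * p * c) * L * I" for a c L I p :: real
    by (simp add: mult_ac)
  ultimately show ?thesis by metis
qed

end

section \<open>Injectivity of the cosine transform\<close>

lemma integral_sphere_uminus:
  fixes F :: "'a::euclidean_space \<Rightarrow> real"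
  assumes F: "F \<in> borel_measurable sphere_measure"
  shows "(LINT \<xi>|sphere_measure. F (- \<xi>)) = (LINT \<xi>|sphere_measure. F \<xi>)"
proof -
  let ?S = "sphere_measure :: 'a measure"
  have um: "uminus \<in> ?S \<rightarrow>\<^sub>M ?S"
    unfolding measurable_cong_sets[OF sets_sphere_measure sets_sphere_measure]
    by (rule measurable_restrict_space2) (auto simp: space_restrict_space intro: measurable_restrict_space1)
  have "distr ?S ?S uminus = ?S"
  proof (rule measure_eqI)
    fix A assume "A \<in> sets (distr ?S ?S uminus)"
    then have A: "A \<in> sets ?S" by simp
    then have A': "A \<in> sets borel" by (auto simp: sets_sphere_measure sets_restrict_space intro!: sets.Int)
    have [measurable]: "(indicator A :: 'a \<Rightarrow> ennreal) \<in> borel_measurable borel" using A' by simp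
    have "emeasure (distr ?S ?S uminus) A = (\<integral>\<^sup>+\<xi>. indicator A \<xi> \<partial>distr ?S ?S uminus)" using A by simp
    also have "\<dots> = (\<integral>\<^sup>+\<xi>. indicator A (- \<xi>) \<partial>?S)"
      using A by (subst nn_integral_distr[OF um]) auto
    also have "\<dots> = ennreal (real DIM('a)) * (\<integral>\<^sup>+y. indicator A (- sgn y) * indicator (cball 0 1 - {0}) y \<partial>lborel)"
      by (rule nn_integral_sphere_measure) measurable
    also have "(\<integral>\<^sup>+y. indicator A (- sgn y) * indicator (cball 0 1 - {0}) y \<partial>lborel) =
      (\<integral>\<^sup>+y. indicator A (sgn y) * indicator (cball 0 1 - {0}) (y::'a) \<partial>lborel)"
    proof -
      have ind: "(indicator (cball 0 1 - {0::'a}) :: 'a \<Rightarrow> ennreal) \<in> borel_measurable borel"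
        by (intro borel_measurable_indicator) simp
      have "(\<lambda>y. indicator A (sgn y) :: ennreal) \<in> borel_measurable (borel :: 'a measure)" by measurable
      from borel_measurable_times_ennreal[OF this ind]
      have "(\<integral>\<^sup>+y. indicator A (sgn y) * indicator (cball 0 1 - {0}) (y::'a) \<partial>lborel) =
          ennreal (\<bar>- 1\<bar> ^ DIM('a)) * (\<integral>\<^sup>+y. indicator A (sgn ((- 1) *\<^sub>R y)) * indicator (cball 0 1 - {0}) ((- 1) *\<^sub>R y) \<partial>lborel)"
        by (rule nn_integral_lborel_dilate) simp
      also have "\<dots> = (\<integral>\<^sup>+y. indicator A (- sgn y) * indicator (cball 0 1 - {0}) y \<partial>lborel)"
        by (simp add: sgn_minus indicator_def)
      finally show ?thesis ..
    qed
    also have "ennreal (real DIM('a)) * \<dots> = (\<integral>\<^sup>+\<xi>. indicator A \<xi> \<partial>?S)"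
      by (rule nn_integral_sphere_measure[symmetric]) measurable
    also have "\<dots> = emeasure ?S A" using A by simp
    finally show "emeasure (distr ?S ?S uminus) A = emeasure ?S A" .
  qed simp
  then show ?thesis using integral_distr[OF um F] by simp
qed

text \<open>Products of exponentials are exponentials, so the linear span is already an algebra;
  scalar multiples are contained in the generators.\<close>

inductive_set exp_span :: "('a::euclidean_space \<Rightarrow> real) set" where
  exp_span_exp: "(\<lambda>\<xi>. c * exp (z \<bullet> \<xi>)) \<in> exp_span"
| exp_span_add: "\<phi> \<in> exp_span \<Longrightarrow> \<psi> \<in> exp_span \<Longrightarrow> (\<lambda>\<xi>. \<phi> \<xi> + \<psi> \<xi>) \<in> exp_span"

lemma exp_span_continuous: "\<phi> \<in> exp_span \<Longrightarrow> continuous_on S \<phi>"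
  by (induction rule: exp_span.induct) (auto intro!: continuous_intros)

lemma exp_span_mult: "\<phi> \<in> exp_span \<Longrightarrow> \<psi> \<in> exp_span \<Longrightarrow> (\<lambda>\<xi>. \<phi> \<xi> * \<psi> \<xi>) \<in> exp_span"
proof (induction rule: exp_span.induct)
  case (exp_span_exp c z)
  from exp_span_exp show ?case
  proof (induction rule: exp_span.induct)
    case (exp_span_exp d w)
    have "(\<lambda>\<xi>. c * exp (z \<bullet> \<xi>) * (d * exp (w \<bullet> \<xi>))) = (\<lambda>\<xi>. (c * d) * exp ((z + w) \<bullet> \<xi>))"
      by (simp add: fun_eq_iff inner_add_left exp_add)
    then show ?case using exp_span.exp_span_exp[of "c * d" "z + w"] by simp
  next
    case (exp_span_add \<phi> \<psi>)
    then show ?case using exp_span.exp_span_add by (simp add: distrib_left)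
  qed
next
  case (exp_span_add \<phi>1 \<phi>2)
  then show ?case using exp_span.exp_span_add by (simp add: distrib_right)
qed

text \<open>Vanishing on the span extends to continuous functions by uniform approximation. The
  positive and negative parts of b then define measures with equal integrals of continuous
  functions, hence equal measures and equal densities.\<close>

lemma sphere_AE_zero_of_exp_moments:
  fixes b :: "'a::euclidean_space \<Rightarrow> real"
  assumes bm[measurable]: "b \<in> borel_measurable borel" and bi: "integrable sphere_measure b"
    and mom: "\<And>z. (LINT \<xi>|sphere_measure. b \<xi> * exp (z \<bullet> \<xi>)) = 0"
  shows "AE \<xi> in sphere_measure. b \<xi> = 0"
proof -
  let ?S = "sphere_measure :: 'a measure"
  have int: "integrable ?S (\<lambda>\<xi>. b \<xi> * \<phi> \<xi>)" if "continuous_on UNIV \<phi>" for \<phi> :: "'a \<Rightarrow> real"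
  proof -
    have [measurable]: "\<phi> \<in> borel_measurable borel" using that by (rule borel_measurable_continuous_onI)
    have "compact (\<phi> ` sphere 0 1)"
      using that continuous_on_subset by (intro compact_continuous_image) auto
    then obtain K where K: "\<forall>y\<in>\<phi> ` sphere 0 1. norm y \<le> K"
      using bounded_iff compact_imp_bounded by blast
    have m: "(\<lambda>\<xi>. b \<xi> * \<phi> \<xi>) \<in> borel_measurable ?S" by (rule borel_measurable_sphere) measurable
    show ?thesis
    proof (rule Bochner_Integration.integrable_bound[OF integrable_mult_left[OF bi, of K] m])
      show "AE \<xi> in ?S. norm (b \<xi> * \<phi> \<xi>) \<le> norm (b \<xi> * K)"
        using K by (intro AE_I2) (auto simp: abs_mult intro!: mult_left_mono intro: order_trans[OF _ abs_ge_self])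
    qed
  qed
  have span: "(LINT \<xi>|?S. b \<xi> * \<phi> \<xi>) = 0" if "\<phi> \<in> exp_span" for \<phi>
    using that
  proof (induction rule: exp_span.induct)
    case (exp_span_exp c z)
    have "(LINT \<xi>|?S. b \<xi> * (c * exp (z \<bullet> \<xi>))) = (LINT \<xi>|?S. c * (b \<xi> * exp (z \<bullet> \<xi>)))" by (simp add: mult_ac)
    then show ?case using mom[of z] by simp
  next
    case (exp_span_add \<phi> \<psi>)
    then show ?case using int[OF exp_span_continuous] by (simp add: distrib_left)
  qed
  interpret function_ring_on "exp_span :: ('a \<Rightarrow> real) set" "sphere 0 1"
  proof
    show "(\<lambda>_. c) \<in> exp_span" for c using exp_span_exp[of c 0] by simp
    show "\<exists>f\<in>exp_span. f x \<noteq> f y" if "x \<noteq> y" for x y :: 'a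
    proof
      show "(\<lambda>\<xi>. 1 * exp ((x - y) \<bullet> \<xi>)) \<in> exp_span" by (rule exp_span_exp)
      have "(x - y) \<bullet> (x - y) > 0" using that by simp
      then show "1 * exp ((x - y) \<bullet> x) \<noteq> 1 * exp ((x - y) \<bullet> y)" by (simp add: inner_diff_right)
    qed
  qed (auto intro: exp_span_continuous exp_span_add exp_span_mult)
  have cont: "(LINT \<xi>|?S. b \<xi> * \<phi> \<xi>) = 0" if \<phi>: "continuous_on UNIV \<phi>" for \<phi> :: "'a \<Rightarrow> real"
  proof (rule ccontr)
    define I where "I = (LINT \<xi>|?S. \<bar>b \<xi>\<bar>)"
    have I: "I \<ge> 0" by (simp add: I_def)
    assume "(LINT \<xi>|?S. b \<xi> * \<phi> \<xi>) \<noteq> 0"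
    \<comment> \<open>Chosen so that I * e stays strictly below the absolute value of the integral;
      adding 1 to I avoids division by 0.\<close>
    define e where "e = \<bar>LINT \<xi>|?S. b \<xi> * \<phi> \<xi>\<bar> / (I + 1)"
    have e: "e > 0" using I \<open>_ \<noteq> 0\<close> by (simp add: e_def)
    obtain g where g: "g \<in> exp_span" "\<And>\<xi>. \<xi> \<in> sphere 0 1 \<Longrightarrow> \<bar>\<phi> \<xi> - g \<xi>\<bar> < e"
      using Stone_Weierstrass_basic[OF continuous_on_subset[OF \<phi>] e] by auto
    have ig: "integrable ?S (\<lambda>\<xi>. b \<xi> * g \<xi>)" by (rule int[OF exp_span_continuous[OF g(1)]])
    have "\<bar>LINT \<xi>|?S. b \<xi> * \<phi> \<xi>\<bar> = \<bar>LINT \<xi>|?S. b \<xi> * \<phi> \<xi> - b \<xi> * g \<xi>\<bar>"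
      using span[OF g(1)] int[OF \<phi>] ig by simp
    also have "\<dots> \<le> (LINT \<xi>|?S. \<bar>b \<xi> * \<phi> \<xi> - b \<xi> * g \<xi>\<bar>)" by (rule integral_abs_bound)
    also have "\<dots> \<le> (LINT \<xi>|?S. \<bar>b \<xi>\<bar> * e)"
    proof (rule integral_mono)
      fix \<xi> :: 'a assume "\<xi> \<in> space ?S"
      then show "\<bar>b \<xi> * \<phi> \<xi> - b \<xi> * g \<xi>\<bar> \<le> \<bar>b \<xi>\<bar> * e"
        unfolding right_diff_distrib[symmetric] abs_mult using g(2)[of \<xi>] by (intro mult_left_mono) auto
    qed (use int[OF \<phi>] ig bi in auto)
    also have "\<dots> = I * e" by (simp add: I_def)
    also have "\<dots> < (I + 1) * e" using e by simp
    also have "\<dots> = \<bar>LINT \<xi>|?S. b \<xi> * \<phi> \<xi>\<bar>" using I by (simp add: e_def)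
    finally show False by simp
  qed
  have idm: "(\<lambda>\<xi>. \<xi>) \<in> borel_measurable ?S" by (rule borel_measurable_sphere) simp
  \<comment> \<open>The measures are moved from the sphere to the ambient Borel space, where
    continuous functions are known to determine them.\<close>
  define M where "M g = distr (density ?S (\<lambda>\<xi>. ennreal (g \<xi>))) borel (\<lambda>\<xi>. \<xi>)" for g :: "'a \<Rightarrow> real"
  have Mnn: "(\<integral>\<^sup>+y. F y \<partial>M g) = (\<integral>\<^sup>+\<xi>. ennreal (g \<xi>) * F \<xi> \<partial>?S)"
    if "F \<in> borel_measurable borel" "g \<in> borel_measurable borel" for F :: "'a \<Rightarrow> ennreal" and g
    unfolding M_def using that idm borel_measurable_sphere[OF that(1)] borel_measurable_sphere[OF that(2)]
    by (subst nn_integral_distr) (auto simp: nn_integral_density)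
  define bp where "bp \<xi> = max 0 (b \<xi>)" for \<xi>
  define bn where "bn \<xi> = max 0 (- b \<xi>)" for \<xi>
  have [measurable]: "bp \<in> borel_measurable borel" "bn \<in> borel_measurable borel"
    unfolding bp_def bn_def by measurable
  have bpn: "b \<xi> = bp \<xi> - bn \<xi>" "0 \<le> bp \<xi>" "0 \<le> bn \<xi>" "bp \<xi> \<le> \<bar>b \<xi>\<bar>" "bn \<xi> \<le> \<bar>b \<xi>\<bar>" for \<xi> by (auto simp: bp_def bn_def)
  have fin: "emeasure (M g) UNIV \<noteq> \<infinity>" if "g \<in> borel_measurable borel" "\<And>\<xi>. g \<xi> \<le> \<bar>b \<xi>\<bar>" for g
  proof -
    have "emeasure (M g) UNIV = (\<integral>\<^sup>+y. 1 \<partial>M g)" by (simp add: M_def)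
    also have "\<dots> = (\<integral>\<^sup>+\<xi>. ennreal (g \<xi>) * 1 \<partial>?S)" using that(1) by (intro Mnn) auto
    also have "\<dots> \<le> (\<integral>\<^sup>+\<xi>. ennreal (norm (b \<xi>)) \<partial>?S)" using that(2) by (intro nn_integral_mono) (simp add: ennreal_leI)
    also have "\<dots> < \<infinity>" using bi by (simp add: integrable_iff_bounded)
    finally show ?thesis by simp
  qed
  have "M bp = M bn"
  proof (rule measure_eqI_continuous)
    fix \<phi> :: "'a \<Rightarrow> real" assume \<phi>: "continuous_on UNIV \<phi>" "\<And>y. 0 \<le> \<phi> y \<and> \<phi> y \<le> 1"
    have [measurable]: "\<phi> \<in> borel_measurable borel" using \<phi>(1) by (rule borel_measurable_continuous_onI)
    have ip: "integrable ?S (\<lambda>\<xi>. g \<xi> * \<phi> \<xi>)" if [measurable]: "g \<in> borel_measurable borel" and "\<And>\<xi>. 0 \<le> g \<xi> \<and> g \<xi> \<le> \<bar>b \<xi>\<bar>" for g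
    proof (rule Bochner_Integration.integrable_bound[OF bi])
      show "(\<lambda>\<xi>. g \<xi> * \<phi> \<xi>) \<in> borel_measurable ?S" by (rule borel_measurable_sphere) measurable
      show "AE \<xi> in ?S. norm (g \<xi> * \<phi> \<xi>) \<le> norm (b \<xi>)"
      proof (rule AE_I2)
        fix \<xi>
        have "g \<xi> * \<phi> \<xi> \<le> \<bar>b \<xi>\<bar> * 1" using that(2)[of \<xi>] \<phi>(2)[of \<xi>] by (intro mult_mono) auto
        then show "norm (g \<xi> * \<phi> \<xi>) \<le> norm (b \<xi>)" using that(2)[of \<xi>] \<phi>(2)[of \<xi>] by (simp add: abs_mult)
      qed
    qed
    have nn: "(\<integral>\<^sup>+y. ennreal (\<phi> y) \<partial>M g) = ennreal (LINT \<xi>|?S. g \<xi> * \<phi> \<xi>)"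
      if [measurable]: "g \<in> borel_measurable borel" and "\<And>\<xi>. 0 \<le> g \<xi> \<and> g \<xi> \<le> \<bar>b \<xi>\<bar>" for g
    proof -
      have "(\<integral>\<^sup>+y. ennreal (\<phi> y) \<partial>M g) = (\<integral>\<^sup>+\<xi>. ennreal (g \<xi> * \<phi> \<xi>) \<partial>?S)"
        using that \<phi>(2) by (subst Mnn) (auto simp: ennreal_mult)
      also have "\<dots> = ennreal (LINT \<xi>|?S. g \<xi> * \<phi> \<xi>)"
        using that \<phi>(2) by (intro nn_integral_eq_integral ip) auto
      finally show ?thesis .
    qed
    have "0 = (LINT \<xi>|?S. bp \<xi> * \<phi> \<xi> - bn \<xi> * \<phi> \<xi>)"
      using cont[OF \<phi>(1)] unfolding left_diff_distrib[symmetric] bpn(1)[symmetric] by simp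
    also have "\<dots> = (LINT \<xi>|?S. bp \<xi> * \<phi> \<xi>) - (LINT \<xi>|?S. bn \<xi> * \<phi> \<xi>)"
      using bpn by (intro Bochner_Integration.integral_diff ip) auto
    finally have "(LINT \<xi>|?S. bp \<xi> * \<phi> \<xi>) = (LINT \<xi>|?S. bn \<xi> * \<phi> \<xi>)" by simp
    then show "(\<integral>\<^sup>+y. ennreal (\<phi> y) \<partial>M bp) = (\<integral>\<^sup>+y. ennreal (\<phi> y) \<partial>M bn)"
      using nn[of bp] nn[of bn] bpn by simp
  next
    show "sets (M bp) = sets borel" "sets (M bn) = sets borel" by (simp_all add: M_def)
    show "emeasure (M bp) UNIV \<noteq> \<infinity>" "emeasure (M bn) UNIV \<noteq> \<infinity>" by (rule fin, measurable, rule bpn)+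
  qed
  have "AE \<xi> in ?S. ennreal (bp \<xi>) = ennreal (bn \<xi>)"
  proof (rule sphere.density_unique_finite_measure)
    show "(\<lambda>\<xi>. ennreal (bp \<xi>)) \<in> borel_measurable ?S" by (rule borel_measurable_sphere) measurable
    show "(\<lambda>\<xi>. ennreal (bn \<xi>)) \<in> borel_measurable ?S" by (rule borel_measurable_sphere) measurable
    fix A assume A: "A \<in> sets ?S"
    then have A': "A \<in> sets borel" by (auto simp: sets_sphere_measure sets_restrict_space intro!: sets.Int)
    have "(\<integral>\<^sup>+\<xi>. ennreal (g \<xi>) * indicator A \<xi> \<partial>?S) = emeasure (M g) A" if "g \<in> borel_measurable borel" for g
      using Mnn[of "indicator A" g] A' that by (simp add: M_def)
    then show "(\<integral>\<^sup>+\<xi>. ennreal (bp \<xi>) * indicator A \<xi> \<partial>?S) = (\<integral>\<^sup>+\<xi>. ennreal (bn \<xi>) * indicator A \<xi> \<partial>?S)"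
      using \<open>M bp = M bn\<close> by simp
  qed auto
  then show ?thesis
  proof eventually_elim
    case (elim \<xi>)
    then have "bp \<xi> = bn \<xi>" using bpn(2,3)[of \<xi>] by simp
    then show ?case unfolding bp_def bn_def max_def by (simp split: if_splits)
  qed
qed

text \<open>The coefficients p arise as alternating sums, from which nonvanishing cannot be read
  off. The explicit coefficients A satisfy a two-term recurrence, that is, a differential equation
  for their generating series; removing the factor exp from the series turns it into another
  two-term recurrence, now for p, with factor 2 * q - 4 * j. This is nonzero for odd q.\<close>

lemma abs_power_gaussian_shift_series:
  assumes q: "odd q"
  obtains p :: "nat \<Rightarrow> real" where "\<And>j. p j \<noteq> 0" "\<And>r::real. (\<lambda>j. p j * (r\<^sup>2) ^ j) sums (LINT t|lborel. exp (- t\<^sup>2) * \<bar>t + r\<bar> ^ q)"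
proof -
  define A where "A i = 4 ^ i / fact (2 * i) * Gamma ((real (q + 2 * i) + 1) / 2)" for i :: nat
  have Apos: "A i > 0" for i unfolding A_def by (intro mult_pos_pos Gamma_real_pos) auto
  \<comment> \<open>The functional equation of \<open>Gamma\<close> at (q + 2 * i + 1) / 2 combined
    with the quotient of successive even factorials.\<close>
  have Arec: "real (2 * i + 2) * real (2 * i + 1) * A (Suc i) = (4 * real i + 2 * (real q + 1)) * A i" for i
  proof -
    let ?x = "(real (q + 2 * i) + 1) / 2"
    have "?x > 0" by simp
    then have "?x \<notin> \<int>\<^sub>\<le>\<^sub>0" using nonpos_Ints_nonpos by force
    then have G: "Gamma (?x + 1) = ?x * Gamma ?x" by (rule Gamma_plus1)
    have arg: "(real (q + 2 * Suc i) + 1) / 2 = ?x + 1" by simp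
    have f: "fact (2 * Suc i) = real (2 * i + 2) * real (2 * i + 1) * fact (2 * i)" by (simp add: algebra_simps)
    have "4 ^ Suc i / fact (2 * Suc i) * (real (2 * i + 2) * real (2 * i + 1)) = 4 * (4 ^ i / fact (2 * i))"
      unfolding f by simp
    then have "real (2 * i + 2) * real (2 * i + 1) * A (Suc i) = 4 * (4 ^ i / fact (2 * i)) * (?x * Gamma ?x)"
      unfolding A_def arg G by (simp only: mult_ac)
    also have "\<dots> = 4 * ?x * A i" unfolding A_def by (simp only: mult_ac)
    also have "4 * ?x = 4 * real i + 2 * (real q + 1)" by simp
    finally show ?thesis .
  qed
  have exp_int: "integrable lborel (\<lambda>t. exp (- t\<^sup>2) * \<bar>t\<bar> ^ q * exp (2 * r * t))" for r :: real
  proof (rule Bochner_Integration.integrable_bound)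
    show "integrable lborel (\<lambda>t::real. exp (2 * r\<^sup>2) * (\<bar>t\<bar> ^ q * exp (- (1/2) * t\<^sup>2)))"
      by (intro integrable_mult_right integrable_abs_power_gaussian) simp
    show "AE t in lborel. norm (exp (- t\<^sup>2) * \<bar>t\<bar> ^ q * exp (2 * r * t)) \<le> norm (exp (2 * r\<^sup>2) * (\<bar>t\<bar> ^ q * exp (- (1/2) * t\<^sup>2)))"
    proof (rule AE_I2)
      fix t :: real
      have "- t\<^sup>2 + 2 * r * t \<le> 2 * r\<^sup>2 + - (1/2) * t\<^sup>2"
        using zero_le_power2[of "t / 2 - r"] unfolding power2_diff by (simp add: power2_eq_square algebra_simps)
      then have "exp (- t\<^sup>2) * exp (2 * r * t) \<le> exp (2 * r\<^sup>2) * exp (- (1/2) * t\<^sup>2)" unfolding exp_add[symmetric] by simp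
      from mult_left_mono[OF this, of "\<bar>t\<bar> ^ q"]
      show "norm (exp (- t\<^sup>2) * \<bar>t\<bar> ^ q * exp (2 * r * t)) \<le> norm (exp (2 * r\<^sup>2) * (\<bar>t\<bar> ^ q * exp (- (1/2) * t\<^sup>2)))"
        by (simp add: mult_ac)
    qed
  qed measurable
  have Asum: "(\<lambda>j. A j * (r\<^sup>2) ^ j) sums (LINT t|lborel. exp (- t\<^sup>2) * \<bar>t\<bar> ^ q * cosh (2 * r * t))" for r
  proof -
    define g where "g j t = exp (- t\<^sup>2) * \<bar>t\<bar> ^ q * ((2 * r * t) ^ (2 * j) / fact (2 * j))" for j and t :: real
    have cs: "(\<lambda>j. y ^ (2 * j) / fact (2 * j)) sums cosh y" for y :: real
    proof -
      have "(\<lambda>n. if even n then y ^ n /\<^sub>R fact n else 0) sums cosh y" by (rule cosh_converges)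
      then have "(\<lambda>j. (\<lambda>n. if even n then y ^ n /\<^sub>R fact n else 0) (2 * j)) sums cosh y"
        by (subst sums_mono_reindex[of "\<lambda>j. 2 * j"]) (auto simp: strict_mono_def elim!: evenE)
      then show ?thesis by (simp add: divide_inverse mult.commute)
    qed
    have "(\<lambda>j. LINT t|lborel. g j t) sums (LINT t|lborel. exp (- t\<^sup>2) * \<bar>t\<bar> ^ q * cosh (2 * r * t))"
    proof (rule sums_integral_dominated(3))
      show "g j \<in> borel_measurable lborel" for j unfolding g_def by measurable
      show "(\<lambda>j. g j t) sums (exp (- t\<^sup>2) * \<bar>t\<bar> ^ q * cosh (2 * r * t))" for t
        unfolding g_def by (intro sums_mult cs)
      show "\<bar>\<Sum>j<k. g j t\<bar> \<le> exp (- t\<^sup>2) * \<bar>t\<bar> ^ q * cosh (2 * r * t)" for k t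
      proof -
        have pos: "(2 * r * t) ^ (2 * j) / fact (2 * j) \<ge> 0" for j by simp
        have "(\<Sum>j<k. (2 * r * t) ^ (2 * j) / fact (2 * j)) \<le> cosh (2 * r * t)"
          using sum_le_suminf[of "\<lambda>j. (2 * r * t) ^ (2 * j) / fact (2 * j)" "{..<k}"] cs[of "2 * r * t"] pos by (auto simp: sums_iff)
        moreover have "(\<Sum>j<k. (2 * r * t) ^ (2 * j) / fact (2 * j)) \<ge> 0" using pos by (rule sum_nonneg)
        ultimately show ?thesis unfolding g_def sum_distrib_left[symmetric] by (simp add: abs_mult mult_left_mono)
      qed
      have "integrable lborel (\<lambda>t. 1/2 * (exp (- t\<^sup>2) * \<bar>t\<bar> ^ q * exp (2 * r * t)) + 1/2 * (exp (- t\<^sup>2) * \<bar>t\<bar> ^ q * exp (2 * (- r) * t)))"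
        by (intro Bochner_Integration.integrable_add integrable_mult_right exp_int)
      then show "integrable lborel (\<lambda>t. exp (- t\<^sup>2) * \<bar>t\<bar> ^ q * cosh (2 * r * t))"
        by (simp add: cosh_def algebra_simps add_divide_distrib)
    qed
    moreover have "(LINT t|lborel. g j t) = A j * (r\<^sup>2) ^ j" for j
    proof -
      have "g j t = (4 ^ j / fact (2 * j) * (r\<^sup>2) ^ j) * (exp (- t\<^sup>2) * \<bar>t\<bar> ^ (q + 2 * j))" for t
        by (simp add: g_def power_add power_mult power_mult_distrib)
      then show ?thesis
        using gaussian_abs_moment[of "q + 2 * j"] by (simp add: A_def has_bochner_integral_iff)
    qed
    ultimately show ?thesis by simp
  qed
  have Aabs: "summable (\<lambda>j. \<bar>A j * y ^ j\<bar>)" for y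
  proof -
    have "summable (\<lambda>j. A j * ((sqrt \<bar>y\<bar>)\<^sup>2) ^ j)" using Asum[of "sqrt \<bar>y\<bar>"] by (simp add: sums_iff)
    then show ?thesis using Apos by (simp add: abs_mult power_abs less_imp_le abs_of_pos)
  qed
  define p where "p k = (\<Sum>i\<le>k. (- 1) ^ i / fact i * A (k - i))" for k
  define P where "P = Abs_fps p"
  define FA where "FA = Abs_fps A"
  have P: "P = fps_exp (- 1) * FA"
    by (rule fps_ext) (simp add: P_def FA_def fps_mult_nth p_def atLeast0AtMost)
  \<comment> \<open>Multiplication by exp (- 1) in the sense of formal series is invertible, so A
    can be substituted by p in the differential equation.\<close>
  have FA: "FA = fps_exp 1 * P"
    unfolding P mult.assoc[symmetric] fps_exp_add_mult[symmetric] by simp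
  have d1: "fps_deriv FA = fps_exp 1 * (fps_deriv P + P)"
    unfolding FA by (simp add: algebra_simps)
  have d2: "fps_deriv (fps_deriv FA) = fps_exp 1 * (fps_deriv (fps_deriv P) + 2 * fps_deriv P + P)"
    unfolding d1 by (simp add: algebra_simps)
  have odeA: "4 * (fps_X * fps_deriv (fps_deriv FA)) + 2 * fps_deriv FA - 4 * (fps_X * fps_deriv FA) - fps_const (2 * (real q + 1)) * FA = 0"
  proof (rule fps_ext)
    fix i
    show "fps_nth (4 * (fps_X * fps_deriv (fps_deriv FA)) + 2 * fps_deriv FA - 4 * (fps_X * fps_deriv FA) - fps_const (2 * (real q + 1)) * FA) i = fps_nth 0 i"
      using Arec[of i] by (cases i) (simp_all add: FA_def numeral_fps_const algebra_simps)
  qed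
  have "fps_exp 1 * (4 * (fps_X * fps_deriv (fps_deriv P)) + 4 * (fps_X * fps_deriv P) + 2 * fps_deriv P - fps_const (2 * real q) * P) = 0"
  proof -
    have k: "fps_const (2 * (real q + 1)) = fps_const (2 * real q) + 2"
      by (simp add: numeral_fps_const algebra_simps)
    show ?thesis using odeA unfolding k d2 d1 FA by (simp add: algebra_simps)
  qed
  then have odeP: "4 * (fps_X * fps_deriv (fps_deriv P)) + 4 * (fps_X * fps_deriv P) + 2 * fps_deriv P - fps_const (2 * real q) * P = 0"
    by (simp add: fps_exp_neq_0)
  have prec: "real (2 * j + 1) * (2 * real (j + 1)) * p (Suc j) = (2 * real q - 4 * real j) * p j" for j
  proof -
    have "fps_nth (4 * (fps_X * fps_deriv (fps_deriv P)) + 4 * (fps_X * fps_deriv P) + 2 * fps_deriv P - fps_const (2 * real q) * P) j = 0"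
      unfolding odeP by simp
    then show ?thesis by (cases j) (simp_all add: P_def numeral_fps_const algebra_simps)
  qed
  have pnz: "p j \<noteq> 0" for j
  proof (induction j)
    case 0
    then show ?case using Apos[of 0] by (simp add: p_def)
  next
    case (Suc j)
    have "2 * real q - 4 * real j \<noteq> 0"
    proof
      assume "2 * real q - 4 * real j = 0"
      then have "q = 2 * j" by linarith
      then show False using q by simp
    qed
    then show ?case using prec[of j] Suc by auto
  qed
  have "(\<lambda>j. p j * (r\<^sup>2) ^ j) sums (LINT t|lborel. exp (- t\<^sup>2) * \<bar>t + r\<bar> ^ q)" for r
  proof -
    have "(\<lambda>j. p j * (r\<^sup>2) ^ j) sums (exp (- 1 * r\<^sup>2) * (LINT t|lborel. exp (- t\<^sup>2) * \<bar>t\<bar> ^ q * cosh (2 * r * t)))"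
      using power_series_times_exp[OF Aabs, of "- 1" "r\<^sup>2"] Asum[of r] by (simp add: p_def sums_iff)
    also have "exp (- 1 * r\<^sup>2) * (LINT t|lborel. exp (- t\<^sup>2) * \<bar>t\<bar> ^ q * cosh (2 * r * t)) = (LINT t|lborel. exp (- t\<^sup>2) * \<bar>t + r\<bar> ^ q)"
    proof -
      \<comment> \<open>Reflection of t makes the two exponentials in \<open>cosh\<close> contribute
        equally, and completing the square with exp (- r^2) turns either of them into a translate of
        the Gaussian.\<close>
      have flip: "(LINT t|lborel. exp (- t\<^sup>2) * \<bar>t\<bar> ^ q * exp (2 * (- r) * t)) = (LINT t|lborel. exp (- t\<^sup>2) * \<bar>t\<bar> ^ q * exp (2 * r * t))"
        by (subst lborel_integral_real_affine[of "- 1" _ 0]) auto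
      have "2 * (LINT t|lborel. exp (- t\<^sup>2) * \<bar>t\<bar> ^ q * cosh (2 * r * t)) = (LINT t|lborel. 2 * (exp (- t\<^sup>2) * \<bar>t\<bar> ^ q * cosh (2 * r * t)))"
        by simp
      also have "\<dots> = (LINT t|lborel. exp (- t\<^sup>2) * \<bar>t\<bar> ^ q * exp (2 * r * t) + exp (- t\<^sup>2) * \<bar>t\<bar> ^ q * exp (2 * (- r) * t))"
        by (intro Bochner_Integration.integral_cong refl) (simp add: cosh_def algebra_simps)
      also have "\<dots> = (LINT t|lborel. exp (- t\<^sup>2) * \<bar>t\<bar> ^ q * exp (2 * r * t)) + (LINT t|lborel. exp (- t\<^sup>2) * \<bar>t\<bar> ^ q * exp (2 * (- r) * t))"
        by (intro Bochner_Integration.integral_add exp_int)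
      finally have "(LINT t|lborel. exp (- t\<^sup>2) * \<bar>t\<bar> ^ q * cosh (2 * r * t)) = (LINT t|lborel. exp (- t\<^sup>2) * \<bar>t\<bar> ^ q * exp (2 * r * t))"
        unfolding flip by simp
      then have "exp (- 1 * r\<^sup>2) * (LINT t|lborel. exp (- t\<^sup>2) * \<bar>t\<bar> ^ q * cosh (2 * r * t)) =
          (LINT t|lborel. exp (- 1 * r\<^sup>2) * (exp (- t\<^sup>2) * \<bar>t\<bar> ^ q * exp (2 * r * t)))" by simp
      also have "\<dots> = (LINT t|lborel. exp (- (t - r)\<^sup>2) * \<bar>t\<bar> ^ q)"
      proof (intro Bochner_Integration.integral_cong refl)
        fix t :: real
        have "exp (- (t - r)\<^sup>2) = exp (- 1 * r\<^sup>2) * (exp (- t\<^sup>2) * exp (2 * r * t))"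
          unfolding exp_add[symmetric] power2_diff by (simp add: algebra_simps)
        then show "exp (- 1 * r\<^sup>2) * (exp (- t\<^sup>2) * \<bar>t\<bar> ^ q * exp (2 * r * t)) = exp (- (t - r)\<^sup>2) * \<bar>t\<bar> ^ q"
          by (simp only: mult_ac)
      qed
      also have "\<dots> = (LINT t|lborel. exp (- t\<^sup>2) * \<bar>t + r\<bar> ^ q)"
        by (subst lborel_integral_real_affine[of 1 _ r]) (auto simp: add.commute)
      finally show ?thesis .
    qed
    finally show ?thesis .
  qed
  then show ?thesis using that[of p] pnz by blast
qed

section \<open>From the cosine transform to exponential moments\<close>

lemma integral_inner_power_gaussian:
  fixes \<xi> z :: "'a::euclidean_space"
  assumes \<xi>: "norm \<xi> = 1"
  shows "integrable lborel (\<lambda>y. \<bar>(y + z) \<bullet> \<xi>\<bar> ^ q * exp (- (norm y)\<^sup>2))"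
    and "(LINT y|lborel. \<bar>(y + z) \<bullet> \<xi>\<bar> ^ q * exp (- (norm y)\<^sup>2)) =
      pi powr ((real DIM('a) - 1) / 2) * (LINT t|lborel. exp (- t\<^sup>2) * \<bar>t + z \<bullet> \<xi>\<bar> ^ q)"
proof -
  let ?r = "z \<bullet> \<xi>" and ?p = "pi powr ((real DIM('a) - 1) / 2)"
  have int1: "integrable lborel (\<lambda>t::real. exp (- t\<^sup>2) * \<bar>t + ?r\<bar> ^ q)"
  proof (rule Bochner_Integration.integrable_bound)
    show "integrable lborel (\<lambda>t::real. (2 * \<bar>?r\<bar>) ^ q * (\<bar>t\<bar> ^ 0 * exp (- 1 * t\<^sup>2)) + 2 ^ q * (\<bar>t\<bar> ^ q * exp (- 1 * t\<^sup>2)))"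
      by (intro Bochner_Integration.integrable_add integrable_mult_right integrable_abs_power_gaussian) auto
    show "AE t in lborel. norm (exp (- t\<^sup>2) * \<bar>t + ?r\<bar> ^ q) \<le>
        norm ((2 * \<bar>?r\<bar>) ^ q * (\<bar>t\<bar> ^ 0 * exp (- 1 * t\<^sup>2)) + 2 ^ q * (\<bar>t\<bar> ^ q * exp (- 1 * t\<^sup>2)))"
    proof (rule AE_I2)
      fix t :: real
      have "\<bar>t + ?r\<bar> ^ q \<le> (2 * max \<bar>t\<bar> \<bar>?r\<bar>) ^ q" by (intro power_mono) auto
      also have "\<dots> \<le> (2 * \<bar>?r\<bar>) ^ q + (2 * \<bar>t\<bar>) ^ q" by (cases "\<bar>t\<bar> \<le> \<bar>?r\<bar>") (auto simp: max_def)
      finally have "\<bar>t + ?r\<bar> ^ q * exp (- t\<^sup>2) \<le> ((2 * \<bar>?r\<bar>) ^ q + (2 * \<bar>t\<bar>) ^ q) * exp (- t\<^sup>2)"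
        by (intro mult_right_mono) auto
      then show "norm (exp (- t\<^sup>2) * \<bar>t + ?r\<bar> ^ q) \<le>
        norm ((2 * \<bar>?r\<bar>) ^ q * (\<bar>t\<bar> ^ 0 * exp (- 1 * t\<^sup>2)) + 2 ^ q * (\<bar>t\<bar> ^ q * exp (- 1 * t\<^sup>2)))"
        by (simp add: power_mult_distrib algebra_simps)
    qed
  qed measurable
  have "(\<integral>\<^sup>+y. ennreal (\<bar>(y + z) \<bullet> \<xi>\<bar> ^ q * exp (- (norm y)\<^sup>2)) \<partial>lborel) =
    (\<integral>\<^sup>+y. ennreal (exp (- (y \<bullet> \<xi>)\<^sup>2) * \<bar>y \<bullet> \<xi> + ?r\<bar> ^ q) * ennreal (exp (- (norm (orth_part \<xi> y))\<^sup>2)) \<partial>lborel)"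
  proof (rule nn_integral_cong)
    fix y
    show "ennreal (\<bar>(y + z) \<bullet> \<xi>\<bar> ^ q * exp (- (norm y)\<^sup>2)) =
      ennreal (exp (- (y \<bullet> \<xi>)\<^sup>2) * \<bar>y \<bullet> \<xi> + ?r\<bar> ^ q) * ennreal (exp (- (norm (orth_part \<xi> y))\<^sup>2))"
      unfolding norm_orth_part[OF \<xi>, of y]
      by (simp add: ennreal_mult[symmetric] inner_add_left exp_diff exp_minus field_simps)
  qed
  also have "\<dots> = (\<integral>\<^sup>+t. ennreal (exp (- t\<^sup>2) * \<bar>t + ?r\<bar> ^ q) \<partial>lborel) * ennreal ?p"
    unfolding nn_integral_gaussian_hyperplane[OF \<xi>, symmetric]
    by (rule nn_integral_line_times_hyperplane[OF _ _ \<xi>]) measurable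
  also have "(\<integral>\<^sup>+t. ennreal (exp (- t\<^sup>2) * \<bar>t + ?r\<bar> ^ q) \<partial>lborel) = ennreal (LINT t|lborel. exp (- t\<^sup>2) * \<bar>t + ?r\<bar> ^ q)"
    by (rule nn_integral_eq_integral[OF int1]) simp
  also have "\<dots> * ennreal ?p = ennreal (?p * (LINT t|lborel. exp (- t\<^sup>2) * \<bar>t + ?r\<bar> ^ q))"
    by (subst ennreal_mult[symmetric]) (auto simp: mult.commute)
  finally have nn: "(\<integral>\<^sup>+y. ennreal (\<bar>(y + z) \<bullet> \<xi>\<bar> ^ q * exp (- (norm y)\<^sup>2)) \<partial>lborel) =
    ennreal (?p * (LINT t|lborel. exp (- t\<^sup>2) * \<bar>t + ?r\<bar> ^ q))" .
  show int: "integrable lborel (\<lambda>y. \<bar>(y + z) \<bullet> \<xi>\<bar> ^ q * exp (- (norm y)\<^sup>2))"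
    by (rule integrableI_nonneg) (use nn in auto)
  show "(LINT y|lborel. \<bar>(y + z) \<bullet> \<xi>\<bar> ^ q * exp (- (norm y)\<^sup>2)) = ?p * (LINT t|lborel. exp (- t\<^sup>2) * \<bar>t + ?r\<bar> ^ q)"
    using nn by (subst integral_eq_nn_integral) auto
qed

text \<open>The kernel itself is not analytic in x, so moments cannot be extracted from it directly.
  Its Gaussian average around y is an entire function of y \<bullet> \<xi>, and scaling y separates
  the even moments. Odd moments are excluded by evenness of b.\<close>

lemma cosine_transform_injective:
  fixes b :: "'a::euclidean_space \<Rightarrow> real"
  assumes bm[measurable]: "b \<in> borel_measurable borel" and bi: "integrable sphere_measure b"
    and even: "\<And>\<xi>. norm \<xi> = 1 \<Longrightarrow> b (- \<xi>) = b \<xi>" and q: "odd q"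
    and zero: "\<And>x. (LINT \<xi>|sphere_measure. \<bar>x \<bullet> \<xi>\<bar> ^ q * b \<xi>) = 0"
  shows "AE \<xi> in sphere_measure. b \<xi> = 0"
proof (rule sphere_AE_zero_of_exp_moments[OF bm bi])
  let ?S = "sphere_measure :: 'a measure" and ?p = "pi powr ((real DIM('a) - 1) / 2)"
  fix z :: 'a
  interpret pair_sigma_finite ?S "lborel :: 'a measure" ..
  have idm: "(\<lambda>x. fst x) \<in> borel_measurable (?S \<Otimes>\<^sub>M (lborel :: 'a measure))"
    by (rule measurable_compose[OF measurable_fst borel_measurable_sphere[OF measurable_ident_sets[OF refl], simplified]])
  note [measurable] = idm
  obtain p :: "nat \<Rightarrow> real" where p: "\<And>j. p j \<noteq> 0"
    "\<And>r::real. (\<lambda>j. p j * (r\<^sup>2) ^ j) sums (LINT t|lborel. exp (- t\<^sup>2) * \<bar>t + r\<bar> ^ q)"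
    using abs_power_gaussian_shift_series[OF q] by blast
  define \<kappa> where "\<kappa> r = (LINT t|lborel. exp (- t\<^sup>2) * \<bar>t + r\<bar> ^ q)" for r :: real
  have pabs: "summable (\<lambda>j. \<bar>p j\<bar> * R ^ j)" if "R \<ge> 0" for R
  proof -
    have "summable (\<lambda>j. p j * ((sqrt (R + 1))\<^sup>2) ^ j)" using p(2)[of "sqrt (R + 1)"] by (rule sums_summable)
    then have "summable (\<lambda>j. norm (p j * R ^ j))"
      using that by (intro powser_insidea[of p "R + 1" R]) auto
    then show ?thesis using that by (simp add: abs_mult)
  qed
  have series: "(\<lambda>j. e j * (LINT \<xi>|?S. b \<xi> * (y \<bullet> \<xi>) ^ (2 * j))) sums (LINT \<xi>|?S. b \<xi> * E (y \<bullet> \<xi>))"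
    if e: "\<And>R. R \<ge> 0 \<Longrightarrow> summable (\<lambda>j. \<bar>e j\<bar> * R ^ j)" and E: "\<And>r. (\<lambda>j. e j * (r\<^sup>2) ^ j) sums E r" for e :: "nat \<Rightarrow> real" and E y
  proof -
    have "(\<lambda>j. LINT \<xi>|?S. b \<xi> * (e j * ((y \<bullet> \<xi>)\<^sup>2) ^ j)) sums (LINT \<xi>|?S. b \<xi> * E (y \<bullet> \<xi>))"
    proof (rule sums_integral_dominated(3)[where G = "\<lambda>\<xi>. \<bar>b \<xi>\<bar> * (\<Sum>j. \<bar>e j\<bar> * ((norm y)\<^sup>2) ^ j)"])
      show "(\<lambda>\<xi>. b \<xi> * (e j * ((y \<bullet> \<xi>)\<^sup>2) ^ j)) \<in> borel_measurable ?S" for j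
        by (rule borel_measurable_sphere) measurable
      show "(\<lambda>j. b \<xi> * (e j * ((y \<bullet> \<xi>)\<^sup>2) ^ j)) sums (b \<xi> * E (y \<bullet> \<xi>))" for \<xi> by (intro sums_mult E)
      show "integrable ?S (\<lambda>\<xi>. \<bar>b \<xi>\<bar> * (\<Sum>j. \<bar>e j\<bar> * ((norm y)\<^sup>2) ^ j))"
        using bi by (intro integrable_mult_left integrable_abs)
      fix k and \<xi> :: 'a assume "\<xi> \<in> space ?S"
      then have "\<bar>y \<bullet> \<xi>\<bar> \<le> norm y" using Cauchy_Schwarz_ineq2[of y \<xi>] by simp
      then have le: "(y \<bullet> \<xi>)\<^sup>2 \<le> (norm y)\<^sup>2" by (simp add: abs_le_square_iff[symmetric])
      have "\<bar>\<Sum>j<k. e j * ((y \<bullet> \<xi>)\<^sup>2) ^ j\<bar> \<le> (\<Sum>j<k. \<bar>e j\<bar> * ((norm y)\<^sup>2) ^ j)"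
        by (rule order_trans[OF sum_abs sum_mono]) (auto simp: abs_mult intro!: mult_left_mono power_mono le)
      also have "\<dots> \<le> (\<Sum>j. \<bar>e j\<bar> * ((norm y)\<^sup>2) ^ j)" by (intro sum_le_suminf e) auto
      finally show "\<bar>\<Sum>j<k. b \<xi> * (e j * ((y \<bullet> \<xi>)\<^sup>2) ^ j)\<bar> \<le> \<bar>b \<xi>\<bar> * (\<Sum>j. \<bar>e j\<bar> * ((norm y)\<^sup>2) ^ j)"
        unfolding sum_distrib_left[symmetric] abs_mult by (intro mult_left_mono) auto
    qed
    moreover have "(LINT \<xi>|?S. b \<xi> * (e j * ((y \<bullet> \<xi>)\<^sup>2) ^ j)) = e j * (LINT \<xi>|?S. b \<xi> * (y \<bullet> \<xi>) ^ (2 * j))" for j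
    proof -
      have "b \<xi> * (e j * ((y \<bullet> \<xi>)\<^sup>2) ^ j) = e j * (b \<xi> * (y \<bullet> \<xi>) ^ (2 * j))" for \<xi> by (simp add: power_mult)
      then show ?thesis by (simp only: integral_mult_right_zero)
    qed
    ultimately show ?thesis by simp
  qed
  \<comment> \<open>The hypothesis at x + y is integrated against a Gaussian in x. The interchange
    of integrals is justified by bounding \<kappa> through the absolute values of its coefficients
    at \<open>norm y\<close>.\<close>
  have smooth0: "(LINT \<xi>|?S. b \<xi> * \<kappa> (y \<bullet> \<xi>)) = 0" for y
  proof -
    define K where "K = (LINT x|lborel. (norm x + norm y) ^ q * exp (- (norm (x::'a))\<^sup>2))"
    define F where "F = (\<lambda>(\<xi>, x). b \<xi> * (\<bar>(x + y) \<bullet> \<xi>\<bar> ^ q * exp (- (norm x)\<^sup>2)))"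
    have [measurable]: "F \<in> borel_measurable (?S \<Otimes>\<^sub>M (lborel :: 'a measure))" unfolding F_def by measurable
    have \<kappa>0: "\<kappa> r \<ge> 0" for r unfolding \<kappa>_def by (intro integral_nonneg_AE AE_I2) simp
    have inner: "(LINT x|lborel. norm (F (\<xi>, x))) = \<bar>b \<xi>\<bar> * (?p * \<kappa> (y \<bullet> \<xi>))" "integrable lborel (\<lambda>x. F (\<xi>, x))"
      "(LINT x|lborel. F (\<xi>, x)) = ?p * (b \<xi> * \<kappa> (y \<bullet> \<xi>))" if "\<xi> \<in> space ?S" for \<xi>
    proof -
      have \<xi>: "norm \<xi> = 1" using that by simp
      note I = integral_inner_power_gaussian[OF \<xi>, of y q]
      show "integrable lborel (\<lambda>x. F (\<xi>, x))" using I(1) by (simp add: F_def)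
      show "(LINT x|lborel. norm (F (\<xi>, x))) = \<bar>b \<xi>\<bar> * (?p * \<kappa> (y \<bullet> \<xi>))" using I(2) by (simp add: F_def abs_mult \<kappa>_def)
      show "(LINT x|lborel. F (\<xi>, x)) = ?p * (b \<xi> * \<kappa> (y \<bullet> \<xi>))" using I(2) by (simp add: F_def \<kappa>_def mult_ac)
    qed
    have \<kappa>le: "\<kappa> r \<le> (\<Sum>j. \<bar>p j\<bar> * (R\<^sup>2) ^ j)" if "\<bar>r\<bar> \<le> R" for r R
    proof -
      have "r\<^sup>2 \<le> R\<^sup>2" using power_mono[OF that, of 2] by simp
      then have "p j * (r\<^sup>2) ^ j \<le> \<bar>p j\<bar> * (R\<^sup>2) ^ j" for j
        by (intro mult_mono[OF abs_ge_self power_mono[OF \<open>r\<^sup>2 \<le> R\<^sup>2\<close>]]) auto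
      then show ?thesis using p(2)[of r] pabs[of "R\<^sup>2"] unfolding \<kappa>_def
        by (intro sums_le[OF _ p(2) summable_sums]) auto
    qed
    have "integrable (?S \<Otimes>\<^sub>M lborel) F"
    proof (rule Fubini_integrable)
      show "AE \<xi> in ?S. integrable lborel (\<lambda>x. F (\<xi>, x))" by (rule AE_I2) (rule inner(2))
      show "integrable ?S (\<lambda>\<xi>. LINT x|lborel. norm (F (\<xi>, x)))"
      proof (rule Bochner_Integration.integrable_bound)
        show "integrable ?S (\<lambda>\<xi>. b \<xi> * (?p * (\<Sum>j. \<bar>p j\<bar> * ((norm y)\<^sup>2) ^ j)))"
          using bi by (rule integrable_mult_left)
        show "AE \<xi> in ?S. norm (LINT x|lborel. norm (F (\<xi>, x))) \<le> norm (b \<xi> * (?p * (\<Sum>j. \<bar>p j\<bar> * ((norm y)\<^sup>2) ^ j)))"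
        proof (rule AE_I2)
          fix \<xi> assume \<xi>: "\<xi> \<in> space ?S"
          then have "\<bar>y \<bullet> \<xi>\<bar> \<le> norm y" using Cauchy_Schwarz_ineq2[of y \<xi>] by simp
          from \<kappa>le[OF this] have "\<bar>b \<xi>\<bar> * (?p * \<kappa> (y \<bullet> \<xi>)) \<le> \<bar>b \<xi>\<bar> * (?p * (\<Sum>j. \<bar>p j\<bar> * ((norm y)\<^sup>2) ^ j))"
            by (intro mult_left_mono) auto
          also have "\<dots> \<le> norm (b \<xi> * (?p * (\<Sum>j. \<bar>p j\<bar> * ((norm y)\<^sup>2) ^ j)))"
            using abs_ge_self[of "?p * (\<Sum>j. \<bar>p j\<bar> * ((norm y)\<^sup>2) ^ j)"] unfolding real_norm_def abs_mult[of "b \<xi>"]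
            by (intro mult_left_mono) auto
          finally show "norm (LINT x|lborel. norm (F (\<xi>, x))) \<le> norm (b \<xi> * (?p * (\<Sum>j. \<bar>p j\<bar> * ((norm y)\<^sup>2) ^ j)))"
            unfolding inner(1)[OF \<xi>] using \<kappa>0 by simp
        qed
      qed measurable
    qed measurable
    then have "(LINT x|lborel. (LINT \<xi>|?S. F (\<xi>, x))) = (LINT \<xi>|?S. (LINT x|lborel. F (\<xi>, x)))"
      using Fubini_integral[of "\<lambda>\<xi> x. F (\<xi>, x)"] by simp
    also have "\<dots> = (LINT \<xi>|?S. ?p * (b \<xi> * \<kappa> (y \<bullet> \<xi>)))"
      by (intro Bochner_Integration.integral_cong refl inner(3))
    also have "\<dots> = ?p * (LINT \<xi>|?S. b \<xi> * \<kappa> (y \<bullet> \<xi>))" by (rule integral_mult_right_zero)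
    also have "(LINT x|lborel. (LINT \<xi>|?S. F (\<xi>, x))) = 0"
    proof -
      have "(LINT \<xi>|?S. F (\<xi>, x)) = 0" for x
      proof -
        have "F (\<xi>, x) = exp (- (norm x)\<^sup>2) * (\<bar>(x + y) \<bullet> \<xi>\<bar> ^ q * b \<xi>)" for \<xi> by (simp add: F_def)
        then show ?thesis using zero[of "x + y"] by (simp only: integral_mult_right_zero mult_zero_right)
      qed
      then show ?thesis by simp
    qed
    finally show ?thesis by simp
  qed
  have mom: "(LINT \<xi>|?S. b \<xi> * (z \<bullet> \<xi>) ^ (2 * j)) = 0" for j
  proof -
    have "p j * (LINT \<xi>|?S. b \<xi> * (z \<bullet> \<xi>) ^ (2 * j)) = 0"
    proof (rule power_series_zero_imp_coeff_zero[where c = "\<lambda>j. p j * (LINT \<xi>|?S. b \<xi> * (z \<bullet> \<xi>) ^ (2 * j))"])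
      fix a :: real assume a: "a > 0"
      \<comment> \<open>Scaling z by sqrt a converts the series of moments into a power series in a
        that vanishes for all a > 0.\<close>
      have "(\<lambda>j. p j * (LINT \<xi>|?S. b \<xi> * ((sqrt a *\<^sub>R z) \<bullet> \<xi>) ^ (2 * j))) sums 0"
        using series[OF pabs p(2), of "sqrt a *\<^sub>R z"] smooth0[of "sqrt a *\<^sub>R z"] by (simp add: \<kappa>_def)
      moreover have "(LINT \<xi>|?S. b \<xi> * ((sqrt a *\<^sub>R z) \<bullet> \<xi>) ^ (2 * j)) = a ^ j * (LINT \<xi>|?S. b \<xi> * (z \<bullet> \<xi>) ^ (2 * j))" for j
      proof -
        have "b \<xi> * ((sqrt a *\<^sub>R z) \<bullet> \<xi>) ^ (2 * j) = a ^ j * (b \<xi> * (z \<bullet> \<xi>) ^ (2 * j))" for \<xi>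
          using a by (simp add: power_mult_distrib power_mult)
        then show ?thesis by (simp only: integral_mult_right_zero)
      qed
      ultimately show "(\<lambda>j. p j * (LINT \<xi>|?S. b \<xi> * (z \<bullet> \<xi>) ^ (2 * j)) * a ^ j) sums 0"
        by (simp add: mult_ac)
    qed
    then show ?thesis using p(1)[of j] by simp
  qed
  \<comment> \<open>Even moments control only the even part of the exponential.\<close>
  have cosh0: "(LINT \<xi>|?S. b \<xi> * cosh (z \<bullet> \<xi>)) = 0"
  proof -
    have "(\<lambda>j. 1 / fact (2 * j) * (LINT \<xi>|?S. b \<xi> * (z \<bullet> \<xi>) ^ (2 * j))) sums (LINT \<xi>|?S. b \<xi> * cosh (z \<bullet> \<xi>))"
    proof (rule series)
      show s: "(\<lambda>j. 1 / fact (2 * j) * (y\<^sup>2) ^ j) sums cosh y" for y :: real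
      proof -
        have "(\<lambda>n. if even n then y ^ n /\<^sub>R fact n else 0) sums cosh y" by (rule cosh_converges)
        then have "(\<lambda>j. (\<lambda>n. if even n then y ^ n /\<^sub>R fact n else 0) (2 * j)) sums cosh y"
          by (subst sums_mono_reindex[of "\<lambda>j. 2 * j"]) (auto simp: strict_mono_def elim!: evenE)
        then show ?thesis by (simp add: divide_inverse mult.commute flip: power_mult)
      qed
      show "summable (\<lambda>j. \<bar>1 / fact (2 * j) :: real\<bar> * R ^ j)" if "R \<ge> 0" for R
        using sums_summable[OF s[of "sqrt R"]] that by simp
    qed
    then show ?thesis unfolding mom by (simp add: sums_iff)
  qed
  have iexp: "integrable ?S (\<lambda>\<xi>. b \<xi> * exp (y \<bullet> \<xi>))" for y
  proof (rule Bochner_Integration.integrable_bound[OF integrable_mult_left[OF bi, of "exp (norm y)"]])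
    show "(\<lambda>\<xi>. b \<xi> * exp (y \<bullet> \<xi>)) \<in> borel_measurable ?S" by (rule borel_measurable_sphere) measurable
    show "AE \<xi> in ?S. norm (b \<xi> * exp (y \<bullet> \<xi>)) \<le> norm (b \<xi> * exp (norm y))"
    proof (rule AE_I2)
      fix \<xi> :: 'a assume "\<xi> \<in> space ?S"
      then have "y \<bullet> \<xi> \<le> norm y" using Cauchy_Schwarz_ineq2[of y \<xi>] by simp
      then show "norm (b \<xi> * exp (y \<bullet> \<xi>)) \<le> norm (b \<xi> * exp (norm y))" by (simp add: abs_mult mult_left_mono)
    qed
  qed
  \<comment> \<open>Evenness of b makes the moments at z and - z equal, so each is the
    \<open>cosh\<close> moment.\<close>
  have "(LINT \<xi>|?S. b \<xi> * exp ((- z) \<bullet> \<xi>)) = (LINT \<xi>|?S. b (- \<xi>) * exp ((- z) \<bullet> (- \<xi>)))"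
    by (rule integral_sphere_uminus[symmetric]) (rule borel_measurable_integrable[OF iexp])
  also have "\<dots> = (LINT \<xi>|?S. b \<xi> * exp (z \<bullet> \<xi>))"
    by (intro Bochner_Integration.integral_cong refl) (simp add: even)
  finally have "2 * (LINT \<xi>|?S. b \<xi> * exp (z \<bullet> \<xi>)) = (LINT \<xi>|?S. b \<xi> * exp (z \<bullet> \<xi>)) + (LINT \<xi>|?S. b \<xi> * exp ((- z) \<bullet> \<xi>))" by simp
  also have "\<dots> = (LINT \<xi>|?S. b \<xi> * exp (z \<bullet> \<xi>) + b \<xi> * exp ((- z) \<bullet> \<xi>))"
    by (intro Bochner_Integration.integral_add[symmetric] iexp)
  also have "\<dots> = (LINT \<xi>|?S. 2 * (b \<xi> * cosh (z \<bullet> \<xi>)))"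
    by (intro Bochner_Integration.integral_cong refl) (simp add: cosh_def algebra_simps)
  finally show "(LINT \<xi>|?S. b \<xi> * exp (z \<bullet> \<xi>)) = 0" using cosh0 by simp
qed

section \<open>Blaschke-Levy representation\<close>

text \<open>Agreement is asked on the ball rather than on the sphere because
  \<open>sgn 0 = 0\<close> also occurs as an argument.\<close>

lemma great_integral_cong:
  assumes "\<And>\<xi>. norm \<xi> \<le> 1 \<Longrightarrow> F \<xi> = G \<xi>"
  shows "great_integral F \<theta> = great_integral G \<theta>"
proof -
  have "F (sgn y) = G (sgn y)" for y by (rule assms) (simp add: norm_sgn)
  then show ?thesis by (simp add: great_integral_def)
qed

text \<open>Duality demands functions bounded on the whole space. Truncating \<bar>x \<bullet>
  \<xi>\<bar> ^ q and the norm of the projection at their maximal values on the sphere supplies the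
  bounds and changes nothing on unit vectors.\<close>

lemma spherical_radon_abs_inner_power:
  fixes f :: "'a::euclidean_space \<Rightarrow> real"
  assumes f: "f \<in> borel_measurable borel" "integrable sphere_measure f"
    and q: "q > 0" and n: "DIM('a) \<ge> 2"
  shows "(LINT \<xi>|sphere_measure. \<bar>x \<bullet> \<xi>\<bar> ^ q * (LINT \<theta>|great_subsphere_measure \<xi>. f \<theta>)) =
    2 * pi powr ((real DIM('a) - 2) / 2) * Gamma ((real q + 1) / 2) / Gamma ((real DIM('a) + real q - 1) / 2) *
      (LINT \<theta>|sphere_measure. f \<theta> * norm (orth_part \<theta> x) ^ q)"
proof -
  define K where "K = 2 * pi powr ((real DIM('a) - 2) / 2) * Gamma ((real q + 1) / 2) / Gamma ((real DIM('a) + real q - 1) / 2)"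
  define g where "g \<xi> = min (\<bar>x \<bullet> \<xi>\<bar> ^ q) (norm x ^ q)" for \<xi>
  define \<gamma> where "\<gamma> \<theta> = K * min (norm x) (norm (orth_part \<theta> x)) ^ q" for \<theta>
  have K: "K \<ge> 0" unfolding K_def using n by (intro divide_nonneg_nonneg mult_nonneg_nonneg Gamma_real_nonneg) auto
  have ip: "\<bar>x \<bullet> \<xi>\<bar> ^ q \<le> norm x ^ q" if "norm \<xi> \<le> 1" for \<xi>
  proof (rule power_mono)
    have "\<bar>x \<bullet> \<xi>\<bar> \<le> norm x * norm \<xi>" by (rule Cauchy_Schwarz_ineq2)
    also have "\<dots> \<le> norm x * 1" using that by (intro mult_left_mono) auto
    finally show "\<bar>x \<bullet> \<xi>\<bar> \<le> norm x" by simp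
  qed simp
  have op: "norm (orth_part \<theta> x) \<le> norm x" if "norm \<theta> = 1" for \<theta>
  proof -
    have "(norm (orth_part \<theta> x))\<^sup>2 = (norm x)\<^sup>2 - (x \<bullet> \<theta>)\<^sup>2"
      unfolding orth_part_def power2_norm_eq_inner using that
      by (simp add: inner_diff_left inner_diff_right inner_commute norm_eq_1 power2_eq_square)
    then have "(norm (orth_part \<theta> x))\<^sup>2 \<le> (norm x)\<^sup>2" by simp
    then show ?thesis by (rule power2_le_imp_le) simp
  qed
  have "(LINT \<xi>|sphere_measure. g \<xi> * (LINT \<theta>|great_subsphere_measure \<xi>. f \<theta>)) = (LINT \<theta>|sphere_measure. f \<theta> * \<gamma> \<theta>)"
  proof (rule spherical_radon_duality(2)[OF f, where D = "norm x ^ q" and E = "K * norm x ^ q"])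
    show "continuous_on UNIV g" unfolding g_def by (intro continuous_intros)
    show "0 \<le> g \<xi> \<and> g \<xi> \<le> norm x ^ q" for \<xi> by (simp add: g_def)
    show "\<gamma> \<in> borel_measurable borel" unfolding \<gamma>_def orth_part_def by measurable
    show "0 \<le> \<gamma> \<theta> \<and> \<gamma> \<theta> \<le> K * norm x ^ q" for \<theta>
      using K by (auto simp: \<gamma>_def intro!: mult_left_mono power_mono)
    show "great_integral (\<lambda>y. ennreal (g y)) \<theta> = ennreal (\<gamma> \<theta>)" if "norm \<theta> = 1" for \<theta>
    proof -
      have "great_integral (\<lambda>y. ennreal (g y)) \<theta> = great_integral (\<lambda>y. ennreal (\<bar>x \<bullet> y\<bar> ^ q)) \<theta>"
        by (rule great_integral_cong) (use ip in \<open>simp add: g_def min_absorb1\<close>)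
      then show ?thesis
        using great_integral_inner_power[OF that q n, of x] op[OF that] by (simp add: \<gamma>_def K_def min_absorb2)
    qed
  qed (rule n)
  moreover have "(LINT \<xi>|sphere_measure. g \<xi> * (LINT \<theta>|great_subsphere_measure \<xi>. f \<theta>)) =
      (LINT \<xi>|sphere_measure. \<bar>x \<bullet> \<xi>\<bar> ^ q * (LINT \<theta>|great_subsphere_measure \<xi>. f \<theta>))"
    by (intro Bochner_Integration.integral_cong refl) (use ip in \<open>simp add: g_def min_absorb1\<close>)
  moreover have "(LINT \<theta>|sphere_measure. f \<theta> * \<gamma> \<theta>) = (LINT \<theta>|sphere_measure. K * (f \<theta> * norm (orth_part \<theta> x) ^ q))"
    by (intro Bochner_Integration.integral_cong refl) (use op in \<open>simp add: \<gamma>_def min_absorb2\<close>)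
  ultimately show ?thesis unfolding K_def[symmetric] by (simp add: integral_mult_right_zero)
qed

lemma spherical_radon_integrable:
  fixes f :: "'a::euclidean_space \<Rightarrow> real"
  assumes f: "f \<in> borel_measurable borel" "integrable sphere_measure f" and n: "DIM('a) \<ge> 2"
  shows "integrable sphere_measure (\<lambda>\<xi>. LINT \<theta>|great_subsphere_measure \<xi>. f \<theta>)"
proof -
  let ?M = "2 * pi powr ((real DIM('a) - 1) / 2) / Gamma ((real DIM('a) - 1) / 2)"
  have "?M \<ge> 0" using n by (intro divide_nonneg_nonneg mult_nonneg_nonneg Gamma_real_nonneg) auto
  then have "integrable sphere_measure (\<lambda>\<xi>. 1 * (LINT \<theta>|great_subsphere_measure \<xi>. f \<theta>))"
    using great_integral_1[OF _ n]
    by (intro spherical_radon_duality(1)[OF f, where \<gamma> = "\<lambda>_. ?M" and D = 1 and E = ?M]) (auto simp: n)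
  then show ?thesis by simp
qed

text \<open>A bound almost everywhere on the sphere says nothing about an individual great
  subsphere, which is a null set. Duality, applied to the indicator of the exceptional set, shows
  that almost every great subsphere meets that set in a null set of its own measure.\<close>

lemma spherical_radon_bound:
  fixes f :: "'a::euclidean_space \<Rightarrow> real"
  assumes f[measurable]: "f \<in> borel_measurable borel" and n: "DIM('a) \<ge> 2" and r: "r \<ge> 0"
    and bound: "AE \<theta> in sphere_measure. \<bar>f \<theta>\<bar> \<le> r"
  shows "AE \<xi> in sphere_measure. \<bar>LINT \<theta>|great_subsphere_measure \<xi>. f \<theta>\<bar> \<le>
    r * (2 * pi powr ((real DIM('a) - 1) / 2) / Gamma ((real DIM('a) - 1) / 2))"
proof -
  let ?S = "sphere_measure :: 'a measure"
  let ?M = "2 * pi powr ((real DIM('a) - 1) / 2) / Gamma ((real DIM('a) - 1) / 2)"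
  have M: "?M \<ge> 0" using n by (intro divide_nonneg_nonneg mult_nonneg_nonneg Gamma_real_nonneg) auto
  define F where "F = (\<lambda>\<theta>. indicator {\<theta>. r < \<bar>f \<theta>\<bar>} \<theta> :: ennreal)"
  have [measurable]: "F \<in> borel_measurable borel" unfolding F_def by measurable
  have "(\<integral>\<^sup>+\<xi>. great_integral F \<xi> \<partial>?S) = (\<integral>\<^sup>+\<theta>. F \<theta> * great_integral (\<lambda>_. ennreal 1) \<theta> \<partial>?S)"
    using great_integral_duality[of F "\<lambda>_. 1" 1] n by simp
  also have "\<dots> = 0"
  proof -
    have "AE \<theta> in ?S. F \<theta> * great_integral (\<lambda>_. ennreal 1) \<theta> = 0"
      using bound by eventually_elim (simp add: F_def)
    from nn_integral_cong_AE[OF this] show ?thesis by simp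
  qed
  finally have "AE \<xi> in ?S. great_integral F \<xi> = 0"
    by (subst (asm) nn_integral_0_iff_AE) (simp_all add: borel_measurable_sphere)
  then show ?thesis using AE_space
  proof eventually_elim
    case (elim \<xi>)
    then have \<xi>: "norm \<xi> = 1" by simp
    let ?G = "great_subsphere_measure \<xi>"
    have "(\<integral>\<^sup>+\<theta>. F \<theta> \<partial>?G) = 0" using great_integral_eq[OF _ \<xi>, of F] elim(1) by simp
    then have "AE \<theta> in ?G. F \<theta> = 0"
      by (subst (asm) nn_integral_0_iff_AE) (simp_all add: borel_measurable_great_subsphere)
    then have le: "AE \<theta> in ?G. \<bar>f \<theta>\<bar> \<le> r"
      by eventually_elim (simp add: F_def indicator_def split: if_splits)
    show ?case
    proof (cases "integrable ?G f")
      case True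
      then have "ennreal \<bar>LINT \<theta>|?G. f \<theta>\<bar> \<le> (\<integral>\<^sup>+\<theta>. ennreal \<bar>f \<theta>\<bar> \<partial>?G)"
        using integral_norm_bound_ennreal[OF True] by simp
      also have "\<dots> \<le> (\<integral>\<^sup>+\<theta>. ennreal r * 1 \<partial>?G)"
        using le by (intro nn_integral_mono_AE) (auto elim!: eventually_mono simp: ennreal_leI)
      also have "\<dots> = ennreal r * (\<integral>\<^sup>+\<theta>. 1 \<partial>?G)" by (rule nn_integral_cmult) simp
      also have "(\<integral>\<^sup>+\<theta>. 1 \<partial>?G) = ennreal ?M"
        using great_integral_eq[OF _ \<xi>, of "\<lambda>_. 1"] great_integral_1[OF \<xi> n] by simp
      also have "ennreal r * ennreal ?M = ennreal (r * ?M)" by (rule ennreal_mult[symmetric, OF r M])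
      finally show ?thesis using mult_nonneg_nonneg[OF r M] by (subst (asm) ennreal_le_iff)
    next
      \<comment> \<open>For a function that is not integrable the integral is 0 by convention, and
        the bound is trivial.\<close>
      case False
      then show ?thesis using mult_nonneg_nonneg[OF r M] by (simp add: not_integrable_integral_eq)
    qed
  qed
qed

lemma inversion_density_cong:
  assumes "\<And>\<theta>. norm \<theta> = 1 \<Longrightarrow> f \<theta> = g \<theta>"
  shows "inversion_density q f \<xi> = inversion_density q g \<xi>"
proof -
  have "(LINT \<theta>|great_subsphere_measure \<xi>. f \<theta>) = (LINT \<theta>|great_subsphere_measure \<xi>. g \<theta>)"
    by (intro Bochner_Integration.integral_cong refl) (simp add: assms great_subsphere_def)
  then show ?thesis by (simp add: inversion_density_def)
qed

text \<open>\<open>Gamma\<close> is given the value 0 at its poles, where the quotient would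
  degenerate; the argument - q / 2 is a half-integer and avoids them.\<close>

lemma C_const_nonzero:
  assumes "odd q"
  shows "C_const (real q) \<noteq> 0"
proof -
  obtain j where "q = 2 * j + 1" using assms by (rule oddE)
  then have "half_integer (- real q / 2)"
    by (auto simp: half_integer_def intro!: exI[of _ "- int j - 1"])
  then have "Gamma (- real q / 2) \<noteq> 0"
    by (simp add: Gamma_eq_zero_iff half_integer_not_nonpos_Int)
  moreover have "Gamma ((real q + 1) / 2) \<noteq> 0"
    by (rule less_imp_neq[symmetric], rule Gamma_real_pos) simp
  ultimately show ?thesis by (simp add: C_const_def)
qed

section \<open>The density and its normalisation\<close>

context homogeneous_laplacian begin

text \<open>The prefactor of the density times the constant of the transform of \<bar>x \<bullet>
  \<xi>\<bar> ^ q equals the constant of the inversion formula: \<open>Gamma ((q + 1) / 2)\<close>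
  cancels against \<open>C_const\<close>, and (n + q - 1) / 2 is m.\<close>

lemma inversion_constant:
  "(- 1) ^ m * pi / (2 * (2 * pi) ^ (DIM('a) - 1) * C_const (real q)) *
     (2 * pi powr ((real DIM('a) - 2) / 2) * Gamma ((real q + 1) / 2) / Gamma ((real DIM('a) + real q - 1) / 2)) =
   sqrt pi / (2 * pi ^ h * (- 4) ^ m) * (Gamma (- real q / 2) / Gamma (real m))"
proof -
  obtain k where k: "h = Suc k" using h_pos by (cases h) auto
  \<comment> \<open>The algebra with opaque letters: P and T stand for the powers (2 * pi)^(n - 1)
    and 2^(q + 1), F for 4^m, L and Q for pi^(h - 1) and pi^h.\<close>
  have red: "e * p / (2 * P * (T * s * G / A)) * (2 * L * G / B) = s / (2 * Q * (e * F)) * (A / B)"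
    if "P * T = 2 * F * L * Q" "p = s * s" "e * e = 1" "s \<noteq> 0" "G \<noteq> 0" "L \<noteq> 0" for e p P T s G A L B Q F :: real
  proof -
    have e: "1 / e = e" using that(3) by (cases "e = 0") (auto simp: field_simps)
    have "e * p / (2 * P * (T * s * G / A)) * (2 * L * G / B) = (e * s * A / B) * (s * G * L) / ((P * T) * (s * G))"
      using that(2) by (simp add: mult_ac)
    also have "\<dots> = (1 / e) * s * A / (2 * F * Q * B)" unfolding that(1) e using that(4-6) by (simp add: mult_ac)
    finally show ?thesis by (simp add: mult_ac)
  qed
  have e: "(- 4) ^ m = (- 1) ^ m * (4::real) ^ m" by (simp flip: power_mult_distrib)
  have arg: "(real DIM('a) + real q - 1) / 2 = real m" "(real DIM('a) - 2) / 2 = real k" "DIM('a) - 1 = 2 * k + 1"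
    using m n k by (simp_all add: field_simps flip: of_nat_add)
  \<comment> \<open>The powers of 2 match because (n - 1) + (q + 1) = 2 * m + 1.\<close>
  have "(2 * pi) ^ (2 * k + 1) * 2 ^ (q + 1) = 2 * 4 ^ m * pi ^ k * pi ^ Suc k"
  proof -
    have "(2::real) ^ (2 * k + 1) * 2 ^ (q + 1) = 2 ^ (2 * m + 1)"
      unfolding power_add[symmetric] using m n k by (intro arg_cong[of _ _ "power 2"]) simp
    also have "\<dots> = 2 * 4 ^ m" by (simp add: power_mult)
    finally have 1: "(2::real) ^ (2 * k + 1) * 2 ^ (q + 1) = 2 * 4 ^ m" .
    have 2: "pi ^ (2 * k + 1) = pi ^ k * pi ^ Suc k" by (simp add: mult_2 power_add)
    have "(2 * pi) ^ (2 * k + 1) * 2 ^ (q + 1) = (2 ^ (2 * k + 1) * 2 ^ (q + 1)) * pi ^ (2 * k + 1)"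
      by (simp only: power_mult_distrib mult_ac)
    then show ?thesis unfolding 1 2 by simp
  qed
  moreover have "2 powr (real q + 1) = 2 ^ (q + 1)"
    using powr_realpow[of 2 "q + 1"] by (simp add: add.commute)
  moreover have "Gamma ((real q + 1) / 2) \<noteq> 0"
    by (rule less_imp_neq[symmetric], rule Gamma_real_pos) simp
  moreover have "((- 1) ^ m * (- 1) ^ m :: real) = 1" by (simp flip: power_mult_distrib)
  ultimately show ?thesis
    unfolding arg C_const_def e k by (intro red) (simp_all add: powr_realpow)
qed

lemma inversion_density_represents:
  "u x = (LINT \<xi>|sphere_measure. \<bar>x \<bullet> \<xi>\<bar> ^ q * inversion_density q f \<xi>)"
proof -
  have q0: "q > 0" using q by (rule odd_pos)
  have n2: "DIM('a) \<ge> 2" using n h_pos by simp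
  have m': "(DIM('a) + q - 1) div 2 = m" using m by simp
  let ?c = "(- 1) ^ m * pi / (2 * (2 * pi) ^ (DIM('a) - 1) * C_const (real q))"
  have "(LINT \<xi>|sphere_measure. \<bar>x \<bullet> \<xi>\<bar> ^ q * inversion_density q f \<xi>) =
     ?c * (LINT \<xi>|sphere_measure. \<bar>x \<bullet> \<xi>\<bar> ^ q * (LINT \<theta>|great_subsphere_measure \<xi>. f \<theta>))"
    unfolding inversion_density_def m' by (subst integral_mult_right_zero[symmetric]) (simp add: mult_ac)
  also have "\<dots> = sqrt pi / (2 * pi ^ h * (- 4) ^ m) * (Gamma (- real q / 2) / Gamma (real m)) *
     (LINT \<theta>|sphere_measure. f \<theta> * norm (orth_part \<theta> x) ^ q)"
    unfolding spherical_radon_abs_inner_power[OF borel_f int_f q0 n2] inversion_constant[symmetric]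
    by (rule mult.assoc[symmetric])
  also have "\<dots> = u x" by (rule inversion_formula[symmetric])
  finally show ?thesis by simp
qed

lemma inversion_density_blaschke_levy: "blaschke_levy q u (inversion_density q f)"
  unfolding blaschke_levy_def
proof (intro conjI ballI allI)
  have n2: "DIM('a) \<ge> 2" using n h_pos by simp
  show "integrable sphere_measure (inversion_density q f)"
    unfolding inversion_density_def[abs_def]
    by (intro integrable_mult_right spherical_radon_integrable borel_f int_f n2)
  show "inversion_density q f (- \<xi>) = inversion_density q f \<xi>" if "\<xi> \<in> sphere 0 1" for \<xi>
    using that by (simp add: inversion_density_def great_subsphere_measure_minus)
  show "u x = (LINT \<xi>|sphere_measure. \<bar>x \<bullet> \<xi>\<bar> ^ q * inversion_density q f \<xi>)" for x
    by (rule inversion_density_represents)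
qed

end

section \<open>Uniqueness, measurability and the supremum bound\<close>

lemma borel_measurable_sphere_extend:
  fixes f :: "'a::euclidean_space \<Rightarrow> real"
  assumes "f \<in> borel_measurable sphere_measure"
  shows "(\<lambda>x. indicator (sphere 0 1) x * f x) \<in> borel_measurable borel"
proof -
  have "f \<in> borel_measurable (restrict_space borel (sphere 0 1))"
    using assms by (simp add: measurable_cong_sets[OF sets_sphere_measure])
  then show ?thesis by (subst (asm) borel_measurable_restrict_space_iff) auto
qed

lemma blaschke_levy_unique:
  fixes b c :: "'a::euclidean_space \<Rightarrow> real"
  assumes b: "blaschke_levy q F b" and c: "blaschke_levy q F c" and q: "odd q"
  shows "AE \<xi> in sphere_measure. b \<xi> = c \<xi>"
proof -
  let ?S = "sphere_measure :: 'a measure"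
  \<comment> \<open>Cut off outside the sphere: b and c are measurable only with respect to the
    sphere, while injectivity is stated for Borel functions on the whole space.\<close>
  define d where "d \<xi> = indicator (sphere 0 1) \<xi> * (b \<xi> - c \<xi>)" for \<xi> :: 'a
  have bc: "integrable ?S b" "integrable ?S c" using b c by (auto simp: blaschke_levy_def)
  have dm: "d \<in> borel_measurable borel"
    unfolding d_def using bc by (intro borel_measurable_sphere_extend) auto
  have di: "integrable ?S d"
    using Bochner_Integration.integrable_diff[OF bc]
    by (subst Bochner_Integration.integrable_cong[OF refl, of _ _ "\<lambda>\<xi>. b \<xi> - c \<xi>"]) (auto simp: d_def)
  have "AE \<xi> in ?S. d \<xi> = 0"
  proof (rule cosine_transform_injective[OF dm di _ q])
    show "d (- \<xi>) = d \<xi>" if "norm \<xi> = 1" for \<xi>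
      using that b c by (simp add: d_def blaschke_levy_def)
    fix x :: 'a
    have ig: "integrable ?S (\<lambda>\<xi>. \<bar>x \<bullet> \<xi>\<bar> ^ q * g \<xi>)" if g: "integrable ?S g" for g
    proof (rule Bochner_Integration.integrable_bound[OF integrable_mult_right[OF g, of "norm x ^ q"]])
      have [measurable]: "g \<in> borel_measurable ?S" using g by simp
      have "(\<lambda>\<xi>. \<bar>x \<bullet> \<xi>\<bar> ^ q) \<in> borel_measurable ?S" by (rule borel_measurable_sphere) measurable
      then show "(\<lambda>\<xi>. \<bar>x \<bullet> \<xi>\<bar> ^ q * g \<xi>) \<in> borel_measurable ?S" by measurable
      show "AE \<xi> in ?S. norm (\<bar>x \<bullet> \<xi>\<bar> ^ q * g \<xi>) \<le> norm (norm x ^ q * g \<xi>)"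
      proof (rule AE_I2)
        fix \<xi> :: 'a assume "\<xi> \<in> space ?S"
        then have "\<bar>x \<bullet> \<xi>\<bar> \<le> norm x" using Cauchy_Schwarz_ineq2[of x \<xi>] by simp
        then have "\<bar>x \<bullet> \<xi>\<bar> ^ q \<le> norm x ^ q" by (rule power_mono) simp
        then show "norm (\<bar>x \<bullet> \<xi>\<bar> ^ q * g \<xi>) \<le> norm (norm x ^ q * g \<xi>)"
          by (simp add: abs_mult mult_right_mono)
      qed
    qed
    have "(LINT \<xi>|?S. \<bar>x \<bullet> \<xi>\<bar> ^ q * d \<xi>) = (LINT \<xi>|?S. \<bar>x \<bullet> \<xi>\<bar> ^ q * b \<xi> - \<bar>x \<bullet> \<xi>\<bar> ^ q * c \<xi>)"
      by (intro Bochner_Integration.integral_cong refl) (simp add: d_def algebra_simps)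
    also have "\<dots> = F x - F x"
      using b c by (subst Bochner_Integration.integral_diff[OF ig[OF bc(1)] ig[OF bc(2)]]) (simp add: blaschke_levy_def)
    finally show "(LINT \<xi>|?S. \<bar>x \<bullet> \<xi>\<bar> ^ q * d \<xi>) = 0" by simp
  qed
  then show ?thesis using AE_space by eventually_elim (simp add: d_def)
qed

text \<open>Measurability is given on the sphere and spread along rays by homogeneity. The origin is
  not constrained by homogeneity, so a value is assigned there.\<close>

lemma homogeneous_off_0_borel:
  fixes f :: "'a::euclidean_space \<Rightarrow> real"
  assumes f: "homogeneous_off_0 p f" "f \<in> borel_measurable sphere_measure"
  shows "(\<lambda>x. if x = 0 then 0 else f x) \<in> borel_measurable borel"
proof -
  note [measurable] = borel_measurable_sphere_extend[OF f(2)]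
  have "(if x = 0 then 0 else f x) = (if x = 0 then 0 else norm x powr p * (indicator (sphere 0 1) (sgn x) * f (sgn x)))" for x
  proof (cases "x = 0")
    case False
    have "f (norm x *\<^sub>R sgn x) = norm x powr p * f (sgn x)"
      using f(1) False by (simp add: homogeneous_off_0_def sgn_zero_iff)
    then show ?thesis using False by (simp add: norm_sgn scaleR_conv_of_real sgn_div_norm)
  qed simp
  then show ?thesis by simp
qed

text \<open>The Radon transform is bounded by the supremum times the area of a great subsphere; the
  rest is bookkeeping in extended reals, with an infinite right side being trivial since the
  constant is positive.\<close>

lemma inversion_density_Linf:
  fixes f :: "'a::euclidean_space \<Rightarrow> real"
  assumes f: "f \<in> borel_measurable borel" and n: "DIM('a) \<ge> 2" and q: "odd q"
  shows "Linf_norm sphere_measure (inversion_density q f) \<le>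
    ereal (2 * pi powr ((real DIM('a) + 1) / 2) /
      (Gamma ((real DIM('a) - 1) / 2) * (2 * pi) ^ (DIM('a) - 1) * \<bar>C_const (real q)\<bar>)) * Linf_norm sphere_measure f"
    (is "_ \<le> ereal ?K * _")
proof -
  let ?S = "sphere_measure :: 'a measure"
  define M where "M = 2 * pi powr ((real DIM('a) - 1) / 2) / Gamma ((real DIM('a) - 1) / 2)"
  have C: "C_const (real q) \<noteq> 0" by (rule C_const_nonzero[OF q])
  have G: "Gamma ((real DIM('a) - 1) / 2) > 0" using n by (intro Gamma_real_pos) auto
  have K: "?K > 0" using C G by simp
  have bm: "(\<lambda>\<xi>. ereal \<bar>inversion_density q f \<xi>\<bar>) \<in> borel_measurable ?S"
    using spherical_radon_measurable[OF f] unfolding inversion_density_def by measurable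
  have fa: "AE \<theta> in ?S. ereal \<bar>f \<theta>\<bar> \<le> Linf_norm ?S f"
    unfolding Linf_norm_def by (rule esssup_AE)
  have c: "\<bar>inversion_density q f \<xi>\<bar> =
     pi / (2 * (2 * pi) ^ (DIM('a) - 1) * \<bar>C_const (real q)\<bar>) * \<bar>LINT \<theta>|great_subsphere_measure \<xi>. f \<theta>\<bar>" for \<xi>
    by (simp add: inversion_density_def abs_mult power_abs)
  \<comment> \<open>The factor 2 in the denominator of \<open>inversion_density\<close> makes the
    left side exactly half of the constant.\<close>
  have cK: "pi / (2 * (2 * pi) ^ (DIM('a) - 1) * \<bar>C_const (real q)\<bar>) * M \<le> ?K"
  proof -
    have "pi * pi powr ((real DIM('a) - 1) / 2) = pi powr ((real DIM('a) + 1) / 2)"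
      using powr_add[of pi 1 "(real DIM('a) - 1) / 2"] by (simp add: field_simps)
    then have "pi / (2 * (2 * pi) ^ (DIM('a) - 1) * \<bar>C_const (real q)\<bar>) * M = ?K / 2"
      by (simp add: M_def mult_ac)
    then show ?thesis using K by simp
  qed
  show ?thesis
  proof (cases "Linf_norm ?S f")
    case PInf
    then show ?thesis using G C by simp
  next
    \<comment> \<open>An essential supremum of an absolute value below 0 would mean that every
      property holds almost everywhere.\<close>
    case MInf
    then have "AE \<theta> in ?S. False" using fa by simp
    then have "AE \<xi> in ?S. ereal \<bar>inversion_density q f \<xi>\<bar> \<le> ereal ?K * Linf_norm ?S f" by eventually_elim simp
    then show ?thesis unfolding Linf_norm_def[of _ "inversion_density q f"] by (rule esssup_I[OF bm])
  next
    case (real r)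
    have "AE \<xi> in ?S. ereal \<bar>inversion_density q f \<xi>\<bar> \<le> ereal ?K * ereal r"
    proof (cases "r \<ge> 0")
      case True
      have "AE \<theta> in ?S. \<bar>f \<theta>\<bar> \<le> r" using fa real by simp
      from spherical_radon_bound[OF f n True this] show ?thesis
      proof eventually_elim
        case (elim \<xi>)
        have "\<bar>inversion_density q f \<xi>\<bar> \<le> pi / (2 * (2 * pi) ^ (DIM('a) - 1) * \<bar>C_const (real q)\<bar>) * (r * M)"
          unfolding c M_def by (intro mult_left_mono elim) simp
        also have "\<dots> = pi / (2 * (2 * pi) ^ (DIM('a) - 1) * \<bar>C_const (real q)\<bar>) * M * r" by (simp add: mult_ac)
        also have "\<dots> \<le> ?K * r" using cK True by (rule mult_right_mono)
        finally show ?case by simp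
      qed
    next
      case False
      have "AE \<theta> in ?S. False" using fa by eventually_elim (use real False in auto)
      then show ?thesis by eventually_elim simp
    qed
    then show ?thesis unfolding real Linf_norm_def[of _ "inversion_density q f"] by (rule esssup_I[OF bm])
  qed
qed

text \<open>An integrable density is determined only up to null sets. Existence is therefore stated
  with the formula at every point of the sphere, while an arbitrary representing density satisfies
  it almost everywhere. The bound uses the absolute value of \<open>C_const\<close>, which is
  negative when q is 1 modulo 4.\<close>

theorem theorem3:
  fixes H f :: "real ^ 'n \<Rightarrow> real" and q :: nat
  assumes "CARD('n) > 1" and "even CARD('n)"
    and "q > 0" and "odd q"
    and "continuous_on UNIV H" and "\<forall>x. H x \<ge> 0" and "even_homogeneous 1 H"
    and "distr_laplacian_pow_on (- {0}) ((CARD('n) + q - 1) div 2) (\<lambda>x. H x ^ q) f"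
    and "homogeneous_off_0 (1 - real CARD('n)) f"
    and "integrable sphere_measure f"
  shows "(\<exists>b. blaschke_levy q (\<lambda>x. H x ^ q) b \<and>
            (\<forall>\<xi>\<in>sphere 0 1. b \<xi> = inversion_density q f \<xi>)) \<and>
         (\<forall>b. blaschke_levy q (\<lambda>x. H x ^ q) b \<longrightarrow>
            (AE \<xi> in sphere_measure. b \<xi> = inversion_density q f \<xi>) \<and>
            (in_Linf sphere_measure b \<longrightarrow>
               Linf_norm sphere_measure b \<le>
                 ereal (2 * pi powr ((real CARD('n) + 1) / 2) /
                   (Gamma ((real CARD('n) - 1) / 2) * (2 * pi) ^ (CARD('n) - 1) *
                    \<bar>C_const (real q)\<bar>)) * Linf_norm sphere_measure f))"
proof -
  let ?S = "sphere_measure :: (real ^ 'n) measure"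
  let ?u = "\<lambda>x. H x ^ q"
  \<comment> \<open>Setting the value at the origin to 0 makes the representative Borel; the sphere
    does not notice.\<close>
  define f0 where "f0 x = (if x = 0 then 0 else f x)" for x
  have f0: "f0 \<theta> = f \<theta>" if "norm \<theta> = 1" for \<theta> using that by (auto simp: f0_def)
  have fm: "f \<in> borel_measurable ?S" using assms(10) by simp
  obtain h where h: "CARD('n) = 2 * h" using assms(2) by (rule evenE)
  have H0: "H 0 = 0"
    using assms(7)[unfolded even_homogeneous_def, rule_format, of 2 0] by simp
  interpret homogeneous_laplacian ?u q h f0 "(CARD('n) + q - 1) div 2"
  proof
    show "continuous_on UNIV ?u" using assms(5) by (intro continuous_intros)
    show "H (t *\<^sub>R x) ^ q = \<bar>t\<bar> ^ q * H x ^ q" for t x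
      using assms(3,7) H0 by (cases "t = 0") (auto simp: even_homogeneous_def power_mult_distrib)
    show "f0 \<in> borel_measurable borel"
      unfolding f0_def using assms(9) fm by (rule homogeneous_off_0_borel)
    show "integrable ?S f0"
      using assms(10) by (subst Bochner_Integration.integrable_cong[OF refl, of _ _ f]) (auto simp: f0)
    show "f0 (t *\<^sub>R x) = f0 x / t ^ (DIM(real ^ 'n) - 1)" if "t > 0" "x \<noteq> 0" for t x
    proof -
      have "t powr (1 - real CARD('n)) = inverse (t powr real (CARD('n) - 1))"
        using assms(1) by (simp add: of_nat_diff flip: powr_minus)
      then have "t powr (1 - real CARD('n)) = 1 / t ^ (CARD('n) - 1)"
        by (simp only: powr_realpow[OF that(1)] divide_inverse mult_1_left)
      then show ?thesis using assms(9) that by (simp add: f0_def homogeneous_off_0_def)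
    qed
    fix \<phi> :: "real ^ 'n \<Rightarrow> real" assume \<phi>: "test_function_on (- {0}) \<phi>"
    \<comment> \<open>The test functions vanish at the origin, so the weak equation is the same for
      the modified representative.\<close>
    then have "\<phi> 0 = 0" using closure_subset[of "{x. \<phi> x \<noteq> 0}"] by (auto simp: test_function_on_def)
    then have "(\<lambda>z. f0 z * \<phi> z) = (\<lambda>z. f z * \<phi> z)" by (auto simp: f0_def)
    then show "(LINT z|lborel. ?u z * (laplacian ^^ ((CARD('n) + q - 1) div 2)) \<phi> z) = (LINT z|lborel. f0 z * \<phi> z)"
      using assms(8) \<phi> by (simp add: distr_laplacian_pow_on_def)
  next
    show "odd q" by (rule assms(4))
    show "DIM(real ^ 'n) = 2 * h" using h by simp
    have "2 * ((2 * h + q - 1) div 2) + 1 = 2 * h + q" using assms(3,4) by presburger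
    then show "2 * ((CARD('n) + q - 1) div 2) + 1 = DIM(real ^ 'n) + q" by (simp add: h)
  qed
  have n2: "DIM(real ^ 'n) \<ge> 2" using assms(1) by simp
  have ff0: "inversion_density q f = inversion_density q f0"
    by (rule ext, rule inversion_density_cong) (simp add: f0)
  have ess: "Linf_norm ?S g = Linf_norm ?S k"
    if "AE \<xi> in ?S. g \<xi> = k \<xi>" "g \<in> borel_measurable ?S" "k \<in> borel_measurable ?S" for g k
    unfolding Linf_norm_def using that by (intro esssup_AE_cong) auto
  have rep: "blaschke_levy q ?u (inversion_density q f)" unfolding ff0 by (rule inversion_density_blaschke_levy)
  show ?thesis
  proof (intro conjI allI impI exI[of _ "inversion_density q f"])
    fix b assume b: "blaschke_levy q ?u b"
    show ae: "AE \<xi> in ?S. b \<xi> = inversion_density q f \<xi>"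
      by (rule blaschke_levy_unique[OF b rep assms(4)])
    have "Linf_norm ?S b = Linf_norm ?S (inversion_density q f0)" 
      unfolding ff0[symmetric] using b rep by (intro ess[OF ae]) (auto simp: blaschke_levy_def)
    also have "\<dots> \<le> ereal (2 * pi powr ((real CARD('n) + 1) / 2) /
                   (Gamma ((real CARD('n) - 1) / 2) * (2 * pi) ^ (CARD('n) - 1) *
                    \<bar>C_const (real q)\<bar>)) * Linf_norm ?S f0"
      using inversion_density_Linf[OF borel_f n2 assms(4)] by simp
    also have "Linf_norm ?S f0 = Linf_norm ?S f" 
      by (rule ess) (auto simp: f0 fm intro!: AE_I2 borel_measurable_integrable[OF int_f])
    finally show "Linf_norm ?S b \<le> ereal (2 * pi powr ((real CARD('n) + 1) / 2) /
                   (Gamma ((real CARD('n) - 1) / 2) * (2 * pi) ^ (CARD('n) - 1) *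
                    \<bar>C_const (real q)\<bar>)) * Linf_norm ?S f" .
  qed (use rep in auto)
qed

end
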